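(* Let $D\subset\mathfrak X$ be a Greenian open set satisfying G. Suppose that for every $z_0\in\partial D$ there exists $0<R\le R_0$ such that C1$(z_0,R)$ and E1$(z_0,R)$ hold, both $X$ and $\widehat X$ satisfy F1$(z_0,R)$, for all $r\in(0,R]$ $$\sup_{x\in D\cap B(z_0,r/2)}\ \sup_{y\in\mathfrak X\setminus B(z_0,r)}\max\big(G_D(x,y),\widehat G_D(x,y)\big)\le c(r)<\infty$$ with $c(r)$ independent of $z_0$, and, in case $D$ is unbounded, for all $r\in(0,R]$, $\lim_{x\to\infty}G_D(x,y)=0$ for all $y\in D\cap B(z_0,r)$. Suppose further that, for any inaccessible point $z_0\in\partial D$ (inaccessible from $D$ with respect to $X$), $\lim_{D\ni x\to z_0}j(x,z_0)=\infty$. (a) Then the finite part $\partial^f_MD$ of the Martin boundary $\partial_MD$ can be identified with $\partial D$, in the sense that the map sending $z\in\partial D$ to the unique Martin boundary point associated with $z$ is a bijection from $\partial D$ onto $\partial_M^fD$. (b) If $D$ is bounded, then $\partial D$ and $\partial_MD$ are homeomorphic.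
   Context: Setting. $(\mathfrak X,d,m)$ is a metric measure space with a countable base such that all bounded closed sets are compact and $m$ has full support; $B(x,r)$ is the ball with center $x$ and radius $r$, $\overline B(x,r)$ its closure, $A^c$ the complement of $A$ in $\mathfrak X$. $R_0\in(0,\infty]$ (the localization radius) is such that $\mathfrak X\setminus B(x,2r)\ne\emptyset$ for all $x\in\mathfrak X$ and all $r<R_0$. $X=(X_t,\mathcal F_t,\mathbb P_x)$ is a Hunt process on $\mathfrak X$ with lifetime $\zeta$ and cemetery $\partial$ (convention: $X_\zeta=\partial$ and $u(\partial)=0$ for every function $u$). Standing assumptions: $X$ admits a strong dual process $\widehat X$ with respect to $m$, which is also a Hunt process; the transition semigroups of $X$ and $\widehat X$ are both Feller and strong Feller; every semi-polar set of $X$ is polar. $X$ has a Lévy system $(J,H)$ with $H_t=t$, i.e. $\mathbb E_x\sum_{0<s\le T}f(X_{s-},X_s)=\mathbb E_x\int_0^T\int f(X_s,y)J(X_s,dy)\,ds$ for every $f:\mathfrak X\times\mathfrak X\to[0,\infty)$ vanishing on the diagonal and every stopping time $T$; similarly for $\widehat X$ with $\widehat J$; and $J(x,dy)=j(x,y)m(dy)$, $\widehat J(x,dy)=\widehat j(x,y)m(dy)$, with $j(x,y)=\widehat j(y,x)>0$ for all $x\ne y$. Objects related to $\widehat X$ carry a hat. For an open set $D$: $\tau_D=\inf\{t>0:X_t\notin D\}$; $X^D$ is $X$ killed at $\tau_D$; $G_D(x,y)$ is the Green function of $X^D$, i.e. $\mathbb E_x\int_0^{\tau_D}f(X_t)dt=\int_DG_D(x,y)f(y)m(dy)$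 for Borel $f\ge0$, with $G_D(x,y)=\widehat G_D(y,x)$ and $G_D=0$ off $D\times D$; $D$ is Greenian if $G_D$ is finite away from the diagonal. $P_D(x,z)=\int_DG_D(x,y)j(y,z)m(dy)$ for $x\in D$, $z\in D^c$. $D^{\mathrm{reg}}$ is the set of $z\in\partial D$ with $\mathbb P_z(\tau_D=0)=1$ and $\widehat D^{\mathrm{reg}}$ its analogue for $\widehat X$. $f:\mathfrak X\to[0,\infty)$ is regular harmonic in $D$ with respect to $X$ if $f(x)=\mathbb E_x[f(X_{\tau_D}),\tau_D<\zeta]$ for all $x\in D$ (similarly for $\widehat X$). A point $z\in\partial D$ is accessible from $D$ with respect to $X$ if $P_D(x,z)=\infty$ for all $x\in D$, and inaccessible otherwise. $x\to\infty$ means that the distance of $x$ to a fixed point tends to $\infty$. Martin boundary. Fix $x_0\in D$ and put $M_D(x,y)=G_D(x,y)/G_D(x_0,y)$, $x,y\in D$, $y\neq x_0$. $\partial_MD$ is the Martin boundary of $D$ with respect to $X^D$ in the sense of Kunita–Watanabe; it satisfies: (M1) $D\cup\partial_MD$ is a compact metric space; (M2) $D$ is open and dense in $D\cup\partial_MD$ and its relative topology is its original topology; (M3) $M_D(x,\cdot)$ extends uniquely to $\partial_MD$ so that $M_D(x,y)\to M_D(x,w)$ as $y\to w\in\partial_MD$ in the Martin topology, $x\mapsto M_D(x,w)$ is excessive for $X^D$ for each $w\in D\cup\partial_MD$, $(x,w)\mapsto M_D(x,w)$ is jointly continuous on $D\times((D\setminus\{x_0\})\cup\partial_MD)$, and $M_D(\cdot,w_1)\ne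 M_D(\cdot,w_2)$ for distinct $w_1,w_2\in\partial_MD$. $w\in\partial_MD$ is a finite Martin boundary point if some bounded (with respect to $d$) sequence $(y_n)\subset D$ converges to $w$ in the Martin topology; $\partial_M^fD$ is the set of finite Martin boundary points (the finite part of the Martin boundary). $w\in\partial_MD$ is associated with $z_0\in\partial D$ if some sequence $(y_n)\subset D$ converges to $w$ in the Martin topology and to $z_0$ in $\mathfrak X$; under the assumptions of the statement there is exactly one Martin boundary point associated with each $z_0\in\partial D$. C1$(z_0,R)$ ($R\le R_0$): for all $0<r_1<r_2<R$ there is $c=c(z_0,r_2/r_1)>0$ such that for all $x\in B(z_0,r_1)$, $y\in\mathfrak X\setminus B(z_0,r_2)$: $c^{-1}j(z_0,y)\le j(x,y)\le c\,j(z_0,y)$ and $c^{-1}\widehat j(z_0,y)\le\widehat j(x,y)\le c\,\widehat j(z_0,y)$. E1$(z_0,R)$: for every $r\in(0,R)$, $\lim_{d(z_0,y)\to0}\sup_{z:d(z_0,z)>r}\frac{j(z,z_0)}{j(z,y)}=\lim_{d(z_0,y)\to0}\inf_{z:d(z_0,z)>r}\frac{j(z,z_0)}{j(z,y)}=1$. F1$(z_0,R)$ for $X$ ($R\le R_0$): for any $\frac12<a<1$ there is $C(a)=C(z_0,R,a)\ge1$ such that for every $r\in(0,R)$, every open $D\subset B(z_0,r)$, every nonnegative $f$ on $\mathfrak X$ which is regular harmonic in $D$ with respect to $X$ and vanishes on $B(z_0,r)\cap(\overline D^{\,c}\cup D^{\mathrm{reg}})$, and all $x\in D\cap B(z_0,r/8)$,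 $$C(a)^{-1}\mathbb E_x[\tau_D]\int_{\overline B(z_0,ar/2)^c}j(z_0,y)f(y)m(dy)\le f(x)\le C(a)\mathbb E_x[\tau_D]\int_{\overline B(z_0,ar/2)^c}j(z_0,y)f(y)m(dy).$$ "$\widehat X$ satisfies F1" means the same with $X,\tau_D,j,D^{\mathrm{reg}}$ replaced by $\widehat X,\widehat\tau_D,\widehat j,\widehat D^{\mathrm{reg}}$. G: $\lim_{D\ni x\to z}G_D(x,y)=0$ for every $z\in D^{\mathrm{reg}}$ and every $y\in D$. *)

theory Defs
  imports "HOL-Probability.Probability"
begin

section \<open>Hunt processes\<close>

text \<open>
  The state space is a type \<open>'x\<close>; class \<^class>\<open>heine_borel\<close> says that bounded closed sets are
  compact.  The cemetery is \<^const>\<open>None\<close>, attached as the point at infinity (isolated if the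
  state space is compact).  Time is \<^typ>\<open>ennreal\<close>, that is \<open>[0,\<infinity>]\<close>, so that a path can be
  evaluated at any stopping time.
\<close>

record ('w, 'x) process =
  traj :: "ennreal \<Rightarrow> 'w \<Rightarrow> 'x option"
  law :: "'x option \<Rightarrow> 'w measure"

definition cem_top :: "'x::topological_space option topology" where
  "cem_top = Alexandroff_compactification euclidean"

definition cem_borel :: "'x::topological_space option measure" where
  "cem_borel = sigma UNIV {U. openin cem_top U}"

text \<open>The convention \<open>u(\<partial>) = 0\<close>.\<close>

abbreviation ext0 :: "('x \<Rightarrow> 'c::zero) \<Rightarrow> 'x option \<Rightarrow> 'c" where
  "ext0 u \<equiv> case_option 0 u"

definition raw_filtration :: "('w, 'x::topological_space) process \<Rightarrow> ennreal \<Rightarrow> 'w measure" where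
  "raw_filtration X t = sigma UNIV (\<Union>s\<in>{..t}. {traj X s -` A | A. A \<in> sets cem_borel})"

text \<open>
  \<open>law X x\<close> lives on the uncompleted \<open>\<sigma>\<close>-algebra generated by the process; probabilities and
  expectations are taken with respect to its completion.
\<close>

definition prob_at :: "('w, 'x) process \<Rightarrow> 'x option \<Rightarrow> 'w measure" where
  "prob_at X x = completion (law X x)"

abbreviation start :: "('w, 'x) process \<Rightarrow> 'x \<Rightarrow> 'w measure" where
  "start X x \<equiv> prob_at X (Some x)"

definition init_law :: "('w, 'x) process \<Rightarrow> 'x option measure \<Rightarrow> 'w measure" where
  "init_law X \<mu> = completion (Giry_Monad.bind \<mu> (law X))"

text \<open>The usual augmentation: the intersection over all initial distributions \<open>\<mu>\<close> of the
  filtrations obtained by adjoining all \<open>P\<^sub>\<mu>\<close>-null sets.\<close>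

definition filt :: "('w, 'x::topological_space) process \<Rightarrow> ennreal \<Rightarrow> 'w measure" where
  "filt X t = sigma UNIV
     {A. \<forall>\<mu>\<in>space (prob_algebra cem_borel).
           \<exists>B\<in>sets (raw_filtration X t). sym_diff A B \<in> null_sets (init_law X \<mu>)}"

definition stopped_sigma :: "('w, 'x::topological_space) process \<Rightarrow> ('w \<Rightarrow> ennreal) \<Rightarrow> 'w measure" where
  "stopped_sigma X T = filtration.pre_sigma UNIV (filt X) T"

definition lifetime :: "('w, 'x) process \<Rightarrow> 'w \<Rightarrow> ennreal" where
  "lifetime X \<omega> = Inf {t. traj X t \<omega> = None}"

definition hunt_process :: "('w, 'x::topological_space) process \<Rightarrow> bool" where
  "hunt_process X \<longleftrightarrow>
     law X \<in> cem_borel \<rightarrow>\<^sub>M prob_algebra (raw_filtration X \<top>) \<and>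
     (\<forall>x. AE \<omega> in prob_at X x. traj X 0 \<omega> = x) \<and>
     (\<forall>\<omega>. traj X \<top> \<omega> = None) \<and>
     (\<forall>s t \<omega>. traj X s \<omega> = None \<and> s \<le> t \<longrightarrow> traj X t \<omega> = None) \<and>
     (\<forall>\<omega>. \<forall>t<\<top>. limitin cem_top (\<lambda>s. traj X s \<omega>) (traj X t \<omega>) (at_right t)) \<and>
     (\<forall>\<omega>. \<forall>t. 0 < t \<and> t < \<top> \<longrightarrow> (\<exists>l. limitin cem_top (\<lambda>s. traj X s \<omega>) l (at_left t))) \<and>
     (\<forall>t<\<top>. \<exists>\<theta>. \<forall>s \<omega>. traj X s (\<theta> \<omega>) = traj X (s + t) \<omega>) \<and>
     (\<forall>t<\<top>. sets (filt X t) = (\<Inter>s\<in>{t<..}. sets (filt X s))) \<and>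
     \<comment> \<open>strong Markov property\<close>
     (\<forall>T. stopping_time (filt X) T \<longrightarrow>
        (\<forall>x s. \<forall>A\<in>sets cem_borel. \<forall>\<Lambda>\<in>sets (stopped_sigma X T).
           emeasure (prob_at X x) ({\<omega>. traj X (T \<omega> + s) \<omega> \<in> A} \<inter> \<Lambda>) =
           (\<integral>\<^sup>+\<omega>\<in>\<Lambda>. emeasure (prob_at X (traj X (T \<omega>) \<omega>)) {\<omega>'. traj X s \<omega>' \<in> A} \<partial>prob_at X x))) \<and>
     \<comment> \<open>quasi-left-continuity\<close>
     (\<forall>T. (\<forall>n. stopping_time (filt X) (T n)) \<and> (\<forall>\<omega>. incseq (\<lambda>n. T n \<omega>)) \<longrightarrow>
        (\<forall>x. AE \<omega> in prob_at X x. (SUP n. T n \<omega>) < \<top> \<longrightarrow>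
           limitin cem_top (\<lambda>n. traj X (T n \<omega>) \<omega>) (traj X (SUP n. T n \<omega>) \<omega>) sequentially))"

section \<open>Semigroup, resolvent and strong duality\<close>

definition semigroup_op :: "('w, 'x) process \<Rightarrow> ennreal \<Rightarrow> ('x \<Rightarrow> real) \<Rightarrow> 'x \<Rightarrow> real" where
  "semigroup_op X t f x = (\<integral>\<omega>. ext0 f (traj X t \<omega>) \<partial>start X x)"

definition vanishing_continuous :: "('x::topological_space \<Rightarrow> real) \<Rightarrow> bool" where
  "vanishing_continuous f \<longleftrightarrow> continuous_on UNIV f \<and> (\<forall>e>0. compact {x. e \<le> \<bar>f x\<bar>})"

definition feller :: "('w, 'x::topological_space) process \<Rightarrow> bool" where
  "feller X \<longleftrightarrow>
     (\<forall>f. vanishing_continuous f \<longrightarrow>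
        (\<forall>t<\<top>. vanishing_continuous (semigroup_op X t f)) \<and>
        uniform_limit UNIV (\<lambda>t. semigroup_op X t f) f (at_right 0))"

definition strong_feller :: "('w, 'x::topological_space) process \<Rightarrow> bool" where
  "strong_feller X \<longleftrightarrow>
     (\<forall>f\<in>borel_measurable borel. bounded (range f) \<longrightarrow>
        (\<forall>t. 0 < t \<and> t < \<top> \<longrightarrow> continuous_on UNIV (semigroup_op X t f)))"

definition resolvent :: "('w, 'x) process \<Rightarrow> real \<Rightarrow> ('x \<Rightarrow> ennreal) \<Rightarrow> 'x \<Rightarrow> ennreal" where
  "resolvent X \<alpha> f x =
     (\<integral>\<^sup>+\<omega>. (\<integral>\<^sup>+t\<in>{0..}. ennreal (exp (- \<alpha> * t)) * ext0 f (traj X (ennreal t) \<omega>) \<partial>lborel) \<partial>start X x)"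

definition resolvent_abs_cont :: "'x::topological_space measure \<Rightarrow> ('w, 'x) process \<Rightarrow> bool" where
  "resolvent_abs_cont m X \<longleftrightarrow>
     (\<forall>\<alpha>>0. \<forall>x. \<forall>A\<in>null_sets m. resolvent X \<alpha> (indicator A) x = 0)"

text \<open>Strong duality in the sense of Blumenthal and Getoor (Chapter VI).\<close>

definition strong_duality ::
  "'x::topological_space measure \<Rightarrow> ('w, 'x) process \<Rightarrow> ('v, 'x) process \<Rightarrow> bool" where
  "strong_duality m X Xh \<longleftrightarrow>
     resolvent_abs_cont m X \<and> resolvent_abs_cont m Xh \<and>
     (\<forall>\<alpha>>0. \<forall>f\<in>borel_measurable borel. \<forall>g\<in>borel_measurable borel.
        (\<integral>\<^sup>+x. f x * resolvent X \<alpha> g x \<partial>m) = (\<integral>\<^sup>+x. resolvent Xh \<alpha> f x * g x \<partial>m))"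

section \<open>Polar and semi-polar sets\<close>

definition hitting_time :: "('w, 'x) process \<Rightarrow> 'x set \<Rightarrow> 'w \<Rightarrow> ennreal" where
  "hitting_time X B \<omega> = Inf {t. 0 < t \<and> traj X t \<omega> \<in> Some ` B}"

definition nearly_borel :: "('w, 'x::topological_space) process \<Rightarrow> 'x set \<Rightarrow> bool" where
  "nearly_borel X B \<longleftrightarrow>
     (\<forall>\<mu>\<in>space (prob_algebra cem_borel). \<exists>A1\<in>sets borel. \<exists>A2\<in>sets borel.
        A1 \<subseteq> B \<and> B \<subseteq> A2 \<and> (AE \<omega> in init_law X \<mu>. \<forall>t. traj X t \<omega> \<notin> Some ` (A2 - A1)))"

definition polar :: "('w, 'x::topological_space) process \<Rightarrow> 'x set \<Rightarrow> bool" where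
  "polar X A \<longleftrightarrow>
     (\<exists>B. nearly_borel X B \<and> A \<subseteq> B \<and> (\<forall>x. AE \<omega> in start X x. hitting_time X B \<omega> = \<top>))"

definition thin_set :: "('w, 'x::topological_space) process \<Rightarrow> 'x set \<Rightarrow> bool" where
  "thin_set X A \<longleftrightarrow>
     (\<exists>B. nearly_borel X B \<and> A \<subseteq> B \<and> (\<forall>x. AE \<omega> in start X x. 0 < hitting_time X B \<omega>))"

definition semipolar :: "('w, 'x::topological_space) process \<Rightarrow> 'x set \<Rightarrow> bool" where
  "semipolar X A \<longleftrightarrow> (\<exists>B :: nat \<Rightarrow> 'x set. A = (\<Union>n. B n) \<and> (\<forall>n. thin_set X (B n)))"

section \<open>L\'evy systems\<close>

definition left_lim :: "('w, 'x::topological_space) process \<Rightarrow> ennreal \<Rightarrow> 'w \<Rightarrow> 'x option" where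
  "left_lim X s \<omega> = (SOME l. limitin cem_top (\<lambda>r. traj X r \<omega>) l (at_left s))"

definition levy_system :: "('w, 'x::topological_space) process \<Rightarrow> ('x \<Rightarrow> 'x measure) \<Rightarrow> bool" where
  "levy_system X J \<longleftrightarrow>
     (\<forall>f :: 'x \<Rightarrow> 'x \<Rightarrow> real.
        (\<lambda>(x, y). f x y) \<in> borel_measurable (borel \<Otimes>\<^sub>M borel) \<and>
        (\<forall>x y. 0 \<le> f x y) \<and> (\<forall>x. f x x = 0) \<longrightarrow>
        (\<forall>T. stopping_time (filt X) T \<longrightarrow>
          (\<forall>x. (\<integral>\<^sup>+\<omega>. (\<integral>\<^sup>+s. (case (left_lim X s \<omega>, traj X s \<omega>) of
                                 (Some u, Some v) \<Rightarrow> ennreal (f u v) | _ \<Rightarrow> 0)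
                       \<partial>count_space {0<..T \<omega>}) \<partial>start X x) =
               (\<integral>\<^sup>+\<omega>. (\<integral>\<^sup>+s\<in>{s. 0 \<le> s \<and> ennreal s \<le> T \<omega>}.
                         ext0 (\<lambda>u. \<integral>\<^sup>+y. ennreal (f u y) \<partial>J u) (traj X (ennreal s) \<omega>)
                       \<partial>lborel) \<partial>start X x))))"

section \<open>The standing assumptions\<close>

locale hunt_setting =
  fixes m :: "'x::{heine_borel, second_countable_topology} measure"
    and R0 :: ereal
    and X :: "('w, 'x) process"
    and Xh :: "('v, 'x) process"
    and j jh :: "'x \<Rightarrow> 'x \<Rightarrow> real"
  assumes sets_m: "sets m = sets borel"
    and m_locally_finite: "\<And>K. compact K \<Longrightarrow> emeasure m K < \<infinity>"
    and m_full_support: "\<And>U. open U \<Longrightarrow> U \<noteq> {} \<Longrightarrow> 0 < emeasure m U"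
    and R0_pos: "0 < R0"
    and R0_localization: "\<And>(x::'x) r. ereal r < R0 \<Longrightarrow> - ball x (2 * r) \<noteq> {}"
    and hunt_X: "hunt_process X"
    and hunt_Xh: "hunt_process Xh"
    and duality: "strong_duality m X Xh"
    and feller_X: "feller X" "strong_feller X"
    and feller_Xh: "feller Xh" "strong_feller Xh"
    and semipolar_polar: "\<And>A. semipolar X A \<Longrightarrow> polar X A"
    and j_measurable: "(\<lambda>(x, y). j x y) \<in> borel_measurable (borel \<Otimes>\<^sub>M borel)"
    and j_dual: "\<And>x y. x \<noteq> y \<Longrightarrow> j x y = jh y x"
    and j_pos: "\<And>x y. x \<noteq> y \<Longrightarrow> 0 < j x y"
    and jh_measurable: "(\<lambda>(x, y). jh x y) \<in> borel_measurable (borel \<Otimes>\<^sub>M borel)"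
    and levy_X: "levy_system X (\<lambda>x. density m (\<lambda>y. ennreal (j x y)))"
    and levy_Xh: "levy_system Xh (\<lambda>x. density m (\<lambda>y. ennreal (jh x y)))"

section \<open>Killed process, Green function, accessible points\<close>

definition exit_time :: "('w, 'x) process \<Rightarrow> 'x set \<Rightarrow> 'w \<Rightarrow> ennreal" where
  "exit_time X D \<omega> = Inf {t. 0 < t \<and> traj X t \<omega> \<notin> Some ` D}"

definition mean_exit :: "('w, 'x) process \<Rightarrow> 'x set \<Rightarrow> 'x \<Rightarrow> ennreal" where
  "mean_exit X D x = (\<integral>\<^sup>+\<omega>. exit_time X D \<omega> \<partial>start X x)"

definition killed_op :: "('w, 'x) process \<Rightarrow> 'x set \<Rightarrow> ennreal \<Rightarrow> ('x \<Rightarrow> ennreal) \<Rightarrow> 'x \<Rightarrow> ennreal" where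
  "killed_op X D t u x =
     (\<integral>\<^sup>+\<omega>\<in>{\<omega>. t < exit_time X D \<omega>}. ext0 u (traj X t \<omega>) \<partial>start X x)"

definition killed_excessive ::
  "('w, 'x::topological_space) process \<Rightarrow> 'x set \<Rightarrow> ('x \<Rightarrow> ennreal) \<Rightarrow> bool" where
  "killed_excessive X D u \<longleftrightarrow>
     u \<in> borel_measurable (restrict_space borel D) \<and>
     (\<forall>x\<in>D. \<forall>t. killed_op X D t u x \<le> u x) \<and>
     (\<forall>x\<in>D. ((\<lambda>t. killed_op X D t u x) \<longlongrightarrow> u x) (at_right 0))"

text \<open>
  The occupation formula determines \<open>G\<^sub>D(x,\<cdot>)\<close> only up to \<open>m\<close>-null sets; the Green function of
  potential theory is the version for which every \<open>G\<^sub>D(\<cdot>,y)\<close> is excessive (for the killed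
  dual process this is required of \<open>G\<^sub>D(x,\<cdot>)\<close>, through the dual Green function).
\<close>

definition green_kernel ::
  "'x::topological_space measure \<Rightarrow> ('w, 'x) process \<Rightarrow> 'x set \<Rightarrow> ('x \<Rightarrow> 'x \<Rightarrow> ennreal) \<Rightarrow> bool" where
  "green_kernel m X D G \<longleftrightarrow>
     (\<lambda>(x, y). G x y) \<in> borel_measurable (borel \<Otimes>\<^sub>M borel) \<and>
     (\<forall>f\<in>borel_measurable borel. \<forall>x\<in>D.
        (\<integral>\<^sup>+\<omega>. (\<integral>\<^sup>+t\<in>{t. 0 \<le> t \<and> ennreal t < exit_time X D \<omega>}.
                  ext0 f (traj X (ennreal t) \<omega>) \<partial>lborel) \<partial>start X x) =
        (\<integral>\<^sup>+y\<in>D. G x y * f y \<partial>m)) \<and>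
     (\<forall>x y. x \<notin> D \<or> y \<notin> D \<longrightarrow> G x y = 0) \<and>
     (\<forall>y\<in>D. killed_excessive X D (\<lambda>x. G x y))"

definition green_functions ::
  "'x::topological_space measure \<Rightarrow> ('w, 'x) process \<Rightarrow> ('v, 'x) process \<Rightarrow> 'x set
    \<Rightarrow> ('x \<Rightarrow> 'x \<Rightarrow> ennreal) \<Rightarrow> ('x \<Rightarrow> 'x \<Rightarrow> ennreal) \<Rightarrow> bool" where
  "green_functions m X Xh D G Gh \<longleftrightarrow>
     green_kernel m X D G \<and> green_kernel m Xh D Gh \<and> (\<forall>x y. G x y = Gh y x)"

definition greenian :: "('x \<Rightarrow> 'x \<Rightarrow> ennreal) \<Rightarrow> bool" where
  "greenian G \<longleftrightarrow> (\<forall>x y. x \<noteq> y \<longrightarrow> G x y < \<infinity>)"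

definition poisson_kernel ::
  "'x measure \<Rightarrow> ('x \<Rightarrow> 'x \<Rightarrow> real) \<Rightarrow> 'x set \<Rightarrow> ('x \<Rightarrow> 'x \<Rightarrow> ennreal) \<Rightarrow> 'x \<Rightarrow> 'x \<Rightarrow> ennreal" where
  "poisson_kernel m j D G x z = (\<integral>\<^sup>+y\<in>D. G x y * ennreal (j y z) \<partial>m)"

definition accessible ::
  "'x::topological_space measure \<Rightarrow> ('x \<Rightarrow> 'x \<Rightarrow> real) \<Rightarrow> 'x set \<Rightarrow> ('x \<Rightarrow> 'x \<Rightarrow> ennreal) \<Rightarrow> 'x \<Rightarrow> bool" where
  "accessible m j D G z \<longleftrightarrow> z \<in> frontier D \<and> (\<forall>x\<in>D. poisson_kernel m j D G x z = \<infinity>)"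

definition inaccessible ::
  "'x::topological_space measure \<Rightarrow> ('x \<Rightarrow> 'x \<Rightarrow> real) \<Rightarrow> 'x set \<Rightarrow> ('x \<Rightarrow> 'x \<Rightarrow> ennreal) \<Rightarrow> 'x \<Rightarrow> bool" where
  "inaccessible m j D G z \<longleftrightarrow> z \<in> frontier D \<and> \<not> accessible m j D G z"

definition regular_points :: "('w, 'x::topological_space) process \<Rightarrow> 'x set \<Rightarrow> 'x set" where
  "regular_points X D = {z \<in> frontier D. AE \<omega> in start X z. exit_time X D \<omega> = 0}"

definition regular_harmonic ::
  "('w, 'x::topological_space) process \<Rightarrow> 'x set \<Rightarrow> ('x \<Rightarrow> real) \<Rightarrow> bool" where
  "regular_harmonic X D f \<longleftrightarrow>
     f \<in> borel_measurable borel \<and> (\<forall>x. 0 \<le> f x) \<and>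
     (\<forall>x\<in>D. ennreal (f x) =
        (\<integral>\<^sup>+\<omega>\<in>{\<omega>. exit_time X D \<omega> < lifetime X \<omega>}.
            ext0 (\<lambda>y. ennreal (f y)) (traj X (exit_time X D \<omega>) \<omega>) \<partial>start X x))"

section \<open>Conditions C1, E1, F1 and G\<close>

definition cond_C1 ::
  "('x::metric_space \<Rightarrow> 'x \<Rightarrow> real) \<Rightarrow> ('x \<Rightarrow> 'x \<Rightarrow> real) \<Rightarrow> 'x \<Rightarrow> ereal \<Rightarrow> bool" where
  "cond_C1 j jh z0 R \<longleftrightarrow>
     (\<exists>c :: real \<Rightarrow> real. \<forall>r1 r2. 0 < r1 \<and> r1 < r2 \<and> ereal r2 < R \<longrightarrow>
        0 < c (r2 / r1) \<and>
        (\<forall>x\<in>ball z0 r1. \<forall>y\<in>- ball z0 r2.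
           inverse (c (r2 / r1)) * j z0 y \<le> j x y \<and> j x y \<le> c (r2 / r1) * j z0 y \<and>
           inverse (c (r2 / r1)) * jh z0 y \<le> jh x y \<and> jh x y \<le> c (r2 / r1) * jh z0 y))"

definition cond_E1 :: "('x::metric_space \<Rightarrow> 'x \<Rightarrow> real) \<Rightarrow> 'x \<Rightarrow> ereal \<Rightarrow> bool" where
  "cond_E1 j z0 R \<longleftrightarrow>
     (\<forall>r. 0 < r \<and> ereal r < R \<longrightarrow>
        ((\<lambda>y. SUP z\<in>{z. r < dist z0 z}. ennreal (j z z0 / j z y)) \<longlongrightarrow> 1) (at z0) \<and>
        ((\<lambda>y. INF z\<in>{z. r < dist z0 z}. ennreal (j z z0 / j z y)) \<longlongrightarrow> 1) (at z0))"

text \<open>\<open>closure (ball _ _)\<close> below is the closure of the open ball, which may be smaller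
  than \<^const>\<open>cball\<close> in a general metric space.\<close>

definition cond_F1 ::
  "'x::metric_space measure \<Rightarrow> ('w, 'x) process \<Rightarrow> ('x \<Rightarrow> 'x \<Rightarrow> real) \<Rightarrow> 'x \<Rightarrow> ereal \<Rightarrow> bool" where
  "cond_F1 m X j z0 R \<longleftrightarrow>
     (\<forall>a. 1/2 < a \<and> a < 1 \<longrightarrow>
        (\<exists>C :: real. 1 \<le> C \<and>
          (\<forall>r D f. 0 < r \<and> ereal r < R \<and> open D \<and> D \<subseteq> ball z0 r \<and> regular_harmonic X D f \<and>
             (\<forall>x\<in>ball z0 r \<inter> (- closure D \<union> regular_points X D). f x = 0) \<longrightarrow>
             (\<forall>x\<in>D \<inter> ball z0 (r / 8).
                let I = (\<integral>\<^sup>+y\<in>- closure (ball z0 (a * r / 2)). ennreal (j z0 y) * ennreal (f y) \<partial>m)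
                in ennreal (inverse C) * mean_exit X D x * I \<le> ennreal (f x) \<and>
                   ennreal (f x) \<le> ennreal C * mean_exit X D x * I))))"

definition cond_G ::
  "('w, 'x::topological_space) process \<Rightarrow> 'x set \<Rightarrow> ('x \<Rightarrow> 'x \<Rightarrow> ennreal) \<Rightarrow> bool" where
  "cond_G X D G \<longleftrightarrow>
     (\<forall>z\<in>regular_points X D. \<forall>y\<in>D. ((\<lambda>x. G x y) \<longlongrightarrow> 0) (at z within D))"

definition to_infinity :: "'x::metric_space \<Rightarrow> 'x filter" where
  "to_infinity o' = filtercomap (\<lambda>x. dist o' x) at_top"

section \<open>Martin boundary\<close>

text \<open>
  \<open>martin_space X D x0 G T \<iota> M\<close>: the topological space \<open>T\<close> is \<open>D \<union> \<partial>\<^sub>M D\<close> with \<open>D\<close> embedded by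
  \<open>\<iota>\<close>, and \<open>M\<close> is the Martin kernel based at \<open>x0\<close>, extended to the boundary.  These properties
  determine the compactification uniquely up to a homeomorphism fixing \<open>D\<close>.  The value of
  the kernel at the pole \<open>\<iota> x0\<close> is left undefined.
\<close>

definition martin_space ::
  "('w, 'x::topological_space) process \<Rightarrow> 'x set \<Rightarrow> 'x \<Rightarrow> ('x \<Rightarrow> 'x \<Rightarrow> ennreal)
    \<Rightarrow> 'b topology \<Rightarrow> ('x \<Rightarrow> 'b) \<Rightarrow> ('x \<Rightarrow> 'b \<Rightarrow> ennreal) \<Rightarrow> bool" where
  "martin_space X D x0 G T \<iota> M \<longleftrightarrow>
     compact_space T \<and> metrizable_space T \<and>
     embedding_map (top_of_set D) T \<iota> \<and> openin T (\<iota> ` D) \<and> T closure_of (\<iota> ` D) = topspace T \<and>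
     (\<forall>x\<in>D. \<forall>y\<in>D - {x0}. M x (\<iota> y) = G x y / G x0 y) \<and>
     (\<forall>w\<in>topspace T - {\<iota> x0}. killed_excessive X D (\<lambda>x. M x w)) \<and>
     continuous_map (prod_topology (top_of_set D) (subtopology T (topspace T - {\<iota> x0}))) euclidean
       (\<lambda>(x, w). M x w) \<and>
     (\<forall>w1\<in>topspace T - \<iota> ` D. \<forall>w2\<in>topspace T - \<iota> ` D. w1 \<noteq> w2 \<longrightarrow> (\<exists>x\<in>D. M x w1 \<noteq> M x w2))"

definition martin_boundary :: "'x set \<Rightarrow> 'b topology \<Rightarrow> ('x \<Rightarrow> 'b) \<Rightarrow> 'b set" where
  "martin_boundary D T \<iota> = topspace T - \<iota> ` D"

definition finite_martin_boundary :: "'x::metric_space set \<Rightarrow> 'b topology \<Rightarrow> ('x \<Rightarrow> 'b) \<Rightarrow> 'b set" where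
  "finite_martin_boundary D T \<iota> =
     {w \<in> martin_boundary D T \<iota>. \<exists>y :: nat \<Rightarrow> 'x.
        range y \<subseteq> D \<and> bounded (range y) \<and> limitin T (\<lambda>n. \<iota> (y n)) w sequentially}"

definition martin_associated ::
  "'x::topological_space set \<Rightarrow> 'b topology \<Rightarrow> ('x \<Rightarrow> 'b) \<Rightarrow> 'x \<Rightarrow> 'b \<Rightarrow> bool" where
  "martin_associated D T \<iota> z w \<longleftrightarrow>
     z \<in> frontier D \<and> w \<in> martin_boundary D T \<iota> \<and>
     (\<exists>y :: nat \<Rightarrow> 'x. range y \<subseteq> D \<and> limitin T (\<lambda>n. \<iota> (y n)) w sequentially \<and> y \<longlonglongrightarrow> z)"

end

theory Submission
  imports Defs
begin

text \<open>
  Let \<open>z0 \<in> \<partial>D\<close>.  The functions \<open>G x\<close> are harmonic near \<open>z0\<close> for the dual process and vanish outside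
  \<open>D\<close>, so F1 makes any two of them comparable there.  If \<open>z0\<close> is accessible, jumps from the far
  part of the space become negligible at small scales, and iterating F1 over shrinking balls contracts
  the oscillation of \<open>G x y / G x0 y\<close>; if \<open>z0\<close> is inaccessible, E1 shows that this ratio tends to the
  ratio of the Poisson kernels at \<open>z0\<close>.  Hence exactly one Martin point is associated with \<open>z0\<close>.

  Suppose that \<open>w\<close> is associated with \<open>z1 \<noteq> z2\<close>, and let \<open>h = M \<cdot> w\<close>.  If \<open>z1\<close> is accessible, the
  approximating quotients are uniformly integrable on leaving \<open>V = D - cball z1 r\<close>, so \<open>1 = h x0\<close> is at
  most the mean of \<open>h\<close> over the exit position from \<open>V\<close>.  As \<open>w\<close> is also associated with \<open>z2\<close>, \<open>h\<close> is
  dominated near \<open>z1\<close> by a potential, whose mean tends to \<open>0\<close> with \<open>r\<close>: a contradiction.  If both points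
  are inaccessible, \<open>h\<close> is the potential of \<open>j \<cdot> z1\<close> and of \<open>j \<cdot> z2\<close> up to constants; subtracting
  what happens after the exit from a small ball at \<open>z1\<close> contradicts the blow-up of \<open>j \<cdot> z1\<close>.

  Compactness of the Martin space and of bounded closed sets turns this correspondence into a
  bijection, and into a homeomorphism if \<open>D\<close> is bounded.
\<close>

section \<open>The one-point compactification of the state space\<close>

text \<open>The occupation formula fixes the Green function only up to null sets, whereas Martin
  kernels are pointwise limits. Strong Feller makes excessive functions lower semicontinuous, and
  absolute continuity of the resolvent then carries an a.e. inequality between \<open>G x\<close>
  and its exit mean to every point. The two processes share the work: F1 for the dual controls
  \<open>G v y\<close> in \<open>y\<close>, hence the quotients; F1 for the original process
  controls it in \<open>v\<close>.

  Oscillation estimates must cope with data far from \<open>z0\<close>, on which numerator and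
  denominator are not known to be comparable. Such data enter through a single jump, so the Levy
  system bounds their share by a multiple of the mean exit time. F1 also bounds the share of the
  nearby data by multiples of that time, with an integral as factor; accessibility is the divergence
  of this integral.

  For the separation, pointwise convergence of the quotients yields by Fatou only that
  \<open>M \<cdot> w\<close> is supermean; mass could be lost at \<open>z1\<close>. The reverse
  inequality needs the expected time near \<open>z1\<close> to be small compared with
  \<open>G x0 y\<close>, and no bound that depends on \<open>v\<close> alone would give
  this.\<close>

lemma topspace_cem_top [simp]: "topspace (cem_top :: 'x::topological_space option topology) = UNIV"
  by (auto simp: cem_top_def) (metis not_Some_eq rangeI)

lemma openin_cem_Some: "open U \<Longrightarrow> openin cem_top (Some ` U)"
  by (simp add: cem_top_def)

lemma closedin_cem_Some:
  fixes K :: "'x::t2_space set"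
  shows "compact K \<Longrightarrow> closedin cem_top (Some ` K)"
  by (simp add: cem_top_def compact_imp_closed)

lemma compl_Some_image: "- Some ` C = insert None (Some ` (- C))"
proof (rule set_eqI)
  show "x \<in> - Some ` C \<longleftrightarrow> x \<in> insert None (Some ` (- C))" for x
    by (cases x) auto
qed

lemma openin_cem_cases:
  assumes "openin cem_top V"
  obtains U where "open U" "V = Some ` U" | C where "closed C" "compact C" "V = - Some ` C"
proof -
  from assms consider U where "open U" "V = Some ` U"
    | C where "closed C" "compact C" "V = insert None (Some ` (- C))"
    by (auto simp: cem_top_def openin_Alexandroff_compactification Compl_eq_Diff_UNIV)
  then show thesis
  proof cases
    case 2
    show thesis by (rule that(2)[OF 2(1,2)]) (simp only: 2(3) compl_Some_image)
  qed (use that in blast)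
qed

text \<open>Extended by \<open>0\<close> at the cemetery, a function vanishing at infinity is
  continuous on the compactification. Paths are thus studied through real functions, for which
  limits preserve measurability.\<close>

lemma limitin_cem_tendsto:
  fixes \<phi> :: "'x::topological_space \<Rightarrow> real"
  assumes "limitin cem_top f l F" "vanishing_continuous \<phi>"
  shows "((\<lambda>t. ext0 \<phi> (f t)) \<longlongrightarrow> ext0 \<phi> l) F"
proof -
  have cont: "continuous_on UNIV \<phi>" and comp: "\<And>e. e > 0 \<Longrightarrow> compact {x. e \<le> \<bar>\<phi> x\<bar>}"
    using assms(2) by (auto simp: vanishing_continuous_def)
  have ev: "\<forall>\<^sub>F t in F. f t \<in> U" if "openin cem_top U" "l \<in> U" for U
    using assms(1) that by (auto simp: limitin_def)
  show ?thesis
  proof (rule topological_tendstoI)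
    fix S :: "real set" assume S: "open S" "ext0 \<phi> l \<in> S"
    show "\<forall>\<^sub>F t in F. ext0 \<phi> (f t) \<in> S"
    proof (cases l)
      case None
      then obtain e where e: "e > 0" "ball 0 e \<subseteq> S"
        using S open_contains_ball by (metis option.simps(4))
      have clo: "closed {x. e \<le> \<bar>\<phi> x\<bar>}"
        by (intro closed_Collect_le continuous_intros cont)
      note compl_Some_image[of "{x. e \<le> \<bar>\<phi> x\<bar>}"]
      then have "openin cem_top (- Some ` {x. e \<le> \<bar>\<phi> x\<bar>})"
        using clo comp[OF e(1)]
        by (auto simp: cem_top_def openin_Alexandroff_compactification Compl_eq_Diff_UNIV)
      from ev[OF this] have "\<forall>\<^sub>F t in F. f t \<in> - Some ` {x. e \<le> \<bar>\<phi> x\<bar>}"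
        using None by auto
      then show ?thesis
      proof eventually_elim
        case (elim t)
        then show ?case using e by (cases "f t") (auto simp: image_iff subset_iff)
      qed
    next
      case (Some x)
      have "open (\<phi> -` S)"
        using S(1) cont by (simp add: continuous_on_open_vimage)
      from ev[OF openin_cem_Some[OF this]] have "\<forall>\<^sub>F t in F. f t \<in> Some ` (\<phi> -` S)"
        using Some S by auto
      then show ?thesis
        by eventually_elim auto
    qed
  qed
qed

lemma limitin_cem_closed:
  assumes "limitin cem_top f l F" "F \<noteq> bot" "eventually (\<lambda>t. f t \<in> C) F" "closedin cem_top C"
  shows "l \<in> C"
  using limitin_closedin[OF assms(1,4,3)] assms(2) by auto

lemma exists_vanishing_positive:
  fixes U :: "'x::heine_borel set"
  assumes "open U"
  obtains \<phi> :: "'x \<Rightarrow> real" where "vanishing_continuous \<phi>" "\<And>x. 0 \<le> \<phi> x" "\<And>x. 0 < \<phi> x \<longleftrightarrow> x \<in> U"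
proof -
  define a :: 'x where "a = undefined"
  \<comment> \<open>\<open>infdist\<close> to the empty set is \<open>0\<close>, hence the case
    \<open>U = UNIV\<close>. The second term of the minimum forces superlevel sets to be
    bounded.\<close>
  define \<phi> where "\<phi> x = min (if U = UNIV then 1 else infdist x (- U)) (1 / (1 + dist a x))" for x
  have nn: "0 \<le> \<phi> x" for x
    by (auto simp: \<phi>_def intro: infdist_nonneg)
  have cont: "continuous_on UNIV \<phi>"
  proof -
    have "continuous_on UNIV (\<lambda>x. if U = UNIV then 1 else infdist x (- U))"
      by (cases "U = UNIV") (auto intro!: continuous_intros)
    then show ?thesis
      unfolding \<phi>_def by (auto intro!: continuous_intros simp: add_nonneg_eq_0_iff)
  qed
  have pos: "0 < \<phi> x \<longleftrightarrow> x \<in> U" for x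
  proof (cases "U = UNIV")
    case True then show ?thesis by (auto simp: \<phi>_def add_pos_nonneg)
  next
    case False
    then have "infdist x (- U) = 0 \<longleftrightarrow> x \<in> - U"
      using assms in_closed_iff_infdist_zero[of "- U" x] by (auto simp: open_closed)
    then have "0 < infdist x (- U) \<longleftrightarrow> x \<in> U"
      using infdist_nonneg[of x "- U"] by auto
    then show ?thesis using False by (auto simp: \<phi>_def add_pos_nonneg)
  qed
  have "compact {x. e \<le> \<bar>\<phi> x\<bar>}" if "e > 0" for e
  proof -
    have "{x. e \<le> \<bar>\<phi> x\<bar>} \<subseteq> cball a (1 / e)"
    proof
      fix x assume "x \<in> {x. e \<le> \<bar>\<phi> x\<bar>}"
      then have "e \<le> 1 / (1 + dist a x)" using nn[of x] by (auto simp: \<phi>_def)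
      then have "e * (1 + dist a x) \<le> 1"
        by (simp add: pos_le_divide_eq add_pos_nonneg)
      then have "e * dist a x \<le> 1" using that by (simp add: distrib_left)
      then show "x \<in> cball a (1 / e)" using that by (simp add: field_simps)
    qed
    moreover have "closed {x. e \<le> \<bar>\<phi> x\<bar>}"
      by (intro closed_Collect_le continuous_intros cont)
    ultimately show ?thesis
      by (meson bounded_cball bounded_subset compact_eq_bounded_closed)
  qed
  then have "vanishing_continuous \<phi>" using cont by (auto simp: vanishing_continuous_def)
  with nn pos that show thesis by blast
qed

text \<open>Divide a function that is positive exactly on \<open>U\<close> by a positive lower bound
  on \<open>K\<close> and cut at \<open>1\<close>.\<close>

lemma exists_vanishing_bump:
  fixes U :: "'x::heine_borel set"
  assumes "open U" "compact K" "K \<subseteq> U"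
  obtains \<phi> :: "'x \<Rightarrow> real" where "vanishing_continuous \<phi>" "\<And>x. 0 \<le> \<phi> x" "\<And>x. \<phi> x \<le> 1"
    "\<And>x. x \<in> K \<Longrightarrow> \<phi> x = 1" "\<And>x. x \<notin> U \<Longrightarrow> \<phi> x = 0"
proof -
  obtain \<psi> :: "'x \<Rightarrow> real" where \<psi>: "vanishing_continuous \<psi>" "\<And>x. 0 \<le> \<psi> x" "\<And>x. 0 < \<psi> x \<longleftrightarrow> x \<in> U"
    using exists_vanishing_positive[OF assms(1)] by blast
  have cont: "continuous_on UNIV \<psi>" using \<psi>(1) by (auto simp: vanishing_continuous_def)
  obtain d where d: "d > 0" "\<And>x. x \<in> K \<Longrightarrow> d \<le> \<psi> x"
  proof (cases "K = {}")
    case False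
    then obtain x0 where "x0 \<in> K" "\<And>x. x \<in> K \<Longrightarrow> \<psi> x0 \<le> \<psi> x"
      using continuous_attains_inf[OF assms(2) False continuous_on_subset[OF cont]] by auto
    then show thesis using that[of "\<psi> x0"] \<psi>(3) assms(3) by auto
  qed (use that[of 1] in auto)
  define \<phi> where "\<phi> x = min 1 (\<psi> x / d)" for x
  have contp: "continuous_on UNIV \<phi>"
    unfolding \<phi>_def using d(1) by (intro continuous_intros cont) auto
  have "compact {x. e \<le> \<bar>\<phi> x\<bar>}" if "e > 0" for e
  proof -
    have "{x. e \<le> \<bar>\<phi> x\<bar>} \<subseteq> {x. e * d \<le> \<bar>\<psi> x\<bar>}"
    proof clarify
      fix x assume "e \<le> \<bar>\<phi> x\<bar>"
      then have "e \<le> \<psi> x / d"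
        using d(1) \<psi>(2)[of x] by (simp add: \<phi>_def)
      then show "e * d \<le> \<bar>\<psi> x\<bar>"
        using d(1) \<psi>(2)[of x] by (simp add: pos_le_divide_eq)
    qed
    moreover have "compact {x. e * d \<le> \<bar>\<psi> x\<bar>}"
      using \<psi>(1) that d(1) by (auto simp: vanishing_continuous_def)
    moreover have "closed {x. e \<le> \<bar>\<phi> x\<bar>}"
      by (intro closed_Collect_le continuous_intros contp)
    ultimately show ?thesis using compact_Int_closed[of _ "{x. e \<le> \<bar>\<phi> x\<bar>}"] by (metis inf.absorb_iff2)
  qed
  then have "vanishing_continuous \<phi>" using contp by (auto simp: vanishing_continuous_def)
  moreover have "\<phi> x = 0" if "x \<notin> U" for x
    using \<psi>(2)[of x] \<psi>(3)[of x] that d(1) by (auto simp: \<phi>_def)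
  ultimately show thesis
    using that[of \<phi>] d \<psi>(2) by (auto simp: \<phi>_def min_def field_simps)
qed

lemma space_cem_borel [simp]: "space cem_borel = UNIV"
  by (simp add: cem_borel_def)

lemma sets_cem_borel: "sets cem_borel = sigma_sets UNIV {U. openin cem_top U}"
  by (simp add: cem_borel_def)

text \<open>Neighbourhoods of the cemetery need no separate test: each is the complement of the copy
  of a closed set, and that copy is a difference of copies of two open sets.\<close>

lemma measurable_cem_borelI:
  fixes f :: "'w \<Rightarrow> 'x::topological_space option"
  assumes "\<And>U. open U \<Longrightarrow> f -` (Some ` U) \<inter> space M \<in> sets M"
  shows "f \<in> M \<rightarrow>\<^sub>M cem_borel"
  unfolding cem_borel_def
proof (rule measurable_measure_of)
  fix V :: "'x option set" assume "V \<in> {U. openin cem_top U}"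
  then have "openin cem_top V" by simp
  then show "f -` V \<inter> space M \<in> sets M"
  proof (cases rule: openin_cem_cases)
    case (1 U) then show ?thesis using assms by auto
  next
    case (2 C)
    have "f -` V \<inter> space M = space M - ((f -` (Some ` UNIV) \<inter> space M) - (f -` (Some ` (- C)) \<inter> space M))"
      unfolding 2 by (auto simp: image_iff)
    also have "\<dots> \<in> sets M"
      using assms[of UNIV] assms[of "- C"] 2 by auto
    finally show ?thesis .
  qed
qed auto

lemma measurable_Some [measurable]: "Some \<in> borel \<rightarrow>\<^sub>M cem_borel"
  by (rule measurable_cem_borelI) (auto simp: inj_vimage_image_eq)

lemma sets_cem_Some [measurable]:
  assumes "A \<in> sets (borel :: 'x::topological_space measure)"
  shows "Some ` A \<in> sets cem_borel"
proof -
  have UN: "range Some \<in> sets (cem_borel :: 'x option measure)"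
    unfolding sets_cem_borel by (rule sigma_sets.Basic) (simp add: openin_cem_Some)
  have "A \<in> sigma_sets UNIV {S. open S}" using assms by (simp add: borel_def)
  then show ?thesis
  proof induction
    case (Basic a) then show ?case
      unfolding sets_cem_borel by (intro sigma_sets.Basic) (simp add: openin_cem_Some)
  next
    case (Compl a)
    have "Some ` (UNIV - a) = range Some - Some ` a" by auto
    with Compl UN show ?case by auto
  next
    case (Union a) then show ?case by (simp add: image_UN)
  qed auto
qed

lemma sets_cem_None [measurable]: "{None} \<in> sets cem_borel"
proof -
  have "{None} = space cem_borel - Some ` UNIV" using notin_range_Some by auto
  then show ?thesis by (metis sets.compl_sets sets_cem_Some sets.top space_borel)
qed

lemma measurable_ext0 [measurable]:
  assumes "u \<in> borel_measurable borel"
  shows "ext0 u \<in> borel_measurable cem_borel"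
proof (rule measurableI)
  fix A :: "'b set" assume "A \<in> sets borel"
  then have "u -` A \<in> sets borel" using measurable_sets[OF assms] by (metis inf_top_right space_borel)
  then have B: "Some ` (u -` A) \<in> sets cem_borel" by auto
  have "ext0 u -` A \<inter> space cem_borel = Some ` (u -` A) \<union> (if 0 \<in> A then {None} else {})"
  proof (rule set_eqI)
    show "x \<in> ext0 u -` A \<inter> space cem_borel \<longleftrightarrow>
        x \<in> Some ` (u -` A) \<union> (if 0 \<in> A then {None} else {})" for x
      by (cases x) auto
  qed
  moreover have "(if 0 \<in> A then {None} else {} :: 'a option set) \<in> sets cem_borel"
    using sets_cem_None by auto
  ultimately show "ext0 u -` A \<inter> space cem_borel \<in> sets cem_borel"
    using B by (simp only: sets.Un)
qed auto

text \<open>Every open set is the positivity set of a vanishing continuous function, so real tests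
  suffice; measurability then survives limits along a path.\<close>

lemma measurable_cem_borel_testI:
  fixes f :: "'w \<Rightarrow> 'x::heine_borel option"
  assumes "\<And>\<phi> :: 'x \<Rightarrow> real. vanishing_continuous \<phi> \<Longrightarrow> (\<lambda>\<omega>. ext0 \<phi> (f \<omega>)) \<in> borel_measurable M"
  shows "f \<in> M \<rightarrow>\<^sub>M cem_borel"
proof (rule measurable_cem_borelI)
  fix U :: "'x set" assume "open U"
  then obtain \<phi> :: "'x \<Rightarrow> real" where \<phi>: "vanishing_continuous \<phi>" "\<And>x. 0 \<le> \<phi> x" "\<And>x. 0 < \<phi> x \<longleftrightarrow> x \<in> U"
    using exists_vanishing_positive by blast
  have "f -` (Some ` U) \<inter> space M = {\<omega> \<in> space M. 0 < ext0 \<phi> (f \<omega>)}"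
  proof (rule set_eqI)
    show "\<omega> \<in> f -` (Some ` U) \<inter> space M \<longleftrightarrow> \<omega> \<in> {\<omega> \<in> space M. 0 < ext0 \<phi> (f \<omega>)}" for \<omega>
      using \<phi>(3) by (cases "f \<omega>") auto
  qed
  also have "\<dots> \<in> sets M"
    using assms[OF \<phi>(1)] by measurable
  finally show "f -` (Some ` U) \<inter> space M \<in> sets M" .
qed

section \<open>Paths of a Hunt process\<close>

locale hunt =
  fixes X :: "('w, 'x::{heine_borel, second_countable_topology}) process"
  assumes hunt: "hunt_process X"
begin

lemmas hunt_conjuncts = hunt[unfolded hunt_process_def]

lemmas law_measurable = hunt_conjuncts[THEN conjunct1]
  and traj_0 = hunt_conjuncts[THEN conjunct2, THEN conjunct1, rule_format]
  and traj_top [simp] = hunt_conjuncts[THEN conjunct2, THEN conjunct2, THEN conjunct1, rule_format]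
  and hunt_conjuncts' = hunt_conjuncts[THEN conjunct2, THEN conjunct2, THEN conjunct2]

lemmas traj_right = hunt_conjuncts'[THEN conjunct2, THEN conjunct1, rule_format]
  and hunt_conjuncts'' = hunt_conjuncts'[THEN conjunct2, THEN conjunct2, THEN conjunct2]

lemmas shift_exists_finite = hunt_conjuncts''[THEN conjunct1, rule_format]
  and filt_right = hunt_conjuncts''[THEN conjunct2, THEN conjunct1, rule_format]
  and simple_strong_markov =
    hunt_conjuncts''[THEN conjunct2, THEN conjunct2, THEN conjunct1, rule_format]

lemma traj_absorb: "traj X s \<omega> = None \<Longrightarrow> s \<le> t \<Longrightarrow> traj X t \<omega> = None"
  using hunt_conjuncts'[THEN conjunct1] by blast

lemma traj_left: "0 < t \<Longrightarrow> t < \<top> \<Longrightarrow> \<exists>l. limitin cem_top (\<lambda>s. traj X s \<omega>) l (at_left t)"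
  using hunt_conjuncts'[THEN conjunct2, THEN conjunct2, THEN conjunct1] by blast

lemma quasi_left: "(\<And>n. stopping_time (filt X) (Tn n)) \<Longrightarrow> (\<And>\<omega>. incseq (\<lambda>n. Tn n \<omega>)) \<Longrightarrow>
    AE \<omega> in prob_at X x. (SUP n. Tn n \<omega>) < \<top> \<longrightarrow>
       limitin cem_top (\<lambda>n. traj X (Tn n \<omega>) \<omega>) (traj X (SUP n. Tn n \<omega>) \<omega>) sequentially"
  by (rule hunt_conjuncts''[THEN conjunct2, THEN conjunct2, THEN conjunct2, rule_format]) simp

lemma space_raw [simp]: "space (raw_filtration X t) = UNIV"
  by (simp add: raw_filtration_def)

lemma sets_raw: "sets (raw_filtration X t) =
    sigma_sets UNIV (\<Union>s\<in>{..t}. {traj X s -` A | A. A \<in> sets cem_borel})"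
  by (simp add: raw_filtration_def)

lemma raw_mono: "s \<le> t \<Longrightarrow> sets (raw_filtration X s) \<subseteq> sets (raw_filtration X t)"
  unfolding sets_raw by (rule sigma_sets_mono') force

lemma traj_raw: "s \<le> t \<Longrightarrow> traj X s \<in> raw_filtration X t \<rightarrow>\<^sub>M cem_borel"
  by (rule measurableI) (auto simp: sets_raw intro!: sigma_sets.Basic)

lemma traj_raw_top [measurable]: "traj X s \<in> raw_filtration X \<top> \<rightarrow>\<^sub>M cem_borel"
  by (rule traj_raw) simp

lemma measurable_rawI:
  assumes "\<And>s. (\<lambda>\<omega>. traj X s (S \<omega>)) \<in> M \<rightarrow>\<^sub>M cem_borel"
  shows "S \<in> M \<rightarrow>\<^sub>M raw_filtration X \<top>"
  unfolding raw_filtration_def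
proof (rule measurable_measure_of)
  fix B assume "B \<in> (\<Union>s\<in>{..\<top>}. {traj X s -` A |A. A \<in> sets cem_borel})"
  then obtain s A where "B = traj X s -` A" "A \<in> sets cem_borel" by auto
  then have "S -` B \<inter> space M = (\<lambda>\<omega>. traj X s (S \<omega>)) -` A \<inter> space M" by auto
  also have "\<dots> \<in> sets M" using assms \<open>A \<in> _\<close> by (rule measurable_sets)
  finally show "S -` B \<inter> space M \<in> sets M" .
qed auto

lemma traj_right_tendsto:
  "t < \<top> \<Longrightarrow> vanishing_continuous \<phi> \<Longrightarrow> ((\<lambda>s. ext0 \<phi> (traj X s \<omega>)) \<longlongrightarrow> ext0 \<phi> (traj X t \<omega>)) (at_right t)"
  by (rule limitin_cem_tendsto[OF traj_right])

text \<open>Progressive measurability: by right continuity the value at \<open>T\<close> is a limit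
  of values at grid points to the right of \<open>T\<close>. Capping these at \<open>t\<close> keeps
  to the part of the path up to \<open>t\<close>. The map \<open>S\<close> lets the path depend on a
  point of another space, such as a product.\<close>

lemma traj_random_time:
  fixes T :: "'a \<Rightarrow> ennreal"
  assumes T[measurable]: "T \<in> borel_measurable M" and le: "\<And>\<omega>. \<omega> \<in> space M \<Longrightarrow> T \<omega> \<le> t"
    and S: "\<And>s. s \<le> t \<Longrightarrow> (\<lambda>\<omega>. traj X s (S \<omega>)) \<in> M \<rightarrow>\<^sub>M cem_borel"
  shows "(\<lambda>\<omega>. traj X (T \<omega>) (S \<omega>)) \<in> M \<rightarrow>\<^sub>M cem_borel"
proof (rule measurable_cem_borel_testI)
  fix \<phi> :: "'x \<Rightarrow> real" assume \<phi>: "vanishing_continuous \<phi>"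
  then have \<phi>m[measurable]: "\<phi> \<in> borel_measurable borel"
    by (auto simp: vanishing_continuous_def intro: borel_measurable_continuous_onI)
  \<comment> \<open>\<open>Suc (N k \<omega>) / Suc k\<close> is the first grid point strictly after
    \<open>T \<omega>\<close>; strictness is needed for a limit from the right.\<close>
  define N where "N k \<omega> = nat \<lfloor>real (Suc k) * enn2real (T \<omega>)\<rfloor>" for k \<omega>
  define R where "R k i = min t (ennreal (real (Suc i) / real (Suc k)))" for k i
  \<comment> \<open>At \<open>T \<omega> = \<top>\<close> the path is in the cemetery, where
    \<open>ext0 \<phi>\<close> is \<open>0\<close>.\<close>
  define Y where "Y k \<omega> = (if T \<omega> = \<top> then 0 else ext0 \<phi> (traj X (R k (N k \<omega>)) (S \<omega>)))" for k \<omega>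
  have Nm[measurable]: "N k \<in> M \<rightarrow>\<^sub>M count_space UNIV" for k
    unfolding N_def by measurable
  have [measurable]: "(\<lambda>\<omega>. traj X (R k (N k \<omega>)) (S \<omega>)) \<in> M \<rightarrow>\<^sub>M cem_borel" for k
    by (rule measurable_compose_countable'[where g="N k" and I=UNIV]) (auto intro!: S simp: R_def)
  have Ym: "Y k \<in> borel_measurable M" for k
    unfolding Y_def by measurable
  show "(\<lambda>\<omega>. ext0 \<phi> (traj X (T \<omega>) (S \<omega>))) \<in> borel_measurable M"
  proof (rule borel_measurable_LIMSEQ_metric[OF Ym])
    fix \<omega> assume w: "\<omega> \<in> space M"
    show "(\<lambda>k. Y k \<omega>) \<longlonglongrightarrow> ext0 \<phi> (traj X (T \<omega>) (S \<omega>))"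
    proof (cases "T \<omega> = \<top>")
      case True then show ?thesis by (simp add: Y_def)
    next
      case False
      then obtain u where u: "T \<omega> = ennreal u" "0 \<le> u" by (cases "T \<omega>") auto
      define a where "a k = real (Suc (N k \<omega>)) / real (Suc k)" for k
      have a1: "u < a k" and a2: "a k \<le> u + 1 / real (Suc k)" for k
      proof -
        define c where "c = real (Suc k) * u"
        have "0 \<le> c" using u by (simp add: c_def)
        then have "real (N k \<omega>) = of_int \<lfloor>c\<rfloor>"
          using u by (simp add: N_def c_def)
        moreover have "of_int \<lfloor>c\<rfloor> \<le> c" "c < of_int \<lfloor>c\<rfloor> + 1"
          by (rule of_int_floor_le, rule real_of_int_floor_add_one_gt)
        ultimately have "c < real (N k \<omega>) + 1" "real (N k \<omega>) + 1 \<le> c + 1"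
          by simp_all
        moreover define d where "d = real (Suc k)"
        moreover define e where "e = real (N k \<omega>) + 1"
        ultimately have *: "d * u < e" "e \<le> d * u + 1" "d > 0"
          unfolding c_def d_def by auto
        have ak: "a k = e / d" by (simp add: a_def e_def d_def add.commute)
        show "u < a k" unfolding ak using * by (simp add: pos_less_divide_eq mult.commute)
        show "a k \<le> u + 1 / real (Suc k)"
          unfolding ak d_def[symmetric] using * by (simp add: field_simps)
      qed
      show ?thesis
      \<comment> \<open>If \<open>T\<close> equals the cap, no capped point lies strictly to the
        right of \<open>T\<close>, but then all of them equal \<open>t\<close>.\<close>
      proof (cases "T \<omega> = t")
        case True
        have "R k (N k \<omega>) = t" for k
          using a1[of k] True u unfolding R_def a_def[symmetric] min_def
          by (auto simp: ennreal_le_iff2)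
        then show ?thesis using False True by (simp add: Y_def)
      next
        case False2: False
        with le[OF w] have lt: "T \<omega> < t" by auto
        have "(\<lambda>k. u + 1 / real (Suc k)) \<longlonglongrightarrow> u + 0"
          by (intro tendsto_intros LIMSEQ_Suc[OF lim_1_over_n])
        then have "a \<longlonglongrightarrow> u"
          by (intro tendsto_sandwich[of "\<lambda>_. u" a _ "\<lambda>k. u + 1 / real (Suc k)"])
             (auto intro!: always_eventually less_imp_le a1 a2 simp del: of_nat_Suc)
        then have "(\<lambda>k. ennreal (a k)) \<longlonglongrightarrow> T \<omega>"
          unfolding u(1) by (intro tendsto_ennrealI)
        then have "(\<lambda>k. min t (ennreal (a k))) \<longlonglongrightarrow> min t (T \<omega>)"
          by (intro tendsto_min tendsto_const)
        then have lim: "(\<lambda>k. R k (N k \<omega>)) \<longlonglongrightarrow> T \<omega>"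
          using lt by (simp add: R_def a_def min_absorb2)
        have gt: "T \<omega> < R k (N k \<omega>)" for k
          using lt a1[of k] u unfolding R_def a_def[symmetric] by (simp add: ennreal_less_iff)
        have "filterlim (\<lambda>k. R k (N k \<omega>)) (at_right (T \<omega>)) sequentially"
          using lim gt by (auto simp: filterlim_at intro!: always_eventually) (metis less_irrefl)
        from filterlim_compose[OF traj_right_tendsto[OF _ \<phi>, of "T \<omega>" "S \<omega>"] this]
        have "(\<lambda>k. ext0 \<phi> (traj X (R k (N k \<omega>)) (S \<omega>))) \<longlonglongrightarrow> ext0 \<phi> (traj X (T \<omega>) (S \<omega>))"
          using False by (simp add: top.not_eq_extremum)
        then show ?thesis using False by (simp add: Y_def)
      qed
    qed
  qed
qed

lemma traj_random_time_top:
  assumes "T \<in> borel_measurable M" "S \<in> M \<rightarrow>\<^sub>M raw_filtration X \<top>"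
  shows "(\<lambda>\<omega>. traj X (T \<omega>) (S \<omega>)) \<in> M \<rightarrow>\<^sub>M cem_borel"
  by (rule traj_random_time[OF assms(1), of \<top>]) (simp_all add: measurable_compose[OF assms(2) traj_raw_top])

lemma traj_joint [measurable]:
  "(\<lambda>(t, \<omega>). traj X t \<omega>) \<in> borel \<Otimes>\<^sub>M raw_filtration X \<top> \<rightarrow>\<^sub>M cem_borel"
  unfolding split_beta by (rule traj_random_time_top) measurable

end

context hunt
begin

section \<open>Filtrations and exit times\<close>

lemma law_in_prob_algebra: "law X x \<in> space (prob_algebra (raw_filtration X \<top>))"
  using measurable_space[OF law_measurable] by simp

lemma sets_law [simp, measurable_cong]: "sets (law X x) = sets (raw_filtration X \<top>)"
  using law_in_prob_algebra[of x] by (simp add: space_prob_algebra)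

lemma space_law [simp]: "space (law X x) = UNIV"
  using sets_eq_imp_space_eq[OF sets_law[of x]] by simp

lemma prob_space_law: "prob_space (law X x)"
  using law_in_prob_algebra[of x] by (simp add: space_prob_algebra)

lemma space_prob_at [simp]: "space (prob_at X x) = UNIV"
  by (simp add: prob_at_def)

lemma prob_space_prob_at: "prob_space (prob_at X x)"
  unfolding prob_at_def using prob_space_law by (rule prob_space.prob_space_completion)

lemma raw_prob_at: "A \<in> sets (raw_filtration X \<top>) \<Longrightarrow> A \<in> sets (prob_at X x)"
  by (simp add: prob_at_def sets_completionI_sets)

lemma emeasure_prob_at: "A \<in> sets (raw_filtration X \<top>) \<Longrightarrow> emeasure (prob_at X x) A = emeasure (law X x) A"
  by (simp add: prob_at_def)

definition law_null :: "'w set \<Rightarrow> bool" where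
  "law_null N \<longleftrightarrow> N \<in> sets (raw_filtration X \<top>) \<and> (\<forall>x. emeasure (law X x) N = 0)"

lemma law_null_empty: "law_null {}"
  by (simp add: law_null_def)

lemma law_null_UN:
  assumes "\<And>n::nat. law_null (N n)"
  shows "law_null (\<Union>n. N n)"
proof -
  have "N n \<in> null_sets (law X x)" for n x
    using assms[of n] by (auto simp: law_null_def null_sets_def)
  then have "(\<Union>n. N n) \<in> null_sets (law X x)" for x
    by (intro null_sets_UN) auto
  then show ?thesis using assms by (auto simp: law_null_def null_sets_def)
qed

lemma law_null_prob_at:
  assumes "law_null N" "A \<subseteq> N"
  shows "A \<in> null_sets (prob_at X x)"
proof -
  have "N \<in> null_sets (law X x)" using assms(1) by (auto simp: law_null_def null_sets_def)
  then show ?thesis unfolding prob_at_def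
    using assms(2) null_sets_completion_subset null_sets_completionI by metis
qed

lemma law_null_AE: "law_null N \<Longrightarrow> AE \<omega> in prob_at X x. \<omega> \<notin> N"
  using law_null_prob_at[of N N x] by (simp add: AE_not_in)

lemma law_measurable_init:
  assumes "\<mu> \<in> space (prob_algebra cem_borel)"
  shows "law X \<in> \<mu> \<rightarrow>\<^sub>M subprob_algebra (raw_filtration X \<top>)" "space \<mu> \<noteq> {}"
proof -
  have s: "sets \<mu> = sets cem_borel" using assms by (simp add: space_prob_algebra)
  have "law X \<in> cem_borel \<rightarrow>\<^sub>M subprob_algebra (raw_filtration X \<top>)"
    by (rule measurable_prob_algebraD[OF law_measurable])
  then show "law X \<in> \<mu> \<rightarrow>\<^sub>M subprob_algebra (raw_filtration X \<top>)"
    using s by (simp cong: measurable_cong_sets)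
  show "space \<mu> \<noteq> {}" using sets_eq_imp_space_eq[OF s] by simp
qed

text \<open>An initial distribution only mixes the laws \<open>law X x\<close>.\<close>

lemma law_null_init:
  assumes \<mu>: "\<mu> \<in> space (prob_algebra cem_borel)" and N: "law_null N" "A \<subseteq> N"
  shows "A \<in> null_sets (init_law X \<mu>)"
proof -
  note m = law_measurable_init[OF \<mu>]
  have "emeasure (Giry_Monad.bind \<mu> (law X)) N = (\<integral>\<^sup>+x. emeasure (law X x) N \<partial>\<mu>)"
    using N m by (intro emeasure_bind) (auto simp: law_null_def)
  also have "\<dots> = 0" using N by (simp add: law_null_def)
  finally have "N \<in> null_sets (Giry_Monad.bind \<mu> (law X))"
    using N m by (auto simp: null_sets_def law_null_def sets_bind)
  then show ?thesis unfolding init_law_def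
    using N(2) null_sets_completion_subset null_sets_completionI by metis
qed

lemma init_law_return: "init_law X (return cem_borel x) = prob_at X x"
proof -
  have "Giry_Monad.bind (return cem_borel x) (law X) = law X x"
    by (rule bind_return[OF measurable_prob_algebraD[OF law_measurable]]) simp
  then show ?thesis by (simp add: init_law_def prob_at_def)
qed

text \<open>Adjoining only the sets that are null under every law gives a concrete \<open>\<sigma>\<close>-algebra
  which contains the exit times and is contained in the usual augmentation.\<close>

definition aug :: "ennreal \<Rightarrow> 'w measure" where
  "aug t = sigma UNIV {A. \<exists>B\<in>sets (raw_filtration X t). \<exists>N. law_null N \<and> sym_diff A B \<subseteq> N}"

lemma space_aug [simp]: "space (aug t) = UNIV"
  by (simp add: aug_def)

text \<open>The sets in \<open>law_null\<close> are closed under countable unions, so the generating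
  family is already a \<sigma>-algebra.\<close>

lemma sets_aug: "sets (aug t) = {A. \<exists>B\<in>sets (raw_filtration X t). \<exists>N. law_null N \<and> sym_diff A B \<subseteq> N}"
  (is "_ = ?S")
proof -
  have "sigma_algebra UNIV ?S"
    unfolding sigma_algebra_iff2
  proof (intro conjI ballI allI impI)
    show "{} \<in> ?S" using law_null_empty by force
  next
    fix A assume "A \<in> ?S"
    then obtain B N where "B \<in> sets (raw_filtration X t)" "law_null N" "sym_diff A B \<subseteq> N" by auto
    then show "UNIV - A \<in> ?S"
      using sets.compl_sets[of B "raw_filtration X t"]
      by (auto intro!: bexI[of _ "UNIV - B"] exI[of _ N])
  next
    fix A :: "nat \<Rightarrow> 'w set" assume "range A \<subseteq> ?S"
    then have "A n \<in> ?S" for n by blast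
    then have "\<forall>n. \<exists>B N. B \<in> sets (raw_filtration X t) \<and> law_null N \<and> sym_diff (A n) B \<subseteq> N" by simp blast
    then obtain B N where *: "\<And>n. B n \<in> sets (raw_filtration X t)" "\<And>n. law_null (N n)"
        "\<And>n. sym_diff (A n) (B n) \<subseteq> N n"
      by metis
    then have "(\<Union>n. B n) \<in> sets (raw_filtration X t)" "law_null (\<Union>n. N n)"
      using law_null_UN by auto
    moreover have "sym_diff (\<Union>n. A n) (\<Union>n. B n) \<subseteq> (\<Union>n. N n)"
      using *(3) by blast
    ultimately show "(\<Union>n. A n) \<in> ?S" by blast
  qed auto
  then show ?thesis
    unfolding aug_def by (rule sigma_algebra.sets_measure_of_eq)
qed

lemma raw_aug: "sets (raw_filtration X t) \<subseteq> sets (aug t)"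
  unfolding sets_aug using law_null_empty by force

lemma aug_mono: "s \<le> t \<Longrightarrow> sets (aug s) \<subseteq> sets (aug t)"
  unfolding sets_aug using raw_mono by blast

lemma aug_filt: "sets (aug t) \<subseteq> sets (filt X t)"
proof
  fix A assume "A \<in> sets (aug t)"
  then obtain B N where B: "B \<in> sets (raw_filtration X t)" "law_null N" "sym_diff A B \<subseteq> N"
    unfolding sets_aug by auto
  then have "\<forall>\<mu>\<in>space (prob_algebra cem_borel). \<exists>B\<in>sets (raw_filtration X t). sym_diff A B \<in> null_sets (init_law X \<mu>)"
    using law_null_init[OF _ B(2,3)] by blast
  then show "A \<in> sets (filt X t)"
    unfolding filt_def by (simp add: sigma_sets.Basic)
qed

lemma space_filt [simp]: "space (filt X t) = UNIV"
  by (simp add: filt_def)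

lemma return_in_prob_algebra: "return cem_borel x \<in> space (prob_algebra cem_borel)"
  by (simp add: space_prob_algebra prob_space_return)

text \<open>Test the augmentation with the point mass at \<open>x\<close>, whose initial law is
  \<open>prob_at X x\<close>.\<close>

lemma filt_prob_at: "sets (filt X t) \<subseteq> sets (prob_at X x)"
proof -
  have "A \<in> sets (prob_at X x)"
    if "B \<in> sets (raw_filtration X t)" "sym_diff A B \<in> null_sets (prob_at X x)" for A B
  proof -
    have B: "B \<in> sets (prob_at X x)" using that(1) raw_mono[of t \<top>] raw_prob_at by auto
    have s: "sym_diff A B \<in> null_sets (completion (law X x))" using that(2) by (simp add: prob_at_def)
    have "A - B \<in> sets (prob_at X x)" "B - A \<in> sets (prob_at X x)"
      unfolding prob_at_def
      using null_sets_completion_subset[OF _ s] null_setsD2 by blast+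
    then have "(B - (B - A)) \<union> (A - B) \<in> sets (prob_at X x)" using B by auto
    moreover have "(B - (B - A)) \<union> (A - B) = A" by auto
    ultimately show ?thesis by simp
  qed
  then have "{A. \<forall>\<mu>\<in>space (prob_algebra cem_borel). \<exists>B\<in>sets (raw_filtration X t).
        sym_diff A B \<in> null_sets (init_law X \<mu>)} \<subseteq> sets (prob_at X x)"
    using return_in_prob_algebra[of x] init_law_return[of x] by fastforce
  then show ?thesis
    unfolding filt_def using sets.sigma_sets_subset[of _ "prob_at X x"] by simp
qed

lemma aug_prob_at: "sets (aug t) \<subseteq> sets (prob_at X x)"
  using aug_filt filt_prob_at by blast

lemma filt_mono: "s \<le> t \<Longrightarrow> sets (filt X s) \<subseteq> sets (filt X t)"
  unfolding filt_def using raw_mono[of s t] by (simp, intro sigma_sets_mono') blast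

sublocale filt: filtration UNIV "filt X"
  by standard (simp_all add: filt_mono)

lemma ennreal_dense_in:
  obtains Q :: "ennreal set" where "countable Q" "\<And>s t. s < t \<Longrightarrow> \<exists>d\<in>Q. s < d \<and> d < t"
proof -
  obtain Q :: "ennreal set" where Q: "countable Q" "\<And>X. open X \<Longrightarrow> X \<noteq> {} \<Longrightarrow> \<exists>d\<in>Q. d \<in> X"
    using countable_dense_setE by auto
  have "\<exists>d\<in>Q. s < d \<and> d < t" if "s < t" for s t
    using Q(2)[of "{s<..<t}"] dense[OF that] by auto
  with Q(1) that show thesis by blast
qed

text \<open>The augmented filtration is right-continuous, and for \<open>s > t\<close> the event
  \<open>T \<le> t\<close> is a countable intersection of events \<open>T < d\<close> with
  \<open>t < d < s\<close>. Right continuity is available at finite times only, so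
  \<open>\<top>\<close> is treated apart.\<close>

lemma stopping_timeI_less:
  assumes "\<And>t. {\<omega>. T \<omega> < t} \<in> sets (filt X t)"
  shows "stopping_time (filt X) T"
proof (rule stopping_timeI)
  fix t
  have "{\<omega>. T \<omega> \<le> t} \<in> sets (filt X t)"
  proof (cases "t = \<top>")
    case True
    then have "{\<omega>. T \<omega> \<le> t} = space (filt X t)" by auto
    then show ?thesis by (metis sets.top)
  next
    case False
    then have lt: "t < \<top>" by (simp add: top.not_eq_extremum)
    obtain Q :: "ennreal set" where Q: "countable Q" "\<And>s t. s < t \<Longrightarrow> \<exists>d\<in>Q. s < d \<and> d < t"
      using ennreal_dense_in by blast
    show ?thesis
      unfolding filt_right[OF lt]
    proof
      fix s assume s: "s \<in> {t<..}"
      have "{\<omega>. T \<omega> \<le> t} = (\<Inter>d\<in>Q \<inter> {t<..<s}. {\<omega>. T \<omega> < d})"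
      proof (intro set_eqI iffI)
        fix \<omega> assume *: "\<omega> \<in> (\<Inter>d\<in>Q \<inter> {t<..<s}. {\<omega>. T \<omega> < d})"
        show "\<omega> \<in> {\<omega>. T \<omega> \<le> t}"
        proof (rule ccontr)
          assume "\<omega> \<notin> {\<omega>. T \<omega> \<le> t}"
          then have "t < min (T \<omega>) s" using s by auto
          then obtain d where "d \<in> Q" "t < d" "d < min (T \<omega>) s" using Q(2) by blast
          then have "\<omega> \<in> {\<omega>. T \<omega> < d}" using * by auto
          with \<open>d < min (T \<omega>) s\<close> show False by auto
        qed
      qed auto
      also have "\<dots> \<in> sets (filt X s)"
      proof (rule sets.countable_INT')
        show "Q \<inter> {t<..<s} \<noteq> {}" using Q(2)[of t s] s by auto
        show "(\<lambda>d. {\<omega>. T \<omega> < d}) ` (Q \<inter> {t<..<s}) \<subseteq> sets (filt X s)"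
        proof clarify
          fix d assume "d \<in> Q" "d \<in> {t<..<s}"
          then have "sets (filt X d) \<subseteq> sets (filt X s)" by (intro filt_mono) auto
          with assms[of d] show "{\<omega>. T \<omega> < d} \<in> sets (filt X s)" by blast
        qed
      qed (use Q in auto)
      finally show "{\<omega>. T \<omega> \<le> t} \<in> sets (filt X s)" .
    qed
  qed
  then show "Measurable.pred (filt X t) (\<lambda>\<omega>. T \<omega> \<le> t)"
    by (simp add: pred_def)
qed

lemma right_eventually_dense:
  fixes s :: ennreal
  assumes "eventually P (at_right s)" "s < t"
    and Q: "\<And>s t. s < t \<Longrightarrow> \<exists>d\<in>Q. s < d \<and> d < t"
  shows "\<exists>d\<in>Q. s < d \<and> d < t \<and> P d"
proof -
  obtain b where b: "b > s" "\<And>y. s < y \<Longrightarrow> y < b \<Longrightarrow> P y"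
    using assms(1,2) by (auto simp: eventually_at_right[OF assms(2)])
  then have "s < min b t" using assms by auto
  then obtain d where "d \<in> Q" "s < d" "d < min b t" using Q by blast
  then show ?thesis using b by auto
qed

lemma traj_right_open:
  assumes "s < \<top>" "open U" "traj X s \<omega> \<in> Some ` U"
  obtains b where "s < b" "\<And>t. s \<le> t \<Longrightarrow> t < b \<Longrightarrow> traj X t \<omega> \<in> Some ` U"
proof -
  have "eventually (\<lambda>t. traj X t \<omega> \<in> Some ` U) (at_right s)"
    using traj_right[OF assms(1), of \<omega>] assms(3) openin_cem_Some[OF assms(2)] by (auto simp: limitin_def)
  then obtain b where "b > s" "\<And>y. s < y \<Longrightarrow> y < b \<Longrightarrow> traj X y \<omega> \<in> Some ` U"
    by (auto simp: eventually_at_right[OF assms(1)])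
  then show thesis using that[of b] assms(3) by (metis order_le_less)
qed

text \<open>If the path were in \<open>U\<close> at the infimum, right continuity would keep it
  there for a while, yet times of \<open>S\<close> lie arbitrarily close. The predicate
  \<open>P\<close> covers exit times and the lifetime at once.\<close>

lemma traj_Inf_notin:
  assumes "open U" and S: "S = {t. P t \<and> traj X t \<omega> \<notin> Some ` U}"
  shows "traj X (Inf S) \<omega> \<notin> Some ` U"
proof
  assume *: "traj X (Inf S) \<omega> \<in> Some ` U"
  then have "Inf S < \<top>" using traj_top by (metis None_notin_image_Some top.not_eq_extremum)
  then obtain b where b: "Inf S < b" "\<And>t. Inf S \<le> t \<Longrightarrow> t < b \<Longrightarrow> traj X t \<omega> \<in> Some ` U"
    using traj_right_open[OF _ assms(1) *] by blast
  then obtain t where "t \<in> S" "t < b" by (auto simp: Inf_less_iff)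
  then show False using b(2)[of t] Inf_lower[of t S] S by auto
qed

lemma traj_exit_notin: "open U \<Longrightarrow> traj X (exit_time X U \<omega>) \<omega> \<notin> Some ` U"
  unfolding exit_time_def by (rule traj_Inf_notin[where P="\<lambda>t. 0 < t"]) auto

lemma traj_before_exit: "0 < s \<Longrightarrow> s < exit_time X U \<omega> \<Longrightarrow> traj X s \<omega> \<in> Some ` U"
  unfolding exit_time_def by (metis (mono_tags, lifting) Inf_lower leD mem_Collect_eq)

lemma exit_time_le: "0 < s \<Longrightarrow> traj X s \<omega> \<notin> Some ` U \<Longrightarrow> exit_time X U \<omega> \<le> s"
  unfolding exit_time_def by (auto intro: Inf_lower)

lemma exit_time_pos:
  assumes "open U" "traj X 0 \<omega> \<in> Some ` U"
  shows "0 < exit_time X U \<omega>"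
proof -
  obtain b where b: "0 < b" "\<And>t. 0 \<le> t \<Longrightarrow> t < b \<Longrightarrow> traj X t \<omega> \<in> Some ` U"
    using traj_right_open[OF _ assms, of thesis] by auto
  have "b \<le> exit_time X U \<omega>"
    unfolding exit_time_def using b(2) by (intro Inf_greatest) (force simp: not_less[symmetric])
  with b(1) show ?thesis by auto
qed

lemma exit_time_mono: "U \<subseteq> V \<Longrightarrow> exit_time X U \<omega> \<le> exit_time X V \<omega>"
  unfolding exit_time_def by (intro Inf_superset_mono) auto

lemma traj_lifetime: "traj X (lifetime X \<omega>) \<omega> = None"
proof -
  have "traj X (lifetime X \<omega>) \<omega> \<notin> Some ` UNIV"
    unfolding lifetime_def by (rule traj_Inf_notin[where P="\<lambda>_. True"]) (auto simp: image_iff)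
  then show ?thesis by (cases "traj X (lifetime X \<omega>) \<omega>") auto
qed

lemma less_lifetime: "traj X t \<omega> \<noteq> None \<Longrightarrow> t < lifetime X \<omega>"
  using traj_lifetime traj_absorb by (metis not_le)

context
  fixes U :: "'x set" assumes U: "open U"
begin

text \<open>The first times \<open>Tn\<close> at which a function positive exactly on
  \<open>U\<close> drops below \<open>1 / (n + 1)\<close> increase, and quasi-left-continuity
  carries the values at \<open>Tn\<close> to the value at their limit, which is therefore
  \<open>0\<close>. So, up to a null set, the path leaves \<open>U\<close> within
  \<open>[q, p]\<close> iff the function takes arbitrarily small values there. This takes the place
  of the debut theorem.\<close>

lemma hit_aug:
  assumes qp: "q \<le> p" "p < \<top>"
  shows "{\<omega>. \<exists>s. q \<le> s \<and> s \<le> p \<and> traj X s \<omega> \<notin> Some ` U} \<in> sets (aug p)"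
proof -
  obtain \<phi> :: "'x \<Rightarrow> real" where \<phi>: "vanishing_continuous \<phi>" "\<And>x. 0 \<le> \<phi> x" "\<And>x. 0 < \<phi> x \<longleftrightarrow> x \<in> U"
    using exists_vanishing_positive[OF U] by blast
  then have \<phi>m[measurable]: "\<phi> \<in> borel_measurable borel"
    by (auto simp: vanishing_continuous_def intro: borel_measurable_continuous_onI)
  define f where "f s \<omega> = ext0 \<phi> (traj X s \<omega>)" for s \<omega>
  have f0: "f s \<omega> = 0 \<longleftrightarrow> traj X s \<omega> \<notin> Some ` U" for s \<omega>
  proof (cases "traj X s \<omega>")
    case (Some x)
    then show ?thesis using \<phi>(2)[of x] \<phi>(3)[of x] by (auto simp: f_def)
  qed (auto simp: f_def)
  have fnn: "0 \<le> f s \<omega>" for s \<omega> using \<phi>(2) by (auto simp: f_def split: option.splits)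
  have fr: "s < \<top> \<Longrightarrow> ((\<lambda>s. f s \<omega>) \<longlongrightarrow> f s \<omega>) (at_right s)" for s \<omega>
    unfolding f_def by (rule traj_right_tendsto[OF _ \<phi>(1)])
  obtain Q :: "ennreal set" where Q: "countable Q" "\<And>s t. s < t \<Longrightarrow> \<exists>d\<in>Q. s < d \<and> d < t"
    using ennreal_dense_in by blast
  have frQ: "\<exists>d\<in>Q. s < d \<and> d < t \<and> f d \<omega> < c" if "s < t" "f s \<omega> < c" for s t \<omega> c
  proof -
    have "s < \<top>" using that(1) by (meson le_less_trans less_le_trans not_le top_greatest)
    from order_tendstoD(2)[OF fr[OF this] that(2)]
    show ?thesis using right_eventually_dense[OF _ that(1) Q(2)] by blast
  qed
  have fm: "s \<le> t \<Longrightarrow> f s \<in> borel_measurable (raw_filtration X t)" for s t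
    unfolding f_def by (rule measurable_compose[OF traj_raw measurable_ext0[OF \<phi>m]])
  define c where "c n = 1 / real (Suc n)" for n
  have c0: "c n > 0" for n by (simp add: c_def)
  have clim: "c \<longlonglongrightarrow> 0" unfolding c_def by (rule LIMSEQ_Suc[OF lim_1_over_n])
  define Tn where "Tn n \<omega> = Inf {s. q \<le> s \<and> f s \<omega> < c n}" for n \<omega>
  have TnQ: "{\<omega>. Tn n \<omega> < t} = (\<Union>d\<in>Q \<inter> {q..<t}. {\<omega>\<in>space (raw_filtration X t). f d \<omega> < c n})" for n t
  proof (intro set_eqI iffI)
    fix \<omega> assume "\<omega> \<in> {\<omega>. Tn n \<omega> < t}"
    then obtain s where s: "q \<le> s" "f s \<omega> < c n" "s < t" by (auto simp: Tn_def Inf_less_iff)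
    from frQ[OF s(3,2)] s show "\<omega> \<in> (\<Union>d\<in>Q \<inter> {q..<t}. {\<omega>\<in>space (raw_filtration X t). f d \<omega> < c n})"
      by (auto intro: order_trans less_imp_le)
  qed (auto simp: Tn_def Inf_less_iff)
  have TnF: "{\<omega>. Tn n \<omega> < t} \<in> sets (raw_filtration X t)" for n t
    unfolding TnQ using Q(1)
    by (intro sets.countable_UN'' borel_measurable_less fm) auto
  have Tst: "stopping_time (filt X) (Tn n)" for n
    by (rule stopping_timeI_less) (use TnF raw_aug aug_filt in blast)
  have Tm[measurable]: "Tn n \<in> borel_measurable (raw_filtration X \<top>)" for n
    by (rule borel_measurableI_less) (use TnF raw_mono[OF top_greatest] in \<open>auto simp: space_raw\<close>)
  have Tinc: "incseq (\<lambda>n. Tn n \<omega>)" for \<omega>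
  proof (rule incseq_SucI)
    fix n
    have "c (Suc n) \<le> c n" by (simp add: c_def field_simps)
    then show "Tn n \<omega> \<le> Tn (Suc n) \<omega>"
      unfolding Tn_def by (intro Inf_superset_mono) auto
  qed
  define T where "T \<omega> = (SUP n. Tn n \<omega>)" for \<omega>
  have [measurable]: "T \<in> borel_measurable (raw_filtration X \<top>)" unfolding T_def by measurable
  have [measurable]: "(\<lambda>\<omega>. f (R \<omega>) \<omega>) \<in> borel_measurable (raw_filtration X \<top>)"
    if [measurable]: "R \<in> borel_measurable (raw_filtration X \<top>)" for R
    unfolding f_def by (rule measurable_compose[OF traj_random_time_top[of R _ "\<lambda>x. x"] measurable_ext0[OF \<phi>m]]) measurable
  have fTn: "f (Tn n \<omega>) \<omega> \<le> c n" if fin: "Tn n \<omega> < \<top>" for n \<omega>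
  proof (rule ccontr)
    assume "\<not> f (Tn n \<omega>) \<omega> \<le> c n"
    then have gt: "c n < f (Tn n \<omega>) \<omega>" by auto
    from order_tendstoD(1)[OF fr[OF fin] this]
    obtain b where b: "b > Tn n \<omega>" "\<And>y. Tn n \<omega> < y \<Longrightarrow> y < b \<Longrightarrow> c n < f y \<omega>"
      by (auto simp: eventually_at_right[OF fin])
    from b(1) obtain s where s: "q \<le> s" "f s \<omega> < c n" "s < b" by (auto simp: Tn_def Inf_less_iff)
    then have "Tn n \<omega> \<le> s" unfolding Tn_def by (intro Inf_lower) auto
    then show False using b(2)[of s] s gt by (metis less_asym order_le_less)
  qed
  \<comment> \<open>The only paths lost are those on which quasi-left-continuity along
    \<open>Tn\<close> fails; they form one null set for all starting points.\<close>
  define N where "N = {\<omega>\<in>space (raw_filtration X \<top>). T \<omega> < \<top> \<and> \<not> (\<lambda>n. f (Tn n \<omega>) \<omega>) \<longlonglongrightarrow> f (T \<omega>) \<omega>}"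
  have Nm: "N \<in> sets (raw_filtration X \<top>)" unfolding N_def
  proof -
    \<comment> \<open>Expressed by a limsup, convergence is visibly a measurable condition.\<close>
    have "(\<lambda>n. f (Tn n \<omega>) \<omega>) \<longlonglongrightarrow> f (T \<omega>) \<omega> \<longleftrightarrow>
        limsup (\<lambda>n. ereal \<bar>f (Tn n \<omega>) \<omega> - f (T \<omega>) \<omega>\<bar>) \<le> 0" for \<omega>
    proof -
      have "(\<lambda>n. f (Tn n \<omega>) \<omega>) \<longlonglongrightarrow> f (T \<omega>) \<omega> \<longleftrightarrow> (\<lambda>n. \<bar>f (Tn n \<omega>) \<omega> - f (T \<omega>) \<omega>\<bar>) \<longlonglongrightarrow> 0"
        by (simp add: tendsto_rabs_zero_iff LIM_zero_iff)
      also have "\<dots> \<longleftrightarrow> (\<lambda>n. ereal \<bar>f (Tn n \<omega>) \<omega> - f (T \<omega>) \<omega>\<bar>) \<longlonglongrightarrow> ereal 0"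
        by (rule lim_ereal[symmetric])
      also have "\<dots> \<longleftrightarrow> limsup (\<lambda>n. ereal \<bar>f (Tn n \<omega>) \<omega> - f (T \<omega>) \<omega>\<bar>) \<le> 0"
      proof
        assume "(\<lambda>n. ereal \<bar>f (Tn n \<omega>) \<omega> - f (T \<omega>) \<omega>\<bar>) \<longlonglongrightarrow> ereal 0"
        then show "limsup (\<lambda>n. ereal \<bar>f (Tn n \<omega>) \<omega> - f (T \<omega>) \<omega>\<bar>) \<le> 0"
          using lim_imp_Limsup[OF sequentially_bot] by (metis order_refl zero_ereal_def)
      next
        assume l: "limsup (\<lambda>n. ereal \<bar>f (Tn n \<omega>) \<omega> - f (T \<omega>) \<omega>\<bar>) \<le> 0"
        have "0 \<le> liminf (\<lambda>n. ereal \<bar>f (Tn n \<omega>) \<omega> - f (T \<omega>) \<omega>\<bar>)"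
          by (rule Liminf_bounded) simp
        moreover have "liminf (\<lambda>n. ereal \<bar>f (Tn n \<omega>) \<omega> - f (T \<omega>) \<omega>\<bar>)
            \<le> limsup (\<lambda>n. ereal \<bar>f (Tn n \<omega>) \<omega> - f (T \<omega>) \<omega>\<bar>)"
          by (rule Liminf_le_Limsup) simp
        ultimately show "(\<lambda>n. ereal \<bar>f (Tn n \<omega>) \<omega> - f (T \<omega>) \<omega>\<bar>) \<longlonglongrightarrow> ereal 0"
          using l by (intro Liminf_eq_Limsup) (auto simp flip: zero_ereal_def)
      qed
      finally show ?thesis .
    qed
    moreover have "{\<omega>\<in>space (raw_filtration X \<top>). T \<omega> < \<top> \<and>
        \<not> limsup (\<lambda>n. ereal \<bar>f (Tn n \<omega>) \<omega> - f (T \<omega>) \<omega>\<bar>) \<le> 0} \<in> sets (raw_filtration X \<top>)"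
      by measurable
    ultimately show "{\<omega>\<in>space (raw_filtration X \<top>). T \<omega> < \<top> \<and> \<not> (\<lambda>n. f (Tn n \<omega>) \<omega>) \<longlonglongrightarrow> f (T \<omega>) \<omega>} \<in> sets (raw_filtration X \<top>)"
      by simp
  qed
  have "AE \<omega> in prob_at X x. \<omega> \<notin> N" for x
    using quasi_left[of Tn x, OF Tst Tinc]
  proof eventually_elim
    case (elim \<omega>)
    then show ?case
      using limitin_cem_tendsto[OF _ \<phi>(1), of "\<lambda>n. traj X (Tn n \<omega>) \<omega>"] unfolding N_def f_def T_def by blast
  qed
  then have "emeasure (prob_at X x) N = 0" for x
    using Nm raw_prob_at by (subst (asm) AE_iff_measurable[of N]) auto
  then have N: "law_null N" using Nm emeasure_prob_at unfolding law_null_def by metis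
  \<comment> \<open>The endpoint \<open>p\<close> is added by hand: right continuity moves a small
    value to a later point of \<open>Q\<close>, and there is none within \<open>[q, p]\<close> when
    the zero sits at \<open>p\<close>.\<close>
  define B where "B = (\<Inter>n. \<Union>d\<in>insert p (Q \<inter> {q..p}). {\<omega>\<in>space (raw_filtration X p). f d \<omega> < c n})"
  have Bm: "B \<in> sets (raw_filtration X p)"
    unfolding B_def using Q(1) sets.top[of "raw_filtration X p"]
    by (intro sets.countable_INT'' sets.countable_UN'' borel_measurable_less fm) auto
  have "sym_diff {\<omega>. \<exists>s. q \<le> s \<and> s \<le> p \<and> traj X s \<omega> \<notin> Some ` U} B \<subseteq> N"
  proof -
    have "\<omega> \<in> B" if s: "q \<le> s" "s \<le> p" "f s \<omega> = 0" for s \<omega>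
    proof (cases "s = p")
      case True
      then show ?thesis using s c0 by (auto simp: B_def)
    next
      case False
      then have "s < p" using s by auto
      show ?thesis unfolding B_def
      proof
        fix n
        obtain d where "d \<in> Q" "s < d" "d < p" "f d \<omega> < c n"
          using frQ[OF \<open>s < p\<close>, of \<omega> "c n"] s c0[of n] by auto
        then show "\<omega> \<in> (\<Union>d\<in>insert p (Q \<inter> {q..p}). {\<omega>\<in>space (raw_filtration X p). f d \<omega> < c n})"
          using s by (auto intro!: bexI[of _ d])
      qed
    qed
    moreover have "\<exists>s. q \<le> s \<and> s \<le> p \<and> f s \<omega> = 0" if w: "\<omega> \<in> B" "\<omega> \<notin> N" for \<omega>
    proof -
      have Tp: "Tn n \<omega> \<le> p" for n
      proof -
        from w(1) have "\<omega> \<in> (\<Union>d\<in>insert p (Q \<inter> {q..p}). {\<omega>\<in>space (raw_filtration X p). f d \<omega> < c n})"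
          unfolding B_def by (rule INT_D) simp
        then obtain d where "d = p \<or> d \<in> Q \<inter> {q..p}" "f d \<omega> < c n" by blast
        then have "q \<le> d" "d \<le> p" "f d \<omega> < c n" using qp by auto
        then have "Tn n \<omega> \<le> d" unfolding Tn_def by (intro Inf_lower) auto
        with \<open>d \<le> p\<close> show ?thesis by auto
      qed
      have qT: "q \<le> Tn n \<omega>" for n unfolding Tn_def by (intro Inf_greatest) auto
      have "T \<omega> \<le> p" unfolding T_def by (rule SUP_least) (rule Tp)
      moreover have "q \<le> T \<omega>" unfolding T_def by (rule SUP_upper2[of 0]) (auto intro: qT)
      moreover have "f (T \<omega>) \<omega> = 0"
      proof -
        have "(\<lambda>n. f (Tn n \<omega>) \<omega>) \<longlonglongrightarrow> f (T \<omega>) \<omega>"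
          using w(2) \<open>T \<omega> \<le> p\<close> qp(2) unfolding N_def by auto
        then have "f (T \<omega>) \<omega> \<le> 0"
          by (rule LIMSEQ_le[OF _ clim]) (use fTn Tp qp(2) le_less_trans in blast)
        with fnn show ?thesis by (metis order_antisym)
      qed
      ultimately show ?thesis by blast
    qed
    ultimately show ?thesis unfolding f0 by blast
  qed
  with Bm N show ?thesis unfolding sets_aug by blast
qed

text \<open>Leaving before \<open>t\<close> means being outside \<open>U\<close> somewhere in an
  interval \<open>[q, p]\<close> with endpoints in a countable dense set and \<open>0 < q\<close>,
  \<open>p < t\<close>. The endpoint \<open>0\<close> is avoided because exit times ignore
  it.\<close>

lemma exit_less_aug: "{\<omega>. exit_time X U \<omega> < t} \<in> sets (aug t)"
proof -
  obtain Q :: "ennreal set" where Q: "countable Q" "\<And>s t. s < t \<Longrightarrow> \<exists>d\<in>Q. s < d \<and> d < t"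
    using ennreal_dense_in by blast
  define H where "H q p = {\<omega>. \<exists>s. q \<le> s \<and> s \<le> p \<and> traj X s \<omega> \<notin> Some ` U}" for q p
  define I where "I = {(q, p) \<in> Q \<times> Q. 0 < q \<and> q \<le> p \<and> p < t}"
  have "{\<omega>. exit_time X U \<omega> < t} = (\<Union>(q, p)\<in>I. H q p)"
  proof (intro set_eqI iffI)
    fix \<omega> assume "\<omega> \<in> {\<omega>. exit_time X U \<omega> < t}"
    then obtain s where s: "0 < s" "traj X s \<omega> \<notin> Some ` U" "s < t"
      by (auto simp: exit_time_def Inf_less_iff)
    obtain q p where "q \<in> Q" "p \<in> Q" "0 < q" "q < s" "s < p" "p < t"
      using Q(2)[OF s(1)] Q(2)[OF s(3)] by blast
    then show "\<omega> \<in> (\<Union>(q, p)\<in>I. H q p)"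
      using s by (intro UN_I[of "(q, p)"]) (auto simp: I_def H_def intro!: exI[of _ s])
  next
    fix \<omega> assume "\<omega> \<in> (\<Union>(q, p)\<in>I. H q p)"
    then obtain q p s where "0 < q" "q \<le> s" "s \<le> p" "p < t" "traj X s \<omega> \<notin> Some ` U"
      by (auto simp: I_def H_def)
    then have "exit_time X U \<omega> \<le> s" by (intro exit_time_le) auto
    with \<open>s \<le> p\<close> \<open>p < t\<close> show "\<omega> \<in> {\<omega>. exit_time X U \<omega> < t}" by auto
  qed
  also have "\<dots> \<in> sets (aug t)"
  proof (rule sets.countable_UN')
    show "countable I" using Q(1) unfolding I_def by (auto intro: countable_subset[of _ "Q \<times> Q"])
    show "(\<lambda>(q, p). H q p) ` I \<subseteq> sets (aug t)"
    proof clarify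
      fix q p assume "(q, p) \<in> I"
      then have "q \<le> p" "p < t" by (auto simp: I_def)
      moreover have "p < \<top>" using \<open>p < t\<close> by (meson less_le_trans top_greatest)
      ultimately show "H q p \<in> sets (aug t)"
        using hit_aug[of q p] aug_mono[OF less_imp_le[OF \<open>p < t\<close>]] unfolding H_def by blast
    qed
  qed
  finally show ?thesis .
qed

lemma stopping_exit: "stopping_time (filt X) (exit_time X U)"
  by (rule stopping_timeI_less) (use exit_less_aug aug_filt in blast)

lemma exit_measurable_aug: "exit_time X U \<in> borel_measurable (aug \<top>)"
  by (rule borel_measurableI_less) (use exit_less_aug aug_mono[OF top_greatest] in auto)

end

end

lemma measurable_subalgebra:
  assumes "f \<in> M \<rightarrow>\<^sub>M N" "space M' = space M" "sets M \<subseteq> sets M'"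
  shows "f \<in> M' \<rightarrow>\<^sub>M N"
  using assms by (auto simp: measurable_def)

context hunt
begin

section \<open>The strong Markov property for path functionals\<close>

text \<open>Supplies the path to which a shift by infinite time can be sent, since
  \<open>hunt_process\<close> grants shifts only for finite times.\<close>

lemma dead_path: "\<exists>\<omega>. \<forall>s. traj X s \<omega> = None"
proof -
  interpret prob_space "prob_at X None" by (rule prob_space_prob_at)
  obtain \<omega> where "traj X 0 \<omega> = None"
    using eventually_happens[OF traj_0[of None]] ae_filter_eq_bot_iff[of "prob_at X None"] emeasure_space_1
    by (auto simp: trivial_limit_def)
  then show ?thesis using traj_absorb[of 0 \<omega>] by auto
qed

lemma shift_exists: "\<exists>\<theta>. \<forall>s \<omega>. traj X s (\<theta> \<omega>) = traj X (s + t) \<omega>"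
proof (cases "t = \<top>")
  case True
  obtain \<omega>0 where "\<forall>s. traj X s \<omega>0 = None" using dead_path by blast
  then show ?thesis using True by (auto intro!: exI[of _ "\<lambda>_. \<omega>0"])
next
  case False
  then show ?thesis using shift_exists_finite[of t] by (simp add: top.not_eq_extremum)
qed

definition shift :: "ennreal \<Rightarrow> 'w \<Rightarrow> 'w" where
  "shift t = (SOME \<theta>. \<forall>s \<omega>. traj X s (\<theta> \<omega>) = traj X (s + t) \<omega>)"

lemma traj_shift [simp]: "traj X s (shift t \<omega>) = traj X (s + t) \<omega>"
  using someI_ex[OF shift_exists[of t]] unfolding shift_def by blast

lemma stopping_borel: "stopping_time (filt X) T \<Longrightarrow> T \<in> borel_measurable (prob_at X x)"
  by (rule measurable_stopping_time) (use filt_prob_at in auto)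

lemma id_prob_at_raw: "(\<lambda>\<omega>. \<omega>) \<in> prob_at X x \<rightarrow>\<^sub>M raw_filtration X \<top>"
  by (rule measurableI) (auto intro: raw_prob_at)

lemma measurable_prob_at: "f \<in> raw_filtration X \<top> \<rightarrow>\<^sub>M N \<Longrightarrow> f \<in> prob_at X x \<rightarrow>\<^sub>M N"
  using measurable_compose[OF id_prob_at_raw] by blast

lemma measurable_aug_prob_at: "f \<in> aug t \<rightarrow>\<^sub>M N \<Longrightarrow> f \<in> prob_at X x \<rightarrow>\<^sub>M N"
  using aug_prob_at[of t x] by (auto simp: measurable_def)

lemma measurable_raw_aug: "f \<in> raw_filtration X t \<rightarrow>\<^sub>M N \<Longrightarrow> f \<in> aug t \<rightarrow>\<^sub>M N"
  using raw_aug[of t] by (auto simp: measurable_def)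

lemma traj_stopping_measurable:
  assumes "T \<in> borel_measurable (prob_at X x)"
  shows "(\<lambda>\<omega>. traj X (T \<omega>) \<omega>) \<in> prob_at X x \<rightarrow>\<^sub>M cem_borel"
  using traj_random_time_top[OF assms id_prob_at_raw] .

text \<open>\<open>shift\<close> is a choice of which only the coordinates are known; measurability
  into the raw \<sigma>-algebra asks for nothing more.\<close>

lemma shift_measurable:
  assumes [measurable]: "T \<in> borel_measurable (prob_at X x)"
  shows "(\<lambda>\<omega>. shift (T \<omega>) \<omega>) \<in> prob_at X x \<rightarrow>\<^sub>M raw_filtration X \<top>"
proof (rule measurable_rawI)
  fix s
  have "(\<lambda>\<omega>. s + T \<omega>) \<in> borel_measurable (prob_at X x)" by measurable
  from traj_stopping_measurable[OF this]
  show "(\<lambda>\<omega>. traj X s (shift (T \<omega>) \<omega>)) \<in> prob_at X x \<rightarrow>\<^sub>M cem_borel" by simp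
qed

lemma traj_in_raw: "A \<in> sets cem_borel \<Longrightarrow> {\<omega>. traj X s \<omega> \<in> A} \<in> sets (raw_filtration X \<top>)"
  using measurable_sets[OF traj_raw_top, of A s] by (simp add: vimage_def)

lemma stopped_sigma_eq: "stopped_sigma X T = filt.pre_sigma T"
  by (simp add: stopped_sigma_def)

lemma stopped_prob_at:
  assumes "stopping_time (filt X) T" "\<Lambda> \<in> sets (stopped_sigma X T)"
  shows "\<Lambda> \<in> sets (prob_at X x)"
  using filt.sets_pre_sigmaD[OF assms[unfolded stopped_sigma_eq], of \<top>] filt_prob_at[of \<top> x] by auto

lemma measurable_stopped_prob_at:
  assumes "stopping_time (filt X) T" "f \<in> stopped_sigma X T \<rightarrow>\<^sub>M N"
  shows "f \<in> prob_at X x \<rightarrow>\<^sub>M N"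
  using assms(2) stopped_prob_at[OF assms(1), of _ x]
  by (auto simp: measurable_def stopped_sigma_eq filt.space_pre_sigma)

text \<open>On the event \<open>T \<le> t\<close> the time may be replaced by
  \<open>min (T \<omega>) t\<close>, and the position at that time is known at time
  \<open>t\<close>.\<close>

lemma traj_stopped:
  assumes T: "stopping_time (filt X) T" and A: "A \<in> sets cem_borel"
  shows "{\<omega>. traj X (T \<omega>) \<omega> \<in> A} \<in> sets (stopped_sigma X T)"
  unfolding stopped_sigma_eq
proof (rule filt.sets_pre_sigmaI[OF T])
  fix t
  have le: "{\<omega>. T \<omega> \<le> a} \<in> sets (filt X t)" if "a \<le> t" for a
    using filt.stopping_time_le_const[OF T that] by (simp add: pred_def)
  have min: "(\<lambda>\<omega>. min (T \<omega>) t) \<in> borel_measurable (filt X t)"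
  proof (rule borel_measurableI_le)
    fix a
    show "{\<omega> \<in> space (filt X t). min (T \<omega>) t \<le> a} \<in> sets (filt X t)"
    proof (cases "t \<le> a")
      case True
      then have "{\<omega> \<in> space (filt X t). min (T \<omega>) t \<le> a} = space (filt X t)"
        by (auto simp: min_def)
      then show ?thesis by (metis sets.top)
    next
      case False
      then have "{\<omega> \<in> space (filt X t). min (T \<omega>) t \<le> a} = {\<omega>. T \<omega> \<le> a}"
        by (auto simp: min_def)
      then show ?thesis using le[of a] False by simp
    qed
  qed
  have tr: "traj X s \<in> filt X t \<rightarrow>\<^sub>M cem_borel" if "s \<le> t" for s
    by (rule measurable_subalgebra[OF traj_raw[OF that]]) (use raw_aug[of t] aug_filt[of t] in auto)
  have "(\<lambda>\<omega>. traj X (min (T \<omega>) t) \<omega>) \<in> filt X t \<rightarrow>\<^sub>M cem_borel"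
    by (rule traj_random_time[OF min min.cobounded2 tr])
  from measurable_sets[OF this A]
  have "{\<omega>. traj X (min (T \<omega>) t) \<omega> \<in> A} \<inter> {\<omega>. T \<omega> \<le> t} \<in> sets (filt X t)"
    using le[of t] by (auto simp: vimage_def)
  moreover have "{\<omega>. traj X (min (T \<omega>) t) \<omega> \<in> A} \<inter> {\<omega>. T \<omega> \<le> t} = {\<omega> \<in> {\<omega>. traj X (T \<omega>) \<omega> \<in> A}. T \<omega> \<le> t}"
    by (auto simp: min_def)
  ultimately show "{\<omega> \<in> {\<omega>. traj X (T \<omega>) \<omega> \<in> A}. T \<omega> \<le> t} \<in> sets (filt X t)" by simp
qed

lemma stopping_add:
  assumes T: "stopping_time (filt X) T"
  shows "stopping_time (filt X) (\<lambda>\<omega>. T \<omega> + s)"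
proof (rule stopping_timeI)
  fix t
  have "{\<omega>. T \<omega> + s \<le> t} \<in> sets (filt X t)"
  proof (cases "s \<le> t")
    case True
    then have "{\<omega>. T \<omega> + s \<le> t} = {\<omega>. T \<omega> \<le> t - s}"
      by (auto simp: ennreal_le_minus_iff)
    then show ?thesis
      using filt.stopping_time_le_const[OF T, of "t - s" t] by (simp add: pred_def)
  next
    case False
    then have "{\<omega>. T \<omega> + s \<le> t} = {}"
      by (auto simp: not_le intro: less_le_trans[OF _ add_increasing])
    then show ?thesis by simp
  qed
  then show "Measurable.pred (filt X t) (\<lambda>\<omega>. T \<omega> + s \<le> t)" by (simp add: pred_def)
qed

lemma law_kernel [measurable]: "law X \<in> cem_borel \<rightarrow>\<^sub>M subprob_algebra (raw_filtration X \<top>)"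
  by (rule measurable_prob_algebraD[OF law_measurable])

lemma nn_integral_prob_at: "(\<integral>\<^sup>+\<omega>. F \<omega> \<partial>prob_at X z) = (\<integral>\<^sup>+\<omega>. F \<omega> \<partial>law X z)"
  by (simp add: prob_at_def nn_integral_completion)

lemma law_integral_measurable:
  "F \<in> borel_measurable (raw_filtration X \<top>) \<Longrightarrow> (\<lambda>z. \<integral>\<^sup>+\<omega>. F \<omega> \<partial>law X z) \<in> borel_measurable cem_borel"
  by (rule measurable_compose[OF law_kernel nn_integral_measurable_subprob_algebra])

lemma law_emeasure_measurable:
  "B \<in> sets (raw_filtration X \<top>) \<Longrightarrow> (\<lambda>z. emeasure (law X z) B) \<in> borel_measurable cem_borel"
  by (rule measurable_emeasure_kernel[OF law_kernel])

lemma simple_strong_markov_fun: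
  assumes T: "stopping_time (filt X) T" and L: "\<Lambda> \<in> sets (stopped_sigma X T)"
    and h: "h \<in> borel_measurable cem_borel"
  shows "(\<integral>\<^sup>+\<omega>\<in>\<Lambda>. h (traj X (T \<omega> + s) \<omega>) \<partial>prob_at X x) =
    (\<integral>\<^sup>+\<omega>\<in>\<Lambda>. (\<integral>\<^sup>+\<omega>'. h (traj X s \<omega>') \<partial>law X (traj X (T \<omega>) \<omega>)) \<partial>prob_at X x)"
proof -
  note Tb[measurable] = stopping_borel[OF T, of x]
  note Lm[measurable] = stopped_prob_at[OF T L, of x]
  have m1[measurable]: "(\<lambda>\<omega>. traj X (T \<omega>) \<omega>) \<in> prob_at X x \<rightarrow>\<^sub>M cem_borel"
    and m2[measurable]: "(\<lambda>\<omega>. traj X (T \<omega> + s) \<omega>) \<in> prob_at X x \<rightarrow>\<^sub>M cem_borel"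
    by (auto intro!: traj_stopping_measurable)
  have m3: "(\<lambda>\<omega>. \<integral>\<^sup>+\<omega>'. h (traj X s \<omega>') \<partial>law X (traj X (T \<omega>) \<omega>)) \<in> borel_measurable (prob_at X x)"
    if [measurable]: "h \<in> borel_measurable cem_borel" for h
  proof -
    have "(\<lambda>\<omega>'. h (traj X s \<omega>')) \<in> borel_measurable (raw_filtration X \<top>)" by measurable
    from measurable_compose[OF m1 law_integral_measurable[OF this]] show ?thesis .
  qed
  show ?thesis
    using h
  proof (induction rule: borel_measurable_induct)
    case (cong f g)
    then have "f = g" by auto
    with cong show ?case by simp
  next
    case (set A)
    have "(\<integral>\<^sup>+\<omega>\<in>\<Lambda>. indicator A (traj X (T \<omega> + s) \<omega>) \<partial>prob_at X x) =
        (\<integral>\<^sup>+\<omega>. indicator ({\<omega>. traj X (T \<omega> + s) \<omega> \<in> A} \<inter> \<Lambda>) \<omega> \<partial>prob_at X x)"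
      by (rule nn_integral_cong) (auto simp: indicator_def)
    also have "\<dots> = emeasure (prob_at X x) ({\<omega>. traj X (T \<omega> + s) \<omega> \<in> A} \<inter> \<Lambda>)"
      using measurable_sets[OF m2 set] Lm by (intro nn_integral_indicator) (auto simp: vimage_def)
    also have "\<dots> = (\<integral>\<^sup>+\<omega>\<in>\<Lambda>. emeasure (prob_at X (traj X (T \<omega>) \<omega>)) {\<omega>'. traj X s \<omega>' \<in> A} \<partial>prob_at X x)"
      by (rule simple_strong_markov[OF T set L]) 
    also have "\<dots> = (\<integral>\<^sup>+\<omega>\<in>\<Lambda>. (\<integral>\<^sup>+\<omega>'. indicator A (traj X s \<omega>') \<partial>law X (traj X (T \<omega>) \<omega>)) \<partial>prob_at X x)"
    proof -
      have r: "{\<omega>'. traj X s \<omega>' \<in> A} \<in> sets (raw_filtration X \<top>)"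
        using measurable_sets[OF traj_raw_top set, of s] by (simp add: vimage_def)
      have "emeasure (prob_at X z) {\<omega>'. traj X s \<omega>' \<in> A} = (\<integral>\<^sup>+\<omega>'. indicator A (traj X s \<omega>') \<partial>law X z)" for z
      proof -
        have "(\<integral>\<^sup>+\<omega>'. indicator A (traj X s \<omega>') \<partial>law X z) = (\<integral>\<^sup>+\<omega>'. indicator {\<omega>'. traj X s \<omega>' \<in> A} \<omega>' \<partial>law X z)"
          by (rule nn_integral_cong) (auto simp: indicator_def)
        also have "\<dots> = emeasure (law X z) {\<omega>'. traj X s \<omega>' \<in> A}"
          using r by (intro nn_integral_indicator) simp
        finally show ?thesis using emeasure_prob_at[OF r] by simp
      qed
      then show ?thesis by simp
    qed
    finally show ?case .
  next
    case (mult u c)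
    then show ?case
      using m3[of u] by (simp add: nn_integral_cmult mult.assoc)
  next
    case (add u v)
    then show ?case
      using m3[of u] m3[of v] by (simp add: nn_integral_add distrib_right)
  next
    case (seq U)
    have [measurable]: "\<And>i. U i \<in> borel_measurable cem_borel" by fact
    have inc: "incseq (\<lambda>i. U i z)" for z
      using seq(3) by (auto simp: incseq_def le_fun_def)
    have 1: "(\<integral>\<^sup>+\<omega>\<in>\<Lambda>. (SUP i. U i) (traj X (T \<omega> + s) \<omega>) \<partial>prob_at X x) =
       (SUP i. \<integral>\<^sup>+\<omega>\<in>\<Lambda>. U i (traj X (T \<omega> + s) \<omega>) \<partial>prob_at X x)"
    proof -
      have "(\<integral>\<^sup>+\<omega>\<in>\<Lambda>. (SUP i. U i) (traj X (T \<omega> + s) \<omega>) \<partial>prob_at X x) =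
        (\<integral>\<^sup>+\<omega>. (SUP i. U i (traj X (T \<omega> + s) \<omega>) * indicator \<Lambda> \<omega>) \<partial>prob_at X x)"
        by (intro nn_integral_cong) (simp add: SUP_mult_right_ennreal image_comp)
      also have "\<dots> = (SUP i. \<integral>\<^sup>+\<omega>\<in>\<Lambda>. U i (traj X (T \<omega> + s) \<omega>) \<partial>prob_at X x)"
        using inc by (intro nn_integral_monotone_convergence_SUP) (auto simp: incseq_def le_fun_def intro!: mult_right_mono)
      finally show ?thesis .
    qed
    have "(\<integral>\<^sup>+\<omega>\<in>\<Lambda>. (\<integral>\<^sup>+\<omega>'. (SUP i. U i) (traj X s \<omega>') \<partial>law X (traj X (T \<omega>) \<omega>)) \<partial>prob_at X x) =
       (\<integral>\<^sup>+\<omega>. (SUP i. (\<integral>\<^sup>+\<omega>'. U i (traj X s \<omega>') \<partial>law X (traj X (T \<omega>) \<omega>)) * indicator \<Lambda> \<omega>) \<partial>prob_at X x)"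
    proof (intro nn_integral_cong)
      fix \<omega>
      have "(\<integral>\<^sup>+\<omega>'. (SUP i. U i) (traj X s \<omega>') \<partial>law X (traj X (T \<omega>) \<omega>)) =
          (\<integral>\<^sup>+\<omega>'. (SUP i. U i (traj X s \<omega>')) \<partial>law X (traj X (T \<omega>) \<omega>))"
        by (simp add: image_comp)
      also have "\<dots> = (SUP i. \<integral>\<^sup>+\<omega>'. U i (traj X s \<omega>') \<partial>law X (traj X (T \<omega>) \<omega>))"
        using inc by (intro nn_integral_monotone_convergence_SUP) (auto simp: incseq_def le_fun_def)
      finally show "(\<integral>\<^sup>+\<omega>'. (SUP i. U i) (traj X s \<omega>') \<partial>law X (traj X (T \<omega>) \<omega>)) * indicator \<Lambda> \<omega> =
         (SUP i. (\<integral>\<^sup>+\<omega>'. U i (traj X s \<omega>') \<partial>law X (traj X (T \<omega>) \<omega>)) * indicator \<Lambda> \<omega>)"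
        by (simp add: SUP_mult_right_ennreal)
    qed
    also have "\<dots> = (SUP i. \<integral>\<^sup>+\<omega>\<in>\<Lambda>. (\<integral>\<^sup>+\<omega>'. U i (traj X s \<omega>') \<partial>law X (traj X (T \<omega>) \<omega>)) \<partial>prob_at X x)"
      using inc m3 by (intro nn_integral_monotone_convergence_SUP)
        (auto simp: incseq_def le_fun_def intro!: mult_right_mono nn_integral_mono)
    finally show ?case using 1 seq.IH by simp
  qed
qed

text \<open>Induction on the earliest time \<open>b\<close>: move to the stopping time
  \<open>T + (b - c)\<close>, absorb the condition at \<open>b\<close> into the event, and apply the
  hypothesis with origin \<open>b\<close>. Hence stopping time, event and origin are all general.
  Only the Markov property for one time is given by \<open>hunt_process\<close>.\<close>

lemma strong_markov_cylinder:
  assumes "finite I" and A: "\<And>i. A i \<in> sets cem_borel"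
    and "stopping_time (filt X) T" "\<Lambda> \<in> sets (stopped_sigma X T)" "\<And>i. i \<in> I \<Longrightarrow> c \<le> i"
  shows "emeasure (prob_at X x) ({\<omega>. \<forall>i\<in>I. traj X (T \<omega> + (i - c)) \<omega> \<in> A i} \<inter> \<Lambda>) =
    (\<integral>\<^sup>+\<omega>\<in>\<Lambda>. emeasure (law X (traj X (T \<omega>) \<omega>)) {\<omega>'. \<forall>i\<in>I. traj X (i - c) \<omega>' \<in> A i} \<partial>prob_at X x)"
  using assms(1,3-)
proof (induction I arbitrary: T \<Lambda> c x rule: finite_linorder_min_induct)
  case empty
  interpret law: prob_space "law X z" for z by (rule prob_space_law)
  have "emeasure (law X z) UNIV = 1" for z using law.emeasure_space_1[of z] by simp
  then show ?case using stopped_prob_at[OF empty(1,2), of x] by simp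
next
  case (insert b I)
  note T = insert.prems(1) and L = insert.prems(2)
  have cb: "c \<le> b" using insert.prems(3) by auto
  have bI: "\<And>i. i \<in> I \<Longrightarrow> b \<le> i" using insert.hyps(2) by auto
  have split: "i - c = (b - c) + (i - b)" if "i \<in> I" for i
  proof -
    have "b < i" using insert.hyps(2) that by auto
    then have "b < \<top>" by (meson less_le_trans top_greatest)
    then obtain rb where b: "b = ennreal rb" "0 \<le> rb" by (cases b) auto
    with cb have "c < \<top>" using \<open>b < \<top>\<close> le_less_trans by blast
    then obtain rc where c: "c = ennreal rc" "0 \<le> rc" by (cases c) auto
    have le: "rc \<le> rb" using cb b c by (simp add: ennreal_le_iff)
    show ?thesis
    proof (cases i)
      case (real r)
      then have "rb \<le> r" using \<open>b < i\<close> b by (simp add: ennreal_less_iff)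
      then show ?thesis using real b c le by (simp add: ennreal_minus flip: ennreal_plus)
    qed simp
  qed
  have raw: "{\<omega>'. \<forall>i\<in>I. traj X (i - d) \<omega>' \<in> A i} \<in> sets (raw_filtration X \<top>)" for d
  proof -
    have "{\<omega>'. \<forall>i\<in>I. traj X (i - d) \<omega>' \<in> A i} = {\<omega>'\<in>space (raw_filtration X \<top>). \<forall>i\<in>I. traj X (i - d) \<omega>' \<in> A i}"
      by simp
    also have "\<dots> \<in> sets (raw_filtration X \<top>)"
      using insert.hyps(1) A by (intro sets.sets_Collect_finite_All) (auto intro!: traj_in_raw)
    finally show ?thesis .
  qed
  define g where "g z = emeasure (law X z) {\<omega>'. \<forall>i\<in>I. traj X (i - b) \<omega>' \<in> A i}" for z
  have g[measurable]: "g \<in> borel_measurable cem_borel"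
    unfolding g_def by (rule law_emeasure_measurable[OF raw])
  define h where "h z = g z * indicator (A b) z" for z
  have h[measurable]: "h \<in> borel_measurable cem_borel"
    unfolding h_def using A[of b] by measurable
  have main: "emeasure (prob_at X x) ({\<omega>. \<forall>i\<in>insert b I. traj X (T \<omega> + (i - c)) \<omega> \<in> A i} \<inter> \<Lambda>) =
      (\<integral>\<^sup>+\<omega>\<in>\<Lambda>. h (traj X (T \<omega> + (b - c)) \<omega>) \<partial>prob_at X x)"
    if T: "stopping_time (filt X) T" and L: "\<Lambda> \<in> sets (stopped_sigma X T)" for T \<Lambda> x
  proof -
    define T' where "T' \<omega> = T \<omega> + (b - c)" for \<omega>
    have T': "stopping_time (filt X) T'" unfolding T'_def by (rule stopping_add[OF T])
    define \<Lambda>' where "\<Lambda>' = \<Lambda> \<inter> {\<omega>. traj X (T' \<omega>) \<omega> \<in> A b}"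
    have "\<Lambda> \<in> sets (stopped_sigma X T')"
      using filt.mono_pre_sigma[OF T T'] L unfolding stopped_sigma_eq T'_def by auto
    then have L': "\<Lambda>' \<in> sets (stopped_sigma X T')"
      unfolding \<Lambda>'_def using traj_stopped[OF T' A[of b]] by auto
    have "{\<omega>. \<forall>i\<in>insert b I. traj X (T \<omega> + (i - c)) \<omega> \<in> A i} \<inter> \<Lambda> =
        {\<omega>. \<forall>i\<in>I. traj X (T' \<omega> + (i - b)) \<omega> \<in> A i} \<inter> \<Lambda>'"
      unfolding \<Lambda>'_def T'_def using split by (auto simp: add.assoc)
    then have "emeasure (prob_at X x) ({\<omega>. \<forall>i\<in>insert b I. traj X (T \<omega> + (i - c)) \<omega> \<in> A i} \<inter> \<Lambda>) =
      (\<integral>\<^sup>+\<omega>\<in>\<Lambda>'. g (traj X (T' \<omega>) \<omega>) \<partial>prob_at X x)"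
      using insert.IH[OF T' L' bI, of x] unfolding g_def by simp
    also have "\<dots> = (\<integral>\<^sup>+\<omega>\<in>\<Lambda>. h (traj X (T \<omega> + (b - c)) \<omega>) \<partial>prob_at X x)"
      by (intro nn_integral_cong) (auto simp: h_def \<Lambda>'_def T'_def indicator_def)
    finally show ?thesis .
  qed
  have "(\<integral>\<^sup>+\<omega>'. h (traj X (b - c) \<omega>') \<partial>law X z) =
      emeasure (law X z) {\<omega>'. \<forall>i\<in>insert b I. traj X (i - c) \<omega>' \<in> A i}" for z
  proof -
    \<comment> \<open>The remaining integrand is identified by the same formula \<open>main\<close>,
      taken at the stopping time \<open>0\<close>.\<close>
    have "UNIV \<in> sets (stopped_sigma X (\<lambda>_. 0))"
      using sets.top[of "stopped_sigma X (\<lambda>_. 0)"] by (simp add: stopped_sigma_eq filt.space_pre_sigma)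
    from main[OF stopping_time_const this, of z]
    have "(\<integral>\<^sup>+\<omega>'. h (traj X (b - c) \<omega>') \<partial>law X z) =
       emeasure (prob_at X z) {\<omega>'. \<forall>i\<in>insert b I. traj X (i - c) \<omega>' \<in> A i}"
      by (simp add: nn_integral_prob_at)
    also have "\<dots> = emeasure (law X z) {\<omega>'. \<forall>i\<in>insert b I. traj X (i - c) \<omega>' \<in> A i}"
    proof (rule emeasure_prob_at)
      have "{\<omega>'. \<forall>i\<in>insert b I. traj X (i - c) \<omega>' \<in> A i} =
        {\<omega>'. \<forall>i\<in>I. traj X (i - c) \<omega>' \<in> A i} \<inter> (traj X (b - c) -` A b \<inter> space (raw_filtration X \<top>))" by auto
      also have "\<dots> \<in> sets (raw_filtration X \<top>)"
        using raw measurable_sets[OF traj_raw_top A] by blast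
      finally show "{\<omega>'. \<forall>i\<in>insert b I. traj X (i - c) \<omega>' \<in> A i} \<in> sets (raw_filtration X \<top>)" .
    qed
    finally show ?thesis .
  qed
  then show ?case
    unfolding main[OF T L, of x] simple_strong_markov_fun[OF T L h] by simp
qed

text \<open>Both sides are integrals of \<open>F\<close> against finite measures, the law of the
  shifted path and a mixture of the laws. They agree on cylinder sets, which are stable under
  intersection and generate the raw \<sigma>-algebra.\<close>

lemma strong_markov_set:
  assumes T: "stopping_time (filt X) T" and L: "\<Lambda> \<in> sets (stopped_sigma X T)"
    and F: "F \<in> borel_measurable (raw_filtration X \<top>)"
  shows "(\<integral>\<^sup>+\<omega>\<in>\<Lambda>. F (shift (T \<omega>) \<omega>) \<partial>prob_at X x) =
    (\<integral>\<^sup>+\<omega>\<in>\<Lambda>. (\<integral>\<^sup>+\<omega>'. F \<omega>' \<partial>law X (traj X (T \<omega>) \<omega>)) \<partial>prob_at X x)"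
proof -
  note Tb[measurable] = stopping_borel[OF T, of x]
  note Lm[measurable] = stopped_prob_at[OF T L, of x]
  note F[measurable]
  note sh[measurable] = shift_measurable[OF Tb]
  have m1[measurable]: "(\<lambda>\<omega>. traj X (T \<omega>) \<omega>) \<in> prob_at X x \<rightarrow>\<^sub>M cem_borel"
    by (auto intro!: traj_stopping_measurable)
  define P where "P = density (prob_at X x) (indicator \<Lambda>)"
  have setsP[measurable_cong]: "sets P = sets (prob_at X x)" by (simp add: P_def)
  define M1 where "M1 = distr P (raw_filtration X \<top>) (\<lambda>\<omega>. shift (T \<omega>) \<omega>)"
  define M2 where "M2 = Giry_Monad.bind P (\<lambda>\<omega>. law X (traj X (T \<omega>) \<omega>))"
  have shP: "(\<lambda>\<omega>. shift (T \<omega>) \<omega>) \<in> P \<rightarrow>\<^sub>M raw_filtration X \<top>" by measurable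
  have kerP: "(\<lambda>\<omega>. law X (traj X (T \<omega>) \<omega>)) \<in> P \<rightarrow>\<^sub>M subprob_algebra (raw_filtration X \<top>)" by measurable
  have spP: "space P = UNIV" by (simp add: P_def)
  define E where "E = {{\<omega>. \<forall>i\<in>I. traj X i \<omega> \<in> A i} | I A. finite I \<and> (\<forall>i. A i \<in> sets cem_borel)}"
  have "M1 = M2"
  proof (rule measure_eqI_generator_eq[where E=E and \<Omega>=UNIV and A="\<lambda>_. UNIV"])
    show "Int_stable E"
    proof (rule Int_stableI)
      fix a b assume "a \<in> E" "b \<in> E"
      then obtain I A J B where *: "a = {\<omega>. \<forall>i\<in>I. traj X i \<omega> \<in> A i}" "finite I" "\<And>i. A i \<in> sets cem_borel"
        "b = {\<omega>. \<forall>i\<in>J. traj X i \<omega> \<in> B i}" "finite J" "\<And>i. B i \<in> sets cem_borel"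
        unfolding E_def by auto
      define C where "C i = (if i \<in> I then A i else UNIV) \<inter> (if i \<in> J then B i else UNIV)" for i
      have "UNIV \<in> sets cem_borel" using sets.top[of cem_borel] by simp
      then have "C i \<in> sets cem_borel" for i using * by (auto simp: C_def)
      moreover have "a \<inter> b = {\<omega>. \<forall>i\<in>I \<union> J. traj X i \<omega> \<in> C i}"
        unfolding * C_def by (auto split: if_splits)
      ultimately show "a \<inter> b \<in> E" unfolding E_def using *(2,5) by blast
    qed
    show "E \<subseteq> Pow UNIV" by auto
    have gen: "sets (raw_filtration X \<top>) = sigma_sets UNIV E"
    proof
      have "(\<Union>s\<in>{..\<top>}. {traj X s -` A |A. A \<in> sets cem_borel}) \<subseteq> E"
      proof clarify
        fix s and A :: "'x option set" assume "A \<in> sets cem_borel"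
        then show "traj X s -` A \<in> E"
          unfolding E_def by (intro CollectI exI[of _ "{s}"] exI[of _ "\<lambda>_. A"]) auto
      qed
      then show "sets (raw_filtration X \<top>) \<subseteq> sigma_sets UNIV E"
        unfolding sets_raw by (rule sigma_sets_mono')
      show "sigma_sets UNIV E \<subseteq> sets (raw_filtration X \<top>)"
      proof -
        have "E \<subseteq> sets (raw_filtration X \<top>)"
        proof
          fix e assume "e \<in> E"
          then obtain I A where "finite I" "\<And>i. A i \<in> sets cem_borel"
            and e: "e = {\<omega>\<in>space (raw_filtration X \<top>). \<forall>i\<in>I. traj X i \<omega> \<in> A i}"
            unfolding E_def by auto
          then show "e \<in> sets (raw_filtration X \<top>)" unfolding e
            by (intro sets.sets_Collect_finite_All) (auto intro!: traj_in_raw)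
        qed
        then show ?thesis using sets.sigma_sets_subset[of E "raw_filtration X \<top>"] by simp
      qed
    qed
    show "sets M1 = sigma_sets UNIV E" unfolding M1_def by (simp add: gen)
    show "sets M2 = sigma_sets UNIV E"
      unfolding M2_def gen[symmetric] by (rule sets_bind[where N="raw_filtration X \<top>"]) (simp_all add: spP)
    show "range (\<lambda>_::nat. UNIV) \<subseteq> E"
      unfolding E_def by (auto intro!: exI[of _ "{}"] exI[of _ "\<lambda>_. UNIV"] simp: sets.top[of cem_borel, simplified])
    show "(\<Union>i::nat. UNIV) = (UNIV :: 'w set)" by auto
    show "emeasure M1 UNIV \<noteq> \<infinity>" 
    proof -
      interpret prob_space "prob_at X x" by (rule prob_space_prob_at)
      have "emeasure M1 UNIV = emeasure P UNIV"
        unfolding M1_def using sets.top[of "raw_filtration X \<top>"] by (subst emeasure_distr[OF shP]) (auto simp: spP)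
      also have "\<dots> = emeasure (prob_at X x) \<Lambda>"
        unfolding P_def using sets.top[of "prob_at X x"] by (subst emeasure_density) (auto simp: nn_integral_indicator[symmetric] simp del: nn_integral_indicator)
      finally show ?thesis by simp
    qed
    fix B assume "B \<in> E"
    then obtain I A where B: "B = {\<omega>. \<forall>i\<in>I. traj X i \<omega> \<in> A i}" "finite I" and A: "\<And>i. A i \<in> sets cem_borel"
      unfolding E_def by auto
    have Br: "B \<in> sets (raw_filtration X \<top>)" using \<open>B \<in> E\<close> gen by auto
    have s1: "(\<lambda>\<omega>. shift (T \<omega>) \<omega>) -` B \<inter> space P = {\<omega>. \<forall>i\<in>I. traj X (T \<omega> + (i - 0)) \<omega> \<in> A i}"
      unfolding B spP by (auto simp: add.commute)
    have s2: "{\<omega>. \<forall>i\<in>I. traj X (T \<omega> + (i - 0)) \<omega> \<in> A i} \<in> sets (prob_at X x)"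
      using measurable_sets[OF shP Br] unfolding s1 setsP .
    have "emeasure M1 B = emeasure P {\<omega>. \<forall>i\<in>I. traj X (T \<omega> + (i - 0)) \<omega> \<in> A i}"
      unfolding M1_def by (subst emeasure_distr[OF shP Br]) (simp only: s1)
    also have "\<dots> = emeasure (prob_at X x) ({\<omega>. \<forall>i\<in>I. traj X (T \<omega> + (i - 0)) \<omega> \<in> A i} \<inter> \<Lambda>)"
    proof -
      have "emeasure P C = emeasure (prob_at X x) (C \<inter> \<Lambda>)" if "C \<in> sets (prob_at X x)" for C
      proof -
        have "emeasure P C = (\<integral>\<^sup>+\<omega>. indicator \<Lambda> \<omega> * indicator C \<omega> \<partial>prob_at X x)"
          unfolding P_def using that by (intro emeasure_density) auto
        also have "\<dots> = (\<integral>\<^sup>+\<omega>. indicator (C \<inter> \<Lambda>) \<omega> \<partial>prob_at X x)"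
          by (intro nn_integral_cong) (auto simp: indicator_def)
        finally show ?thesis using that by simp
      qed
      then show ?thesis using s2 .
    qed
    also have "\<dots> = (\<integral>\<^sup>+\<omega>\<in>\<Lambda>. emeasure (law X (traj X (T \<omega>) \<omega>)) {\<omega>'. \<forall>i\<in>I. traj X (i - 0) \<omega>' \<in> A i} \<partial>prob_at X x)"
      by (rule strong_markov_cylinder[OF B(2) A T L]) simp
    also have "\<dots> = (\<integral>\<^sup>+\<omega>\<in>\<Lambda>. emeasure (law X (traj X (T \<omega>) \<omega>)) B \<partial>prob_at X x)"
      by (simp add: B(1))
    also have "\<dots> = (\<integral>\<^sup>+\<omega>. emeasure (law X (traj X (T \<omega>) \<omega>)) B \<partial>P)"
      unfolding P_def using measurable_compose[OF m1 law_emeasure_measurable[OF Br]]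
      by (subst nn_integral_density) (auto simp: mult.commute)
    also have "\<dots> = emeasure M2 B"
      unfolding M2_def by (rule emeasure_bind[symmetric, OF _ kerP Br]) (simp add: spP)
    finally show "emeasure M1 B = emeasure M2 B" .
  qed
  then have eq: "(\<integral>\<^sup>+\<omega>. F \<omega> \<partial>M1) = (\<integral>\<^sup>+\<omega>. F \<omega> \<partial>M2)" by simp
  have "(\<integral>\<^sup>+\<omega>\<in>\<Lambda>. F (shift (T \<omega>) \<omega>) \<partial>prob_at X x) = (\<integral>\<^sup>+\<omega>. F (shift (T \<omega>) \<omega>) \<partial>P)"
    unfolding P_def by (subst nn_integral_density) (auto simp: mult.commute)
  also have "\<dots> = (\<integral>\<^sup>+\<omega>. F \<omega> \<partial>M1)"
    unfolding M1_def by (subst nn_integral_distr[OF shP]) (use F in simp_all)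
  also have "\<dots> = (\<integral>\<^sup>+\<omega>. (\<integral>\<^sup>+\<omega>'. F \<omega>' \<partial>law X (traj X (T \<omega>) \<omega>)) \<partial>P)"
    unfolding eq M2_def by (rule nn_integral_bind[OF F kerP])
  also have "\<dots> = (\<integral>\<^sup>+\<omega>\<in>\<Lambda>. (\<integral>\<^sup>+\<omega>'. F \<omega>' \<partial>law X (traj X (T \<omega>) \<omega>)) \<partial>prob_at X x)"
    unfolding P_def using measurable_compose[OF m1 law_integral_measurable[OF F]]
    by (subst nn_integral_density) (auto simp: mult.commute)
  finally show ?thesis .
qed

lemma law_null_Un: "law_null A \<Longrightarrow> law_null B \<Longrightarrow> law_null (A \<union> B)"
  using null_sets.Un[of A "law X _" B] by (auto simp: law_null_def null_sets_def)

lemma completion_AE_measurable: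
  fixes f g :: "'w \<Rightarrow> ennreal"
  assumes "f \<in> borel_measurable (prob_at X x)" "AE \<omega> in prob_at X x. f \<omega> = g \<omega>"
  shows "g \<in> borel_measurable (prob_at X x)"
proof -
  interpret complete_measure "prob_at X x"
    using completion.complete_measure_axioms[of "law X x"] by (simp add: prob_at_def)
  obtain N where N: "N \<in> null_sets (prob_at X x)" "{\<omega> \<in> space (prob_at X x). f \<omega> \<noteq> g \<omega>} \<subseteq> N"
    using assms(2) by (auto elim!: AE_E simp: null_sets_def)
  show ?thesis
  proof (rule measurableI)
    fix A :: "ennreal set" assume "A \<in> sets borel"
    then have 1: "f -` A \<inter> space (prob_at X x) \<in> sets (prob_at X x)"
      using assms(1) by (rule measurable_sets[rotated])
    have "(g -` A) \<inter> N \<in> sets (prob_at X x)"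
      by (rule complete[OF _ N(1)]) auto
    then have "(f -` A \<inter> space (prob_at X x) - N) \<union> (g -` A \<inter> N) \<in> sets (prob_at X x)"
      using 1 N(1) by auto
    moreover have "f \<omega> = g \<omega>" if "\<omega> \<notin> N" for \<omega>
      using N(2) that by auto
    then have "(f -` A \<inter> space (prob_at X x) - N) \<union> (g -` A \<inter> N) = g -` A \<inter> space (prob_at X x)"
      by auto
    ultimately show "g -` A \<inter> space (prob_at X x) \<in> sets (prob_at X x)" by simp
  qed auto
qed

text \<open>Exit times are measurable only for \<open>aug\<close>, whereas \<open>law X\<close> and
  the Markov property live on the raw \<sigma>-algebra; this passes between the two.\<close>

lemma aug_raw_version:
  fixes F :: "'w \<Rightarrow> ennreal"
  assumes "F \<in> borel_measurable (aug \<top>)"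
  obtains G N where "G \<in> borel_measurable (raw_filtration X \<top>)" "law_null N" "\<And>\<omega>. \<omega> \<notin> N \<Longrightarrow> F \<omega> = G \<omega>"
proof -
  have "\<exists>G\<in>borel_measurable (raw_filtration X \<top>). \<exists>N. law_null N \<and> (\<forall>\<omega>. \<omega> \<notin> N \<longrightarrow> F \<omega> = G \<omega>)"
    using assms
  proof (induction rule: borel_measurable_induct)
    case (cong f g)
    then have "f = g" by auto
    with cong show ?case by simp
  next
    case (set A)
    then obtain B N where B: "B \<in> sets (raw_filtration X \<top>)" "law_null N" "sym_diff A B \<subseteq> N"
      unfolding sets_aug by auto
    then have "indicator A \<omega> = (indicator B \<omega> :: ennreal)" if "\<omega> \<notin> N" for \<omega>
      using that by (auto simp: indicator_def)
    with B show ?case by (intro bexI[of _ "indicator B"] exI[of _ N]) auto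
  next
    case (mult u c)
    then obtain G N where "G \<in> borel_measurable (raw_filtration X \<top>)" "law_null N" "\<And>\<omega>. \<omega> \<notin> N \<Longrightarrow> u \<omega> = G \<omega>"
      by blast
    then show ?case by (intro bexI[of _ "\<lambda>\<omega>. c * G \<omega>"] exI[of _ N]) auto
  next
    case (add u v)
    then obtain G N G' N' where *: "G \<in> borel_measurable (raw_filtration X \<top>)" "law_null N" "\<And>\<omega>. \<omega> \<notin> N \<Longrightarrow> u \<omega> = G \<omega>"
      "G' \<in> borel_measurable (raw_filtration X \<top>)" "law_null N'" "\<And>\<omega>. \<omega> \<notin> N' \<Longrightarrow> v \<omega> = G' \<omega>"
      by metis
    have "law_null (N \<union> N')"
      using *(2,5) by (rule law_null_Un)
    then show ?case using * by (intro bexI[of _ "\<lambda>\<omega>. G' \<omega> + G \<omega>"] exI[of _ "N \<union> N'"]) auto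
  next
    case (seq U)
    then have "\<forall>i. \<exists>G N. G \<in> borel_measurable (raw_filtration X \<top>) \<and> law_null N \<and> (\<forall>\<omega>. \<omega> \<notin> N \<longrightarrow> U i \<omega> = G \<omega>)"
      by metis
    then obtain G N where *: "\<And>i. G i \<in> borel_measurable (raw_filtration X \<top>)" "\<And>i::nat. law_null (N i)"
      "\<And>i \<omega>. \<omega> \<notin> N i \<Longrightarrow> U i \<omega> = G i \<omega>" by metis
    then have "(SUP i. U i) \<omega> = (SUP i. G i \<omega>)" if "\<omega> \<notin> (\<Union>i. N i)" for \<omega>
      using that by (simp add: image_comp)
    then show ?case
      using * law_null_UN[of N] by (intro bexI[of _ "\<lambda>\<omega>. SUP i. G i \<omega>"] exI[of _ "\<Union>i. N i"]) auto
  qed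
  with that show thesis by blast
qed

lemma strong_markov_weight:
  assumes T: "stopping_time (filt X) T" and W: "W \<in> borel_measurable (stopped_sigma X T)"
    and F: "F \<in> borel_measurable (raw_filtration X \<top>)"
  shows "(\<integral>\<^sup>+\<omega>. W \<omega> * F (shift (T \<omega>) \<omega>) \<partial>prob_at X x) =
    (\<integral>\<^sup>+\<omega>. W \<omega> * (\<integral>\<^sup>+\<omega>'. F \<omega>' \<partial>law X (traj X (T \<omega>) \<omega>)) \<partial>prob_at X x)"
proof -
  note Tb[measurable] = stopping_borel[OF T, of x]
  have m1: "(\<lambda>\<omega>. F (shift (T \<omega>) \<omega>)) \<in> borel_measurable (prob_at X x)"
    by (rule measurable_compose[OF shift_measurable[OF Tb] F])
  have m2: "(\<lambda>\<omega>. \<integral>\<^sup>+\<omega>'. F \<omega>' \<partial>law X (traj X (T \<omega>) \<omega>)) \<in> borel_measurable (prob_at X x)"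
    by (rule measurable_compose[OF traj_stopping_measurable[OF Tb] law_integral_measurable[OF F]])
  note m = m1 m2 measurable_stopped_prob_at[OF T, of _ _ x]
  show ?thesis
    using W
  proof (induction rule: borel_measurable_induct)
    case (cong f g)
    then have "f = g" by (auto simp: stopped_sigma_eq filt.space_pre_sigma)
    with cong show ?case by simp
  next
    case (set \<Lambda>)
    show ?case using strong_markov_set[OF T set F, of x] by (simp add: mult.commute)
  next
    case (mult u c)
    then show ?case using m m(3)[OF \<open>u \<in> _\<close>] by (simp add: nn_integral_cmult mult.assoc)
  next
    case (add u v)
    then show ?case using m m(3)[OF \<open>u \<in> _\<close>] m(3)[OF \<open>v \<in> _\<close>]
      by (simp add: nn_integral_add distrib_right)
  next
    case (seq U)
    have inc: "incseq (\<lambda>i. U i z)" for z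
      using seq(3) by (auto simp: incseq_def le_fun_def)
    have "(\<integral>\<^sup>+\<omega>. (SUP i. U i) \<omega> * H \<omega> \<partial>prob_at X x) = (SUP i. \<integral>\<^sup>+\<omega>. U i \<omega> * H \<omega> \<partial>prob_at X x)"
      if "H \<in> borel_measurable (prob_at X x)" for H
    proof -
      have "(\<integral>\<^sup>+\<omega>. (SUP i. U i) \<omega> * H \<omega> \<partial>prob_at X x) = (\<integral>\<^sup>+\<omega>. (SUP i. U i \<omega> * H \<omega>) \<partial>prob_at X x)"
        by (intro nn_integral_cong) (simp add: SUP_mult_right_ennreal image_comp)
      also have "\<dots> = (SUP i. \<integral>\<^sup>+\<omega>. U i \<omega> * H \<omega> \<partial>prob_at X x)"
        using inc that m(3)[OF seq(1)] by (intro nn_integral_monotone_convergence_SUP)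
          (auto simp: incseq_def le_fun_def intro!: mult_right_mono)
      finally show ?thesis .
    qed
    then show ?case using m seq.IH by simp
  qed
qed

lemma strong_markov:
  assumes T: "stopping_time (filt X) T" and W: "W \<in> borel_measurable (stopped_sigma X T)"
    and F: "F \<in> borel_measurable (aug \<top>)"
  shows "(\<integral>\<^sup>+\<omega>. W \<omega> * F (shift (T \<omega>) \<omega>) \<partial>prob_at X x) =
    (\<integral>\<^sup>+\<omega>. W \<omega> * (\<integral>\<^sup>+\<omega>'. F \<omega>' \<partial>prob_at X (traj X (T \<omega>) \<omega>)) \<partial>prob_at X x)" (is ?eq)
    and "(\<lambda>\<omega>. F (shift (T \<omega>) \<omega>)) \<in> borel_measurable (prob_at X x)" (is ?meas)
proof -
  note Tb[measurable] = stopping_borel[OF T, of x]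
  obtain G N where G: "G \<in> borel_measurable (raw_filtration X \<top>)" "law_null N" "\<And>\<omega>. \<omega> \<notin> N \<Longrightarrow> F \<omega> = G \<omega>"
    using aug_raw_version[OF F] by blast
  \<comment> \<open>A set null under every law is avoided after the shift as well, by the Markov
    property applied to its indicator.\<close>
  have AE: "AE \<omega> in prob_at X x. shift (T \<omega>) \<omega> \<notin> N"
  proof -
    have Nm: "N \<in> sets (raw_filtration X \<top>)" and N0: "\<And>z. emeasure (law X z) N = 0"
      using G(2) by (auto simp: law_null_def)
    have UN: "UNIV \<in> sets (stopped_sigma X T)"
      using sets.top[of "stopped_sigma X T"] by (simp add: stopped_sigma_eq filt.space_pre_sigma)
    have "(\<integral>\<^sup>+\<omega>. indicator N (shift (T \<omega>) \<omega>) \<partial>prob_at X x) = 0"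
      using strong_markov_set[OF T UN borel_measurable_indicator[OF Nm], of x] Nm N0 by simp
    moreover have "(\<lambda>\<omega>. indicator N (shift (T \<omega>) \<omega>) :: ennreal) \<in> borel_measurable (prob_at X x)"
      by (rule measurable_compose[OF shift_measurable[OF Tb] borel_measurable_indicator[OF Nm]])
    ultimately have "AE \<omega> in prob_at X x. indicator N (shift (T \<omega>) \<omega>) = (0::ennreal)"
      by (subst (asm) nn_integral_0_iff_AE) auto
    then show ?thesis by eventually_elim (auto simp: indicator_def split: if_splits)
  qed
  have "(\<integral>\<^sup>+\<omega>. W \<omega> * F (shift (T \<omega>) \<omega>) \<partial>prob_at X x) = (\<integral>\<^sup>+\<omega>. W \<omega> * G (shift (T \<omega>) \<omega>) \<partial>prob_at X x)"
    using AE by (intro nn_integral_cong_AE, eventually_elim) (simp add: G(3))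
  also have "\<dots> = (\<integral>\<^sup>+\<omega>. W \<omega> * (\<integral>\<^sup>+\<omega>'. G \<omega>' \<partial>law X (traj X (T \<omega>) \<omega>)) \<partial>prob_at X x)"
    by (rule strong_markov_weight[OF T W G(1)])
  also have "(\<lambda>z. \<integral>\<^sup>+\<omega>'. G \<omega>' \<partial>law X z) = (\<lambda>z. \<integral>\<^sup>+\<omega>'. F \<omega>' \<partial>prob_at X z)"
  proof
    fix z
    show "(\<integral>\<^sup>+\<omega>'. G \<omega>' \<partial>law X z) = (\<integral>\<^sup>+\<omega>'. F \<omega>' \<partial>prob_at X z)"
      unfolding nn_integral_prob_at[of _ G, symmetric]
      using law_null_AE[OF G(2), of z] by (intro nn_integral_cong_AE, eventually_elim) (simp add: G(3))
  qed
  finally show ?eq by (simp add: fun_eq_iff)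
  have "(\<lambda>\<omega>. G (shift (T \<omega>) \<omega>)) \<in> borel_measurable (prob_at X x)"
    by (rule measurable_compose[OF shift_measurable[OF Tb] G(1)])
  then show ?meas
    by (rule completion_AE_measurable) (use AE in eventually_elim, simp add: G(3))
qed

lemma prob_at_integral_measurable:
  assumes "F \<in> borel_measurable (aug \<top>)"
  shows "(\<lambda>z. \<integral>\<^sup>+\<omega>. F \<omega> \<partial>prob_at X z) \<in> borel_measurable cem_borel"
proof -
  obtain G N where G: "G \<in> borel_measurable (raw_filtration X \<top>)" "law_null N" "\<And>\<omega>. \<omega> \<notin> N \<Longrightarrow> F \<omega> = G \<omega>"
    using aug_raw_version[OF assms] by blast
  have "(\<integral>\<^sup>+\<omega>'. G \<omega>' \<partial>law X z) = (\<integral>\<^sup>+\<omega>'. F \<omega>' \<partial>prob_at X z)" for z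
    unfolding nn_integral_prob_at[of _ G, symmetric]
    using law_null_AE[OF G(2), of z] by (intro nn_integral_cong_AE, eventually_elim) (simp add: G(3))
  with law_integral_measurable[OF G(1)] show ?thesis by simp
qed

lemma Inf_shift_ennreal:
  assumes "T < (\<top>::ennreal)"
  shows "Inf {t. T < t \<and> P t} = T + Inf {s. 0 < s \<and> P (s + T)}"
proof (rule antisym)
  have "Inf {t. T < t \<and> P t} - T \<le> Inf {s. 0 < s \<and> P (s + T)}"
  proof (rule Inf_greatest)
    fix s assume "s \<in> {s. 0 < s \<and> P (s + T)}"
    then have "T < s + T"
      using assms by (cases s; cases T) (auto simp: ennreal_less_iff simp flip: ennreal_plus)
    then have "Inf {t. T < t \<and> P t} \<le> s + T" using \<open>s \<in> _\<close> by (intro Inf_lower) auto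
    then show "Inf {t. T < t \<and> P t} - T \<le> s"
      using assms by (auto simp: ennreal_minus_le_iff add.commute)
  qed
  then show "Inf {t. T < t \<and> P t} \<le> T + Inf {s. 0 < s \<and> P (s + T)}"
    using assms by (auto simp: ennreal_minus_le_iff add.commute)
  show "T + Inf {s. 0 < s \<and> P (s + T)} \<le> Inf {t. T < t \<and> P t}"
  proof (rule Inf_greatest)
    fix t assume t: "t \<in> {t. T < t \<and> P t}"
    then have eq: "t - T + T = t" by (intro diff_add_cancel_ennreal) auto
    have "0 < t - T" using t by (simp add: diff_gr0_ennreal)
    then have "Inf {s. 0 < s \<and> P (s + T)} \<le> t - T" using t eq by (intro Inf_lower) auto
    then have "T + Inf {s. 0 < s \<and> P (s + T)} \<le> T + (t - T)" by (rule add_left_mono)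
    then show "T + Inf {s. 0 < s \<and> P (s + T)} \<le> t" using eq by (metis add.commute)
  qed
qed

lemma exit_time_shift:
  assumes "T < exit_time X D \<omega>"
  shows "exit_time X D \<omega> = T + exit_time X D (shift T \<omega>)"
proof -
  have "T < \<top>" using assms by (meson less_le_trans top_greatest)
  have "{t. 0 < t \<and> traj X t \<omega> \<notin> Some ` D} = {t. T < t \<and> traj X t \<omega> \<notin> Some ` D}"
    using assms exit_time_le[of _ \<omega> D] by (auto intro: less_le_trans le_less_trans)
  then have "exit_time X D \<omega> = Inf {t. T < t \<and> traj X t \<omega> \<notin> Some ` D}"
    by (simp add: exit_time_def)
  also have "\<dots> = T + Inf {s. 0 < s \<and> traj X (s + T) \<omega> \<notin> Some ` D}"
    by (rule Inf_shift_ennreal[OF \<open>T < \<top>\<close>])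
  finally show ?thesis by (simp add: exit_time_def)
qed

end

section \<open>Killed semigroups and excessive functions\<close>

text \<open>One side of the duality, so that the process and its dual become two instances of the
  same theory.\<close>

locale jump_hunt = hunt X
  for X :: "('w, 'x::{heine_borel, second_countable_topology}) process" +
  fixes m :: "'x measure" and j :: "'x \<Rightarrow> 'x \<Rightarrow> real"
  assumes sets_m: "sets m = sets borel"
    and m_finite_compact: "\<And>K. compact K \<Longrightarrow> emeasure m K < \<infinity>"
    and m_pos_open: "\<And>U. open U \<Longrightarrow> U \<noteq> {} \<Longrightarrow> 0 < emeasure m U"
    and feller: "feller X" "strong_feller X"
    and abs_cont: "resolvent_abs_cont m X"
    and j_measurable: "(\<lambda>(x, y). j x y) \<in> borel_measurable (borel \<Otimes>\<^sub>M borel)"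
    and levy: "levy_system X (\<lambda>x. density m (\<lambda>y. ennreal (j x y)))"

section \<open>Occupation times, exit means and the killed semigroup\<close>

context hunt
begin

lemma emeasure_prob_at_UNIV [simp]: "emeasure (prob_at X x) UNIV = 1"
  using prob_space.emeasure_space_1[OF prob_space_prob_at[of x]] by simp

lemma measure_prob_at_UNIV [simp]: "measure (prob_at X x) UNIV = 1"
  by (simp add: measure_def)

lemma id_aug_raw: "(\<lambda>\<omega>. \<omega>) \<in> aug \<top> \<rightarrow>\<^sub>M raw_filtration X \<top>"
  using raw_aug[of \<top>] by (intro measurableI) auto

lemma id_prob_at_aug: "(\<lambda>\<omega>. \<omega>) \<in> prob_at X x \<rightarrow>\<^sub>M aug \<top>"
  using aug_prob_at[of \<top> x] by (intro measurableI) auto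

lemma traj_joint_aug:
  "(\<lambda>(\<omega>, t). traj X (ennreal t) \<omega>) \<in> aug \<top> \<Otimes>\<^sub>M lborel \<rightarrow>\<^sub>M cem_borel"
  unfolding split_beta
  by (rule traj_random_time_top[OF _ measurable_compose[OF measurable_fst id_aug_raw]]) measurable

lemma traj_aug: "traj X s \<in> aug \<top> \<rightarrow>\<^sub>M cem_borel"
  by (rule measurable_raw_aug[OF traj_raw_top])

lemma AE_start: "AE \<omega> in start X x. traj X 0 \<omega> = Some x"
  by (rule traj_0)

text \<open>The functional whose mean is the left-hand side of the occupation formula in
  \<open>green_kernel\<close>.\<close>

definition occ_path :: "'x set \<Rightarrow> ('x \<Rightarrow> ennreal) \<Rightarrow> 'w \<Rightarrow> ennreal" where
  "occ_path D f \<omega> = (\<integral>\<^sup>+t\<in>{t. 0 \<le> t \<and> ennreal t < exit_time X D \<omega>}. ext0 f (traj X (ennreal t) \<omega>) \<partial>lborel)"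

definition occ :: "'x set \<Rightarrow> ('x \<Rightarrow> ennreal) \<Rightarrow> 'x \<Rightarrow> ennreal" where
  "occ D f x = (\<integral>\<^sup>+\<omega>. occ_path D f \<omega> \<partial>start X x)"

lemma occ_path_measurable:
  assumes D: "open D" and f[measurable]: "f \<in> borel_measurable borel"
  shows "occ_path D f \<in> borel_measurable (aug \<top>)"
proof -
  note traj_joint_aug[measurable] exit_measurable_aug[OF D, measurable]
  have "(\<lambda>(\<omega>, t). ext0 f (traj X (ennreal t) \<omega>)) \<in> borel_measurable (aug \<top> \<Otimes>\<^sub>M lborel)"
    using measurable_compose[OF traj_joint_aug measurable_ext0[OF f]] by (simp add: split_beta)
  then have [measurable]: "(\<lambda>z. ext0 f (traj X (ennreal (snd z)) (fst z))) \<in> borel_measurable (aug \<top> \<Otimes>\<^sub>M lborel)"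
    by (simp add: split_beta)
  have "(\<lambda>(\<omega>, t). ext0 f (traj X (ennreal t) \<omega>) * indicator {t. 0 \<le> t \<and> ennreal t < exit_time X D \<omega>} t)
      \<in> borel_measurable (aug \<top> \<Otimes>\<^sub>M lborel)"
    unfolding split_beta indicator_def mem_Collect_eq by measurable
  then show ?thesis
    unfolding occ_path_def[abs_def] by (rule lborel.borel_measurable_nn_integral)
qed

lemma prob_at_integral_Some:
  assumes "F \<in> borel_measurable (aug \<top>)"
  shows "(\<lambda>x. \<integral>\<^sup>+\<omega>. F \<omega> \<partial>start X x) \<in> borel_measurable borel"
  by (rule measurable_compose[OF measurable_Some prob_at_integral_measurable[OF assms]])

lemma occ_measurable:
  "open D \<Longrightarrow> f \<in> borel_measurable borel \<Longrightarrow> occ D f \<in> borel_measurable borel"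
  unfolding occ_def[abs_def] by (intro prob_at_integral_Some occ_path_measurable)

lemma occ_path_mono: "(\<And>x. f x \<le> g x) \<Longrightarrow> occ_path D f \<omega> \<le> occ_path D g \<omega>"
  unfolding occ_path_def by (intro nn_integral_mono mult_right_mono) (auto split: option.splits)

lemma occ_path_cong: "(\<And>x. x \<in> D \<Longrightarrow> f x = g x) \<Longrightarrow> occ_path D f \<omega> = occ_path D g \<omega>"
proof -
  assume eq: "\<And>x. x \<in> D \<Longrightarrow> f x = g x"
  \<comment> \<open>At time \<open>0\<close> the path may be outside \<open>D\<close>, since
    \<open>exit_time\<close> looks only at positive times; a single instant carries no Lebesgue
    mass.\<close>
  have "AE t in lborel. t \<noteq> (0::real)" by (rule AE_lborel_singleton)
  then have "AE t in lborel. ext0 f (traj X (ennreal t) \<omega>) * indicator {t. 0 \<le> t \<and> ennreal t < exit_time X D \<omega>} t =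
     ext0 g (traj X (ennreal t) \<omega>) * indicator {t. 0 \<le> t \<and> ennreal t < exit_time X D \<omega>} t"
  proof eventually_elim
    case (elim t)
    show ?case
    proof (cases "0 \<le> t \<and> ennreal t < exit_time X D \<omega>")
      case True
      then have "traj X (ennreal t) \<omega> \<in> Some ` D"
        using elim by (intro traj_before_exit) auto
      then show ?thesis using eq by auto
    qed auto
  qed
  then show ?thesis unfolding occ_path_def by (rule nn_integral_cong_AE)
qed

lemma traj_exit_cases:
  assumes D: "open D" "open U" "U \<subseteq> D" and 0: "traj X 0 \<omega> \<in> Some ` U"
  shows "(traj X (exit_time X U \<omega>) \<omega> \<in> Some ` D \<and> exit_time X U \<omega> < exit_time X D \<omega>) \<or>
    (traj X (exit_time X U \<omega>) \<omega> \<notin> Some ` D \<and> exit_time X U \<omega> = exit_time X D \<omega>)"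
proof -
  have pos: "0 < exit_time X U \<omega>" by (rule exit_time_pos[OF D(2) 0])
  have le: "exit_time X U \<omega> \<le> exit_time X D \<omega>" by (rule exit_time_mono[OF D(3)])
  show ?thesis
  proof (cases "traj X (exit_time X U \<omega>) \<omega> \<in> Some ` D")
    case True
    then have "exit_time X U \<omega> \<noteq> exit_time X D \<omega>" using traj_exit_notin[OF D(1)] by metis
    with le True show ?thesis by auto
  next
    case False
    then have "exit_time X D \<omega> \<le> exit_time X U \<omega>" by (rule exit_time_le[OF pos])
    with le False show ?thesis by auto
  qed
qed

lemma nn_integral_real_shift:
  fixes g :: "real \<Rightarrow> ennreal"
  assumes "g \<in> borel_measurable borel"
  shows "(\<integral>\<^sup>+t. g (t + r) \<partial>lborel) = (\<integral>\<^sup>+t. g t \<partial>lborel)"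
  using nn_integral_real_affine[OF assms, of 1 r] by (simp add: add.commute)

lemma path_measurable: "(\<lambda>t. traj X (ennreal t) \<omega>) \<in> borel \<rightarrow>\<^sub>M cem_borel"
proof -
  have "(\<lambda>t::real. (t, \<omega>)) \<in> borel \<rightarrow>\<^sub>M borel \<Otimes>\<^sub>M aug \<top>"
    by (rule measurable_Pair) (auto intro!: measurable_const)
  then have "(\<lambda>t::real. (\<omega>, t)) \<in> borel \<rightarrow>\<^sub>M aug \<top> \<Otimes>\<^sub>M lborel"
    by (intro measurable_Pair) (auto intro!: measurable_const)
  from measurable_compose[OF this traj_joint_aug] show ?thesis by simp
qed

lemma occ_path_split:
  assumes D: "open D" "open U" "U \<subseteq> D" and f[measurable]: "f \<in> borel_measurable borel"
    and 0: "traj X 0 \<omega> \<in> Some ` U"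
  shows "occ_path D f \<omega> = occ_path U f \<omega> +
     (if traj X (exit_time X U \<omega>) \<omega> \<in> Some ` D then occ_path D f (shift (exit_time X U \<omega>) \<omega>) else 0)"
  using traj_exit_cases[OF D 0]
proof (elim disjE conjE)
  assume *: "traj X (exit_time X U \<omega>) \<omega> \<notin> Some ` D" "exit_time X U \<omega> = exit_time X D \<omega>"
  then show ?thesis by (simp add: occ_path_def)
next
  assume *: "traj X (exit_time X U \<omega>) \<omega> \<in> Some ` D" and lt: "exit_time X U \<omega> < exit_time X D \<omega>"
  have "exit_time X U \<omega> < \<top>" using lt by (meson less_le_trans top_greatest)
  then obtain r where r: "exit_time X U \<omega> = ennreal r" "0 \<le> r" by (cases "exit_time X U \<omega>") auto
  define a where "a = exit_time X D \<omega>"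
  have a: "a = ennreal r + exit_time X D (shift (ennreal r) \<omega>)"
    using exit_time_shift[OF lt] r by (simp add: a_def)
  have [measurable]: "(\<lambda>t. traj X (ennreal t) \<omega>) \<in> borel \<rightarrow>\<^sub>M cem_borel" by (rule path_measurable)
  have [measurable]: "(\<lambda>t. ext0 f (traj X (ennreal t) \<omega>)) \<in> borel_measurable borel"
    by (rule measurable_compose[OF path_measurable measurable_ext0[OF f]])
  define g where "g t = ext0 f (traj X (ennreal t) \<omega>) * indicator {t. r \<le> t \<and> ennreal t < a} t" for t
  have gm[measurable]: "g \<in> borel_measurable borel"
    unfolding g_def by measurable
  have "occ_path D f \<omega> = (\<integral>\<^sup>+t. ext0 f (traj X (ennreal t) \<omega>) * indicator {t. 0 \<le> t \<and> ennreal t < ennreal r} t + g t \<partial>lborel)"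
    unfolding occ_path_def
  proof (intro nn_integral_cong)
    fix t
    have "ennreal t < a" if "t < r" "0 \<le> t"
    proof -
      have "ennreal t < ennreal r" using that by (intro ennreal_lessI) auto
      also have "\<dots> < a" using lt r by (simp add: a_def)
      finally show ?thesis .
    qed
    then show "ext0 f (traj X (ennreal t) \<omega>) * indicator {t. 0 \<le> t \<and> ennreal t < exit_time X D \<omega>} t =
       ext0 f (traj X (ennreal t) \<omega>) * indicator {t. 0 \<le> t \<and> ennreal t < ennreal r} t + g t"
      using r(2) unfolding g_def a_def[symmetric] by (auto simp: indicator_def ennreal_less_iff not_le)
  qed
  also have "\<dots> = occ_path U f \<omega> + (\<integral>\<^sup>+t. g t \<partial>lborel)"
    unfolding occ_path_def r(1) by (rule nn_integral_add) measurable
  also have "(\<integral>\<^sup>+t. g t \<partial>lborel) = (\<integral>\<^sup>+t. g (t + r) \<partial>lborel)"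
    by (rule nn_integral_real_shift[symmetric, OF gm])
  also have "\<dots> = occ_path D f (shift (ennreal r) \<omega>)"
    unfolding occ_path_def
  proof (intro nn_integral_cong)
    fix t
    have "ennreal (t + r) < a \<longleftrightarrow> ennreal t < exit_time X D (shift (ennreal r) \<omega>)" if "0 \<le> t"
      unfolding a using that r(2)
      by (cases "exit_time X D (shift (ennreal r) \<omega>)")
         (auto simp: ennreal_less_iff simp flip: ennreal_plus)
    then show "g (t + r) = ext0 f (traj X (ennreal t) (shift (ennreal r) \<omega>)) *
         indicator {t. 0 \<le> t \<and> ennreal t < exit_time X D (shift (ennreal r) \<omega>)} t"
      using r(2) by (auto simp: g_def indicator_def ennreal_plus)
  qed
  finally show ?thesis using * r(1) by simp
qed

lemma exit_prob_at: "open U \<Longrightarrow> exit_time X U \<in> borel_measurable (prob_at X x)"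
  by (rule measurable_aug_prob_at[OF exit_measurable_aug])

lemma traj_exit_prob_at: "open U \<Longrightarrow> (\<lambda>\<omega>. traj X (exit_time X U \<omega>) \<omega>) \<in> prob_at X x \<rightarrow>\<^sub>M cem_borel"
  by (rule traj_stopping_measurable[OF exit_prob_at])

lemma traj_exit_aug: "open U \<Longrightarrow> (\<lambda>\<omega>. traj X (exit_time X U \<omega>) \<omega>) \<in> aug \<top> \<rightarrow>\<^sub>M cem_borel"
  by (rule traj_random_time_top[OF exit_measurable_aug id_aug_raw])

definition exit_int :: "'x set \<Rightarrow> ('x \<Rightarrow> ennreal) \<Rightarrow> 'x \<Rightarrow> ennreal" where
  "exit_int U f x = (\<integral>\<^sup>+\<omega>. ext0 f (traj X (exit_time X U \<omega>) \<omega>) \<partial>start X x)"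

lemma exit_int_measurable:
  "open U \<Longrightarrow> f \<in> borel_measurable borel \<Longrightarrow> exit_int U f \<in> borel_measurable borel"
  unfolding exit_int_def[abs_def]
  by (intro prob_at_integral_Some measurable_compose[OF traj_exit_aug measurable_ext0])

text \<open>After leaving \<open>U\<close> the path restarts at its exit position. The factor
  \<open>indicator D\<close> matters: started at an irregular point outside \<open>D\<close>, a path
  has a positive exit time from \<open>D\<close>, although the original path has already left
  \<open>D\<close>.\<close>

lemma occ_split:
  assumes D: "open D" "open U" "U \<subseteq> D" and f: "f \<in> borel_measurable borel" and x: "x \<in> U"
  shows "occ D f x = occ U f x + exit_int U (\<lambda>v. occ D f v * indicator D v) x"
proof -
  define F where "F \<omega> = (if traj X 0 \<omega> \<in> Some ` D then occ_path D f \<omega> else 0)" for \<omega>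
  have [measurable]: "Some ` D \<in> sets cem_borel" using D(1) by (intro sets_cem_Some) auto
  note [measurable] = traj_aug[of 0] occ_path_measurable[OF D(1) f]
  have F: "F \<in> borel_measurable (aug \<top>)" unfolding F_def by measurable
  note sm = strong_markov[OF stopping_exit[OF D(2)] borel_measurable_const[of 1] F, of "Some x"]
  have FD: "(\<integral>\<^sup>+\<omega>'. F \<omega>' \<partial>prob_at X z) = ext0 (\<lambda>v. occ D f v * indicator D v) z" for z
  proof -
    have "(\<integral>\<^sup>+\<omega>'. F \<omega>' \<partial>prob_at X z) = (\<integral>\<^sup>+\<omega>'. (if z \<in> Some ` D then 1 else 0) * occ_path D f \<omega>' \<partial>prob_at X z)"
      using traj_0[of z] by (intro nn_integral_cong_AE, eventually_elim) (auto simp: F_def)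
    also have "\<dots> = (if z \<in> Some ` D then 1 else 0) * (\<integral>\<^sup>+\<omega>'. occ_path D f \<omega>' \<partial>prob_at X z)"
      by (rule nn_integral_cmult) (rule measurable_aug_prob_at, measurable)
    also have "\<dots> = ext0 (\<lambda>v. occ D f v * indicator D v) z"
      by (cases z) (auto simp: occ_def indicator_def)
    finally show ?thesis .
  qed
  have "occ D f x = (\<integral>\<^sup>+\<omega>. occ_path U f \<omega> + F (shift (exit_time X U \<omega>) \<omega>) \<partial>start X x)"
    unfolding occ_def
  proof (rule nn_integral_cong_AE)
    show "AE \<omega> in start X x. occ_path D f \<omega> = occ_path U f \<omega> + F (shift (exit_time X U \<omega>) \<omega>)"
      using AE_start[of x]
    proof eventually_elim
      case (elim \<omega>)
      then have "traj X 0 \<omega> \<in> Some ` U" using x by auto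
      from occ_path_split[OF D f this] show ?case by (simp add: F_def)
    qed
  qed
  also have "\<dots> = occ U f x + (\<integral>\<^sup>+\<omega>. F (shift (exit_time X U \<omega>) \<omega>) \<partial>start X x)"
    unfolding occ_def
    by (rule nn_integral_add[OF measurable_aug_prob_at[OF occ_path_measurable[OF D(2) f]] sm(2)])
  also have "(\<integral>\<^sup>+\<omega>. F (shift (exit_time X U \<omega>) \<omega>) \<partial>start X x) = exit_int U (\<lambda>v. occ D f v * indicator D v) x"
    using sm(1) by (simp add: FD exit_int_def)
  finally show ?thesis .
qed

lemma killed_integrand_measurable:
  fixes f :: "'x \<Rightarrow> ennreal"
  assumes D: "open D" and f: "f \<in> borel_measurable borel"
  shows "(\<lambda>\<omega>. ext0 f (traj X t \<omega>) * indicator {\<omega>. t < exit_time X D \<omega>} \<omega>) \<in> borel_measurable (aug \<top>)"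
proof -
  have "{\<omega> \<in> space (aug \<top>). t < exit_time X D \<omega>} \<in> sets (aug \<top>)"
    using exit_measurable_aug[OF D] by (intro borel_measurable_less) auto
  then have "(indicator {\<omega>. t < exit_time X D \<omega>} :: 'w \<Rightarrow> ennreal) \<in> borel_measurable (aug \<top>)"
    by (intro borel_measurable_indicator) simp
  from borel_measurable_times_ennreal[OF measurable_compose[OF traj_aug measurable_ext0[OF f]] this]
  show ?thesis .
qed

lemma killed_op_measurable:
  assumes D: "open D" and f: "f \<in> borel_measurable borel"
  shows "killed_op X D t f \<in> borel_measurable borel"
  unfolding killed_op_def[abs_def]
  by (intro prob_at_integral_Some killed_integrand_measurable[OF assms])

lemma exit_gt_filt: "open D \<Longrightarrow> {\<omega>. s < exit_time X D \<omega>} \<in> sets (stopped_sigma X (\<lambda>_. s))"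
  unfolding stopped_sigma_eq
proof (rule filt.sets_pre_sigmaI[OF stopping_time_const])
  fix t assume D: "open D"
  have "{\<omega>. exit_time X D \<omega> \<le> s} \<in> sets (filt X s)"
    using stopping_timeD[OF stopping_exit[OF D], of s] by (simp add: pred_def)
  then have "space (filt X s) - {\<omega>. exit_time X D \<omega> \<le> s} \<in> sets (filt X s)" by blast
  moreover have "space (filt X s) - {\<omega>. exit_time X D \<omega> \<le> s} = {\<omega>. s < exit_time X D \<omega>}" by auto
  ultimately show "{\<omega> \<in> {\<omega>. s < exit_time X D \<omega>}. s \<le> t} \<in> sets (filt X t)"
    using filt_mono[of s t] by (cases "s \<le> t") auto
qed

lemma killed_op_split:
  assumes D: "open D" and f: "f \<in> borel_measurable borel" and st: "0 < s" "s \<le> t" "t < \<top>"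
  shows "killed_op X D t f x = (\<integral>\<^sup>+\<omega>\<in>{\<omega>. s < exit_time X D \<omega>}. ext0 (killed_op X D (t - s) f) (traj X s \<omega>) \<partial>start X x)"
proof -
  define F where "F \<omega> = ext0 f (traj X (t - s) \<omega>) * indicator {\<omega>. t - s < exit_time X D \<omega>} \<omega>" for \<omega>
  have F: "F \<in> borel_measurable (aug \<top>)"
    unfolding F_def by (rule killed_integrand_measurable[OF D f])
  define W where "W = (indicator {\<omega>. s < exit_time X D \<omega>} :: 'w \<Rightarrow> ennreal)"
  have W: "W \<in> borel_measurable (stopped_sigma X (\<lambda>_. s))"
    unfolding W_def using exit_gt_filt[OF D] by (rule borel_measurable_indicator)
  have sfin: "s < \<top>" using st by auto
  have FD: "(\<integral>\<^sup>+\<omega>'. F \<omega>' \<partial>prob_at X z) = ext0 (killed_op X D (t - s) f) z" for z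
  proof (cases z)
    case None
    have "(\<integral>\<^sup>+\<omega>'. F \<omega>' \<partial>prob_at X None) = (\<integral>\<^sup>+\<omega>'. 0 \<partial>prob_at X None)"
      using traj_0[of None]
    proof (intro nn_integral_cong_AE, eventually_elim)
      case (elim \<omega>)
      then have "traj X 0 \<omega> = None" by simp
      then have "traj X (t - s) \<omega> = None" by (rule traj_absorb) simp
      then show ?case by (simp add: F_def)
    qed
    then show ?thesis using None by simp
  qed (simp add: F_def killed_op_def)
  have "killed_op X D t f x = (\<integral>\<^sup>+\<omega>. W \<omega> * F (shift s \<omega>) \<partial>start X x)"
    unfolding killed_op_def
  proof (rule nn_integral_cong)
    fix \<omega>
    show "ext0 f (traj X t \<omega>) * indicator {\<omega>. t < exit_time X D \<omega>} \<omega> = W \<omega> * F (shift s \<omega>)"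
    proof (cases "s < exit_time X D \<omega>")
      case True
      have "t < exit_time X D \<omega> \<longleftrightarrow> t - s < exit_time X D (shift s \<omega>)"
        unfolding exit_time_shift[OF True] using st sfin
        by (metis add_diff_inverse_ennreal ennreal_add_left_cancel_less top.not_eq_extremum infinity_ennreal_def)
      moreover have "t - s + s = t" using st by (simp add: diff_add_cancel_ennreal)
      ultimately show ?thesis using True by (auto simp: W_def F_def indicator_def)
    next
      case False
      then have "\<not> t < exit_time X D \<omega>" using st by auto
      with False show ?thesis by (simp add: W_def)
    qed
  qed
  also have "\<dots> = (\<integral>\<^sup>+\<omega>. W \<omega> * ext0 (killed_op X D (t - s) f) (traj X s \<omega>) \<partial>start X x)"
    using strong_markov(1)[OF stopping_time_const W F, of "Some x"] by (simp add: FD)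
  finally show ?thesis by (simp add: W_def mult.commute)
qed

lemma killed_op_cong:
  assumes "0 < t" "\<And>x. x \<in> D \<Longrightarrow> f x = g x"
  shows "killed_op X D t f x = killed_op X D t g x"
  unfolding killed_op_def
proof (rule nn_integral_cong)
  fix \<omega>
  show "ext0 f (traj X t \<omega>) * indicator {\<omega>. t < exit_time X D \<omega>} \<omega> =
      ext0 g (traj X t \<omega>) * indicator {\<omega>. t < exit_time X D \<omega>} \<omega>"
    using traj_before_exit[OF assms(1), of D \<omega>] assms(2) by (cases "t < exit_time X D \<omega>") auto
qed

lemma exit_right_prob:
  assumes N: "open N" "x \<in> N"
    and t: "\<And>n. t n > 0" "t \<longlonglongrightarrow> (0::ennreal)"
  shows "(\<lambda>n. emeasure (start X x) {\<omega>. t n < exit_time X N \<omega>}) \<longlonglongrightarrow> 1"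
proof -
  interpret prob_space "start X x" by (rule prob_space_prob_at)
  note [measurable] = exit_prob_at[OF N(1), of "Some x"]
  have mm: "{\<omega>. t n < exit_time X N \<omega>} \<in> sets (start X x)" for n
  proof -
    have "{\<omega> \<in> space (start X x). t n < exit_time X N \<omega>} \<in> sets (start X x)" by measurable
    then show ?thesis by simp
  qed
  have "(\<lambda>n. \<integral>\<^sup>+\<omega>. indicator {\<omega>. t n < exit_time X N \<omega>} \<omega> \<partial>start X x) \<longlonglongrightarrow> (\<integral>\<^sup>+\<omega>. 1 \<partial>start X x)"
  proof (rule nn_integral_dominated_convergence[where w="\<lambda>_. 1"])
    show "AE \<omega> in start X x. (\<lambda>n. indicator {\<omega>. t n < exit_time X N \<omega>} \<omega>) \<longlonglongrightarrow> (1::ennreal)"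
      using AE_start[of x]
    proof eventually_elim
      case (elim \<omega>)
      then have "0 < exit_time X N \<omega>" using N by (intro exit_time_pos) auto
      from order_tendstoD(2)[OF t(2) this]
      have "\<forall>\<^sub>F n in sequentially. indicator {\<omega>. t n < exit_time X N \<omega>} \<omega> = (1::ennreal)"
        by eventually_elim simp
      then show ?case by (rule tendsto_eventually)
    qed
  qed (use mm in \<open>auto simp: indicator_def emeasure_space_1 intro!: borel_measurable_indicator\<close>)
  moreover have "(\<integral>\<^sup>+\<omega>. indicator {\<omega>. t n < exit_time X N \<omega>} \<omega> \<partial>start X x) = emeasure (start X x) {\<omega>. t n < exit_time X N \<omega>}" for n
    using mm by simp
  ultimately show ?thesis using emeasure_space_1 by simp
qed

end

section \<open>Lower semicontinuity and comparison of excessive functions\<close>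

context jump_hunt
begin

text \<open>Suppose the exit happens by time \<open>s\<close>. From the exit position, outside
  \<open>D\<close>, the integral of \<open>1 - \<phi>\<close> over the next \<open>s\<close> units
  of time has mean at least \<open>s * (1 - d)\<close>. From a point of \<open>K\<close>, however,
  its integral over \<open>[0, 2 * s]\<close> has mean at most \<open>2 * s * d\<close>, uniformly
  by the Feller property.\<close>

lemma exit_prob_small:
  assumes D: "open D" and K: "compact K" "K \<subseteq> D" and e: "0 < (e::real)" and b: "0 < (b::real)"
  obtains s where "0 < s" "s < b"
    "\<And>x. x \<in> K \<Longrightarrow> emeasure (start X x) {\<omega>. exit_time X D \<omega> \<le> ennreal s} \<le> ennreal e"
proof -
  obtain \<phi> :: "'x \<Rightarrow> real" where \<phi>: "vanishing_continuous \<phi>" "\<And>x. 0 \<le> \<phi> x" "\<And>x. \<phi> x \<le> 1"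
    "\<And>x. x \<in> K \<Longrightarrow> \<phi> x = 1" "\<And>x. x \<notin> D \<Longrightarrow> \<phi> x = 0"
    using exists_vanishing_bump[OF D K] by blast
  then have \<phi>m[measurable]: "\<phi> \<in> borel_measurable borel"
    by (auto simp: vanishing_continuous_def intro: borel_measurable_continuous_onI)
  \<comment> \<open>Chosen so that \<open>2 * d = e * (1 - d)\<close>, which turns
    \<open>s * (1 - d)\<close> times the probability being at most \<open>2 * s * d\<close> into the
    bound \<open>e\<close>.\<close>
  define d where "d = e / (2 + e)"
  have d: "0 < d" "d < 1" using e by (auto simp: d_def field_simps)
  have de: "2 * d = e * (1 - d)" using e by (simp add: d_def field_simps)
  have "uniform_limit UNIV (\<lambda>t. semigroup_op X t \<phi>) \<phi> (at_right 0)"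
    using feller(1) \<phi>(1) by (auto simp: feller_def)
  from uniform_limitD[OF this d(1)]
  obtain b1 where b1: "0 < b1" "\<And>t x. 0 < t \<Longrightarrow> t < b1 \<Longrightarrow> \<bar>semigroup_op X t \<phi> x - \<phi> x\<bar> < d"
    by (auto simp: eventually_at_right[of 0 "\<top>::ennreal"] dist_real_def)
  have "0 < min b1 (ennreal b)" using b1 b by simp
  then obtain s2 where s2: "0 < s2" "s2 < min b1 (ennreal b)" using dense by blast
  then have "s2 < \<top>" by (meson less_le_trans top_greatest)
  then obtain r where r: "s2 = ennreal r" by (cases s2) auto
  then have rpos: "0 < r" using s2(1) by (simp add: ennreal_less_zero_iff)
  define s where "s = r / 2"
  have s: "0 < s" "s < b" using rpos s2 r b by (auto simp: s_def ennreal_less_iff)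
  have ub: "\<And>u. 0 < u \<Longrightarrow> u \<le> 2 * s \<Longrightarrow> ennreal u < b1"
    using s2(2) r by (auto simp: s_def intro: le_less_trans[OF ennreal_leI])
  define \<psi> where "\<psi> z = ennreal (1 - ext0 \<phi> z)" for z
  have \<psi>m[measurable]: "\<psi> \<in> borel_measurable cem_borel" unfolding \<psi>_def by measurable
  have mean: "(\<integral>\<^sup>+\<omega>. \<psi> (traj X (ennreal u) \<omega>) \<partial>start X y) = ennreal (1 - semigroup_op X (ennreal u) \<phi> y)" for u y
  proof -
    interpret prob_space "start X y" by (rule prob_space_prob_at)
    have [measurable]: "(\<lambda>\<omega>. ext0 \<phi> (traj X (ennreal u) \<omega>)) \<in> borel_measurable (start X y)"
      by (rule measurable_prob_at) measurable
    have bd: "0 \<le> ext0 \<phi> z \<and> ext0 \<phi> z \<le> 1" for z using \<phi>(2,3) by (cases z) auto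
    have int: "integrable (start X y) (\<lambda>\<omega>. ext0 \<phi> (traj X (ennreal u) \<omega>))"
      using bd by (intro integrable_const_bound[of _ 1]) auto
    have "(\<integral>\<^sup>+\<omega>. \<psi> (traj X (ennreal u) \<omega>) \<partial>start X y) = ennreal (\<integral>\<omega>. 1 - ext0 \<phi> (traj X (ennreal u) \<omega>) \<partial>start X y)"
      unfolding \<psi>_def using int bd by (intro nn_integral_eq_integral) auto
    also have "(\<integral>\<omega>. 1 - ext0 \<phi> (traj X (ennreal u) \<omega>) \<partial>start X y) = 1 - semigroup_op X (ennreal u) \<phi> y"
      unfolding semigroup_op_def using int by (simp add: prob_space)
    finally show ?thesis .
  qed
  define B where "B c \<omega> = (\<integral>\<^sup>+u. \<psi> (traj X (ennreal u) \<omega>) * indicator {0..c} u \<partial>lborel)" for c :: real and \<omega>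
  have Bm2: "(\<lambda>(\<omega>, u). \<psi> (traj X (ennreal u) \<omega>) * indicator {0..c} u) \<in> borel_measurable (aug \<top> \<Otimes>\<^sub>M lborel)" for c :: real
  proof -
    have "(\<lambda>z. \<psi> (traj X (ennreal (snd z)) (fst z))) \<in> borel_measurable (aug \<top> \<Otimes>\<^sub>M lborel)"
      using measurable_compose[OF traj_joint_aug \<psi>m] by (simp add: split_beta)
    then show ?thesis unfolding split_beta by measurable
  qed
  then have Bm: "B c \<in> borel_measurable (aug \<top>)" for c
    unfolding B_def[abs_def] by (rule lborel.borel_measurable_nn_integral)
  have EB: "(\<integral>\<^sup>+\<omega>. B c \<omega> \<partial>start X y) = (\<integral>\<^sup>+u. (\<integral>\<^sup>+\<omega>. \<psi> (traj X (ennreal u) \<omega>) \<partial>start X y) * indicator {0..c} u \<partial>lborel)" for c y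
  proof -
    interpret prob_space "start X y" by (rule prob_space_prob_at)
    interpret pair_sigma_finite "start X y" lborel ..
    have "aug \<top> \<Otimes>\<^sub>M (lborel :: real measure) \<rightarrow>\<^sub>M borel \<subseteq> start X y \<Otimes>\<^sub>M lborel \<rightarrow>\<^sub>M (borel :: ennreal measure)"
    proof
      fix f :: "'w \<times> real \<Rightarrow> ennreal" assume f: "f \<in> aug \<top> \<Otimes>\<^sub>M lborel \<rightarrow>\<^sub>M borel"
      have "(\<lambda>z. (fst z, snd z)) \<in> start X y \<Otimes>\<^sub>M lborel \<rightarrow>\<^sub>M aug \<top> \<Otimes>\<^sub>M lborel"
        by (intro measurable_Pair measurable_compose[OF measurable_fst id_prob_at_aug] measurable_snd)
      from measurable_compose[OF this f] show "f \<in> start X y \<Otimes>\<^sub>M lborel \<rightarrow>\<^sub>M borel" by simp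
    qed
    then have m: "(\<lambda>(\<omega>, u). \<psi> (traj X (ennreal u) \<omega>) * indicator {0..c} u) \<in> borel_measurable (start X y \<Otimes>\<^sub>M lborel)"
      using Bm2[of c] by blast
    have "(\<integral>\<^sup>+\<omega>. B c \<omega> \<partial>start X y) = (\<integral>\<^sup>+u. (\<integral>\<^sup>+\<omega>. \<psi> (traj X (ennreal u) \<omega>) * indicator {0..c} u \<partial>start X y) \<partial>lborel)"
      unfolding B_def using Fubini'[OF m] by simp
    also have "\<dots> = (\<integral>\<^sup>+u. (\<integral>\<^sup>+\<omega>. \<psi> (traj X (ennreal u) \<omega>) \<partial>start X y) * indicator {0..c} u \<partial>lborel)"
      by (intro nn_integral_cong nn_integral_multc measurable_prob_at[OF measurable_compose[OF traj_raw_top \<psi>m]])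
    finally show ?thesis .
  qed
  have EB_D: "ennreal (s * (1 - d)) \<le> (\<integral>\<^sup>+\<omega>. B s \<omega> \<partial>prob_at X z)" if "z \<notin> Some ` D" for z
  proof (cases z)
    case None
    interpret prob_space "prob_at X None" by (rule prob_space_prob_at)
    have "ennreal (s * (1 - d)) \<le> ennreal s" using s d by (intro ennreal_leI) (auto simp: mult_le_cancel_left2)
    also have "\<dots> = (\<integral>\<^sup>+\<omega>. ennreal s \<partial>prob_at X None)" using emeasure_space_1 by simp
    also have "\<dots> = (\<integral>\<^sup>+\<omega>. B s \<omega> \<partial>prob_at X None)"
      using traj_0[of None]
    proof (intro nn_integral_cong_AE, eventually_elim)
      case (elim \<omega>)
      then have "traj X u \<omega> = None" for u using traj_absorb[of 0 \<omega> u] by simp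
      then have "B s \<omega> = (\<integral>\<^sup>+u. indicator {0..s} u \<partial>lborel)" by (simp add: B_def \<psi>_def)
      then show ?case using s by simp
    qed
    finally show ?thesis using None by simp
  next
    case (Some y)
    then have "y \<notin> D" using that by auto
    then have lower: "ennreal (1 - d) \<le> ennreal (1 - semigroup_op X (ennreal u) \<phi> y)" if "0 < u" "u \<le> 2 * s" for u
      using b1(2)[of "ennreal u" y] ub[OF that] that \<phi>(5)[of y] by (intro ennreal_leI) auto
    have "ennreal (s * (1 - d)) = (\<integral>\<^sup>+u. ennreal (1 - d) * indicator {0<..s} u \<partial>lborel)"
      using s d by (simp add: nn_integral_cmult_indicator mult.commute flip: ennreal_mult)
    also have "\<dots> \<le> (\<integral>\<^sup>+\<omega>. B s \<omega> \<partial>start X y)"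
      unfolding EB mean using lower s by (intro nn_integral_mono) (auto simp: indicator_def)
    finally show ?thesis using Some by simp
  qed
  have "emeasure (start X x) {\<omega>. exit_time X D \<omega> \<le> ennreal s} \<le> ennreal e" if x: "x \<in> K" for x
  proof -
    note [measurable] = exit_prob_at[OF D, of "Some x"]
    define L where "L = {\<omega>. exit_time X D \<omega> \<le> ennreal s}"
    have "{\<omega> \<in> space (start X x). exit_time X D \<omega> \<le> ennreal s} \<in> sets (start X x)" by measurable
    then have Lm[measurable]: "L \<in> sets (start X x)" by (simp add: L_def)
    define W where "W = (indicator L :: 'w \<Rightarrow> ennreal)"
    have Wm: "W \<in> borel_measurable (stopped_sigma X (exit_time X D))"
    proof -
      have "{\<omega> \<in> space (stopped_sigma X (exit_time X D)). exit_time X D \<omega> \<le> ennreal s} \<in> sets (stopped_sigma X (exit_time X D))"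
        using filt.measurable_stopping_time_pre_sigma[OF stopping_exit[OF D]]
        unfolding stopped_sigma_eq by measurable
      then show ?thesis
        unfolding W_def L_def by (intro borel_measurable_indicator) (simp add: stopped_sigma_eq filt.space_pre_sigma)
    qed
    have "ennreal (s * (1 - d)) * emeasure (start X x) L = (\<integral>\<^sup>+\<omega>. ennreal (s * (1 - d)) * indicator L \<omega> \<partial>start X x)"
      by (simp add: nn_integral_cmult_indicator)
    also have "\<dots> = (\<integral>\<^sup>+\<omega>. W \<omega> * ennreal (s * (1 - d)) \<partial>start X x)"
      unfolding W_def by (simp only: mult.commute)
    also have "\<dots> \<le> (\<integral>\<^sup>+\<omega>. W \<omega> * (\<integral>\<^sup>+\<omega>'. B s \<omega>' \<partial>prob_at X (traj X (exit_time X D \<omega>) \<omega>)) \<partial>start X x)"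
      by (intro nn_integral_mono mult_left_mono EB_D traj_exit_notin[OF D]) simp
    also have "\<dots> = (\<integral>\<^sup>+\<omega>. W \<omega> * B s (shift (exit_time X D \<omega>) \<omega>) \<partial>start X x)"
      by (rule strong_markov(1)[symmetric, OF stopping_exit[OF D] Wm Bm])
    also have "\<dots> \<le> (\<integral>\<^sup>+\<omega>. B (2 * s) \<omega> \<partial>start X x)"
    proof (rule nn_integral_mono)
      fix \<omega>
      show "W \<omega> * B s (shift (exit_time X D \<omega>) \<omega>) \<le> B (2 * s) \<omega>"
      \<comment> \<open>The window of length \<open>s\<close> that follows an exit before
        \<open>s\<close> is contained in \<open>[0, 2 * s]\<close>.\<close>
      proof (cases "exit_time X D \<omega> \<le> ennreal s")
        case True
        then have "exit_time X D \<omega> < \<top>" by (rule le_less_trans) simp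
        then obtain q where q: "exit_time X D \<omega> = ennreal q" "0 \<le> q" by (cases "exit_time X D \<omega>") auto
        then have "q \<le> s" using True s by (simp add: ennreal_le_iff)
        define g where "g t = \<psi> (traj X (ennreal t) \<omega>) * indicator {q..q + s} t" for t
        have [measurable]: "(\<lambda>t. \<psi> (traj X (ennreal t) \<omega>)) \<in> borel_measurable borel"
          by (rule measurable_compose[OF path_measurable \<psi>m])
        have gm: "g \<in> borel_measurable borel" unfolding g_def by measurable
        have "B s (shift (ennreal q) \<omega>) = (\<integral>\<^sup>+u. g (u + q) \<partial>lborel)"
          unfolding B_def g_def using q(2) by (intro nn_integral_cong) (auto simp: indicator_def ennreal_plus)
        also have "\<dots> = (\<integral>\<^sup>+u. g u \<partial>lborel)" by (rule nn_integral_real_shift[OF gm])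
        also have "\<dots> \<le> B (2 * s) \<omega>"
          unfolding B_def g_def using q(2) \<open>q \<le> s\<close> by (intro nn_integral_mono) (auto simp: indicator_def)
        finally show ?thesis using True q by (simp add: W_def L_def)
      qed (simp add: W_def L_def)
    qed
    also have "\<dots> \<le> (\<integral>\<^sup>+u. ennreal d * indicator {0..2 * s} u \<partial>lborel)"
      unfolding EB mean
    proof (rule nn_integral_mono_AE)
      have "AE t in lborel. t \<noteq> (0::real)" by (rule AE_lborel_singleton)
      then show "AE u in lborel. ennreal (1 - semigroup_op X (ennreal u) \<phi> x) * indicator {0..2 * s} u \<le> ennreal d * indicator {0..2 * s} u"
      proof eventually_elim
        case (elim u)
        have "1 - semigroup_op X (ennreal u) \<phi> x \<le> d" if "0 \<le> u" "u \<le> 2 * s"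
          using b1(2)[of "ennreal u" x] ub[of u] that elim \<phi>(4)[OF x] by auto
        then show ?case by (auto simp: indicator_def intro!: ennreal_leI)
      qed
    qed
    also have "\<dots> = ennreal (s * (2 * d))"
      using s d by (simp add: nn_integral_cmult_indicator mult.commute mult.left_commute flip: ennreal_mult)
    also have "\<dots> = ennreal (s * (1 - d)) * ennreal e"
      using s d e de by (simp add: mult.assoc mult.commute flip: ennreal_mult)
    finally show ?thesis
      using s d unfolding L_def[symmetric] by (subst (asm) ennreal_mult_le_mult_iff) auto
  qed
  with s that show thesis by blast
qed

lemma ennreal_SUP_min_nat: "(SUP n. min a (of_nat n)) = (a::ennreal)"
proof (cases a)
  case top
  then show ?thesis by (simp add: ennreal_SUP_of_nat_eq_top)
next
  case (real r)
  obtain n where "r \<le> real n" using real_arch_simple by blast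
  then have "a \<le> of_nat n" unfolding real ennreal_of_nat_eq_real_of_nat by (rule ennreal_leI)
  then have "a \<le> (SUP n. min a (of_nat n))" by (intro SUP_upper2[of n]) auto
  then show ?thesis by (intro antisym SUP_least) auto
qed

text \<open>\<open>u\<close> is approached from below by \<open>killed_op\<close> at a small time
  \<open>t\<close>, applied to a bounded truncation. Killing during the first \<open>s\<close> units
  of time is then ignored: what remains is the free semigroup at \<open>s\<close> applied to a
  bounded function, continuous by strong Feller, and the error is at most \<open>n\<close> times the
  probability of an exit by time \<open>s\<close>, small uniformly near \<open>x\<close>.\<close>

lemma excessive_lsc:
  assumes D: "open D" and u: "killed_excessive X D u" and x: "x \<in> D" and c: "c < u x"
  shows "\<forall>\<^sub>F y in nhds x. c < u y"
proof -
  define v where "v y = u y * indicator D y" for y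
  have v[measurable]: "v \<in> borel_measurable borel"
    using u D unfolding killed_excessive_def v_def
    by (subst (asm) borel_measurable_restrict_space_iff_ennreal) auto
  have vD: "v y = u y" if "y \<in> D" for y using that by (simp add: v_def)
  obtain c' where c': "c < c'" "c' < u x" using dense[OF c] by blast
  have "((\<lambda>t. killed_op X D t u x) \<longlongrightarrow> u x) (at_right 0)"
    using u x by (auto simp: killed_excessive_def)
  from order_tendstoD(1)[OF this c'(2)]
  obtain b where b: "0 < b" "\<And>t. 0 < t \<Longrightarrow> t < b \<Longrightarrow> c' < killed_op X D t u x"
    by (auto simp: eventually_at_right[of 0 "\<top>::ennreal"])
  obtain t where t: "0 < t" "t < b" using dense[OF b(1)] by blast
  have tfin: "t < \<top>" using t by (meson less_le_trans top_greatest)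
  have "c' < killed_op X D t v x"
    using b(2)[OF t] killed_op_cong[OF t(1), of D v u x] vD by simp
  also have "killed_op X D t v x = (SUP n. killed_op X D t (\<lambda>y. min (v y) (of_nat n)) x)"
  proof -
    have "ext0 v z = (SUP n. ext0 (\<lambda>y. min (v y) (of_nat n)) z)" for z
      by (cases z) (simp_all add: ennreal_SUP_min_nat)
    then have "killed_op X D t v x = (\<integral>\<^sup>+\<omega>. (SUP n. ext0 (\<lambda>y. min (v y) (of_nat n)) (traj X t \<omega>) *
        indicator {\<omega>. t < exit_time X D \<omega>} \<omega>) \<partial>start X x)"
      unfolding killed_op_def by (simp add: SUP_mult_right_ennreal)
    also have "\<dots> = (SUP n. killed_op X D t (\<lambda>y. min (v y) (of_nat n)) x)"
      unfolding killed_op_def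
    proof (rule nn_integral_monotone_convergence_SUP)
      have "min a (of_nat i) \<le> min a (of_nat k)" if "i \<le> k" for i k and a :: ennreal
        using that by (intro min.mono) auto
      then show "incseq (\<lambda>n \<omega>. ext0 (\<lambda>y. min (v y) (of_nat n)) (traj X t \<omega>) * indicator {\<omega>. t < exit_time X D \<omega>} \<omega>)"
        by (auto simp: incseq_def le_fun_def split: option.splits intro!: mult_right_mono)
      show "(\<lambda>\<omega>. ext0 (\<lambda>y. min (v y) (of_nat n)) (traj X t \<omega>) * indicator {\<omega>. t < exit_time X D \<omega>} \<omega>) \<in> borel_measurable (start X x)" for n
        by (rule measurable_aug_prob_at[OF killed_integrand_measurable[OF D]]) measurable
    qed
    finally show ?thesis .
  qed
  finally obtain n where n: "c' < killed_op X D t (\<lambda>y. min (v y) (of_nat n)) x"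
    by (auto simp: less_SUP_iff)
  define w where "w y = min (v y) (of_nat n)" for y
  have wm: "w \<in> borel_measurable borel" unfolding w_def by measurable
  have c'fin: "c' < \<top>" using c' by (meson less_le_trans top_greatest)
  have dpos: "0 < c' - c" using c' by (simp add: diff_gr0_ennreal)
  \<comment> \<open>The error allowance: \<open>n * e\<close> may not exceed the gap
    \<open>c' - c\<close>. Division by \<open>Suc n\<close> covers \<open>n = 0\<close>.\<close>
  obtain e where e: "0 < e" "of_nat n * ennreal e \<le> c' - c"
  proof -
    have "c' - c \<le> c'" by (rule diff_le_self_ennreal)
    then have "c' - c < \<top>" using c'fin by (rule le_less_trans)
    then obtain d where d: "c' - c = ennreal d" "0 \<le> d" by (cases "c' - c") auto
    then have "0 < d" using dpos by simp
    then have "of_nat n * ennreal (d / real (Suc n)) \<le> c' - c"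
      unfolding d ennreal_of_nat_eq_real_of_nat
      by (subst ennreal_mult[symmetric]) (auto intro!: ennreal_leI simp: field_simps simp del: of_nat_Suc)
    then show thesis using \<open>0 < d\<close> by (intro that[of "d / real (Suc n)"]) auto
  qed
  obtain \<epsilon> where \<epsilon>: "0 < \<epsilon>" "cball x \<epsilon> \<subseteq> D" using D x open_contains_cball by blast
  have K: "compact (cball x \<epsilon>)" by (simp add: compact_eq_bounded_closed)
  obtain r where r: "t = ennreal r" "0 < r" using t tfin by (cases t) (auto simp: ennreal_less_zero_iff)
  obtain s where s: "0 < s" "s < r"
    "\<And>y. y \<in> cball x \<epsilon> \<Longrightarrow> emeasure (start X y) {\<omega>. exit_time X D \<omega> \<le> ennreal s} \<le> ennreal e"
    using exit_prob_small[OF D K \<epsilon>(2) e(1) r(2)] by blast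
  \<comment> \<open>The part of the killed semigroup after time \<open>s\<close>. It is bounded by
    \<open>n\<close> but merely Borel; the free step of length \<open>s\<close> makes it
    continuous.\<close>
  define q where "q = killed_op X D (t - ennreal s) w"
  have qm[measurable]: "q \<in> borel_measurable borel" unfolding q_def by (rule killed_op_measurable[OF D wm])
  have qle: "q y \<le> of_nat n" for y
  proof -
    interpret prob_space "start X y" by (rule prob_space_prob_at)
    have "q y \<le> (\<integral>\<^sup>+\<omega>. of_nat n \<partial>start X y)"
      unfolding q_def killed_op_def w_def by (intro nn_integral_mono) (auto simp: indicator_def split: option.splits)
    then show ?thesis using emeasure_space_1 by simp
  qed
  have split: "killed_op X D t w y = (\<integral>\<^sup>+\<omega>\<in>{\<omega>. ennreal s < exit_time X D \<omega>}. ext0 q (traj X (ennreal s) \<omega>) \<partial>start X y)" for y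
    unfolding q_def using s r tfin by (intro killed_op_split[OF D wm]) (auto intro!: ennreal_leI)
  define P where "P y = (\<integral>\<^sup>+\<omega>. ext0 q (traj X (ennreal s) \<omega>) \<partial>start X y)" for y
  define q' where "q' y = enn2real (q y)" for y
  have q'm[measurable]: "q' \<in> borel_measurable borel" unfolding q'_def by measurable
  have qq': "q y = ennreal (q' y)" for y
    using le_less_trans[OF qle[of y] of_nat_less_top] unfolding q'_def by (intro ennreal_enn2real[symmetric]) auto
  have q'bd: "0 \<le> q' y" "q' y \<le> real n" for y
  proof -
    show "0 \<le> q' y" by (simp add: q'_def)
    show "q' y \<le> real n"
      unfolding q'_def using qle[of y] by (intro enn2real_leI) (simp_all add: ennreal_of_nat_eq_real_of_nat)
  qed
  have PP: "P y = ennreal (semigroup_op X (ennreal s) q' y)" for y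
  proof -
    interpret prob_space "start X y" by (rule prob_space_prob_at)
    have [measurable]: "(\<lambda>\<omega>. ext0 q' (traj X (ennreal s) \<omega>)) \<in> borel_measurable (start X y)"
      by (rule measurable_prob_at) measurable
    have bd: "0 \<le> ext0 q' z \<and> ext0 q' z \<le> real n" for z using q'bd by (cases z) auto
    have "P y = (\<integral>\<^sup>+\<omega>. ennreal (ext0 q' (traj X (ennreal s) \<omega>)) \<partial>start X y)"
      unfolding P_def by (intro nn_integral_cong) (auto simp: qq' split: option.splits)
    also have "\<dots> = ennreal (semigroup_op X (ennreal s) q' y)"
      unfolding semigroup_op_def using bd
      by (intro nn_integral_eq_integral integrable_const_bound[of _ "real n"]) auto
    finally show ?thesis .
  qed
  have "continuous_on UNIV (semigroup_op X (ennreal s) q')"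
  proof -
    have "bounded (range q')"
      unfolding bounded_iff using q'bd by (auto intro!: exI[of _ "real n"])
    then show ?thesis
      using feller(2) s(1) unfolding strong_feller_def by (simp add: q'm)
  qed
  then have "isCont (semigroup_op X (ennreal s) q') x"
    by (simp add: continuous_on_eq_continuous_at)
  then have "((\<lambda>y. P y) \<longlongrightarrow> P x) (nhds x)"
    unfolding PP by (intro tendsto_ennrealI) (simp add: isCont_def tendsto_nhds_iff)
  moreover have "c' < P x"
  proof -
    have "killed_op X D t w x \<le> P x"
      unfolding split P_def by (intro nn_integral_mono) (auto simp: indicator_def)
    then show ?thesis using n unfolding w_def by (rule less_le_trans[rotated])
  qed
  ultimately have "\<forall>\<^sub>F y in nhds x. c' < P y" by (rule order_tendstoD(1))
  moreover have "\<forall>\<^sub>F y in nhds x. y \<in> ball x \<epsilon>"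
    using \<epsilon>(1) by (intro eventually_nhds_in_open) auto
  ultimately show ?thesis
  proof eventually_elim
    case (elim y)
    then have yK: "y \<in> cball x \<epsilon>" and yD: "y \<in> D" using \<epsilon> by auto
    note [measurable] = exit_prob_at[OF D, of "Some y"]
    have [measurable]: "(\<lambda>\<omega>. ext0 q (traj X (ennreal s) \<omega>)) \<in> borel_measurable (start X y)"
      by (rule measurable_prob_at) measurable
    have "P y \<le> (\<integral>\<^sup>+\<omega>. ext0 q (traj X (ennreal s) \<omega>) * indicator {\<omega>. ennreal s < exit_time X D \<omega>} \<omega>
         + of_nat n * indicator {\<omega>. exit_time X D \<omega> \<le> ennreal s} \<omega> \<partial>start X y)"
      unfolding P_def by (intro nn_integral_mono) (auto simp: indicator_def qle not_less split: option.splits)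
    also have "\<dots> = killed_op X D t w y + of_nat n * emeasure (start X y) {\<omega>. exit_time X D \<omega> \<le> ennreal s}"
    proof -
      have "{\<omega>\<in>space (start X y). exit_time X D \<omega> \<le> ennreal s} \<in> sets (start X y)" by measurable
      then have [measurable]: "{\<omega>. exit_time X D \<omega> \<le> ennreal s} \<in> sets (start X y)" by simp
      have "{\<omega>\<in>space (start X y). ennreal s < exit_time X D \<omega>} \<in> sets (start X y)" by measurable
      then have [measurable]: "{\<omega>. ennreal s < exit_time X D \<omega>} \<in> sets (start X y)" by simp
      show ?thesis unfolding split by (simp add: nn_integral_add nn_integral_cmult_indicator)
    qed
    also have "\<dots> \<le> u y + of_nat n * ennreal e"
    proof (intro add_mono mult_left_mono s(3) yK)
      have "killed_op X D t w y \<le> killed_op X D t v y"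
        unfolding killed_op_def w_def by (intro nn_integral_mono mult_right_mono) (auto split: option.splits)
      also have "\<dots> = killed_op X D t u y" by (rule killed_op_cong[OF t(1) vD])
      also have "\<dots> \<le> u y" using u yD by (auto simp: killed_excessive_def)
      finally show "killed_op X D t w y \<le> u y" .
    qed simp
    also have "\<dots> \<le> u y + (c' - c)" using e by (intro add_left_mono)
    finally have "c' < u y + (c' - c)" using elim by (metis less_le_trans)
    then show "c < u y"
      using c' c'fin by (cases "u y"; cases c'; cases c) (auto simp: ennreal_minus ennreal_less_iff simp flip: ennreal_plus)
  qed
qed

text \<open>The resolvent does not charge \<open>A\<close>, so by Fubini neither does the law of the
  position at almost every time.\<close>

lemma AE_time_null:
  assumes "A \<in> null_sets m"
  shows "AE t in lborel. 0 < t \<longrightarrow> emeasure (start X x) {\<omega>. traj X (ennreal t) \<omega> \<in> Some ` A} = 0"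
proof -
  have Am[measurable]: "A \<in> sets borel" using assms sets_m by auto
  interpret prob_space "start X x" by (rule prob_space_prob_at)
  interpret pair_sigma_finite lborel "start X x" ..
  have "Some ` A \<in> sets cem_borel" using Am by (rule sets_cem_Some)
  then have Sm: "{\<omega>. traj X s \<omega> \<in> Some ` A} \<in> sets (start X x)" for s
    by (intro raw_prob_at traj_in_raw)
  have "resolvent X 1 (indicator A) x = 0"
    using abs_cont assms unfolding resolvent_abs_cont_def by auto
  define g where "g t \<omega> = ennreal (exp (- 1 * t)) * ext0 (indicator A) (traj X (ennreal t) \<omega>) * indicator {0..} t" for t \<omega>
  have "(\<lambda>z. (snd z, fst z)) \<in> lborel \<Otimes>\<^sub>M start X x \<rightarrow>\<^sub>M aug \<top> \<Otimes>\<^sub>M lborel"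
    by (intro measurable_Pair measurable_compose[OF measurable_snd id_prob_at_aug] measurable_fst)
  from measurable_compose[OF this measurable_compose[OF traj_joint_aug measurable_ext0[OF borel_measurable_indicator[OF Am]]]]
  have [measurable]: "(\<lambda>z. ext0 (indicator A) (traj X (ennreal (fst z)) (snd z)) :: ennreal) \<in> borel_measurable (lborel \<Otimes>\<^sub>M start X x)"
    by (simp add: split_beta)
  have gm: "(\<lambda>(t, \<omega>). g t \<omega>) \<in> borel_measurable (lborel \<Otimes>\<^sub>M start X x)"
    unfolding g_def split_beta by measurable
  have "0 = (\<integral>\<^sup>+\<omega>. \<integral>\<^sup>+t. g t \<omega> \<partial>lborel \<partial>start X x)"
    using \<open>resolvent X 1 (indicator A) x = 0\<close> unfolding resolvent_def g_def by simp
  also have "\<dots> = (\<integral>\<^sup>+t. \<integral>\<^sup>+\<omega>. g t \<omega> \<partial>start X x \<partial>lborel)"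
    using Fubini[OF gm] by simp
  finally have "AE t in lborel. (\<integral>\<^sup>+\<omega>. g t \<omega> \<partial>start X x) = 0"
    using nn_integral_0_iff_AE[of "\<lambda>t. \<integral>\<^sup>+\<omega>. g t \<omega> \<partial>start X x" lborel] sigma_finite_measure.borel_measurable_nn_integral_fst[OF prob_space_imp_sigma_finite[OF prob_space_prob_at] gm]
    by simp
  then show ?thesis
  proof eventually_elim
    case (elim t)
    show ?case
    proof
      assume "0 < t"
      have "(\<integral>\<^sup>+\<omega>. g t \<omega> \<partial>start X x) = (\<integral>\<^sup>+\<omega>. ennreal (exp (- t)) * indicator {\<omega>. traj X (ennreal t) \<omega> \<in> Some ` A} \<omega> \<partial>start X x)"
        unfolding g_def using \<open>0 < t\<close> by (intro nn_integral_cong) (auto simp: indicator_def split: option.splits)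
      also have "\<dots> = ennreal (exp (- t)) * emeasure (start X x) {\<omega>. traj X (ennreal t) \<omega> \<in> Some ` A}"
        using Sm by (simp add: nn_integral_cmult_indicator)
      finally show "emeasure (start X x) {\<omega>. traj X (ennreal t) \<omega> \<in> Some ` A} = 0"
        using elim by simp
    qed
  qed
qed

text \<open>For \<open>c < k y\<close> lower semicontinuity gives a neighbourhood \<open>N\<close>
  with \<open>k > c\<close>. At a small time at which the process does not charge the exceptional
  set, \<open>p\<close> is at least \<open>c\<close> along the paths still in \<open>N\<close>; so
  \<open>p y\<close> is at least \<open>c\<close> times the probability of these paths, which tends
  to \<open>1\<close>.\<close>

lemma excessive_comparison:
  assumes V: "open V" "V \<subseteq> D" "y \<in> V" and D: "open D"
    and k[measurable]: "k \<in> borel_measurable borel" and p[measurable]: "p \<in> borel_measurable borel"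
    and lsc: "\<And>c. c < k y \<Longrightarrow> \<forall>\<^sub>F z in nhds y. c < k z"
    and ae: "AE z in m. z \<in> V \<longrightarrow> k z \<le> p z"
    and super: "\<And>t. killed_op X D t p y \<le> p y"
  shows "k y \<le> p y"
proof (rule dense_le)
  fix c assume "c < k y"
  from lsc[OF this] obtain N0 where N0: "open N0" "y \<in> N0" "\<And>z. z \<in> N0 \<Longrightarrow> c < k z"
    by (auto simp: eventually_nhds)
  define N where "N = N0 \<inter> V"
  have N: "open N" "y \<in> N" "N \<subseteq> V" "\<And>z. z \<in> N \<Longrightarrow> c < k z" using N0 V by (auto simp: N_def)
  define A where "A = {z \<in> space m. z \<in> V \<and> \<not> k z \<le> p z}"
  have spm: "space m = UNIV" using sets_eq_imp_space_eq[OF sets_m] by simp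
  have [measurable]: "V \<in> sets borel" using V(1) by simp
  have "{z \<in> space borel. z \<in> V \<and> \<not> k z \<le> p z} \<in> sets borel" by measurable
  then have "A \<in> sets m" unfolding sets_m A_def spm by simp
  then have A0: "A \<in> null_sets m" using ae by (subst (asm) AE_iff_null) (auto simp: A_def)
  \<comment> \<open>The bad times form a Lebesgue null set, so good ones exist arbitrarily close to
    \<open>0\<close>.\<close>
  have "\<exists>t. 0 < t \<and> t < 1 / real (Suc n) \<and> emeasure (start X y) {\<omega>. traj X (ennreal t) \<omega> \<in> Some ` A} = 0" for n
  proof (rule ccontr)
    assume *: "\<not> ?thesis"
    have "AE t in lborel. t \<notin> {0<..<1 / real (Suc n)}"
      using AE_time_null[OF A0, of y] by eventually_elim (use * in auto)
    then have "{0<..<1 / real (Suc n)} \<in> null_sets lborel"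
      by (simp add: AE_iff_null_sets)
    then show False by (simp add: null_sets_def del: of_nat_Suc)
  qed
  then obtain t where t: "\<And>n. 0 < t n" "\<And>n. t n < 1 / real (Suc n)"
    "\<And>n. emeasure (start X y) {\<omega>. traj X (ennreal (t n)) \<omega> \<in> Some ` A} = 0" by metis
  have "t \<longlonglongrightarrow> 0"
    by (rule real_tendsto_sandwich[OF _ _ tendsto_const LIMSEQ_Suc[OF lim_1_over_n]])
       (use t in \<open>auto intro!: always_eventually less_imp_le simp del: of_nat_Suc\<close>)
  then have "(\<lambda>n. ennreal (t n)) \<longlonglongrightarrow> 0" using tendsto_ennrealI by fastforce
  from exit_right_prob[OF N(1,2) _ this] t(1)
  have lim: "(\<lambda>n. emeasure (start X y) {\<omega>. ennreal (t n) < exit_time X N \<omega>}) \<longlonglongrightarrow> 1" by simp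
  have "c * emeasure (start X y) {\<omega>. ennreal (t n) < exit_time X N \<omega>} \<le> p y" for n
  proof -
    note [measurable] = exit_prob_at[OF N(1), of "Some y"]
    have mm: "{\<omega>. ennreal (t n) < exit_time X N \<omega>} \<in> sets (start X y)"
    proof -
      have "{\<omega> \<in> space (start X y). ennreal (t n) < exit_time X N \<omega>} \<in> sets (start X y)" by measurable
      then show ?thesis by simp
    qed
    have "Some ` A \<in> sets cem_borel" using A0 sets_m by (intro sets_cem_Some) auto
    then have Sm: "{\<omega>. traj X (ennreal (t n)) \<omega> \<in> Some ` A} \<in> sets (start X y)"
      by (intro raw_prob_at traj_in_raw)
    then have ae: "AE \<omega> in start X y. traj X (ennreal (t n)) \<omega> \<notin> Some ` A"
      using t(3)[of n] by (subst AE_iff_measurable[OF Sm]) auto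
    have "c * emeasure (start X y) {\<omega>. ennreal (t n) < exit_time X N \<omega>} =
      (\<integral>\<^sup>+\<omega>. c * indicator {\<omega>. ennreal (t n) < exit_time X N \<omega>} \<omega> \<partial>start X y)"
      using mm by (simp add: nn_integral_cmult_indicator)
    also have "\<dots> \<le> killed_op X D (ennreal (t n)) p y"
      unfolding killed_op_def
    proof (rule nn_integral_mono_AE, use ae in eventually_elim)
      case (elim \<omega>)
      show ?case
      proof (cases "ennreal (t n) < exit_time X N \<omega>")
        case True
        then have "traj X (ennreal (t n)) \<omega> \<in> Some ` N" using t(1)[of n] by (intro traj_before_exit) auto
        then obtain z where z: "traj X (ennreal (t n)) \<omega> = Some z" "z \<in> N" by auto
        then have "z \<notin> A" using elim by auto
        then have "k z \<le> p z" using z N by (auto simp: A_def spm)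
        with N(4)[OF z(2)] have "c \<le> p z" by auto
        moreover have "ennreal (t n) < exit_time X D \<omega>"
          using True exit_time_mono[OF order_trans[OF N(3) V(2)], of \<omega>] by (rule less_le_trans)
        ultimately show ?thesis using z True by simp
      qed simp
    qed
    also have "\<dots> \<le> p y" by (rule super)
    finally show ?thesis .
  qed
  moreover have "(\<lambda>n. c * emeasure (start X y) {\<omega>. ennreal (t n) < exit_time X N \<omega>}) \<longlonglongrightarrow> c * 1"
    using lim less_le_trans[OF \<open>c < k y\<close> top_greatest] by (intro ennreal_tendsto_cmult) auto
  ultimately show "c \<le> p y"
    using LIMSEQ_le_const2[of _ "c * 1" "p y"] by auto
qed

end

section \<open>Exit distributions and the Levy system\<close>

text \<open>A measure on the state space itself: the mass at the cemetery is dropped, in accordance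
  with the convention that functions vanish there.\<close>

definition option_law :: "'w measure \<Rightarrow> ('w \<Rightarrow> 'x::topological_space option) \<Rightarrow> 'x measure" where
  "option_law M Z = distr (density M (indicator {\<omega>. Z \<omega> \<noteq> None})) borel (\<lambda>\<omega>. the (Z \<omega>))"

lemma sets_option_law [simp, measurable_cong]: "sets (option_law M Z) = sets borel"
  by (simp add: option_law_def)

lemma space_option_law [simp]: "space (option_law M Z) = UNIV"
  by (simp add: option_law_def)

lemma measurable_the [measurable]: "the \<in> cem_borel \<rightarrow>\<^sub>M borel"
proof (rule measurableI)
  fix A :: "'a set" assume A: "A \<in> sets borel"
  have "the -` A \<inter> space cem_borel = Some ` A \<union> (if the None \<in> A then {None} else {})"
  proof (rule set_eqI)
    show "z \<in> the -` A \<inter> space cem_borel \<longleftrightarrow> z \<in> Some ` A \<union> (if the None \<in> A then {None} else {})" for z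
      by (cases z) auto
  qed
  moreover have "Some ` A \<in> sets cem_borel" using A by (rule sets_cem_Some)
  moreover have "(if the None \<in> A then {None} else {} :: 'a option set) \<in> sets cem_borel"
    using sets_cem_None by auto
  ultimately show "the -` A \<inter> space cem_borel \<in> sets cem_borel" by (simp only: sets.Un)
qed auto

lemma option_law_ind_measurable:
  assumes "space M = UNIV" and Z: "Z \<in> M \<rightarrow>\<^sub>M cem_borel"
  shows "{\<omega>. Z \<omega> \<noteq> None} \<in> sets M"
proof -
  have "{\<omega>. Z \<omega> \<noteq> None} = space M - Z -` {None} \<inter> space M" using assms(1) by auto
  then show ?thesis using measurable_sets[OF Z sets_cem_None] by auto
qed

lemma nn_integral_option_law:
  assumes sp: "space M = UNIV" and Z: "Z \<in> M \<rightarrow>\<^sub>M cem_borel" and f: "f \<in> borel_measurable borel"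
  shows "(\<integral>\<^sup>+v. f v \<partial>option_law M Z) = (\<integral>\<^sup>+\<omega>. ext0 f (Z \<omega>) \<partial>M)"
proof -
  note option_law_ind_measurable[OF sp Z, measurable]
  have m1: "(\<lambda>\<omega>. the (Z \<omega>)) \<in> M \<rightarrow>\<^sub>M borel" by (rule measurable_compose[OF Z measurable_the])
  then have m2: "(\<lambda>\<omega>. the (Z \<omega>)) \<in> density M (indicator {\<omega>. Z \<omega> \<noteq> None}) \<rightarrow>\<^sub>M borel" by simp
  have m3: "(\<lambda>\<omega>. f (the (Z \<omega>))) \<in> borel_measurable M" by (rule measurable_compose[OF m1 f])
  have "(\<integral>\<^sup>+v. f v \<partial>option_law M Z) = (\<integral>\<^sup>+\<omega>. f (the (Z \<omega>)) \<partial>density M (indicator {\<omega>. Z \<omega> \<noteq> None}))"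
    unfolding option_law_def by (subst nn_integral_distr[OF m2]) (use f in simp_all)
  also have "\<dots> = (\<integral>\<^sup>+\<omega>. indicator {\<omega>. Z \<omega> \<noteq> None} \<omega> * f (the (Z \<omega>)) \<partial>M)"
    by (rule nn_integral_density[OF borel_measurable_indicator[OF option_law_ind_measurable[OF sp Z]] m3])
  also have "\<dots> = (\<integral>\<^sup>+\<omega>. ext0 f (Z \<omega>) \<partial>M)"
    by (intro nn_integral_cong) (auto split: option.splits)
  finally show ?thesis .
qed

lemma emeasure_option_law_le:
  assumes sp: "space M = UNIV" and Z: "Z \<in> M \<rightarrow>\<^sub>M cem_borel"
  shows "emeasure (option_law M Z) UNIV \<le> emeasure M UNIV"
proof -
  have "emeasure (option_law M Z) UNIV = (\<integral>\<^sup>+v. 1 \<partial>option_law M Z)" by simp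
  also have "\<dots> = (\<integral>\<^sup>+\<omega>. ext0 (\<lambda>_. 1) (Z \<omega>) \<partial>M)" by (rule nn_integral_option_law[OF sp Z]) simp
  also have "\<dots> \<le> (\<integral>\<^sup>+\<omega>. 1 \<partial>M)" by (intro nn_integral_mono) (auto split: option.splits)
  finally show ?thesis using sp by simp
qed

lemma emeasure_lborel_half_line: "emeasure lborel {0::real..} = \<top>"
proof -
  have "of_nat n \<le> emeasure lborel {0::real..}" for n
  proof -
    have "of_nat n = emeasure lborel {0..real n}" by (simp add: ennreal_of_nat_eq_real_of_nat)
    also have "\<dots> \<le> emeasure lborel {0::real..}" by (intro emeasure_mono) auto
    finally show ?thesis .
  qed
  then have "(SUP n. of_nat n) \<le> emeasure lborel {0::real..}" by (rule SUP_least)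
  then show ?thesis by (simp add: ennreal_SUP_of_nat_eq_top top_unique)
qed

section \<open>Exit laws, killed laws and elementary properties of occupation times\<close>

context hunt
begin

text \<open>Harmonic measure. Exit means become integrals against it and are open to Fubini's
  theorem.\<close>

definition exit_law :: "'x set \<Rightarrow> 'x \<Rightarrow> 'x measure" where
  "exit_law U x = option_law (start X x) (\<lambda>\<omega>. traj X (exit_time X U \<omega>) \<omega>)"

lemma sets_exit_law [simp, measurable_cong]: "sets (exit_law U x) = sets borel"
  by (simp add: exit_law_def)

lemma space_exit_law [simp]: "space (exit_law U x) = UNIV"
  by (simp add: exit_law_def)

lemma exit_int_eq: "open U \<Longrightarrow> f \<in> borel_measurable borel \<Longrightarrow> exit_int U f x = (\<integral>\<^sup>+v. f v \<partial>exit_law U x)"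
  unfolding exit_int_def exit_law_def by (rule nn_integral_option_law[symmetric, OF _ traj_exit_prob_at]) auto

lemma finite_exit_law: "open U \<Longrightarrow> finite_measure (exit_law U x)"
  using emeasure_option_law_le[OF space_prob_at traj_exit_prob_at, of U "Some x"]
  by (intro finite_measureI) (auto simp: exit_law_def top_unique)

lemma exit_law_AE_notin:
  assumes U: "open U"
  shows "AE v in exit_law U x. v \<notin> U"
proof -
  have "(\<integral>\<^sup>+v. indicator U v \<partial>exit_law U x) = exit_int U (indicator U) x"
    using U by (intro exit_int_eq[symmetric]) auto
  also have "\<dots> = (\<integral>\<^sup>+\<omega>. 0 \<partial>start X x)"
    unfolding exit_int_def
  proof (rule nn_integral_cong)
    fix \<omega> show "ext0 (indicator U) (traj X (exit_time X U \<omega>) \<omega>) = (0::ennreal)"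
      using traj_exit_notin[OF U, of \<omega>]
      by (cases "traj X (exit_time X U \<omega>) \<omega>") (simp_all add: inj_image_mem_iff)
  qed
  finally have "emeasure (exit_law U x) U = 0" using U by simp
  then show ?thesis using U by (intro AE_not_in) (auto simp: null_sets_def)
qed

lemma exit_int_cong:
  assumes U: "open U" and eq: "\<And>v. v \<notin> U \<Longrightarrow> f v = g v"
  shows "exit_int U f x = exit_int U g x"
  unfolding exit_int_def
proof (rule nn_integral_cong)
  fix \<omega> show "ext0 f (traj X (exit_time X U \<omega>) \<omega>) = ext0 g (traj X (exit_time X U \<omega>) \<omega>)"
    using traj_exit_notin[OF U, of \<omega>] eq by (cases "traj X (exit_time X U \<omega>) \<omega>") auto
qed

lemma exit_int_mono: "(\<And>v. f v \<le> g v) \<Longrightarrow> exit_int U f x \<le> exit_int U g x"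
  unfolding exit_int_def by (intro nn_integral_mono) (auto split: option.splits)

lemma exit_int_mono':
  assumes U: "open U" and le: "\<And>v. v \<notin> U \<Longrightarrow> f v \<le> g v"
  shows "exit_int U f x \<le> exit_int U g x"
  unfolding exit_int_def
proof (rule nn_integral_mono)
  fix \<omega> show "ext0 f (traj X (exit_time X U \<omega>) \<omega>) \<le> ext0 g (traj X (exit_time X U \<omega>) \<omega>)"
    using traj_exit_notin[OF U, of \<omega>] le by (cases "traj X (exit_time X U \<omega>) \<omega>") auto
qed

lemma exit_int_add:
  "open U \<Longrightarrow> f \<in> borel_measurable borel \<Longrightarrow> g \<in> borel_measurable borel \<Longrightarrow>
    exit_int U (\<lambda>v. f v + g v) x = exit_int U f x + exit_int U g x"
  by (simp add: exit_int_eq nn_integral_add)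

lemma exit_int_cmult:
  "open U \<Longrightarrow> f \<in> borel_measurable borel \<Longrightarrow> exit_int U (\<lambda>v. c * f v) x = c * exit_int U f x"
  by (simp add: exit_int_eq nn_integral_cmult)

lemma exit_int_SUP:
  assumes "open U" "\<And>n. f n \<in> borel_measurable borel" "incseq f"
  shows "exit_int U (\<lambda>v. SUP n. f n v) x = (SUP n. exit_int U (f n) x)"
proof -
  have "(\<integral>\<^sup>+v. (SUP n. f n v) \<partial>exit_law U x) = (SUP n. \<integral>\<^sup>+v. f n v \<partial>exit_law U x)"
    using assms by (intro nn_integral_monotone_convergence_SUP) auto
  then show ?thesis using assms by (simp add: exit_int_eq)
qed

text \<open>The killed semigroup as a kernel, for exchanging it with exit means.\<close>

definition killed_law :: "'x set \<Rightarrow> ennreal \<Rightarrow> 'x \<Rightarrow> 'x measure" where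
  "killed_law D t x = option_law (density (start X x) (indicator {\<omega>. t < exit_time X D \<omega>})) (traj X t)"

lemma sets_killed_law [simp, measurable_cong]: "sets (killed_law U t x) = sets borel"
  by (simp add: killed_law_def)

lemma killed_ind_measurable: "open D \<Longrightarrow> {\<omega>. t < exit_time X D \<omega>} \<in> sets (prob_at X x)"
proof -
  assume D: "open D"
  note [measurable] = exit_prob_at[OF D, of x]
  have "{\<omega> \<in> space (prob_at X x). t < exit_time X D \<omega>} \<in> sets (prob_at X x)" by measurable
  then show ?thesis by simp
qed

lemma killed_op_eq:
  assumes D: "open D" and f: "f \<in> borel_measurable borel"
  shows "killed_op X D t f x = (\<integral>\<^sup>+v. f v \<partial>killed_law D t x)"
proof -
  note killed_ind_measurable[OF D, measurable]
  have tm: "traj X t \<in> start X x \<rightarrow>\<^sub>M cem_borel" by (rule measurable_prob_at) measurable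
  have "(\<integral>\<^sup>+v. f v \<partial>killed_law D t x) =
      (\<integral>\<^sup>+\<omega>. ext0 f (traj X t \<omega>) \<partial>density (start X x) (indicator {\<omega>. t < exit_time X D \<omega>}))"
    unfolding killed_law_def using tm by (intro nn_integral_option_law f) auto
  also have "\<dots> = killed_op X D t f x"
    unfolding killed_op_def using measurable_compose[OF tm measurable_ext0[OF f]]
    by (subst nn_integral_density) (auto simp: mult.commute)
  finally show ?thesis by simp
qed

lemma finite_killed_law:
  assumes D: "open D" shows "finite_measure (killed_law D t x)"
proof -
  have "(\<integral>\<^sup>+v. 1 \<partial>killed_law D t x) = killed_op X D t (\<lambda>_. 1) x"
    by (rule killed_op_eq[symmetric, OF D]) simp
  also have "\<dots> \<le> (\<integral>\<^sup>+\<omega>. 1 \<partial>start X x)"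
    unfolding killed_op_def by (intro nn_integral_mono) (auto simp: indicator_def split: option.splits)
  finally show ?thesis by (intro finite_measureI) (auto simp: top_unique)
qed

lemma at_left_nonbot:
  assumes "0 < (t::ennreal)" shows "at_left t \<noteq> bot"
proof
  assume "at_left t = bot"
  then have "eventually (\<lambda>_. False) (at_left t)" by simp
  then obtain b where "b < t" "\<And>y. b < y \<Longrightarrow> y < t \<Longrightarrow> False"
    by (auto simp: eventually_at_left[OF assms])
  then show False using dense[of b t] by blast
qed

text \<open>Excludes a left limit at the cemetery while the path is alive. If the exit times of
  growing balls stayed below a time at which the path is alive, quasi-left-continuity would make the
  exit positions converge to a point of the state space, hence be bounded.\<close>

lemma bounded_paths:
  "AE \<omega> in prob_at X x. \<forall>t. traj X t \<omega> \<noteq> None \<longrightarrow>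
     (\<exists>n. \<forall>s. 0 < s \<and> s \<le> t \<longrightarrow> traj X s \<omega> \<in> Some ` ball a (real n))"
proof -
  define Tn where "Tn n = exit_time X (ball a (real n))" for n
  have "stopping_time (filt X) (Tn n)" for n unfolding Tn_def by (rule stopping_exit) simp
  moreover have "incseq (\<lambda>n. Tn n \<omega>)" for \<omega>
    unfolding Tn_def by (intro incseq_SucI exit_time_mono subset_ball) simp
  ultimately have "AE \<omega> in prob_at X x. (SUP n. Tn n \<omega>) < \<top> \<longrightarrow>
       limitin cem_top (\<lambda>n. traj X (Tn n \<omega>) \<omega>) (traj X (SUP n. Tn n \<omega>) \<omega>) sequentially"
    by (rule quasi_left)
  then show ?thesis
  proof eventually_elim
    case (elim \<omega>)
    show ?case
    proof (intro allI impI, rule ccontr)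
      fix t assume t: "traj X t \<omega> \<noteq> None"
        and *: "\<not> (\<exists>n. \<forall>s. 0 < s \<and> s \<le> t \<longrightarrow> traj X s \<omega> \<in> Some ` ball a (real n))"
      have "Tn n \<omega> \<le> t" for n
      proof -
        from * obtain s where "0 < s" "s \<le> t" "traj X s \<omega> \<notin> Some ` ball a (real n)" by blast
        then have "Tn n \<omega> \<le> s" unfolding Tn_def by (intro exit_time_le)
        with \<open>s \<le> t\<close> show ?thesis by simp
      qed
      then have le: "(SUP n. Tn n \<omega>) \<le> t" by (rule SUP_least)
      have "t \<noteq> \<top>" using t traj_top by metis
      then have "(SUP n. Tn n \<omega>) < \<top>" using le by (metis le_less_trans top.not_eq_extremum)
      with elim have lim: "limitin cem_top (\<lambda>n. traj X (Tn n \<omega>) \<omega>) (traj X (SUP n. Tn n \<omega>) \<omega>) sequentially"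
        by simp
      have "traj X (SUP n. Tn n \<omega>) \<omega> \<noteq> None"
      proof
        assume "traj X (SUP n. Tn n \<omega>) \<omega> = None"
        from traj_absorb[OF this le] t show False by simp
      qed
      then obtain y where y: "traj X (SUP n. Tn n \<omega>) \<omega> = Some y" by auto
      have "\<forall>\<^sub>F n in sequentially. traj X (Tn n \<omega>) \<omega> \<in> Some ` ball y 1"
        using lim openin_cem_Some[of "ball y 1"] unfolding limitin_def y by auto
      moreover obtain n0 where n0: "dist a y + 1 \<le> real n0" using real_arch_simple by blast
      ultimately obtain n where n: "n0 \<le> n" "traj X (Tn n \<omega>) \<omega> \<in> Some ` ball y 1"
        by (auto simp: eventually_sequentially) (metis le_cases)
      then have "traj X (Tn n \<omega>) \<omega> \<in> Some ` ball a (real n)"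
      proof -
        have "ball y 1 \<subseteq> ball a (real n)"
        proof
          fix z assume "z \<in> ball y 1"
          moreover have "dist a z \<le> dist a y + dist y z" by (rule dist_triangle)
          moreover have "real n0 \<le> real n" using n by simp
          ultimately show "z \<in> ball a (real n)" using n0 by (simp add: mem_ball)
        qed
        with n(2) show ?thesis by blast
      qed
      then show False unfolding Tn_def using traj_exit_notin[of "ball a (real n)" \<omega>] by simp
    qed
  qed
qed

lemma occ_path_SUP:
  assumes "\<And>n. F n \<in> borel_measurable borel" "incseq F"
  shows "occ_path U (\<lambda>u. SUP n. F n u) \<omega> = (SUP n. occ_path U (F n) \<omega>)"
proof -
  have [measurable]: "(\<lambda>t. ext0 (F n) (traj X (ennreal t) \<omega>)) \<in> borel_measurable borel" for n
    by (rule measurable_compose[OF path_measurable measurable_ext0[OF assms(1)]])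
  have "{t. 0 \<le> t \<and> ennreal t < exit_time X U \<omega>} \<in> sets borel" by measurable
  then have [measurable]: "{t. 0 \<le> t \<and> ennreal t < exit_time X U \<omega>} \<in> sets lborel" by simp
  have "ext0 (\<lambda>u. SUP n. F n u) z = (SUP n. ext0 (F n) z)" for z by (cases z) auto
  then have "occ_path U (\<lambda>u. SUP n. F n u) \<omega> =
     (\<integral>\<^sup>+t. (SUP n. ext0 (F n) (traj X (ennreal t) \<omega>) * indicator {t. 0 \<le> t \<and> ennreal t < exit_time X U \<omega>} t) \<partial>lborel)"
    unfolding occ_path_def by (simp add: SUP_mult_right_ennreal)
  also have "\<dots> = (SUP n. occ_path U (F n) \<omega>)"
    unfolding occ_path_def using assms(2)
    by (intro nn_integral_monotone_convergence_SUP)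
       (auto simp: incseq_def le_fun_def intro!: mult_right_mono split: option.splits)
  finally show ?thesis .
qed

lemma occ_SUP:
  assumes "open U" "\<And>n. F n \<in> borel_measurable borel" "incseq F"
  shows "occ U (\<lambda>u. SUP n. F n u) x = (SUP n. occ U (F n) x)"
  unfolding occ_def occ_path_SUP[OF assms(2,3)]
proof (rule nn_integral_monotone_convergence_SUP)
  show "incseq (\<lambda>n. occ_path U (F n))"
    using assms(3) by (auto simp: incseq_def le_fun_def intro!: occ_path_mono)
  show "occ_path U (F n) \<in> borel_measurable (start X x)" for n
    by (rule measurable_aug_prob_at[OF occ_path_measurable[OF assms(1,2)]])
qed

lemma occ_mono:
  assumes "\<And>u. u \<in> U \<Longrightarrow> F u \<le> H u" shows "occ U F x \<le> occ U H x"
proof -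
  have "occ U F x = occ U (\<lambda>u. if u \<in> U then F u else 0) x"
    unfolding occ_def by (intro nn_integral_cong occ_path_cong) auto
  also have "\<dots> \<le> occ U (\<lambda>u. if u \<in> U then H u else 0) x"
    unfolding occ_def using assms by (intro nn_integral_mono occ_path_mono) auto
  also have "\<dots> = occ U H x"
    unfolding occ_def by (intro nn_integral_cong occ_path_cong) auto
  finally show ?thesis .
qed

lemma occ_cong: "(\<And>u. u \<in> U \<Longrightarrow> F u = H u) \<Longrightarrow> occ U F x = occ U H x"
  by (intro antisym occ_mono) auto

lemma occ_path_cmult:
  assumes "F \<in> borel_measurable borel"
  shows "occ_path U (\<lambda>u. c * F u) \<omega> = c * occ_path U F \<omega>"
proof -
  have m[measurable]: "(\<lambda>t. ext0 F (traj X (ennreal t) \<omega>)) \<in> borel_measurable borel"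
    by (rule measurable_compose[OF path_measurable measurable_ext0[OF assms]])
  have "{t. 0 \<le> t \<and> ennreal t < exit_time X U \<omega>} \<in> sets borel" by measurable
  then have [measurable]: "{t. 0 \<le> t \<and> ennreal t < exit_time X U \<omega>} \<in> sets lborel" by simp
  have "ext0 (\<lambda>u. c * F u) z = c * ext0 F z" for z by (cases z) auto
  then show ?thesis unfolding occ_path_def
    by (simp add: mult.assoc nn_integral_cmult)
qed

lemma occ_cmult:
  assumes "open U" "F \<in> borel_measurable borel"
  shows "occ U (\<lambda>u. c * F u) x = c * occ U F x"
  unfolding occ_def occ_path_cmult[OF assms(2)]
  by (rule nn_integral_cmult[OF measurable_aug_prob_at[OF occ_path_measurable[OF assms]]])

lemma mean_exit_eq: "mean_exit X U x = occ U (\<lambda>_. 1) x"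
proof -
  have "occ_path U (\<lambda>_. 1) \<omega> = exit_time X U \<omega>" for \<omega>
  proof -
    have "occ_path U (\<lambda>_. 1) \<omega> = (\<integral>\<^sup>+t. indicator {t. 0 \<le> t \<and> ennreal t < exit_time X U \<omega>} t \<partial>lborel)"
      unfolding occ_path_def
    proof (rule nn_integral_cong_AE)
      have "AE t in lborel. t \<noteq> (0::real)" by (rule AE_lborel_singleton)
      then show "AE t in lborel. ext0 (\<lambda>_. 1) (traj X (ennreal t) \<omega>) * indicator {t. 0 \<le> t \<and> ennreal t < exit_time X U \<omega>} t =
         (indicator {t. 0 \<le> t \<and> ennreal t < exit_time X U \<omega>} t :: ennreal)"
      proof eventually_elim
        case (elim t)
        show ?case
        proof (cases "0 \<le> t \<and> ennreal t < exit_time X U \<omega>")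
          case True
          then have "traj X (ennreal t) \<omega> \<in> Some ` U" using elim by (intro traj_before_exit) auto
          then show ?thesis by auto
        qed simp
      qed
    qed
    also have "\<dots> = exit_time X U \<omega>"
    proof (cases "exit_time X U \<omega>")
      case (real r)
      then have "{t. 0 \<le> t \<and> ennreal t < exit_time X U \<omega>} = {0..<r}"
        by (auto simp: ennreal_less_iff)
      then show ?thesis using real by simp
    next
      case top
      then have "{t. 0 \<le> t \<and> ennreal t < exit_time X U \<omega>} = {0..}" by auto
      then show ?thesis using top by (simp add: emeasure_lborel_half_line)
    qed
    finally show ?thesis .
  qed
  then show ?thesis unfolding mean_exit_def occ_def by (intro nn_integral_cong) simp
qed

lemma occ_pos:
  assumes U: "open U" "x \<in> U" and F[measurable]: "F \<in> borel_measurable borel" and pos: "\<And>u. u \<in> U \<Longrightarrow> 0 < F u"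
  shows "0 < occ U F x"
proof (rule ccontr)
  assume "\<not> 0 < occ U F x"
  then have "(\<integral>\<^sup>+\<omega>. occ_path U F \<omega> \<partial>start X x) = 0" by (simp add: occ_def)
  then have "AE \<omega> in start X x. occ_path U F \<omega> = 0"
    using measurable_aug_prob_at[OF occ_path_measurable[OF U(1) F]] by (simp add: nn_integral_0_iff_AE)
  then have "AE \<omega> in start X x. False"
    using AE_start[of x]
  proof eventually_elim
    case (elim \<omega>)
    have "0 < exit_time X U \<omega>" using elim U by (intro exit_time_pos) auto
    then obtain e where e: "0 < e" "e < exit_time X U \<omega>" using dense by blast
    then have "e < \<top>" by (meson less_le_trans top_greatest)
    then obtain r where r: "e = ennreal r" "0 < r" using e by (cases e) (auto simp: ennreal_less_zero_iff)
    have [measurable]: "(\<lambda>t. ext0 F (traj X (ennreal t) \<omega>)) \<in> borel_measurable borel"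
      by (rule measurable_compose[OF path_measurable measurable_ext0[OF F]])
    have "{t. 0 \<le> t \<and> ennreal t < exit_time X U \<omega>} \<in> sets borel" by measurable
    then have [measurable]: "{t. 0 \<le> t \<and> ennreal t < exit_time X U \<omega>} \<in> sets lborel" by simp
    have "AE t in lborel. ext0 F (traj X (ennreal t) \<omega>) * indicator {t. 0 \<le> t \<and> ennreal t < exit_time X U \<omega>} t = 0"
      using elim(1) unfolding occ_path_def by (subst (asm) nn_integral_0_iff_AE) auto
    then have "AE t in lborel. t \<notin> {0<..r}"
    proof eventually_elim
      case (elim t)
      show ?case
      proof
        assume t: "t \<in> {0<..r}"
        then have "ennreal t < exit_time X U \<omega>"
          using e r by (auto intro: le_less_trans[OF ennreal_leI])
        moreover from this have "traj X (ennreal t) \<omega> \<in> Some ` U"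
          using t by (intro traj_before_exit) auto
        ultimately show False using elim pos t by (auto simp: indicator_def) (metis less_irrefl)
      qed
    qed
    then have "{0<..r} \<in> null_sets lborel" by (simp add: AE_iff_null_sets)
    then show False using r(2) by (simp add: null_sets_def)
  qed
  then show False
    using prob_space.emeasure_space_1[OF prob_space_prob_at[of "Some x"]] ae_filter_eq_bot_iff[of "start X x"]
    by (simp add: trivial_limit_def)
qed

end

section \<open>The Ikeda-Watanabe formula for jumps out of an open set\<close>

context jump_hunt
begin

lemma space_m: "space m = UNIV"
  using sets_eq_imp_space_eq[OF sets_m] by simp

lemma sigma_finite_m: "sigma_finite_measure m"
proof (rule sigma_finite_measure.intro, intro exI conjI ballI)
  show "countable (range (\<lambda>n::nat. cball (undefined::'x) (real n)))" by simp
  show "range (\<lambda>n::nat. cball (undefined::'x) (real n)) \<subseteq> sets m" unfolding sets_m by auto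
  show "\<Union> (range (\<lambda>n::nat. cball (undefined::'x) (real n))) = space m"
  proof -
    have "z \<in> \<Union> (range (\<lambda>n::nat. cball (undefined::'x) (real n)))" for z
    proof -
      obtain n where "dist undefined z \<le> real n" using real_arch_simple by blast
      then have "z \<in> cball undefined (real n)" by simp
      then show ?thesis by blast
    qed
    then show ?thesis unfolding space_m by blast
  qed
  fix A assume "A \<in> range (\<lambda>n::nat. cball (undefined::'x) (real n))"
  then have "compact A" by (auto simp: compact_eq_bounded_closed)
  from m_finite_compact[OF this] show "emeasure m A \<noteq> \<infinity>" by auto
qed

lemma measurable_m: "f \<in> borel_measurable borel \<Longrightarrow> f \<in> borel_measurable m"
  using sets_m by (simp cong: measurable_cong_sets)

lemma measurable_pair_m: "f \<in> borel_measurable (borel \<Otimes>\<^sub>M borel) \<Longrightarrow> f \<in> borel_measurable (borel \<Otimes>\<^sub>M m)"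
  using sets_m by (simp cong: measurable_cong_sets sets_pair_measure_cong)

lemma integral_m_measurable:
  "(\<lambda>(u, v). f u v) \<in> borel_measurable (borel \<Otimes>\<^sub>M borel) \<Longrightarrow> (\<lambda>u. \<integral>\<^sup>+v. f u v \<partial>m) \<in> borel_measurable borel"
  by (intro sigma_finite_measure.borel_measurable_nn_integral[OF sigma_finite_m] measurable_pair_m)

lemma j_section: "j u \<in> borel_measurable borel" "(\<lambda>u. j u v) \<in> borel_measurable borel"
proof -
  have "(\<lambda>v. (u, v)) \<in> borel \<rightarrow>\<^sub>M borel \<Otimes>\<^sub>M borel" "(\<lambda>u. (u, v)) \<in> borel \<rightarrow>\<^sub>M borel \<Otimes>\<^sub>M borel"
    by measurable
  from this[THEN measurable_compose[OF _ j_measurable]]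
  show "j u \<in> borel_measurable borel" "(\<lambda>u. j u v) \<in> borel_measurable borel" by simp_all
qed

definition jump_int :: "'x set \<Rightarrow> ('x \<Rightarrow> ennreal) \<Rightarrow> 'x \<Rightarrow> ennreal" where
  "jump_int A f u = (\<integral>\<^sup>+v. f v * indicator A v * ennreal (j u v) \<partial>m)"

lemma jump_int_measurable:
  assumes [measurable]: "A \<in> sets borel" "f \<in> borel_measurable borel"
  shows "jump_int A f \<in> borel_measurable borel"
  unfolding jump_int_def[abs_def]
proof (rule integral_m_measurable)
  note j_measurable[measurable]
  have [measurable]: "(\<lambda>z. j (fst z) (snd z)) \<in> borel_measurable (borel \<Otimes>\<^sub>M borel)"
    using j_measurable by (simp add: split_beta)
  show "(\<lambda>(u, v). f v * indicator A v * ennreal (j u v)) \<in> borel_measurable (borel \<Otimes>\<^sub>M borel)"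
    unfolding split_beta by measurable
qed

text \<open>In the sum of the Levy system over the jumps up to the exit time only the last term can
  survive, since before it the path is in \<open>U\<close>, away from \<open>A\<close>. As
  \<open>A\<close> misses the closure of \<open>U\<close>, the path can reach \<open>A\<close> at
  the exit only by a jump.\<close>

lemma levy_exit_real:
  fixes f :: "'x \<Rightarrow> real"
  assumes U: "open U" "x \<in> U" and A[measurable]: "A \<in> sets borel" and disj: "A \<inter> closure U = {}"
    and f[measurable]: "f \<in> borel_measurable borel" and f0: "\<And>v. 0 \<le> f v"
  shows "exit_int U (\<lambda>v. ennreal (f v) * indicator A v) x = occ U (jump_int A (\<lambda>v. ennreal (f v))) x"
proof -
  have [measurable]: "closure U \<in> sets borel" by simp
  \<comment> \<open>The left limit at the exit may lie on the boundary of \<open>U\<close>, hence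
    the closure; its disjointness from \<open>A\<close> makes \<open>g\<close> vanish on the
    diagonal, as \<open>levy_system\<close> demands.\<close>
  define g where "g u v = f v * indicator A v * indicator (closure U) u" for u v
  have gm: "(\<lambda>(u, v). g u v) \<in> borel_measurable (borel \<Otimes>\<^sub>M borel)"
    unfolding g_def split_beta by measurable
  have g0: "0 \<le> g u v" "g u u = 0" for u v using f0 disj by (auto simp: g_def indicator_def)
  have eq: "(\<integral>\<^sup>+\<omega>. (\<integral>\<^sup>+s. (case (left_lim X s \<omega>, traj X s \<omega>) of
                                 (Some u, Some v) \<Rightarrow> ennreal (g u v) | _ \<Rightarrow> 0)
                       \<partial>count_space {0<..exit_time X U \<omega>}) \<partial>start X x) =
       (\<integral>\<^sup>+\<omega>. (\<integral>\<^sup>+s\<in>{s. 0 \<le> s \<and> ennreal s \<le> exit_time X U \<omega>}.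
                         ext0 (\<lambda>u. \<integral>\<^sup>+y. ennreal (g u y) \<partial>density m (\<lambda>y. ennreal (j u y))) (traj X (ennreal s) \<omega>)
                       \<partial>lborel) \<partial>start X x)"
  proof -
    have "(\<lambda>(x, y). g x y) \<in> borel_measurable (borel \<Otimes>\<^sub>M borel) \<and> (\<forall>x y. 0 \<le> g x y) \<and> (\<forall>x. g x x = 0)"
      using gm g0 by blast
    from levy[unfolded levy_system_def, THEN spec, of g, THEN mp, OF this, THEN spec, THEN mp,
        OF stopping_exit[OF U(1)], THEN spec, of x]
    show ?thesis .
  qed
  have "exit_int U (\<lambda>v. ennreal (f v) * indicator A v) x =
    (\<integral>\<^sup>+\<omega>. (\<integral>\<^sup>+s. (case (left_lim X s \<omega>, traj X s \<omega>) of
                                 (Some u, Some v) \<Rightarrow> ennreal (g u v) | _ \<Rightarrow> 0)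
                       \<partial>count_space {0<..exit_time X U \<omega>}) \<partial>start X x)"
    unfolding exit_int_def
  proof (rule nn_integral_cong_AE)
    show "AE \<omega> in start X x. ext0 (\<lambda>v. ennreal (f v) * indicator A v) (traj X (exit_time X U \<omega>) \<omega>) =
       (\<integral>\<^sup>+s. (case (left_lim X s \<omega>, traj X s \<omega>) of
                                 (Some u, Some v) \<Rightarrow> ennreal (g u v) | _ \<Rightarrow> 0)
                       \<partial>count_space {0<..exit_time X U \<omega>})"
      using AE_start[of x] bounded_paths[where x="Some x" and a=x]
    proof eventually_elim
      case (elim \<omega>)
      define \<tau> where "\<tau> = exit_time X U \<omega>"
      have tpos: "0 < \<tau>" unfolding \<tau>_def using elim U by (intro exit_time_pos) auto
      define h where "h s = (case (left_lim X s \<omega>, traj X s \<omega>) of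
                                 (Some u, Some v) \<Rightarrow> ennreal (g u v) | _ \<Rightarrow> 0)" for s
      have "(\<integral>\<^sup>+s. h s \<partial>count_space {0<..\<tau>}) = (\<Sum>s\<in>{\<tau>}. h s)"
      proof (rule nn_integral_count_space')
        fix s assume "s \<in> {0<..\<tau>}" "s \<notin> {\<tau>}"
        then have "traj X s \<omega> \<in> Some ` U" unfolding \<tau>_def by (intro traj_before_exit) auto
        then obtain v where "traj X s \<omega> = Some v" "v \<in> U" by auto
        moreover have "v \<notin> A" using \<open>v \<in> U\<close> disj closure_subset by blast
        ultimately show "h s = 0" by (auto simp: h_def g_def split: option.splits)
      qed (use tpos in auto)
      also have "\<dots> = ext0 (\<lambda>v. ennreal (f v) * indicator A v) (traj X \<tau> \<omega>)"
      proof (cases "traj X \<tau> \<omega>")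
        case None then show ?thesis by (simp add: h_def split: option.splits)
      next
        case (Some v)
        show ?thesis
        proof (cases "v \<in> A")
          case False
          then show ?thesis using Some by (auto simp: h_def g_def split: option.splits)
        next
          case True
          have "\<tau> \<noteq> \<top>" using Some traj_top by (metis option.distinct(1))
          then have tfin: "\<tau> < \<top>" by (simp add: top.not_eq_extremum)
          have lim: "limitin cem_top (\<lambda>r. traj X r \<omega>) (left_lim X \<tau> \<omega>) (at_left \<tau>)"
            unfolding left_lim_def using traj_left[OF tpos tfin] by (rule someI_ex)
          obtain n where n: "\<And>s. 0 < s \<Longrightarrow> s \<le> \<tau> \<Longrightarrow> traj X s \<omega> \<in> Some ` ball x (real n)"
            using elim(2) Some by (metis option.distinct(1))
          \<comment> \<open>Compactness gives closedness in the compactification; a merely closed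
            set could have the cemetery as a limit point.\<close>
          have "compact (closure U \<inter> cball x (real n))"
            by (auto simp: compact_eq_bounded_closed bounded_Int)
          then have cl: "closedin cem_top (Some ` (closure U \<inter> cball x (real n)))"
            by (rule closedin_cem_Some)
          have "\<forall>\<^sub>F s in at_left \<tau>. traj X s \<omega> \<in> Some ` (closure U \<inter> cball x (real n))"
            unfolding eventually_at_left[OF tpos]
          proof (intro exI[of _ 0] conjI allI impI tpos)
            fix s assume "0 < s" "s < \<tau>"
            then have "traj X s \<omega> \<in> Some ` U" "traj X s \<omega> \<in> Some ` ball x (real n)"
              using n[of s] unfolding \<tau>_def by (auto intro: traj_before_exit)
            then show "traj X s \<omega> \<in> Some ` (closure U \<inter> cball x (real n))"
              using closure_subset[of U] by fastforce
          qed
          from limitin_cem_closed[OF lim at_left_nonbot[OF tpos] this cl]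
          obtain u where "left_lim X \<tau> \<omega> = Some u" "u \<in> closure U" by auto
          then show ?thesis using Some True f0[of v] by (simp add: h_def g_def)
        qed
      qed
      finally show ?case unfolding h_def \<tau>_def by simp
    qed
  qed
  also note eq
  also have "(\<integral>\<^sup>+\<omega>. (\<integral>\<^sup>+s\<in>{s. 0 \<le> s \<and> ennreal s \<le> exit_time X U \<omega>}.
                         ext0 (\<lambda>u. \<integral>\<^sup>+y. ennreal (g u y) \<partial>density m (\<lambda>y. ennreal (j u y))) (traj X (ennreal s) \<omega>)
                       \<partial>lborel) \<partial>start X x) = occ U (jump_int A (\<lambda>v. ennreal (f v))) x"
    unfolding occ_def occ_path_def
  proof (rule nn_integral_cong, rule nn_integral_cong_AE)
    fix \<omega>
    have 1: "AE t in lborel. t \<noteq> (0::real)" by (rule AE_lborel_singleton)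
    \<comment> \<open>The Levy system integrates up to and including the exit time, the occupation
      functional stops short of it.\<close>
    have 2: "AE t in lborel. t \<noteq> enn2real (exit_time X U \<omega>)" by (rule AE_lborel_singleton)
    have gg: "(\<integral>\<^sup>+y. ennreal (g u y) \<partial>density m (\<lambda>y. ennreal (j u y))) = jump_int A (\<lambda>v. ennreal (f v)) u"
      if "u \<in> U" for u
    proof -
      have "u \<in> closure U" using that closure_subset by blast
      have [measurable]: "j u \<in> borel_measurable m" by (rule measurable_m[OF j_section(1)])
      have [measurable]: "g u \<in> borel_measurable m" unfolding g_def by (rule measurable_m) measurable
      have "(\<integral>\<^sup>+y. ennreal (g u y) \<partial>density m (\<lambda>y. ennreal (j u y))) = (\<integral>\<^sup>+y. ennreal (j u y) * ennreal (g u y) \<partial>m)"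
        by (rule nn_integral_density) auto
      also have "\<dots> = jump_int A (\<lambda>v. ennreal (f v)) u"
        unfolding jump_int_def g_def using \<open>u \<in> closure U\<close>
        by (intro nn_integral_cong) (auto simp: indicator_def mult.commute)
      finally show ?thesis .
    qed
    show "AE t in lborel. ext0 (\<lambda>u. \<integral>\<^sup>+y. ennreal (g u y) \<partial>density m (\<lambda>y. ennreal (j u y))) (traj X (ennreal t) \<omega>) *
         indicator {s. 0 \<le> s \<and> ennreal s \<le> exit_time X U \<omega>} t =
       ext0 (jump_int A (\<lambda>v. ennreal (f v))) (traj X (ennreal t) \<omega>) *
         indicator {t. 0 \<le> t \<and> ennreal t < exit_time X U \<omega>} t"
      using 1 2
    proof eventually_elim
      case (elim t)
      show ?case
      proof (cases "0 \<le> t \<and> ennreal t \<le> exit_time X U \<omega>")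
        case False
        then show ?thesis by (auto simp: indicator_def)
      next
        case True
        have "ennreal t \<noteq> exit_time X U \<omega>" using elim(2) True by (metis enn2real_ennreal)
        then have lt: "ennreal t < exit_time X U \<omega>" using True by (metis order_le_less)
        then have "traj X (ennreal t) \<omega> \<in> Some ` U" using True elim by (intro traj_before_exit) auto
        then show ?thesis using lt True gg by auto
      qed
    qed
  qed
  finally show ?thesis .
qed

text \<open>\<open>levy_system\<close> speaks of real integrands; truncation and monotone
  convergence admit the value \<open>\<top>\<close>, which Green functions may take at their
  pole.\<close>

lemma levy_exit:
  assumes U: "open U" "x \<in> U" and A[measurable]: "A \<in> sets borel" and disj: "A \<inter> closure U = {}"
    and f[measurable]: "f \<in> borel_measurable borel"
  shows "exit_int U (\<lambda>v. f v * indicator A v) x = occ U (jump_int A f) x"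
proof -
  define F where "F n v = min (f v) (of_nat n)" for n v
  have fin: "F n v < \<top>" for n v by (simp add: F_def min_less_iff_disj of_nat_less_top)
  then have F: "F n v = ennreal (enn2real (F n v))" for n v by simp
  have Fm[measurable]: "F n \<in> borel_measurable borel" for n unfolding F_def by measurable
  have Finc: "F i v \<le> F k v" if "i \<le> k" for i k v
    unfolding F_def using that by (intro min.mono) auto
  have Fsup: "f v = (SUP n. F n v)" for v unfolding F_def by (simp add: ennreal_SUP_min_nat)
  have step: "exit_int U (\<lambda>v. F n v * indicator A v) x = occ U (jump_int A (F n)) x" for n
    using levy_exit_real[OF U A disj, of "\<lambda>v. enn2real (F n v)"] F by simp
  have "exit_int U (\<lambda>v. f v * indicator A v) x = exit_int U (\<lambda>v. SUP n. F n v * indicator A v) x"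
    by (simp add: Fsup SUP_mult_right_ennreal)
  also have "\<dots> = (SUP n. exit_int U (\<lambda>v. F n v * indicator A v) x)"
    using Finc by (intro exit_int_SUP[OF U(1)]) (auto simp: incseq_def le_fun_def intro!: mult_right_mono)
  also have "\<dots> = (SUP n. occ U (jump_int A (F n)) x)" by (simp add: step)
  also have "\<dots> = occ U (\<lambda>u. SUP n. jump_int A (F n) u) x"
    using Finc by (intro occ_SUP[symmetric, OF U(1)] jump_int_measurable)
      (auto simp: incseq_def le_fun_def jump_int_def intro!: nn_integral_mono mult_right_mono)
  also have "(\<lambda>u. SUP n. jump_int A (F n) u) = jump_int A f"
  proof
    fix u
    have jm[measurable]: "j u \<in> borel_measurable m" by (rule measurable_m[OF j_section(1)])
    have fm: "(\<lambda>v. F n v * indicator A v) \<in> borel_measurable m" for n by (rule measurable_m) measurable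
    have "jump_int A f u = (\<integral>\<^sup>+v. (SUP n. F n v * indicator A v * ennreal (j u v)) \<partial>m)"
      unfolding jump_int_def by (simp add: Fsup SUP_mult_right_ennreal)
    also have "\<dots> = (SUP n. jump_int A (F n) u)"
      unfolding jump_int_def using Finc fm
      by (intro nn_integral_monotone_convergence_SUP) (auto simp: incseq_def le_fun_def intro!: mult_right_mono)
    finally show "(SUP n. jump_int A (F n) u) = jump_int A f u" ..
  qed
  finally show ?thesis .
qed

end

section \<open>Green functions as harmonic functions\<close>

text \<open>Both functions may be infinite, so differences are avoided. On a set of finite measure
  with \<open>p \<le> q < r \<le> k\<close> the integrals give \<open>r * m A \<le> q * m A\<close>,
  whence the set is null; countably many such sets exhaust \<open>p < k\<close>.\<close>

lemma AE_le_from_integrals: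
  assumes \<sigma>: "sigma_finite_measure m" and sm: "sets m = sets borel"
    and k: "k \<in> borel_measurable borel" and p: "p \<in> borel_measurable borel" and V: "V \<in> sets borel"
    and le: "\<And>A. A \<in> sets borel \<Longrightarrow> A \<subseteq> V \<Longrightarrow> (\<integral>\<^sup>+y. k y * indicator A y \<partial>m) \<le> (\<integral>\<^sup>+y. p y * indicator A y \<partial>m)"
  shows "AE y in m. y \<in> V \<longrightarrow> k y \<le> (p y :: ennreal)"
proof -
  note [measurable] = k p V
  obtain B :: "nat \<Rightarrow> 'a set" where B: "range B \<subseteq> sets m" "(\<Union>i. B i) = space m" "\<And>i. emeasure m (B i) \<noteq> \<infinity>"
    using sigma_finite_measure.sigma_finite[OF \<sigma>] by metis
  have spm: "space m = UNIV" using sets_eq_imp_space_eq[OF sm] by simp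
  have Bm[measurable]: "B i \<in> sets borel" for i using B(1) sm by auto
  obtain Q :: "ennreal set" where Q: "countable Q" "\<And>s t. s < t \<Longrightarrow> \<exists>d\<in>Q. s < d \<and> d < t"
  proof -
    obtain Q :: "ennreal set" where Q: "countable Q" "\<And>X. open X \<Longrightarrow> X \<noteq> {} \<Longrightarrow> \<exists>d\<in>Q. d \<in> X"
      using countable_dense_setE by auto
    have "\<exists>d\<in>Q. s < d \<and> d < t" if "s < t" for s t
      using Q(2)[of "{s<..<t}"] dense[OF that] by auto
    with Q(1) that show thesis by blast
  qed
  define I where "I = {(q, r) \<in> Q \<times> Q. q < r}"
  define A where "A q r i = {y \<in> space borel. y \<in> V \<and> y \<in> B i \<and> p y \<le> q \<and> r \<le> k y}" for q r i
  have Am: "A q r i \<in> sets borel" for q r i unfolding A_def by measurable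
  then have Amm: "A q r i \<in> sets m" for q r i using sm by simp
  have null: "A q r i \<in> null_sets m" if qr: "q < r" for q r i
  proof -
    have fin: "emeasure m (A q r i) < \<top>"
    proof -
      have "emeasure m (A q r i) \<le> emeasure m (B i)"
        using Bm sm by (intro emeasure_mono) (auto simp: A_def)
      then show ?thesis using B(3)[of i] by (auto simp: top.not_eq_extremum intro: le_less_trans)
    qed
    have "r * emeasure m (A q r i) = (\<integral>\<^sup>+y. r * indicator (A q r i) y \<partial>m)"
      using Amm by (simp add: nn_integral_cmult_indicator)
    also have "\<dots> \<le> (\<integral>\<^sup>+y. k y * indicator (A q r i) y \<partial>m)"
      by (intro nn_integral_mono) (auto simp: A_def indicator_def)
    also have "\<dots> \<le> (\<integral>\<^sup>+y. p y * indicator (A q r i) y \<partial>m)"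
      by (rule le[OF Am]) (auto simp: A_def)
    also have "\<dots> \<le> (\<integral>\<^sup>+y. q * indicator (A q r i) y \<partial>m)"
      by (intro nn_integral_mono) (auto simp: A_def indicator_def)
    also have "\<dots> = q * emeasure m (A q r i)"
      using Amm by (simp add: nn_integral_cmult_indicator)
    finally have *: "emeasure m (A q r i) * r \<le> emeasure m (A q r i) * q" by (simp add: mult.commute)
    have "emeasure m (A q r i) = 0"
    proof (rule ccontr)
      assume "emeasure m (A q r i) \<noteq> 0"
      then have "r \<le> q" using * fin by (subst (asm) ennreal_mult_le_mult_iff) auto
      with qr show False by simp
    qed
    then show ?thesis using Amm by (auto simp: null_sets_def)
  qed
  have "(\<Union>(q, r)\<in>I. \<Union>i. A q r i) \<in> null_sets m"
  proof (rule null_sets_UN')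
    show "countable I" using Q(1) unfolding I_def by (auto intro: countable_subset[of _ "Q \<times> Q"])
    show "(case qr of (q, r) \<Rightarrow> \<Union>i. A q r i) \<in> null_sets m" if "qr \<in> I" for qr
      using that null by (auto simp: I_def intro!: null_sets_UN)
  qed
  then have "AE y in m. y \<notin> (\<Union>(q, r)\<in>I. \<Union>i. A q r i)" by (rule AE_not_in)
  then show ?thesis
  proof eventually_elim
    case (elim y)
    show ?case
    proof (intro impI, rule ccontr)
      assume y: "y \<in> V" "\<not> k y \<le> p y"
      then obtain q where q: "q \<in> Q" "p y < q" "q < k y" using Q(2)[of "p y" "k y"] by (metis not_le)
      obtain r where r: "r \<in> Q" "q < r" "r < k y" using Q(2)[OF q(3)] by blast
      obtain i where "y \<in> B i" using B(2) spm by blast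
      then have "y \<in> A q r i" using y q r by (auto simp: A_def)
      moreover have "(q, r) \<in> I" using q r by (auto simp: I_def)
      ultimately show False using elim by blast
    qed
  qed
qed

text \<open>Fatou's lemma along sequences, which suffice in a first countable space.\<close>

lemma lsc_integral:
  fixes K :: "'a \<Rightarrow> 'b::first_countable_topology \<Rightarrow> ennreal"
  assumes m: "\<And>z. (\<lambda>v. K v z) \<in> borel_measurable \<nu>"
    and lsc: "\<And>v c. c < K v y \<Longrightarrow> \<forall>\<^sub>F z in nhds y. c < K v z"
    and c: "c < (\<integral>\<^sup>+v. K v y \<partial>\<nu>)"
  shows "\<forall>\<^sub>F z in nhds y. c < (\<integral>\<^sup>+v. K v z \<partial>\<nu>)"
proof -
  have "\<forall>\<^sub>F z in inf (nhds y) (principal UNIV). c < (\<integral>\<^sup>+v. K v z \<partial>\<nu>)"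
  proof (rule sequentially_imp_eventually_nhds_within, intro allI impI)
    fix f :: "nat \<Rightarrow> 'b" assume "(\<forall>n. f n \<in> UNIV) \<and> f \<longlonglongrightarrow> y"
    then have f: "f \<longlonglongrightarrow> y" by simp
    have "(\<integral>\<^sup>+v. K v y \<partial>\<nu>) \<le> (\<integral>\<^sup>+v. liminf (\<lambda>n. K v (f n)) \<partial>\<nu>)"
    proof (rule nn_integral_mono)
      fix v
      show "K v y \<le> liminf (\<lambda>n. K v (f n))"
        unfolding le_Liminf_iff
      proof (intro allI impI)
        fix c assume "c < K v y"
        from lsc[OF this] f show "\<forall>\<^sub>F n in sequentially. c < K v (f n)"
          unfolding filterlim_iff by blast
      qed
    qed
    also have "\<dots> \<le> liminf (\<lambda>n. \<integral>\<^sup>+v. K v (f n) \<partial>\<nu>)"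
      by (rule nn_integral_liminf[OF m])
    finally have "c < liminf (\<lambda>n. \<integral>\<^sup>+v. K v (f n) \<partial>\<nu>)" using c by (rule less_le_trans[rotated])
    then show "\<forall>\<^sub>F n in sequentially. c < (\<integral>\<^sup>+v. K v (f n) \<partial>\<nu>)"
      by (rule less_LiminfD)
  qed
  then show ?thesis by simp
qed

locale green_pair =
  fwd: jump_hunt X m j + bwd: jump_hunt Xh m jh
  for X :: "('w, 'x::{heine_borel, second_countable_topology}) process"
    and Xh :: "('v, 'x) process" and m j jh +
  fixes D :: "'x set" and G Gh :: "'x \<Rightarrow> 'x \<Rightarrow> ennreal"
  assumes open_D: "open D"
    and green: "green_functions m X Xh D G Gh"
    and greenian: "greenian G"
    and j_dual: "\<And>x y. x \<noteq> y \<Longrightarrow> j x y = jh y x"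
    and j_pos: "\<And>x y. x \<noteq> y \<Longrightarrow> 0 < j x y"
begin

text \<open>Every result for the process becomes one for its dual, with the variables of the Green
  function exchanged.\<close>

lemma swap: "green_pair Xh X m jh j D Gh G"
proof (intro green_pair.intro green_pair_axioms.intro bwd.jump_hunt_axioms fwd.jump_hunt_axioms open_D)
  show "green_functions m Xh X D Gh G" using green by (auto simp: green_functions_def)
  show "greenian Gh" using greenian green by (auto simp: greenian_def green_functions_def)
  show "jh x y = j y x" "0 < jh x y" if "x \<noteq> y" for x y using j_dual[of y x] j_pos[of y x] that by auto
qed

lemma kernel: "green_kernel m X D G" "green_kernel m Xh D Gh" and dual: "Gh y x = G x y"
  using green by (auto simp: green_functions_def)

lemma G_measurable: "(\<lambda>(x, y). G x y) \<in> borel_measurable (borel \<Otimes>\<^sub>M borel)"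
  using kernel(1) by (simp add: green_kernel_def)

lemma G_measurable' [measurable]: "(\<lambda>z. G (fst z) (snd z)) \<in> borel_measurable (borel \<Otimes>\<^sub>M borel)"
  using G_measurable by (simp add: split_beta)

lemma G_section [measurable]: "G x \<in> borel_measurable borel" "(\<lambda>x. G x y) \<in> borel_measurable borel"
proof -
  have "(\<lambda>v. (x, v)) \<in> borel \<rightarrow>\<^sub>M borel \<Otimes>\<^sub>M borel" "(\<lambda>u. (u, y)) \<in> borel \<rightarrow>\<^sub>M borel \<Otimes>\<^sub>M borel"
    by measurable
  from this[THEN measurable_compose[OF _ G_measurable]]
  show "G x \<in> borel_measurable borel" "(\<lambda>x. G x y) \<in> borel_measurable borel" by simp_all
qed

lemma G_outside: "x \<notin> D \<or> y \<notin> D \<Longrightarrow> G x y = 0"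
  using kernel(1) by (simp add: green_kernel_def)

lemma G_finite: "x \<noteq> y \<Longrightarrow> G x y < \<top>"
  using greenian by (simp add: greenian_def)

lemma occ_green:
  assumes f: "f \<in> borel_measurable borel" and x: "x \<in> D"
  shows "fwd.occ D f x = (\<integral>\<^sup>+y. G x y * f y \<partial>m)"
proof -
  have "fwd.occ D f x = (\<integral>\<^sup>+y\<in>D. G x y * f y \<partial>m)"
    using kernel(1) f x unfolding green_kernel_def fwd.occ_def fwd.occ_path_def by blast
  also have "\<dots> = (\<integral>\<^sup>+y. G x y * f y \<partial>m)"
    by (intro nn_integral_cong) (auto simp: indicator_def G_outside)
  finally show ?thesis .
qed

lemma excessive_bwd: "x \<in> D \<Longrightarrow> killed_excessive Xh D (\<lambda>y. G x y)"
  using kernel(2) dual by (simp add: green_kernel_def)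

lemma G_lsc_bwd: "y \<in> D \<Longrightarrow> c < G v y \<Longrightarrow> \<forall>\<^sub>F z in nhds y. c < G v z"
proof -
  assume y: "y \<in> D" and c: "c < G v y"
  then have "v \<in> D" using G_outside by (metis not_less_zero)
  from bwd.excessive_lsc[OF open_D excessive_bwd[OF this] y c] show ?thesis .
qed

text \<open>Integration in the second variable gives the relations between \<open>G x\<close> and its exit average
  almost everywhere; both sides are excessive for the dual process, so they hold everywhere.\<close>

context
  fixes U x assumes U: "open U" "U \<subseteq> D" and x: "x \<in> U"
begin

lemma exit_green_measurable: "(\<lambda>y. fwd.exit_int U (\<lambda>v. G v y) x) \<in> borel_measurable borel"
proof -
  interpret fm: finite_measure "fwd.exit_law U x" by (rule fwd.finite_exit_law[OF U(1)])
  have "(\<lambda>(y, v). G v y) \<in> borel_measurable (borel \<Otimes>\<^sub>M fwd.exit_law U x)"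
  proof -
    have "(\<lambda>z. (snd z, fst z)) \<in> borel \<Otimes>\<^sub>M borel \<rightarrow>\<^sub>M borel \<Otimes>\<^sub>M (borel :: 'x measure)" by measurable
    from measurable_compose[OF this G_measurable]
    show ?thesis by (simp add: split_beta cong: measurable_cong_sets sets_pair_measure_cong)
  qed
  from fm.borel_measurable_nn_integral[OF this]
  have "(\<lambda>y. \<integral>\<^sup>+v. G v y \<partial>fwd.exit_law U x) \<in> borel_measurable borel" by simp
  then show ?thesis using U by (simp add: fwd.exit_int_eq)
qed

lemma exit_green_integral:
  assumes f: "f \<in> borel_measurable borel"
  shows "(\<integral>\<^sup>+y. G x y * f y \<partial>m) = fwd.occ U f x + (\<integral>\<^sup>+y. fwd.exit_int U (\<lambda>v. G v y) x * f y \<partial>m)"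
proof -
  interpret fm: finite_measure "fwd.exit_law U x" by (rule fwd.finite_exit_law[OF U(1)])
  interpret sf: sigma_finite_measure m by (rule fwd.sigma_finite_m)
  interpret ps: pair_sigma_finite "fwd.exit_law U x" m ..
  note f[measurable]
  have xD: "x \<in> D" using x U by auto
  have gm: "(\<lambda>(v, y). G v y * f y) \<in> borel_measurable (fwd.exit_law U x \<Otimes>\<^sub>M m)"
  proof -
    have "(\<lambda>(v, y). G v y * f y) \<in> borel_measurable (borel \<Otimes>\<^sub>M borel)" unfolding split_beta by measurable
    then show ?thesis using fwd.sets_m by (simp cong: measurable_cong_sets sets_pair_measure_cong)
  qed
  have om: "(\<lambda>v. fwd.occ D f v * indicator D v) \<in> borel_measurable borel"
  proof -
    have [measurable]: "D \<in> sets borel" using open_D by simp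
    show ?thesis using fwd.occ_measurable[OF open_D f] by measurable
  qed
  have eq: "fwd.occ D f v * indicator D v = (\<integral>\<^sup>+y. G v y * f y \<partial>m)" for v
    using occ_green[OF f, of v] by (cases "v \<in> D") (auto simp: G_outside)
  have "(\<integral>\<^sup>+y. G x y * f y \<partial>m) = fwd.occ D f x" by (rule occ_green[OF f xD, symmetric])
  also have "\<dots> = fwd.occ U f x + fwd.exit_int U (\<lambda>v. fwd.occ D f v * indicator D v) x"
    by (rule fwd.occ_split[OF open_D U f x])
  also have "fwd.exit_int U (\<lambda>v. fwd.occ D f v * indicator D v) x =
      (\<integral>\<^sup>+v. \<integral>\<^sup>+y. G v y * f y \<partial>m \<partial>fwd.exit_law U x)"
    using fwd.exit_int_eq[OF U(1) om] unfolding eq .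
  also have "\<dots> = (\<integral>\<^sup>+y. \<integral>\<^sup>+v. G v y * f y \<partial>fwd.exit_law U x \<partial>m)"
    using ps.Fubini'[OF gm] by simp
  also have "\<dots> = (\<integral>\<^sup>+y. fwd.exit_int U (\<lambda>v. G v y) x * f y \<partial>m)"
  proof (intro nn_integral_cong)
    fix y
    have [measurable]: "(\<lambda>v. G v y) \<in> borel_measurable (fwd.exit_law U x)"
      using G_section(2)[of y] by (simp cong: measurable_cong_sets)
    show "(\<integral>\<^sup>+v. G v y * f y \<partial>fwd.exit_law U x) = fwd.exit_int U (\<lambda>v. G v y) x * f y"
      using U by (simp add: nn_integral_multc fwd.exit_int_eq)
  qed
  finally show ?thesis .
qed

lemma exit_green_supermedian:
  assumes y: "y \<in> D"
  shows "killed_op Xh D t (\<lambda>y. fwd.exit_int U (\<lambda>v. G v y) x) y \<le> fwd.exit_int U (\<lambda>v. G v y) x"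
proof -
  interpret fm: finite_measure "fwd.exit_law U x" by (rule fwd.finite_exit_law[OF U(1)])
  interpret km: finite_measure "bwd.killed_law D t y" by (rule bwd.finite_killed_law[OF open_D])
  interpret ps: pair_sigma_finite "bwd.killed_law D t y" "fwd.exit_law U x" ..
  have gm: "(\<lambda>(z, v). G v z) \<in> borel_measurable (bwd.killed_law D t y \<Otimes>\<^sub>M fwd.exit_law U x)"
  proof -
    have "(\<lambda>z. (snd z, fst z)) \<in> borel \<Otimes>\<^sub>M borel \<rightarrow>\<^sub>M borel \<Otimes>\<^sub>M (borel :: 'x measure)" by measurable
    from measurable_compose[OF this G_measurable]
    show ?thesis by (simp add: split_beta cong: measurable_cong_sets sets_pair_measure_cong)
  qed
  have "killed_op Xh D t (\<lambda>y. fwd.exit_int U (\<lambda>v. G v y) x) y =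
      (\<integral>\<^sup>+z. \<integral>\<^sup>+v. G v z \<partial>fwd.exit_law U x \<partial>bwd.killed_law D t y)"
    using bwd.killed_op_eq[OF open_D exit_green_measurable] U by (simp add: fwd.exit_int_eq)
  also have "\<dots> = (\<integral>\<^sup>+v. \<integral>\<^sup>+z. G v z \<partial>bwd.killed_law D t y \<partial>fwd.exit_law U x)"
    using ps.Fubini'[OF gm] by simp
  also have "\<dots> \<le> (\<integral>\<^sup>+v. G v y \<partial>fwd.exit_law U x)"
  proof (rule nn_integral_mono)
    fix v
    have eq: "(\<integral>\<^sup>+z. G v z \<partial>bwd.killed_law D t y) = killed_op Xh D t (G v) y"
      by (rule bwd.killed_op_eq[OF open_D G_section(1), symmetric])
    show "(\<integral>\<^sup>+z. G v z \<partial>bwd.killed_law D t y) \<le> G v y"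
    proof (cases "v \<in> D")
      case True
      then show ?thesis unfolding eq using excessive_bwd[OF True] y by (auto simp: killed_excessive_def)
    next
      case False
      then show ?thesis by (simp add: G_outside)
    qed
  qed
  finally show ?thesis using U by (simp add: fwd.exit_int_eq)
qed

lemma exit_green_lsc:
  assumes y: "y \<in> D" and c: "c < fwd.exit_int U (\<lambda>v. G v y) x"
  shows "\<forall>\<^sub>F z in nhds y. c < fwd.exit_int U (\<lambda>v. G v z) x"
proof -
  have "\<forall>\<^sub>F z in nhds y. c < (\<integral>\<^sup>+v. G v z \<partial>fwd.exit_law U x)"
    using c U G_section(2)
    by (intro lsc_integral G_lsc_bwd[OF y]) (auto simp: fwd.exit_int_eq cong: measurable_cong_sets)
  then show ?thesis using U by (simp add: fwd.exit_int_eq)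
qed

lemma exit_green_le:
  assumes y: "y \<in> D"
  shows "fwd.exit_int U (\<lambda>v. G v y) x \<le> G x y"
proof (rule bwd.excessive_comparison[OF open_D subset_refl y open_D exit_green_measurable G_section(1)])
  show "AE z in m. z \<in> D \<longrightarrow> fwd.exit_int U (\<lambda>v. G v z) x \<le> G x z"
  proof (rule AE_le_from_integrals[OF fwd.sigma_finite_m fwd.sets_m exit_green_measurable G_section(1)])
    show "D \<in> sets borel" using open_D by simp
    fix A :: "'x set" assume "A \<in> sets borel"
    then show "(\<integral>\<^sup>+y. fwd.exit_int U (\<lambda>v. G v y) x * indicator A y \<partial>m) \<le> (\<integral>\<^sup>+y. G x y * indicator A y \<partial>m)"
      using exit_green_integral[of "indicator A"] by simp
  qed
  show "killed_op Xh D t (G x) y \<le> G x y" for t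
    using excessive_bwd[of x] x U y by (auto simp: killed_excessive_def)
qed (rule exit_green_lsc[OF y])

text \<open>For test functions supported off \<open>U\<close> the time spent before the exit
  contributes nothing. The closure is removed in order to have an open set around \<open>y\<close>
  on which the identity holds almost everywhere.\<close>

lemma exit_green_eq:
  assumes y: "y \<in> D" "y \<notin> closure U"
  shows "fwd.exit_int U (\<lambda>v. G v y) x = G x y"
proof (rule antisym[OF exit_green_le[OF y(1)]])
  have V: "open (D - closure U)" "D - closure U \<subseteq> D" "y \<in> D - closure U"
    using open_D y by auto
  show "G x y \<le> fwd.exit_int U (\<lambda>v. G v y) x"
  proof (rule bwd.excessive_comparison[OF V open_D G_section(1) exit_green_measurable])
    show "AE z in m. z \<in> D - closure U \<longrightarrow> G x z \<le> fwd.exit_int U (\<lambda>v. G v z) x"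
    proof (rule AE_le_from_integrals[OF fwd.sigma_finite_m fwd.sets_m G_section(1) exit_green_measurable])
      show "D - closure U \<in> sets borel" using V by simp
      fix A :: "'x set" assume A: "A \<in> sets borel" "A \<subseteq> D - closure U"
      have "fwd.occ U (indicator A) x = fwd.occ U (\<lambda>_. 0) x"
        using A closure_subset[of U] by (intro fwd.occ_cong) (auto simp: indicator_def)
      also have "\<dots> = 0" using fwd.occ_cmult[OF U(1), of "\<lambda>_. 0" 0 x] by simp
      finally show "(\<integral>\<^sup>+y. G x y * indicator A y \<partial>m) \<le> (\<integral>\<^sup>+y. fwd.exit_int U (\<lambda>v. G v y) x * indicator A y \<partial>m)"
        using exit_green_integral[of "indicator A"] A by simp
    qed
    show "killed_op Xh D t (\<lambda>y. fwd.exit_int U (\<lambda>v. G v y) x) y \<le> fwd.exit_int U (\<lambda>v. G v y) x" for t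
      by (rule exit_green_supermedian[OF y(1)])
  qed (rule G_lsc_bwd[OF y(1)])
qed

end

text \<open>If \<open>w\<close> carries mass and \<open>G w w = \<infinity>\<close>, jumps onto \<open>w\<close> would make \<open>G x w\<close> infinite.\<close>

lemma AE_G_finite:
  assumes w: "w \<in> D" and x: "x \<in> D" "x \<noteq> w"
  shows "AE v in m. G v w < \<top>"
proof (cases "emeasure m {w} = 0")
  case True
  then have "{w} \<in> null_sets m" using fwd.sets_m by (auto simp: null_sets_def)
  then have "AE v in m. v \<noteq> w" using AE_not_in by fastforce
  then show ?thesis by eventually_elim (rule G_finite)
next
  case False
  obtain e where e: "0 < e" "ball x e \<subseteq> D" using open_D x open_contains_ball by blast
  define U where "U = ball x (min e (dist x w / 2))"
  have d: "0 < dist x w" using x by simp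
  have U: "open U" "U \<subseteq> D" "x \<in> U" using e d by (auto simp: U_def)
  have "closure U \<subseteq> cball x (dist x w / 2)"
    unfolding U_def by (rule closure_minimal) auto
  then have wU: "w \<notin> closure U" using d by auto
  have fm: "fwd.jump_int {w} (\<lambda>v. G v w) \<in> borel_measurable borel"
    by (rule fwd.jump_int_measurable) auto
  have ji: "fwd.jump_int {w} (\<lambda>v. G v w) u = G w w * ennreal (j u w) * emeasure m {w}" for u
  proof -
    have "fwd.jump_int {w} (\<lambda>v. G v w) u = (\<integral>\<^sup>+v. G w w * ennreal (j u w) * indicator {w} v \<partial>m)"
      unfolding fwd.jump_int_def by (intro nn_integral_cong) (auto simp: indicator_def)
    then show ?thesis using fwd.sets_m by (simp add: nn_integral_cmult_indicator)
  qed
  have "G w w < \<top>"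
  proof (rule ccontr)
    assume "\<not> G w w < \<top>"
    then have top: "G w w = \<top>" using top.not_eq_extremum by blast
    have jt: "fwd.jump_int {w} (\<lambda>v. G v w) u = \<top>" if "u \<in> U" for u
    proof -
      have "u \<noteq> w" using that wU closure_subset by blast
      then show ?thesis unfolding ji top using j_pos[of u w] False by (simp add: ennreal_top_mult ennreal_mult_eq_top_iff)
    qed
    have pos: "0 < fwd.occ U (\<lambda>_. 1) x" by (rule fwd.occ_pos[OF U(1,3)]) auto
    have "\<top> = \<top> * fwd.occ U (\<lambda>_. 1) x" using pos by (simp add: ennreal_top_mult)
    also have "\<dots> = fwd.occ U (\<lambda>_. \<top> * 1) x" by (rule fwd.occ_cmult[symmetric, OF U(1)]) simp
    also have "\<dots> = fwd.occ U (fwd.jump_int {w} (\<lambda>v. G v w)) x" by (rule fwd.occ_cong) (simp add: jt)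
    also have "\<dots> = fwd.exit_int U (\<lambda>v. G v w * indicator {w} v) x"
      using wU by (intro fwd.levy_exit[symmetric, OF U(1,3)]) auto
    also have "\<dots> \<le> fwd.exit_int U (\<lambda>v. G v w) x"
      by (rule fwd.exit_int_mono) (auto simp: indicator_def)
    also have "\<dots> \<le> G x w" by (rule exit_green_le[OF U w])
    also have "\<dots> < \<top>" by (rule G_finite[OF x(2)])
    finally show False by simp
  qed
  then have "G v w < \<top>" for v using G_finite[of v w] by (cases "v = w") auto
  then show ?thesis by simp
qed

lemma potential_pos:
  assumes B: "open B" "x \<in> B" "x \<in> D" "\<And>v. v \<in> B \<Longrightarrow> v \<in> D \<Longrightarrow> 0 < F v" and F[measurable]: "F \<in> borel_measurable borel"
  shows "0 < (\<integral>\<^sup>+v. F v * G x v \<partial>m)"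
proof -
  have o: "open (B \<inter> D)" "x \<in> B \<inter> D" using B open_D by auto
  have "0 < fwd.occ (B \<inter> D) F x" using B by (intro fwd.occ_pos[OF o F]) auto
  also have "\<dots> \<le> fwd.occ D F x"
    using fwd.occ_split[OF open_D o(1) _ F o(2)] by auto
  also have "\<dots> = (\<integral>\<^sup>+v. F v * G x v \<partial>m)" using occ_green[OF F B(3)] by (simp add: mult.commute)
  finally show ?thesis .
qed

end

section \<open>Condition F1 for extended-valued data\<close>

context jump_hunt
begin

text \<open>F1 speaks of one function on the whole space: here the data outside \<open>U\<close>
  together with their exit mean inside.\<close>

definition harm_ext :: "'x set \<Rightarrow> ('x \<Rightarrow> ennreal) \<Rightarrow> 'x \<Rightarrow> ennreal" where
  "harm_ext U f x = (if x \<in> U then exit_int U f x else f x)"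

text \<open>The integral in F1 for \<open>a = 3/4\<close>, the value fixed throughout.\<close>

definition far_int :: "'x \<Rightarrow> real \<Rightarrow> ('x \<Rightarrow> ennreal) \<Rightarrow> ennreal" where
  "far_int z0 r f = (\<integral>\<^sup>+y\<in>- closure (ball z0 (3 * r / 8)). ennreal (j z0 y) * f y \<partial>m)"

lemma harm_ext_measurable:
  "open U \<Longrightarrow> f \<in> borel_measurable borel \<Longrightarrow> harm_ext U f \<in> borel_measurable borel"
proof -
  assume U: "open U" and f: "f \<in> borel_measurable borel"
  have [measurable]: "U \<in> sets borel" using U by simp
  show ?thesis
    using exit_int_measurable[OF U f] f unfolding harm_ext_def[abs_def] by measurable
qed

text \<open>F1 is about finite functions, while the data \<open>f\<close> may be
  \<open>\<top>\<close> on a null set. Passing to \<open>enn2real\<close> changes neither side: the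
  exit law does not charge the infinite values because its integral of \<open>f\<close> is finite,
  and \<open>m\<close> does not charge them by assumption.\<close>

lemma F1_bounds:
  assumes F1: "cond_F1 m X j z0 R"
  obtains C :: real where "1 \<le> C"
    "\<And>r U f x. 0 < r \<Longrightarrow> ereal r < R \<Longrightarrow> open U \<Longrightarrow> U \<subseteq> ball z0 r \<Longrightarrow> f \<in> borel_measurable borel \<Longrightarrow>
       (\<And>x. x \<in> U \<Longrightarrow> exit_int U f x < \<top>) \<Longrightarrow> (AE v in m. v \<notin> U \<longrightarrow> f v < \<top>) \<Longrightarrow>
       (\<And>v. v \<in> ball z0 r \<Longrightarrow> v \<notin> U \<Longrightarrow> f v = 0) \<Longrightarrow> x \<in> U \<Longrightarrow> x \<in> ball z0 (r / 8) \<Longrightarrow>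
       exit_int U f x \<le> ennreal C * (mean_exit X U x * far_int z0 r (harm_ext U f)) \<and>
       mean_exit X U x * far_int z0 r (harm_ext U f) \<le> ennreal C * exit_int U f x"
proof -
  from F1[unfolded cond_F1_def, rule_format, of "3/4"] obtain C where C: "1 \<le> C"
    and b: "\<And>r U g x. 0 < r \<and> ereal r < R \<and> open U \<and> U \<subseteq> ball z0 r \<and> regular_harmonic X U g \<and>
             (\<forall>x\<in>ball z0 r \<inter> (- closure U \<union> regular_points X U). g x = 0) \<Longrightarrow>
             x\<in>U \<inter> ball z0 (r / 8) \<Longrightarrow>
                let I = (\<integral>\<^sup>+y\<in>- closure (ball z0 (3/4 * r / 2)). ennreal (j z0 y) * ennreal (g y) \<partial>m)
                in ennreal (inverse C) * mean_exit X U x * I \<le> ennreal (g x) \<and>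
                   ennreal (g x) \<le> ennreal C * mean_exit X U x * I"
    by force
  show thesis
  proof (rule that[OF C])
    fix r U f x
    assume r: "0 < r" "ereal r < R" and U: "open U" "U \<subseteq> ball z0 r"
      and f[measurable]: "f \<in> borel_measurable borel" and fin: "\<And>x. x \<in> U \<Longrightarrow> exit_int U f x < \<top>"
      and ae: "AE v in m. v \<notin> U \<longrightarrow> f v < \<top>" and zero: "\<And>v. v \<in> ball z0 r \<Longrightarrow> v \<notin> U \<Longrightarrow> f v = 0"
      and x: "x \<in> U" "x \<in> ball z0 (r / 8)"
    define H where "H = harm_ext U f"
    define g where "g v = enn2real (H v)" for v
    have Hm[measurable]: "H \<in> borel_measurable borel" unfolding H_def by (rule harm_ext_measurable[OF U(1) f])
    have gm: "g \<in> borel_measurable borel" unfolding g_def by measurable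
    have gU: "ennreal (g v) = exit_int U f v" if "v \<in> U" for v
      using fin[OF that] that by (simp add: g_def H_def harm_ext_def)
    have "regular_harmonic X U g"
      unfolding regular_harmonic_def
    proof (intro conjI ballI gm allI)
      show "0 \<le> g v" for v by (simp add: g_def)
      fix v assume v: "v \<in> U"
      have "exit_int U f v = (\<integral>\<^sup>+u. f u \<partial>exit_law U v)" by (rule exit_int_eq[OF U(1) f])
      also have "\<dots> = (\<integral>\<^sup>+u. ennreal (g u) \<partial>exit_law U v)"
      proof (rule nn_integral_cong_AE)
        have "(\<integral>\<^sup>+u. f u \<partial>exit_law U v) \<noteq> \<infinity>"
          using fin[OF v] exit_int_eq[OF U(1) f, of v] by simp
        then have "AE u in exit_law U v. f u \<noteq> \<infinity>"
          by (rule nn_integral_noteq_infinite[rotated]) (simp cong: measurable_cong_sets)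
        then show "AE u in exit_law U v. f u = ennreal (g u)"
          using exit_law_AE_notin[OF U(1), of v]
          by eventually_elim (simp add: g_def H_def harm_ext_def top.not_eq_extremum)
      qed
      also have "\<dots> = exit_int U (\<lambda>y. ennreal (g y)) v"
        using gm by (intro exit_int_eq[symmetric, OF U(1)]) auto
      also have "\<dots> = (\<integral>\<^sup>+\<omega>\<in>{\<omega>. exit_time X U \<omega> < lifetime X \<omega>}.
            ext0 (\<lambda>y. ennreal (g y)) (traj X (exit_time X U \<omega>) \<omega>) \<partial>start X v)"
        unfolding exit_int_def
      proof (rule nn_integral_cong)
        fix \<omega>
        show "ext0 (\<lambda>y. ennreal (g y)) (traj X (exit_time X U \<omega>) \<omega>) =
          ext0 (\<lambda>y. ennreal (g y)) (traj X (exit_time X U \<omega>) \<omega>) * indicator {\<omega>. exit_time X U \<omega> < lifetime X \<omega>} \<omega>"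
          using less_lifetime[of "exit_time X U \<omega>" \<omega>]
          by (cases "traj X (exit_time X U \<omega>) \<omega>") auto
      qed
      finally show "ennreal (g v) = (\<integral>\<^sup>+\<omega>\<in>{\<omega>. exit_time X U \<omega> < lifetime X \<omega>}.
            ext0 (\<lambda>y. ennreal (g y)) (traj X (exit_time X U \<omega>) \<omega>) \<partial>start X v)"
        using gU[OF v] by simp
    qed
    \<comment> \<open>The points at which F1 asks for zeros are outside \<open>U\<close>, because an
      open set contains none of its frontier points; there the data vanish by assumption.\<close>
    moreover have "g v = 0" if "v \<in> ball z0 r \<inter> (- closure U \<union> regular_points X U)" for v
    proof -
      have "v \<notin> U" using that closure_subset[of U] U(1)
        by (auto simp: regular_points_def frontier_def interior_open)
      then show ?thesis using zero[of v] that by (simp add: g_def H_def harm_ext_def)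
    qed
    ultimately have *: "ennreal (inverse C) * mean_exit X U x * far_int z0 r (\<lambda>y. ennreal (g y)) \<le> ennreal (g x) \<and>
        ennreal (g x) \<le> ennreal C * mean_exit X U x * far_int z0 r (\<lambda>y. ennreal (g y))"
      using b[of r U g x] r U x by (auto simp: Let_def far_int_def field_simps)
    have I: "far_int z0 r (\<lambda>y. ennreal (g y)) = far_int z0 r H"
      unfolding far_int_def
    proof (rule nn_integral_cong_AE, use ae in eventually_elim)
      case (elim v)
      then have "H v < \<top>" using fin[of v] by (auto simp: H_def harm_ext_def)
      then show ?case by (simp add: g_def)
    qed
    have "mean_exit X U x * far_int z0 r H \<le> ennreal C * exit_int U f x"
    proof -
      have "mean_exit X U x * far_int z0 r H = ennreal C * (ennreal (inverse C) * mean_exit X U x * far_int z0 r H)"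
        using C by (simp add: mult.assoc[symmetric] flip: ennreal_mult)
      also have "\<dots> \<le> ennreal C * ennreal (g x)" using * I by (intro mult_left_mono) auto
      finally show ?thesis using gU[OF x(1)] by simp
    qed
    then show "exit_int U f x \<le> ennreal C * (mean_exit X U x * far_int z0 r (harm_ext U f)) \<and>
       mean_exit X U x * far_int z0 r (harm_ext U f) \<le> ennreal C * exit_int U f x"
      using * I gU[OF x(1)] unfolding H_def[symmetric] by (simp add: mult.assoc)
  qed
qed

end

section \<open>Boundary ratios of harmonic functions\<close>

context jump_hunt
begin

text \<open>F1 with its constant named, so that a locale can fix it for all radii, open sets and
  data.\<close>

definition F1_with :: "real \<Rightarrow> 'x \<Rightarrow> ereal \<Rightarrow> bool" where
  "F1_with C z0 R \<longleftrightarrow> 1 \<le> C \<and>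
    (\<forall>r U f x. 0 < r \<and> ereal r < R \<and> open U \<and> U \<subseteq> ball z0 r \<and> f \<in> borel_measurable borel \<and>
       (\<forall>x\<in>U. exit_int U f x < \<top>) \<and> (AE v in m. v \<notin> U \<longrightarrow> f v < \<top>) \<and>
       (\<forall>v\<in>ball z0 r - U. f v = 0) \<and> x \<in> U \<and> x \<in> ball z0 (r / 8) \<longrightarrow>
       exit_int U f x \<le> ennreal C * (mean_exit X U x * far_int z0 r (harm_ext U f)) \<and>
       mean_exit X U x * far_int z0 r (harm_ext U f) \<le> ennreal C * exit_int U f x)"

lemma F1_with_exists:
  assumes "cond_F1 m X j z0 R"
  shows "\<exists>C. F1_with C z0 R"
proof (rule F1_bounds[OF assms])
  fix C :: real
  assume C: "1 \<le> C" and
    *: "\<And>r U f x. 0 < r \<Longrightarrow> ereal r < R \<Longrightarrow> open U \<Longrightarrow> U \<subseteq> ball z0 r \<Longrightarrow> f \<in> borel_measurable borel \<Longrightarrow>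
       (\<And>x. x \<in> U \<Longrightarrow> exit_int U f x < \<top>) \<Longrightarrow> (AE v in m. v \<notin> U \<longrightarrow> f v < \<top>) \<Longrightarrow>
       (\<And>v. v \<in> ball z0 r \<Longrightarrow> v \<notin> U \<Longrightarrow> f v = 0) \<Longrightarrow> x \<in> U \<Longrightarrow> x \<in> ball z0 (r / 8) \<Longrightarrow>
       exit_int U f x \<le> ennreal C * (mean_exit X U x * far_int z0 r (harm_ext U f)) \<and>
       mean_exit X U x * far_int z0 r (harm_ext U f) \<le> ennreal C * exit_int U f x"
  have "F1_with C z0 R"
    unfolding F1_with_def
  proof (rule conjI[OF C], intro allI, rule impI)
    fix r U f x
    assume "0 < r \<and> ereal r < R \<and> open U \<and> U \<subseteq> ball z0 r \<and> f \<in> borel_measurable borel \<and>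
       (\<forall>x\<in>U. exit_int U f x < \<top>) \<and> (AE v in m. v \<notin> U \<longrightarrow> f v < \<top>) \<and>
       (\<forall>v\<in>ball z0 r - U. f v = 0) \<and> x \<in> U \<and> x \<in> ball z0 (r / 8)"
    then show "exit_int U f x \<le> ennreal C * (mean_exit X U x * far_int z0 r (harm_ext U f)) \<and>
       mean_exit X U x * far_int z0 r (harm_ext U f) \<le> ennreal C * exit_int U f x"
      by (elim conjE, intro *) simp_all
  qed
  then show ?thesis ..
qed

text \<open>Harmonicity is asked in all balls of radius up to \<open>r0\<close>, as F1 is applied
  over shrinking ones. Elsewhere finiteness is asked only off a null set, to admit Green functions
  that are infinite at their pole.\<close>

definition bdry_harm :: "'x set \<Rightarrow> 'x \<Rightarrow> real \<Rightarrow> ('x \<Rightarrow> ennreal) \<Rightarrow> bool" where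
  "bdry_harm D z0 r0 f \<longleftrightarrow> f \<in> borel_measurable borel \<and> (\<forall>x. x \<notin> D \<longrightarrow> f x = 0) \<and>
     (\<forall>r x. 0 < r \<and> r \<le> r0 \<and> x \<in> D \<inter> ball z0 r \<longrightarrow> exit_int (D \<inter> ball z0 r) f x = f x \<and> f x < \<top>) \<and>
     (AE v in m. f v < \<top>)"

end

text \<open>C1 enters only with the radii \<open>s / 2\<close> and \<open>s\<close>, so one
  constant, that of the ratio \<open>2\<close>, serves all scales.\<close>

locale bdry_point = jump_hunt X m j
  for X :: "('w, 'x::{heine_borel, second_countable_topology}) process" and m j +
  fixes D :: "'x set" and z0 :: 'x and R :: ereal and C c1 :: real
  assumes D: "open D" and z0: "z0 \<in> frontier D" and R: "0 < R"
    and F1: "F1_with C z0 R"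
    and c1: "0 < c1"
    and C1: "\<And>s u w. 0 < s \<Longrightarrow> ereal s < R \<Longrightarrow> u \<in> ball z0 (s / 2) \<Longrightarrow> w \<notin> ball z0 s \<Longrightarrow> j u w \<le> c1 * j z0 w"
begin

abbreviation "U r \<equiv> D \<inter> ball z0 r"
abbreviation "T r x \<equiv> mean_exit X (U r) x"
abbreviation "near r f \<equiv> jump_int (ball z0 r) f z0"
abbreviation "far r f \<equiv> jump_int (- ball z0 r) f z0"
abbreviation "full f \<equiv> jump_int UNIV f z0"

lemma C_ge: "1 \<le> C" using F1 by (simp add: F1_with_def)

lemma z0_notin: "z0 \<notin> D" using z0 D by (simp add: frontier_def interior_open)

lemma open_U: "open (U r)" using D by auto

lemma ball_borel [measurable]: "ball (a :: 'x) s \<in> sets borel" "- ball (a :: 'x) s \<in> sets borel"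
  by simp_all

lemma U_nonempty: "0 < r \<Longrightarrow> U r \<noteq> {}"
proof -
  assume r: "0 < r"
  have "z0 \<in> closure D" using z0 by (simp add: frontier_def)
  then obtain y where "y \<in> D" "dist y z0 < r" using r closure_approachable by blast
  then show ?thesis by (auto simp: dist_commute)
qed

lemma T_pos: "x \<in> U r \<Longrightarrow> 0 < T r x"
  unfolding mean_exit_eq by (rule occ_pos[OF open_U]) auto

lemma F1_use:
  assumes r: "0 < r" "ereal r < R" and f: "f \<in> borel_measurable borel"
    and fin: "\<And>x. x \<in> U r \<Longrightarrow> exit_int (U r) f x < \<top>" and ae: "AE v in m. f v < \<top>"
    and zero: "\<And>v. v \<notin> D \<Longrightarrow> f v = 0" and x: "x \<in> U (r / 8)"
  shows "exit_int (U r) f x \<le> ennreal C * (T r x * far_int z0 r (harm_ext (U r) f))"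
    and "T r x * far_int z0 r (harm_ext (U r) f) \<le> ennreal C * exit_int (U r) f x"
proof -
  have ae': "AE v in m. v \<notin> U r \<longrightarrow> f v < \<top>" using ae by eventually_elim simp
  have xU: "x \<in> U r" "x \<in> ball z0 (r / 8)" using x r by auto
  show "exit_int (U r) f x \<le> ennreal C * (T r x * far_int z0 r (harm_ext (U r) f))"
    "T r x * far_int z0 r (harm_ext (U r) f) \<le> ennreal C * exit_int (U r) f x"
    using F1[unfolded F1_with_def, THEN conjunct2, THEN spec, THEN spec, THEN spec, THEN spec, THEN mp, of r "U r" f x]
      r open_U f fin ae' zero xU by auto
qed

text \<open>Boundary Harnack principle: up to constants F1 factorises a harmonic function into the
  mean exit time at the point and an integral that depends on the function alone. In the cross
  product these factors match, and each of the four uses of F1 costs a factor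
  \<open>C\<close>.\<close>

lemma cross:
  assumes r: "0 < r" "ereal r < R" and xy: "x \<in> U (r / 8)" "y \<in> U (r / 8)"
    and f: "f \<in> borel_measurable borel" "\<And>x. x \<in> U r \<Longrightarrow> exit_int (U r) f x < \<top>"
      "AE v in m. f v < \<top>" "\<And>v. v \<notin> D \<Longrightarrow> f v = 0"
    and g: "g \<in> borel_measurable borel" "\<And>x. x \<in> U r \<Longrightarrow> exit_int (U r) g x < \<top>"
      "AE v in m. g v < \<top>" "\<And>v. v \<notin> D \<Longrightarrow> g v = 0"
  shows "exit_int (U r) f x * exit_int (U r) g y \<le> ennreal (C ^ 4) * (exit_int (U r) f y * exit_int (U r) g x)"
proof -
  define I where "I = far_int z0 r (harm_ext (U r) f)"
  define J where "J = far_int z0 r (harm_ext (U r) g)"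
  have "exit_int (U r) f x * exit_int (U r) g y \<le> (ennreal C * (T r x * I)) * (ennreal C * (T r y * J))"
    unfolding I_def J_def using r xy f g by (intro mult_mono F1_use) auto
  also have "\<dots> = ennreal C * ennreal C * ((T r y * I) * (T r x * J))"
    by (simp add: ac_simps)
  also have "\<dots> \<le> ennreal C * ennreal C * ((ennreal C * exit_int (U r) f y) * (ennreal C * exit_int (U r) g x))"
    unfolding I_def J_def using r xy f g by (intro mult_mono F1_use) auto
  also have "\<dots> = (ennreal C * ennreal C * ennreal C * ennreal C) * (exit_int (U r) f y * exit_int (U r) g x)"
    by (simp add: ac_simps)
  also have "ennreal C * ennreal C * ennreal C * ennreal C = ennreal (C ^ 4)"
    using C_ge by (simp add: power4_eq_xxxx mult.assoc flip: ennreal_mult)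
  finally show ?thesis .
qed

lemma bdry_harmD:
  assumes "bdry_harm D z0 r0 f"
  shows "f \<in> borel_measurable borel" "\<And>x. x \<notin> D \<Longrightarrow> f x = 0" "AE v in m. f v < \<top>"
    "\<And>r x. 0 < r \<Longrightarrow> r \<le> r0 \<Longrightarrow> x \<in> U r \<Longrightarrow> exit_int (U r) f x = f x"
    "\<And>r x. 0 < r \<Longrightarrow> r \<le> r0 \<Longrightarrow> x \<in> U r \<Longrightarrow> f x < \<top>"
  using assms unfolding bdry_harm_def by auto

lemma harm_ext_bdry:
  assumes "bdry_harm D z0 r0 f" "0 < r" "r \<le> r0"
  shows "harm_ext (U r) f = f"
  using bdry_harmD(4)[OF assms] by (auto simp: harm_ext_def fun_eq_iff)

lemma bdry_harm_bounds:
  assumes f: "bdry_harm D z0 r0 f" and r: "0 < r" "r \<le> r0" "ereal r < R" and x: "x \<in> U (r / 8)"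
  shows "f x \<le> ennreal C * (T r x * far_int z0 r f)" "T r x * far_int z0 r f \<le> ennreal C * f x"
proof -
  have "x \<in> U r" using x r by auto
  then have e: "exit_int (U r) f x = f x" by (rule bdry_harmD(4)[OF f r(1,2)])
  show "f x \<le> ennreal C * (T r x * far_int z0 r f)" "T r x * far_int z0 r f \<le> ennreal C * f x"
    using F1_use[OF r(1,3) bdry_harmD(1)[OF f] _ bdry_harmD(3)[OF f] bdry_harmD(2)[OF f] x]
      bdry_harmD(4,5)[OF f r(1,2)] e harm_ext_bdry[OF f r(1,2)] by auto
qed

lemma bdry_harm_cross:
  assumes f: "bdry_harm D z0 r0 f" and g: "bdry_harm D z0 r0 g"
    and r: "0 < r" "r \<le> r0" "ereal r < R" and xy: "x \<in> U (r / 8)" "y \<in> U (r / 8)"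
  shows "f x * g y \<le> ennreal (C ^ 4) * (f y * g x)"
proof -
  have xyU: "x \<in> U r" "y \<in> U r" using xy r by auto
  show ?thesis
    using cross[OF r(1,3) xy bdry_harmD(1)[OF f] _ bdry_harmD(3)[OF f] bdry_harmD(2)[OF f]
        bdry_harmD(1)[OF g] _ bdry_harmD(3)[OF g] bdry_harmD(2)[OF g]]
      bdry_harmD(4,5)[OF f r(1,2)] bdry_harmD(4,5)[OF g r(1,2)] xyU by auto
qed

lemma jump_int_mono_set: "A \<subseteq> B \<Longrightarrow> jump_int A f u \<le> jump_int B f u"
  unfolding jump_int_def by (intro nn_integral_mono) (auto simp: indicator_def)

lemma far_int_eq: "far_int z0 r f = jump_int (- closure (ball z0 (3 * r / 8))) f z0"
  unfolding far_int_def jump_int_def by (intro nn_integral_cong) (simp add: ac_simps)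

lemma far_le_far_int: "0 < r \<Longrightarrow> far r f \<le> far_int z0 r f"
proof -
  assume r: "0 < r"
  have "closure (ball z0 (3 * r / 8)) \<subseteq> cball z0 (3 * r / 8)" by (rule closure_minimal) auto
  also have "\<dots> \<subseteq> ball z0 r" using r by auto
  finally show ?thesis unfolding far_int_eq by (intro jump_int_mono_set) auto
qed

text \<open>Read off from the lower half of F1 at any point of the small ball, where
  \<open>f\<close> is finite and the mean exit time positive.\<close>

lemma far_finite:
  assumes f: "bdry_harm D z0 r0 f" and r: "0 < r" "r \<le> r0" "ereal r < R"
  shows "far_int z0 r f < \<top>" "far r f < \<top>"
proof -
  have "U (r / 8) \<noteq> {}" using U_nonempty[of "r / 8"] r by simp
  then obtain x where x: "x \<in> U (r / 8)" by blast
  have xU: "x \<in> U r" using x r by auto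
  have "T r x * far_int z0 r f \<le> ennreal C * f x" by (rule bdry_harm_bounds(2)[OF f r x])
  also have "\<dots> < \<top>" using bdry_harmD(5)[OF f r(1,2) xU] by (simp add: ennreal_mult_less_top)
  finally have "T r x * far_int z0 r f < \<top>" .
  then show "far_int z0 r f < \<top>" using T_pos[OF xU] by (auto simp: ennreal_mult_less_top)
  with far_le_far_int[OF r(1)] show "far r f < \<top>" by (rule le_less_trans)
qed

lemma bdry_harm_pos:
  assumes f: "bdry_harm D z0 r0 f" and r: "0 < r" "r \<le> r0" "ereal r < R" and x: "x \<in> U (r / 8)"
    and pos: "0 < far_int z0 r f"
  shows "0 < f x"
proof (rule ccontr)
  assume "\<not> 0 < f x"
  then have "T r x * far_int z0 r f = 0" using bdry_harm_bounds(2)[OF f r x] by simp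
  moreover have "x \<in> U r" using x r by auto
  ultimately show False using T_pos[of x r] pos by auto
qed

lemma T_finite:
  assumes f: "bdry_harm D z0 r0 f" and r: "0 < r" "r \<le> r0" "ereal r < R" and x: "x \<in> U (r / 8)"
    and pos: "0 < far_int z0 r f"
  shows "T r x < \<top>"
proof -
  have xU: "x \<in> U r" using x r by auto
  have "T r x * far_int z0 r f \<le> ennreal C * f x" by (rule bdry_harm_bounds(2)[OF f r x])
  also have "\<dots> < \<top>" using bdry_harmD(5)[OF f r(1,2) xU] by (simp add: ennreal_mult_less_top)
  finally show ?thesis using pos by (auto simp: ennreal_mult_less_top)
qed

lemma full_eq:
  assumes f: "f \<in> borel_measurable borel"
  shows "full f = near r f + far r f"
proof -
  note [measurable] = f j_section(1)
  have m: "(\<lambda>v. f v * indicator A v * ennreal (j z0 v)) \<in> borel_measurable m" if [measurable]: "A \<in> sets borel" for A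
    by (rule measurable_m) measurable
  have "full f = (\<integral>\<^sup>+v. f v * indicator (ball z0 r) v * ennreal (j z0 v) + f v * indicator (- ball z0 r) v * ennreal (j z0 v) \<partial>m)"
    unfolding jump_int_def by (intro nn_integral_cong) (auto simp: indicator_def)
  also have "\<dots> = near r f + far r f"
    unfolding jump_int_def by (intro nn_integral_add m) auto
  finally show ?thesis .
qed

text \<open>The Levy system controls the far part, so only the near part has to be compared.\<close>

definition near_part :: "real \<Rightarrow> real \<Rightarrow> ('x \<Rightarrow> ennreal) \<Rightarrow> 'x \<Rightarrow> ennreal" where
  "near_part r s f = exit_int (U r) (\<lambda>v. f v * indicator (ball z0 s) v)"

definition far_part :: "real \<Rightarrow> real \<Rightarrow> ('x \<Rightarrow> ennreal) \<Rightarrow> 'x \<Rightarrow> ennreal" where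
  "far_part r s f = exit_int (U r) (\<lambda>v. f v * indicator (- ball z0 s) v)"

lemma parts_add:
  assumes f: "bdry_harm D z0 r0 f" and r: "0 < r" "r \<le> r0" and x: "x \<in> U r"
  shows "f x = near_part r s f x + far_part r s f x"
proof -
  note [measurable] = bdry_harmD(1)[OF f]
  have "f x = exit_int (U r) f x" by (rule bdry_harmD(4)[OF f r x, symmetric])
  also have "\<dots> = exit_int (U r) (\<lambda>v. f v * indicator (ball z0 s) v + f v * indicator (- ball z0 s) v) x"
    by (rule exit_int_cong[OF open_U]) (auto simp: indicator_def)
  also have "\<dots> = near_part r s f x + far_part r s f x"
    unfolding near_part_def far_part_def by (rule exit_int_add[OF open_U]) measurable
  finally show ?thesis .
qed

lemma far_part_eq:
  assumes f: "bdry_harm D z0 r0 f" and rs: "r < s" and x: "x \<in> U r"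
  shows "far_part r s f x = occ (U r) (jump_int (- ball z0 s) f) x"
  unfolding far_part_def
proof (rule levy_exit[OF open_U x _ _ bdry_harmD(1)[OF f]])
  have "closure (U r) \<subseteq> cball z0 r" by (rule closure_minimal) auto
  also have "\<dots> \<subseteq> ball z0 s" using rs by auto
  finally show "- ball z0 s \<inter> closure (U r) = {}" by auto
qed simp

lemma occ_const: "occ (U r) (\<lambda>_. c) x = c * T r x"
  using occ_cmult[OF open_U, of "\<lambda>_. 1" r c x] by (simp add: mean_exit_eq)

lemma jump_int_le:
  assumes A: "A \<in> sets borel" and f: "f \<in> borel_measurable borel" and c: "0 \<le> c"
    and le: "\<And>w. w \<in> A \<Longrightarrow> j u w \<le> c * j u' w"
  shows "jump_int A f u \<le> ennreal c * jump_int A f u'"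
proof -
  note [measurable] = A f j_section(1)
  have m: "(\<lambda>v. f v * indicator A v * ennreal (j u' v)) \<in> borel_measurable m"
    by (rule measurable_m) measurable
  have "jump_int A f u \<le> (\<integral>\<^sup>+v. ennreal c * (f v * indicator A v * ennreal (j u' v)) \<partial>m)"
    unfolding jump_int_def
  proof (rule nn_integral_mono)
    fix v
    have "ennreal (j u v) \<le> ennreal c * ennreal (j u' v)" if "v \<in> A"
      using le[OF that] c by (simp add: ennreal_mult'[symmetric] ennreal_leI)
    then have "f v * ennreal (j u v) \<le> ennreal c * (f v * ennreal (j u' v))" if "v \<in> A"
      using mult_left_mono[of "ennreal (j u v)" "ennreal c * ennreal (j u' v)" "f v"] that
      by (simp add: mult.left_commute)
    then show "f v * indicator A v * ennreal (j u v) \<le> ennreal c * (f v * indicator A v * ennreal (j u' v))"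
      by (auto simp: indicator_def)
  qed
  also have "\<dots> = ennreal c * jump_int A f u'" unfolding jump_int_def by (rule nn_integral_cmult[OF m])
  finally show ?thesis .
qed

text \<open>The path must jump from within \<open>s / 2\<close> to beyond \<open>s\<close>. By C1
  the rate of such jumps is at most \<open>c1\<close> times that at \<open>z0\<close>, wherever the
  path is, so integrating it over time gives the mean exit time.\<close>

lemma far_part_le:
  assumes f: "bdry_harm D z0 r0 f" and s: "0 < s" "ereal s < R" and r: "r \<le> s / 2" and x: "x \<in> U r"
  shows "far_part r s f x \<le> ennreal c1 * far s f * T r x"
proof -
  have "far_part r s f x = occ (U r) (jump_int (- ball z0 s) f) x"
    using r s by (intro far_part_eq[OF f _ x]) auto
  also have "\<dots> \<le> occ (U r) (\<lambda>_. ennreal c1 * far s f) x"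
    using C1[OF s] r c1 by (intro occ_mono jump_int_le bdry_harmD(1)[OF f]) auto
  finally show ?thesis by (simp add: occ_const)
qed

lemma near_part_finite:
  assumes f: "bdry_harm D z0 r0 f" and r: "0 < r" "r \<le> r0" and x: "x \<in> U r"
  shows "near_part r s f x \<le> f x" "near_part r s f x < \<top>"
proof -
  show "near_part r s f x \<le> f x" unfolding parts_add[OF f r x, of s] by simp
  then show "near_part r s f x < \<top>" using bdry_harmD(5)[OF f r x] by (rule le_less_trans)
qed

text \<open>F1 for the truncated data. Of its integral only the annulus is kept, on which the data
  are those of \<open>f\<close> itself; at an accessible point this share diverges as
  \<open>r\<close> shrinks.\<close>

lemma near_part_ge:
  assumes f: "bdry_harm D z0 r0 f" and r: "0 < r" "r \<le> r0" "ereal r < R" and x: "x \<in> U (r / 8)"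
  shows "jump_int (ball z0 s - ball z0 r) f z0 * T r x \<le> ennreal C * near_part r s f x"
proof -
  define g where "g = (\<lambda>v. f v * indicator (ball z0 s) v)"
  note [measurable] = bdry_harmD(1)[OF f]
  have gm: "g \<in> borel_measurable borel" unfolding g_def by measurable
  have ae: "AE v in m. g v < \<top>" using bdry_harmD(3)[OF f] by eventually_elim (auto simp: g_def indicator_def)
  have "jump_int (ball z0 s - ball z0 r) f z0 \<le> far_int z0 r (harm_ext (U r) g)"
    unfolding far_int_eq jump_int_def
  proof (rule nn_integral_mono)
    fix v
    have "closure (ball z0 (3 * r / 8)) \<subseteq> cball z0 (3 * r / 8)" by (rule closure_minimal) auto
    also have "\<dots> \<subseteq> ball z0 r" using r by auto
    finally show "f v * indicator (ball z0 s - ball z0 r) v * ennreal (j z0 v) \<le>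
       harm_ext (U r) g v * indicator (- closure (ball z0 (3 * r / 8))) v * ennreal (j z0 v)"
      by (auto simp: indicator_def harm_ext_def g_def)
  qed
  then have "jump_int (ball z0 s - ball z0 r) f z0 * T r x \<le> T r x * far_int z0 r (harm_ext (U r) g)"
    by (subst mult.commute) (rule mult_left_mono, auto)
  also have "\<dots> \<le> ennreal C * exit_int (U r) g x"
    using near_part_finite(2)[OF f r(1,2)] bdry_harmD(2)[OF f]
    by (intro F1_use(2)[OF r(1,3) gm _ ae _ x]) (auto simp: near_part_def g_def)
  finally show ?thesis by (simp add: near_part_def g_def)
qed

text \<open>F1 for the truncated data again. Inside \<open>U r\<close> their extension is at most
  \<open>f\<close> by harmonicity, so its integral is at most that of \<open>f\<close> over the ball
  of radius \<open>s\<close>.\<close>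

lemma near_part_le:
  assumes f: "bdry_harm D z0 r0 f" and r: "0 < r" "r \<le> r0" "ereal r < R" and rs: "r \<le> s" and x: "x \<in> U (r / 8)"
  shows "near_part r s f x \<le> ennreal C * (T r x * near s f)"
proof -
  define g where "g = (\<lambda>v. f v * indicator (ball z0 s) v)"
  note [measurable] = bdry_harmD(1)[OF f]
  have gm: "g \<in> borel_measurable borel" unfolding g_def by measurable
  have ae: "AE v in m. g v < \<top>" using bdry_harmD(3)[OF f] by eventually_elim (auto simp: g_def indicator_def)
  have "exit_int (U r) g x \<le> ennreal C * (T r x * far_int z0 r (harm_ext (U r) g))"
    using near_part_finite(2)[OF f r(1,2)] bdry_harmD(2)[OF f]
    by (intro F1_use(1)[OF r(1,3) gm _ ae _ x]) (auto simp: near_part_def g_def)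
  also have "far_int z0 r (harm_ext (U r) g) \<le> near s f"
    unfolding far_int_eq jump_int_def
  proof (rule nn_integral_mono)
    fix v
    have "harm_ext (U r) g v \<le> f v * indicator (ball z0 s) v"
    proof (cases "v \<in> U r")
      case True
      then show ?thesis using near_part_finite(1)[OF f r(1,2) True, of s] rs
        by (auto simp: harm_ext_def near_part_def g_def indicator_def)
    next
      case False then show ?thesis by (simp only: harm_ext_def g_def False if_False order_refl)
    qed
    then show "harm_ext (U r) g v * indicator (- closure (ball z0 (3 * r / 8))) v * ennreal (j z0 v) \<le>
        f v * indicator (ball z0 s) v * ennreal (j z0 v)"
      by (auto simp: indicator_def intro: mult_right_mono)
  qed
  finally show ?thesis by (simp add: near_part_def g_def mult_left_mono)
qed

text \<open>The annuli miss only the centre, where \<open>f\<close> vanishes. Starting with inner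
  radius \<open>s / 2\<close> meets the restriction \<open>r \<le> s / 2\<close> of
  \<open>far_part_le\<close>.\<close>

lemma annulus_tendsto:
  assumes f: "bdry_harm D z0 r0 f" and s: "0 < s"
  shows "(SUP n. jump_int (ball z0 s - ball z0 (s / real (n + 2))) f z0) = near s f"
proof -
  note [measurable] = bdry_harmD(1)[OF f] j_section(1)
  have f0: "f z0 = 0" using bdry_harmD(2)[OF f z0_notin] .
  define A where "A n = ball z0 s - ball z0 (s / real (n + 2))" for n
  have inc: "A n \<subseteq> A k" if "n \<le> k" for n k
  proof -
    have "s / real (k + 2) \<le> s / real (n + 2)" using that s by (intro divide_left_mono) auto
    then show ?thesis unfolding A_def by (intro Diff_mono subset_refl subset_ball)
  qed
  have [measurable]: "A n \<in> sets borel" for n unfolding A_def by simp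
  have m: "(\<lambda>v. f v * indicator (A n) v * ennreal (j z0 v)) \<in> borel_measurable m" for n
    by (rule measurable_m) measurable
  have "(SUP n. jump_int (A n) f z0) = (\<integral>\<^sup>+v. (SUP n. f v * indicator (A n) v * ennreal (j z0 v)) \<partial>m)"
    unfolding jump_int_def
    by (rule nn_integral_monotone_convergence_SUP[symmetric, OF _ m])
      (use inc in \<open>auto simp: incseq_def le_fun_def indicator_def\<close>)
  also have "\<dots> = near s f"
    unfolding jump_int_def
  proof (rule nn_integral_cong)
    fix v
    show "(SUP n. f v * indicator (A n) v * ennreal (j z0 v)) = f v * indicator (ball z0 s) v * ennreal (j z0 v)"
    proof (cases "v \<in> ball z0 s \<and> v \<noteq> z0")
      case True
      then have d: "0 < dist z0 v" by auto
      obtain n where "s / dist z0 v \<le> real n" using real_arch_simple by blast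
      then have "s / dist z0 v \<le> real (n + 2)" by simp
      then have "s / real (n + 2) \<le> dist z0 v" using d s by (simp add: field_simps)
      then have "v \<in> A n" using True by (auto simp: A_def)
      then have "f v * indicator (ball z0 s) v * ennreal (j z0 v) \<le> (SUP n. f v * indicator (A n) v * ennreal (j z0 v))"
        using True by (intro SUP_upper2[of n]) auto
      moreover have "(SUP n. f v * indicator (A n) v * ennreal (j z0 v)) \<le> f v * indicator (ball z0 s) v * ennreal (j z0 v)"
        by (intro SUP_least) (auto simp: A_def indicator_def)
      ultimately show ?thesis by (rule antisym[rotated])
    next
      case False
      then have "f v * indicator (ball z0 s) v = 0" "\<And>n. f v * indicator (A n) v = 0"
        using f0 by (auto simp: A_def indicator_def)
      then show ?thesis by (simp only: mult_zero_left) simp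
    qed
  qed
  finally show ?thesis unfolding A_def .
qed

lemma annulus_large:
  assumes f: "bdry_harm D z0 r0 f" and s: "0 < s" and inf: "near s f = \<top>"
  obtains n0 where "\<And>n. n0 \<le> n \<Longrightarrow> ennreal K \<le> jump_int (ball z0 s - ball z0 (s / real (n + 2))) f z0"
proof -
  have "ennreal K < (SUP n. jump_int (ball z0 s - ball z0 (s / real (n + 2))) f z0)"
    unfolding annulus_tendsto[OF f s] inf by simp
  then obtain n0 where n0: "ennreal K < jump_int (ball z0 s - ball z0 (s / real (n0 + 2))) f z0"
    by (auto simp: less_SUP_iff)
  have "ennreal K \<le> jump_int (ball z0 s - ball z0 (s / real (n + 2))) f z0" if "n0 \<le> n" for n
  proof -
    have "s / real (n + 2) \<le> s / real (n0 + 2)" using that s by (intro divide_left_mono) auto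
    then have "ball z0 s - ball z0 (s / real (n0 + 2)) \<subseteq> ball z0 s - ball z0 (s / real (n + 2))"
      by (intro Diff_mono subset_refl subset_ball)
    from jump_int_mono_set[OF this, of f z0] n0 show ?thesis by auto
  qed
  with that show thesis by blast
qed

end

section \<open>Contraction of the oscillation of a ratio at an accessible point\<close>

lemma oscillation_contract:
  fixes c a A n1 n2 n1' n2' g g' h h' :: real
  assumes c: "1 \<le> c" and pos: "0 < n2" "0 < n2'"
    and eq: "n1 = a * n2 + g" "A * n2 = n1 + h" "n1' = a * n2' + g'" "A * n2' = n1' + h'"
    and le: "g * n2' \<le> c * (g' * n2)" "h' * n2 \<le> c * (h * n2')"
  shows "n1 / n2 - n1' / n2' \<le> (c - 1) / (c + 1) * (A - a)"
proof -
  \<comment> \<open>In terms of the ratios the hypotheses say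
    \<open>\<rho> - a \<le> c * (\<rho>' - a)\<close> and
    \<open>A - \<rho>' \<le> c * (A - \<rho>)\<close>; their sum is the claim.\<close>
  define \<rho> where "\<rho> = n1 / n2"
  define \<rho>' where "\<rho>' = n1' / n2'"
  have n: "n1 = \<rho> * n2" "n1' = \<rho>' * n2'" using pos by (auto simp: \<rho>_def \<rho>'_def)
  have g: "g = (\<rho> - a) * n2" "g' = (\<rho>' - a) * n2'" "h = (A - \<rho>) * n2" "h' = (A - \<rho>') * n2'"
    using eq n by (auto simp: algebra_simps)
  have p: "0 < n2 * n2'" using pos by simp
  have "(\<rho> - a) * (n2 * n2') \<le> (c * (\<rho>' - a)) * (n2 * n2')"
    using le(1) unfolding g by (simp add: algebra_simps)
  then have 1: "\<rho> - a \<le> c * (\<rho>' - a)" using p by (simp add: mult_le_cancel_right)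
  have "(A - \<rho>') * (n2 * n2') \<le> (c * (A - \<rho>)) * (n2 * n2')"
    using le(2) unfolding g by (simp add: algebra_simps)
  then have 2: "A - \<rho>' \<le> c * (A - \<rho>)" using p by (simp add: mult_le_cancel_right)
  have "(c + 1) * (\<rho> - \<rho>') \<le> (c - 1) * (A - a)"
    using 1 2 by (simp add: algebra_simps)
  then show ?thesis
    unfolding \<rho>_def[symmetric] \<rho>'_def[symmetric] using c by (simp add: field_simps)
qed

context bdry_point
begin

text \<open>Both parts are measured against the mean exit time: the far part is at most
  \<open>c1 * L\<close> times it, the near part at least \<open>K / C\<close> times it, and
  \<open>K\<close> can be taken as large as desired because the integral over the annuli
  diverges.\<close>

lemma part_ratio:
  assumes f: "bdry_harm D z0 r0 f" and s: "0 < s" "s \<le> r0" "ereal s < R" and inf: "full f = \<top>" and e: "0 < e"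
  shows "\<exists>n0. \<forall>n\<ge>n0. \<forall>y\<in>U (s / real (n + 2) / 8).
     far_part (s / real (n + 2)) s f y \<le> ennreal e * near_part (s / real (n + 2)) s f y \<and>
     0 < near_part (s / real (n + 2)) s f y"
proof -
  have Lfin: "far s f < \<top>" by (rule far_finite(2)[OF f s])
  then obtain L where L: "far s f = ennreal L" "0 \<le> L" by (cases "far s f") auto
  have near: "near s f = \<top>" using inf Lfin unfolding full_eq[OF bdry_harmD(1)[OF f], of s] by auto
  \<comment> \<open>Makes \<open>c1 * C * L / K\<close> at most \<open>e\<close>; the summand
    \<open>1\<close> keeps \<open>K\<close> positive when \<open>L = 0\<close>.\<close>
  define K where "K = c1 * C * L / e + 1"
  have K: "0 < K" "c1 * C * L \<le> e * K"
  proof -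
    have "0 \<le> c1 * C * L / e" using c1 C_ge L e by (intro divide_nonneg_pos mult_nonneg_nonneg) auto
    then show "0 < K" by (simp add: K_def)
    show "c1 * C * L \<le> e * K" using e by (simp add: K_def distrib_left)
  qed
  obtain n0 where n0: "\<And>n. n0 \<le> n \<Longrightarrow> ennreal K \<le> jump_int (ball z0 s - ball z0 (s / real (n + 2))) f z0"
    using annulus_large[OF f s(1) near] by blast
  show ?thesis
  proof (intro exI[of _ n0] allI impI ballI)
    fix n y assume n: "n0 \<le> n" and y: "y \<in> U (s / real (n + 2) / 8)"
    define r where "r = s / real (n + 2)"
    have r: "0 < r" "r \<le> s / 2" using s by (auto simp: r_def field_simps)
    then have r': "r \<le> r0" "r \<le> s" using s by auto
    have rR: "ereal r < R" using r' s by (meson ereal_less_eq(3) le_less_trans)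
    have y: "y \<in> U (r / 8)" using y by (simp add: r_def)
    have yU: "y \<in> U r" using y r by auto
    have T0: "0 < T r y" by (rule T_pos[OF yU])
    have a: "ennreal K * T r y \<le> ennreal C * near_part r s f y"
      using near_part_ge[OF f r(1) r'(1) rR y, of s] mult_right_mono[OF n0[OF n], of "T r y"]
      by (auto simp: r_def intro: order_trans)
    have fp: "far_part r s f y \<le> ennreal c1 * ennreal L * T r y"
      using far_part_le[OF f s(1,3) r(2) yU] L by simp
    have "near_part r s f y < \<top>" by (rule near_part_finite(2)[OF f r(1) r'(1) yU])
    then obtain N where N: "near_part r s f y = ennreal N" "0 \<le> N" by (cases "near_part r s f y") auto
    have "ennreal K * T r y < \<top>" by (rule le_less_trans[OF a]) (simp add: N ennreal_mult_less_top)
    then have "T r y < \<top>" using K by (auto simp: ennreal_mult_less_top)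
    then obtain t where t: "T r y = ennreal t" "0 < t" using T0 by (cases "T r y") auto
    have Kt: "K * t \<le> C * N"
      using a K C_ge N t by (simp add: ennreal_le_iff flip: ennreal_mult)
    have "far_part r s f y < \<top>" by (rule le_less_trans[OF fp]) (simp add: t ennreal_mult_less_top)
    then obtain P where P: "far_part r s f y = ennreal P" "0 \<le> P" by (cases "far_part r s f y") auto
    have Pt: "P \<le> c1 * L * t"
      using fp P t c1 L by (simp add: ennreal_le_iff flip: ennreal_mult)
    have "K * P \<le> K * (c1 * L * t)" using Pt K by (intro mult_left_mono) auto
    also have "\<dots> = c1 * L * (K * t)" by simp
    also have "\<dots> \<le> c1 * L * (C * N)" using Kt c1 L by (intro mult_left_mono) auto
    also have "\<dots> = (c1 * C * L) * N" by simp
    also have "\<dots> \<le> (e * K) * N" using K N by (intro mult_right_mono) auto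
    finally have "K * P \<le> K * (e * N)" by (simp add: ac_simps)
    then have PeN: "P \<le> e * N" using K by simp
    have "0 < N"
    proof (rule ccontr)
      assume "\<not> 0 < N"
      then have "K * t \<le> 0" using Kt N by auto
      then show False using K t by (simp add: mult_le_0_iff)
    qed
    then show "far_part (s / real (n + 2)) s f y \<le> ennreal e * near_part (s / real (n + 2)) s f y \<and>
     0 < near_part (s / real (n + 2)) s f y"
      unfolding r_def[symmetric] N P using PeN e by (simp add: ennreal_leI flip: ennreal_mult)
  qed
qed

end

locale bdry_ratio = bdry_point X m j D z0 R C c1
  for X :: "('w, 'x::{heine_borel, second_countable_topology}) process" and m j D z0 R C c1 +
  fixes f1 f2 :: "'x \<Rightarrow> ennreal" and r0 :: real
  assumes r0: "0 < r0" "ereal r0 < R"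
    and f1: "bdry_harm D z0 r0 f1" and f2: "bdry_harm D z0 r0 f2"
    and pos1: "\<And>r. 0 < r \<Longrightarrow> r \<le> r0 \<Longrightarrow> 0 < far_int z0 r f1"
    and pos2: "\<And>r. 0 < r \<Longrightarrow> r \<le> r0 \<Longrightarrow> 0 < far_int z0 r f2"
    and E1: "\<And>s e. 0 < s \<Longrightarrow> ereal s < R \<Longrightarrow> 0 < e \<Longrightarrow> \<exists>r>0. \<forall>u\<in>ball z0 r - {z0}. \<forall>w. w \<notin> ball z0 s \<longrightarrow>
        j z0 w \<le> (1 + e) * j u w \<and> j u w \<le> (1 + e) * j z0 w"
begin

definition q :: "'x \<Rightarrow> real" where "q y = enn2real (f1 y) / enn2real (f2 y)"

text \<open>The factor of \<open>oscillation_contract\<close> for the Harnack constant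
  \<open>C ^ 4\<close>.\<close>

definition \<theta> :: real where "\<theta> = (C ^ 4 - 1) / (C ^ 4 + 1)"

lemma less_R: "r \<le> r0 \<Longrightarrow> ereal r < R"
  using r0(2) by (meson ereal_less_eq(3) le_less_trans)

lemma ratio_values:
  assumes y: "y \<in> U (r0 / 8)"
  shows "0 < f1 y" "f1 y < \<top>" "0 < f2 y" "f2 y < \<top>"
proof -
  have yU: "y \<in> U r0" using y r0 by auto
  show "f1 y < \<top>" "f2 y < \<top>"
    using bdry_harmD(5)[OF f1 r0(1) order_refl yU] bdry_harmD(5)[OF f2 r0(1) order_refl yU] by auto
  show "0 < f1 y" "0 < f2 y"
    using bdry_harm_pos[OF f1 r0(1) order_refl r0(2) y] bdry_harm_pos[OF f2 r0(1) order_refl r0(2) y] pos1 pos2 r0 by auto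
qed

lemma f1_eq:
  assumes y: "y \<in> U (r0 / 8)"
  shows "f1 y = ennreal (q y) * f2 y" "0 < q y"
proof -
  obtain a where a: "f1 y = ennreal a" "0 < a" using ratio_values[OF y] by (cases "f1 y") auto
  obtain b where b: "f2 y = ennreal b" "0 < b" using ratio_values[OF y] by (cases "f2 y") auto
  have "q y = a / b" using a b by (simp add: q_def)
  then show "f1 y = ennreal (q y) * f2 y" "0 < q y"
    unfolding a b using a b by (simp_all flip: ennreal_mult)
qed

lemma q_bounded: "\<exists>A0>0. \<forall>y\<in>U (r0 / 8). q y \<le> A0"
proof -
  have "U (r0 / 8) \<noteq> {}" using U_nonempty[of "r0 / 8"] r0 by simp
  then obtain y0 where y0: "y0 \<in> U (r0 / 8)" by blast
  show ?thesis
  proof (intro exI conjI ballI)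
    show "0 < C ^ 4 * q y0" using C_ge f1_eq(2)[OF y0] by simp
    fix y assume y: "y \<in> U (r0 / 8)"
    obtain b where b: "f2 y = ennreal b" "0 < b" using ratio_values[OF y] by (cases "f2 y") auto
    obtain b0 where b0: "f2 y0 = ennreal b0" "0 < b0" using ratio_values[OF y0] by (cases "f2 y0") auto
    have "f1 y * f2 y0 \<le> ennreal (C ^ 4) * (f1 y0 * f2 y)"
      by (rule bdry_harm_cross[OF f1 f2 r0(1) order_refl r0(2) y y0])
    then have "q y * b * b0 \<le> C ^ 4 * (q y0 * b0 * b)"
      unfolding f1_eq(1)[OF y] f1_eq(1)[OF y0] b b0 using f1_eq(2)[OF y] f1_eq(2)[OF y0] b b0 C_ge
      by (simp add: ennreal_le_iff flip: ennreal_mult)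
    then have "q y * (b * b0) \<le> (C ^ 4 * q y0) * (b * b0)" by (simp add: ac_simps)
    then show "q y \<le> C ^ 4 * q y0" using b b0 by (simp add: mult_le_cancel_right)
  qed
qed

text \<open>The bounded ratio compares the integrals near \<open>z0\<close>, and far from
  \<open>z0\<close> they are finite anyway.\<close>

lemma full_infinite: "full f1 = \<top> \<Longrightarrow> full f2 = \<top>"
proof (rule ccontr)
  assume i: "full f1 = \<top>" and ni: "full f2 \<noteq> \<top>"
  obtain A0 where A0: "0 < A0" "\<And>y. y \<in> U (r0 / 8) \<Longrightarrow> q y \<le> A0" using q_bounded by blast
  define s where "s = r0 / 8"
  have s: "0 < s" "s \<le> r0" using r0 by (auto simp: s_def)
  note [measurable] = bdry_harmD(1)[OF f2] j_section(1)
  have m: "(\<lambda>v. f2 v * indicator (ball z0 s) v * ennreal (j z0 v)) \<in> borel_measurable m"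
    by (rule measurable_m) measurable
  have "near s f1 \<le> (\<integral>\<^sup>+v. ennreal A0 * (f2 v * indicator (ball z0 s) v * ennreal (j z0 v)) \<partial>m)"
    unfolding jump_int_def
  proof (rule nn_integral_mono)
    fix v
    show "f1 v * indicator (ball z0 s) v * ennreal (j z0 v) \<le> ennreal A0 * (f2 v * indicator (ball z0 s) v * ennreal (j z0 v))"
    proof (cases "v \<in> U s")
      case True
      then have "f1 v \<le> ennreal A0 * f2 v"
        unfolding s_def by (subst f1_eq(1)) (auto intro!: mult_right_mono ennreal_leI A0)
      from mult_right_mono[OF this, of "ennreal (j z0 v)"] True show ?thesis by (simp add: mult.assoc)
    next
      case False
      then show ?thesis using bdry_harmD(2)[OF f1, of v] by (auto simp: indicator_def)
    qed
  qed
  also have "\<dots> = ennreal A0 * near s f2" unfolding jump_int_def by (rule nn_integral_cmult[OF m])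
  also have "\<dots> < \<top>"
    using ni jump_int_mono_set[of "ball z0 s" UNIV f2 z0] A0 
    by (auto simp: ennreal_mult_less_top top.not_eq_extremum intro: le_less_trans)
  finally have "near s f1 < \<top>" .
  moreover have "far s f1 < \<top>" by (rule far_finite(2)[OF f1 s less_R[OF s(2)]])
  ultimately have "full f1 < \<top>" unfolding full_eq[OF bdry_harmD(1)[OF f1], of s] by simp
  with i show False by simp
qed

text \<open>Bounds \<open>a \<le> q \<le> A\<close> make \<open>f1 - a * f2\<close> and
  \<open>A * f2 - f1\<close> nonnegative near \<open>z0\<close>. Cut off to the ball of radius
  \<open>s\<close>, these are admissible data for the Harnack principle against \<open>f2\<close>,
  which shrinks the oscillation of the near parts by \<open>\<theta>\<close>. The far parts change
  each ratio by a factor between \<open>1 / (1 + e)\<close> and \<open>1 + e\<close>, whence the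
  error \<open>2 * e * A\<close>.\<close>

lemma osc_step:
  assumes inf: "full f1 = \<top>" and s: "0 < s" "s \<le> r0 / 8" and a: "0 \<le> a" "a \<le> A"
    and bd: "\<And>y. y \<in> U s \<Longrightarrow> a \<le> q y" "\<And>y. y \<in> U s \<Longrightarrow> q y \<le> A" and e: "0 < e"
  shows "\<exists>r. 0 < r \<and> r \<le> s \<and> (\<forall>y\<in>U r. \<forall>y'\<in>U r. q y - q y' \<le> \<theta> * (A - a) + 2 * e * A)"
proof -
  have s': "s \<le> r0" using s r0 by auto
  have sR: "ereal s < R" by (rule less_R[OF s'])
  have inf2: "full f2 = \<top>" by (rule full_infinite[OF inf])
  obtain n1 where n1: "\<forall>n\<ge>n1. \<forall>y\<in>U (s / real (n + 2) / 8).
     far_part (s / real (n + 2)) s f1 y \<le> ennreal e * near_part (s / real (n + 2)) s f1 y \<and>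
     0 < near_part (s / real (n + 2)) s f1 y"
    using part_ratio[OF f1 s(1) s' sR inf e] by blast
  obtain n2 where n2: "\<forall>n\<ge>n2. \<forall>y\<in>U (s / real (n + 2) / 8).
     far_part (s / real (n + 2)) s f2 y \<le> ennreal e * near_part (s / real (n + 2)) s f2 y \<and>
     0 < near_part (s / real (n + 2)) s f2 y"
    using part_ratio[OF f2 s(1) s' sR inf2 e] by blast
  define r where "r = s / real (max n1 n2 + 2)"
  have r: "0 < r" "r \<le> s" using s by (auto simp: r_def field_simps)
  have r': "r \<le> r0" using r s' by auto
  have rR: "ereal r < R" by (rule less_R[OF r'])
  have p1: "far_part r s f1 y \<le> ennreal e * near_part r s f1 y" "0 < near_part r s f1 y"
    and p2: "far_part r s f2 y \<le> ennreal e * near_part r s f2 y" "0 < near_part r s f2 y"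
    if "y \<in> U (r / 8)" for y
    using n1[rule_format, of "max n1 n2" y] n2[rule_format, of "max n1 n2" y] that by (auto simp: r_def)
  \<comment> \<open>Truncated subtraction is exact here: on \<open>U s\<close> by the bounds on
    \<open>q\<close>, and off \<open>D\<close> because both functions vanish.\<close>
  define \<phi> where "\<phi> v = (f1 v - ennreal a * f2 v) * indicator (ball z0 s) v" for v
  define \<psi> where "\<psi> v = (ennreal A * f2 v - f1 v) * indicator (ball z0 s) v" for v
  define F2 where "F2 v = f2 v * indicator (ball z0 s) v" for v
  define F1' where "F1' v = f1 v * indicator (ball z0 s) v" for v
  note [measurable] = bdry_harmD(1)[OF f1] bdry_harmD(1)[OF f2]
  have meas[measurable]: "\<phi> \<in> borel_measurable borel" "\<psi> \<in> borel_measurable borel"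
    "F2 \<in> borel_measurable borel" "F1' \<in> borel_measurable borel"
    unfolding \<phi>_def \<psi>_def F2_def F1'_def by measurable
  have in_s: "a * enn2real (f2 v) \<ge> 0 \<and> ennreal a * f2 v \<le> f1 v \<and> f1 v \<le> ennreal A * f2 v" if "v \<in> U s" for v
  proof -
    have v8: "v \<in> U (r0 / 8)" using that s by auto
    show ?thesis
      unfolding f1_eq(1)[OF v8] using bd[OF that] a
      by (auto intro!: mult_right_mono ennreal_leI)
  qed
  have out: "f1 v = 0" "f2 v = 0" if "v \<notin> D" for v
    using bdry_harmD(2)[OF f1 that] bdry_harmD(2)[OF f2 that] by auto
  have e1: "F1' v = ennreal a * F2 v + \<phi> v" for v
    using in_s[of v] out[of v]
    by (cases "v \<in> D"; cases "v \<in> ball z0 s") (auto simp: F1'_def F2_def \<phi>_def add_diff_inverse_ennreal)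
  have e2: "ennreal A * F2 v = F1' v + \<psi> v" for v
    using in_s[of v] out[of v]
    by (cases "v \<in> D"; cases "v \<in> ball z0 s") (auto simp: F1'_def F2_def \<psi>_def add_diff_inverse_ennreal)
  have N1: "exit_int (U r) F1' y = near_part r s f1 y" and N2: "exit_int (U r) F2 y = near_part r s f2 y" for y
    by (simp_all add: near_part_def F1'_def[abs_def] F2_def[abs_def])
  have E1: "near_part r s f1 y = ennreal a * near_part r s f2 y + exit_int (U r) \<phi> y" for y
  proof -
    have "near_part r s f1 y = exit_int (U r) (\<lambda>v. ennreal a * F2 v + \<phi> v) y"
      unfolding N1[symmetric] by (simp add: e1[abs_def])
    also have "\<dots> = exit_int (U r) (\<lambda>v. ennreal a * F2 v) y + exit_int (U r) \<phi> y"
      by (rule exit_int_add[OF open_U]) measurable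
    finally show ?thesis by (simp add: exit_int_cmult[OF open_U meas(3)] N2)
  qed
  have E2: "ennreal A * near_part r s f2 y = near_part r s f1 y + exit_int (U r) \<psi> y" for y
  proof -
    have "ennreal A * near_part r s f2 y = exit_int (U r) (\<lambda>v. ennreal A * F2 v) y"
      by (simp add: exit_int_cmult[OF open_U meas(3)] N2)
    also have "\<dots> = exit_int (U r) (\<lambda>v. F1' v + \<psi> v) y" by (simp add: e2)
    also have "\<dots> = exit_int (U r) F1' y + exit_int (U r) \<psi> y"
      by (rule exit_int_add[OF open_U]) measurable
    finally show ?thesis by (simp add: N1)
  qed
  have fin2: "near_part r s f2 y < \<top>" and fin1: "near_part r s f1 y < \<top>" if "y \<in> U r" for y
    by (rule near_part_finite(2)[OF f2 r(1) r' that], rule near_part_finite(2)[OF f1 r(1) r' that])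
  have fin\<phi>: "exit_int (U r) \<phi> y < \<top>" if "y \<in> U r" for y
    using fin1[OF that] E1[of y] by (auto intro: le_less_trans)
  have fin\<psi>: "exit_int (U r) \<psi> y < \<top>" if "y \<in> U r" for y
  proof -
    have "exit_int (U r) \<psi> y \<le> ennreal A * near_part r s f2 y" unfolding E2 by simp
    also have "\<dots> < \<top>" using fin2[OF that] by (simp add: ennreal_mult_less_top)
    finally show ?thesis .
  qed
  have ae2: "AE v in m. F2 v < \<top>"
    using bdry_harmD(3)[OF f2] by eventually_elim (auto simp: F2_def indicator_def)
  have ae\<phi>: "AE v in m. \<phi> v < \<top>"
    using bdry_harmD(3)[OF f1]
    by eventually_elim (auto simp: \<phi>_def indicator_def intro: le_less_trans[OF diff_le_self_ennreal])
  have ae\<psi>: "AE v in m. \<psi> v < \<top>"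
    using bdry_harmD(3)[OF f2]
    by eventually_elim (auto simp: \<psi>_def indicator_def ennreal_mult_less_top intro!: le_less_trans[OF diff_le_self_ennreal])
  have z: "\<phi> v = 0" "\<psi> v = 0" "F2 v = 0" if "v \<notin> D" for v
    using out[OF that] by (auto simp: \<phi>_def \<psi>_def F2_def)
  have main: "q y - q y' \<le> \<theta> * (A - a) + 2 * e * A" if y: "y \<in> U (r / 8)" "y' \<in> U (r / 8)" for y y'
  proof -
    have yU: "y \<in> U r" "y' \<in> U r" using y r by auto
    have y8: "y \<in> U (r0 / 8)" "y' \<in> U (r0 / 8)" using yU r s by auto
    have ex: "\<exists>n1 n2 g h p1 p2. near_part r s f1 y = ennreal n1 \<and> near_part r s f2 y = ennreal n2 \<and>
        exit_int (U r) \<phi> y = ennreal g \<and> exit_int (U r) \<psi> y = ennreal h \<and>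
        0 < n1 \<and> 0 < n2 \<and> 0 \<le> g \<and> 0 \<le> h \<and> n1 = a * n2 + g \<and> A * n2 = n1 + h \<and>
        q y = (n1 + p1) / (n2 + p2) \<and> 0 \<le> p1 \<and> p1 \<le> e * n1 \<and> 0 \<le> p2 \<and> p2 \<le> e * n2"
      if y: "y \<in> U (r / 8)" for y
    proof -
      have yU: "y \<in> U r" using y r by auto
      obtain n1 where n1: "near_part r s f1 y = ennreal n1" "0 < n1"
        using fin1[OF yU] p1(2)[OF y] by (cases "near_part r s f1 y") auto
      obtain n2 where n2: "near_part r s f2 y = ennreal n2" "0 < n2"
        using fin2[OF yU] p2(2)[OF y] by (cases "near_part r s f2 y") auto
      obtain g where g: "exit_int (U r) \<phi> y = ennreal g" "0 \<le> g"
        using fin\<phi>[OF yU] by (cases "exit_int (U r) \<phi> y") auto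
      obtain h where h: "exit_int (U r) \<psi> y = ennreal h" "0 \<le> h"
        using fin\<psi>[OF yU] by (cases "exit_int (U r) \<psi> y") auto
      have "far_part r s f1 y < \<top>" using p1(1)[OF y] n1 e by (auto simp: le_less_trans simp flip: ennreal_mult)
      then obtain p1' where p1': "far_part r s f1 y = ennreal p1'" "0 \<le> p1'" by (cases "far_part r s f1 y") auto
      have "far_part r s f2 y < \<top>" using p2(1)[OF y] n2 e by (auto simp: le_less_trans simp flip: ennreal_mult)
      then obtain p2' where p2': "far_part r s f2 y = ennreal p2'" "0 \<le> p2'" by (cases "far_part r s f2 y") auto
      have "n1 = a * n2 + g"
        using E1[of y] n1 n2 g a by (simp flip: ennreal_mult ennreal_plus)
      moreover have "A * n2 = n1 + h"
        using E2[of y] n1 n2 h a by (simp flip: ennreal_mult ennreal_plus)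
      moreover have "p1' \<le> e * n1" using p1(1)[OF y] n1 p1' e by (simp add: ennreal_le_iff flip: ennreal_mult)
      moreover have "p2' \<le> e * n2" using p2(1)[OF y] n2 p2' e by (simp add: ennreal_le_iff flip: ennreal_mult)
      moreover have "f1 y = ennreal (n1 + p1')" "f2 y = ennreal (n2 + p2')"
        using parts_add[OF f1 r(1) r' yU, of s] parts_add[OF f2 r(1) r' yU, of s] n1 n2 p1' p2' by simp_all
      then have "q y = (n1 + p1') / (n2 + p2')" using n1 n2 p1' p2' by (simp add: q_def del: ennreal_plus)
      ultimately show ?thesis using n1 n2 g h p1' p2' by blast
    qed
    from ex[OF y(1)] obtain n1 n2 g h p1 p2 where
      v: "near_part r s f1 y = ennreal n1" "near_part r s f2 y = ennreal n2"
        "exit_int (U r) \<phi> y = ennreal g" "exit_int (U r) \<psi> y = ennreal h"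
        "0 < n1" "0 < n2" "0 \<le> g" "0 \<le> h" "n1 = a * n2 + g" "A * n2 = n1 + h"
        "q y = (n1 + p1) / (n2 + p2)" "0 \<le> p1" "p1 \<le> e * n1" "0 \<le> p2" "p2 \<le> e * n2" by blast
    from ex[OF y(2)] obtain n1' n2' g' h' p1' p2' where
      w: "near_part r s f1 y' = ennreal n1'" "near_part r s f2 y' = ennreal n2'"
        "exit_int (U r) \<phi> y' = ennreal g'" "exit_int (U r) \<psi> y' = ennreal h'"
        "0 < n1'" "0 < n2'" "0 \<le> g'" "0 \<le> h'" "n1' = a * n2' + g'" "A * n2' = n1' + h'"
        "q y' = (n1' + p1') / (n2' + p2')" "0 \<le> p1'" "p1' \<le> e * n1'" "0 \<le> p2'" "p2' \<le> e * n2'" by blast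
    have c0: "1 \<le> C ^ 4" using C_ge by simp
    have "exit_int (U r) \<phi> y * exit_int (U r) F2 y' \<le> ennreal (C ^ 4) * (exit_int (U r) \<phi> y' * exit_int (U r) F2 y)"
      by (rule cross[OF r(1) rR y meas(1) fin\<phi> ae\<phi> z(1) meas(3) _ ae2 z(3)]) (simp_all add: N2 fin2)
    then have g: "g * n2' \<le> C ^ 4 * (g' * n2)"
      unfolding N2 v w using v w c0 by (simp add: ennreal_le_iff flip: ennreal_mult)
    have "exit_int (U r) \<psi> y' * exit_int (U r) F2 y \<le> ennreal (C ^ 4) * (exit_int (U r) \<psi> y * exit_int (U r) F2 y')"
      by (rule cross[OF r(1) rR y(2,1) meas(2) fin\<psi> ae\<psi> z(2) meas(3) _ ae2 z(3)]) (simp_all add: N2 fin2)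
    then have h: "h' * n2 \<le> C ^ 4 * (h * n2')"
      unfolding N2 v w using v w c0 by (simp add: ennreal_le_iff flip: ennreal_mult)
    have osc: "n1 / n2 - n1' / n2' \<le> \<theta> * (A - a)"
      unfolding \<theta>_def by (rule oscillation_contract[OF c0 v(6) w(6) v(9,10) w(9,10) g h])
    have "q y \<le> (1 + e) * (n1 / n2)"
    proof -
      have "q y \<le> (n1 + e * n1) / n2" unfolding v(11) using v by (intro frac_le) auto
      also have "\<dots> = (1 + e) * (n1 / n2)" by (simp add: distrib_right add_divide_distrib)
      finally show ?thesis .
    qed
    also have "\<dots> \<le> n1 / n2 + e * A"
    proof -
      have "n1 \<le> A * n2" using v by simp
      then have "n1 / n2 \<le> A" using v(6) by (simp add: pos_divide_le_eq)
      then have "e * (n1 / n2) \<le> e * A" using e by (intro mult_left_mono) auto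
      then show ?thesis by (simp add: distrib_right add_divide_distrib)
    qed
    finally have 1: "q y \<le> n1 / n2 + e * A" .
    have "n1' / n2' - e * A \<le> q y'"
    proof -
      have "n1' \<le> A * n2'" using w by simp
      then have rA: "n1' / n2' \<le> A" using w(6) by (simp add: pos_divide_le_eq)
      have "n1' / ((1 + e) * n2') \<le> q y'"
        unfolding w(11) using w e by (intro frac_le) (auto simp: distrib_right)
      moreover have "n1' / n2' - e * A \<le> n1' / ((1 + e) * n2')"
      proof -
        have "(n1' / n2') / (1 + e) \<ge> (n1' / n2') * (1 - e)"
        proof -
          have "(1 - e) * (1 + e) \<le> 1" by (simp add: algebra_simps)
          then have "1 - e \<le> 1 / (1 + e)" using e by (simp add: pos_le_divide_eq)
          then have "(n1' / n2') * (1 - e) \<le> (n1' / n2') * (1 / (1 + e))" using w by (intro mult_left_mono) auto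
          then show ?thesis by simp
        qed
        moreover have "e * (n1' / n2') \<le> e * A" using rA e by (intro mult_left_mono) auto
        moreover have "n1' / ((1 + e) * n2') = (n1' / n2') / (1 + e)" by (simp add: mult.commute)
        moreover have "(n1' / n2') * (1 - e) = n1' / n2' - e * (n1' / n2')"
          by (subst mult.commute) (simp only: left_diff_distrib mult_1_left)
        ultimately show ?thesis by linarith
      qed
      ultimately show ?thesis by linarith
    qed
    with 1 osc show ?thesis by linarith
  qed
  \<comment> \<open>F1 compares values only in the ball of one eighth of the radius.\<close>
  show ?thesis
    using main r by (intro exI[of _ "r / 8"]) auto
qed

text \<open>Instead of iterating, take the infimum of all bounds on the oscillation over some small
  ball: a positive infimum would be undercut by one more contraction step.\<close>

lemma accessible_oscillation:
  assumes inf: "full f1 = \<top>" and e: "0 < e"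
  shows "\<exists>r>0. \<forall>y\<in>U r. \<forall>y'\<in>U r. q y - q y' \<le> e"
proof -
  obtain A0 where A0: "0 < A0" "\<And>y. y \<in> U (r0 / 8) \<Longrightarrow> q y \<le> A0" using q_bounded by blast
  define S where "S = {d. 0 \<le> d \<and> (\<exists>s. 0 < s \<and> s \<le> r0 / 8 \<and> (\<forall>y\<in>U s. \<forall>y'\<in>U s. q y - q y' \<le> d))}"
  have "A0 \<in> S"
  proof -
    have "q y - q y' \<le> A0" if "y \<in> U (r0 / 8)" "y' \<in> U (r0 / 8)" for y y'
      using A0(2)[OF that(1)] f1_eq(2)[OF that(2)] by simp
    then show ?thesis using A0(1) r0 unfolding S_def by (auto intro!: exI[of _ "r0 / 8"])
  qed
  have bdd: "bdd_below S" unfolding S_def by (auto intro!: bdd_belowI[of _ 0])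
  have "1 \<le> C ^ 4" using C_ge by simp
  then have \<theta>: "0 \<le> \<theta>" "\<theta> < 1" by (simp_all add: \<theta>_def pos_divide_less_eq)
  have step: "\<theta> * d + 2 * \<epsilon> * A0 \<in> S" if d: "d \<in> S" and \<epsilon>: "0 < \<epsilon>" for d \<epsilon>
  proof -
    from d obtain s where s: "0 < s" "s \<le> r0 / 8" "\<And>y y'. y \<in> U s \<Longrightarrow> y' \<in> U s \<Longrightarrow> q y - q y' \<le> d" "0 \<le> d"
      unfolding S_def by blast
    have sub: "U s \<subseteq> U (r0 / 8)" using s by auto
    have ne: "U s \<noteq> {}" by (rule U_nonempty[OF s(1)])
    define a where "a = Inf (q ` U s)"
    define A where "A = Sup (q ` U s)"
    have bb: "bdd_below (q ` U s)" "bdd_above (q ` U s)"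
    proof -
      show "bdd_below (q ` U s)"
      proof (rule bdd_belowI[of _ 0])
        fix x assume "x \<in> q ` U s"
        then obtain y where "x = q y" "y \<in> U (r0 / 8)" using sub by blast
        then show "0 \<le> x" using f1_eq(2)[of y] by simp
      qed
      show "bdd_above (q ` U s)"
        by (rule bdd_aboveI[of _ A0]) (use A0(2) sub in auto)
    qed
    have a0: "0 \<le> a" unfolding a_def
    proof (rule cInf_greatest)
      fix x assume "x \<in> q ` U s"
      then obtain y where "x = q y" "y \<in> U (r0 / 8)" using sub by blast
      then show "0 \<le> x" using f1_eq(2)[of y] by simp
    qed (use ne in simp)
    have AA0: "A \<le> A0" unfolding A_def using ne sub A0(2) by (intro cSup_least) auto
    have lo: "a \<le> q y" and hi: "q y \<le> A" if "y \<in> U s" for y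
      unfolding a_def A_def using that bb by (auto intro: cInf_lower cSup_upper)
    have "A \<le> a + d"
      unfolding A_def
    proof (rule cSup_least)
      show "q ` U s \<noteq> {}" using ne by simp
      fix x assume "x \<in> q ` U s"
      then obtain y where y: "x = q y" "y \<in> U s" by blast
      have "x - d \<le> a" unfolding a_def
      proof (rule cInf_greatest)
        show "q ` U s \<noteq> {}" using ne by simp
        fix z assume "z \<in> q ` U s"
        then obtain y' where y': "z = q y'" "y' \<in> U s" by blast
        show "x - d \<le> z" using s(3)[OF y(2) y'(2)] y y' by simp
      qed
      then show "x \<le> a + d" by simp
    qed
    moreover obtain y where y: "y \<in> U s" using ne by blast
    ultimately have aA: "a \<le> A" using lo[OF y] hi[OF y] by simp
    from osc_step[OF inf s(1,2) a0 aA lo hi \<epsilon>]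
    obtain r where r: "0 < r" "r \<le> s" "\<And>y y'. y \<in> U r \<Longrightarrow> y' \<in> U r \<Longrightarrow> q y - q y' \<le> \<theta> * (A - a) + 2 * \<epsilon> * A"
      by blast
    have "\<theta> * (A - a) + 2 * \<epsilon> * A \<le> \<theta> * d + 2 * \<epsilon> * A0"
      using \<open>A \<le> a + d\<close> AA0 \<theta>(1) \<epsilon> by (intro add_mono mult_left_mono) auto
    then have "q y - q y' \<le> \<theta> * d + 2 * \<epsilon> * A0" if "y \<in> U r" "y' \<in> U r" for y y'
      using r(3)[OF that] by linarith
    moreover have "0 \<le> \<theta> * d + 2 * \<epsilon> * A0" using \<theta> s(4) \<epsilon> A0 by simp
    ultimately show ?thesis
      unfolding S_def using r s by (auto intro!: exI[of _ r])
  qed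
  have Inf0: "0 \<le> Inf S" using \<open>A0 \<in> S\<close> by (intro cInf_greatest) (auto simp: S_def)
  have "Inf S \<le> 0"
  proof (rule ccontr)
    assume "\<not> Inf S \<le> 0"
    then have p: "0 < Inf S" by simp
    define \<delta> where "\<delta> = Inf S"
    \<comment> \<open>For \<open>d\<close> below this bound \<open>\<theta> * d\<close> stays below
      \<open>\<delta>\<close> by at least \<open>\<delta> * (1 - \<theta>) / (1 + \<theta>)\<close>,
      and \<open>\<epsilon>\<close> is chosen to use up half of this gap.\<close>
    have "\<delta> < 2 * \<delta> / (1 + \<theta>)" using p \<theta> by (simp add: \<delta>_def pos_less_divide_eq)
    then obtain d where d: "d \<in> S" "d < 2 * \<delta> / (1 + \<theta>)"
      using cInf_less_iff[of S] \<open>A0 \<in> S\<close> bdd unfolding \<delta>_def by auto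
    define \<epsilon> where "\<epsilon> = \<delta> * (1 - \<theta>) / (1 + \<theta>) / (4 * A0)"
    have \<epsilon>: "0 < \<epsilon>" using p \<theta> A0 by (simp add: \<epsilon>_def \<delta>_def)
    have "\<theta> * d \<le> \<theta> * (2 * \<delta> / (1 + \<theta>))" using d \<theta> by (intro mult_left_mono) auto
    moreover have "2 * \<epsilon> * A0 = \<delta> * (1 - \<theta>) / (1 + \<theta>) / 2" using A0 by (simp add: \<epsilon>_def)
    moreover have "\<theta> * (2 * \<delta> / (1 + \<theta>)) + \<delta> * (1 - \<theta>) / (1 + \<theta>) = \<delta>"
    proof -
      have "\<theta> * (2 * \<delta> / (1 + \<theta>)) + \<delta> * (1 - \<theta>) / (1 + \<theta>) = (\<theta> * (2 * \<delta>) + \<delta> * (1 - \<theta>)) / (1 + \<theta>)"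
        by (simp add: add_divide_distrib)
      also have "\<theta> * (2 * \<delta>) + \<delta> * (1 - \<theta>) = \<delta> * (1 + \<theta>)" by (simp add: algebra_simps)
      also have "\<dots> / (1 + \<theta>) = \<delta>" using \<theta> by simp
      finally show ?thesis .
    qed
    moreover have "0 < \<delta> * (1 - \<theta>) / (1 + \<theta>)" using p \<theta> by (simp add: \<delta>_def)
    moreover have "a + c < \<delta>'" if "a \<le> b" "c = h / 2" "b + h = \<delta>'" "0 < h" for a b c h \<delta>' :: real
      using that by linarith
    ultimately have "\<theta> * d + 2 * \<epsilon> * A0 < \<delta>" by blast
    moreover have "\<delta> \<le> \<theta> * d + 2 * \<epsilon> * A0"
      unfolding \<delta>_def by (rule cInf_lower[OF step[OF d(1) \<epsilon>] bdd])
    ultimately show False by simp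
  qed
  then have "Inf S < e" using e by simp
  then obtain d where "d \<in> S" "d < e" using cInf_less_iff[of S] \<open>A0 \<in> S\<close> bdd by auto
  then obtain s where "0 < s" "\<forall>y\<in>U s. \<forall>y'\<in>U s. q y - q y' \<le> d" unfolding S_def by blast
  then show ?thesis using \<open>d < e\<close> by (intro exI[of _ s]) (auto intro: order_trans[OF _ less_imp_le])
qed

end

section \<open>Inaccessible points: the limit of the ratio\<close>

context bdry_point
begin

lemma near_small:
  assumes f: "bdry_harm D z0 r0 f" and fin: "full f < \<top>" and s: "0 < s" and e: "0 < (e::real)"
  shows "\<exists>t. 0 < t \<and> t \<le> s \<and> near t f \<le> ennreal e"
proof -
  note [measurable] = bdry_harmD(1)[OF f] j_section(1)
  have nfin: "near s f < \<top>" using jump_int_mono_set[of "ball z0 s" UNIV f z0] fin by (auto intro: le_less_trans)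
  show ?thesis
  proof (cases "near s f = 0")
    case True then show ?thesis using s by (intro exI[of _ s]) auto
  next
    case False
    obtain b where b: "near s f = ennreal b" "0 < b" using nfin False by (cases "near s f") auto
    have "near s f - ennreal e < (SUP n. jump_int (ball z0 s - ball z0 (s / real (n + 2))) f z0)"
      unfolding annulus_tendsto[OF f s] b using b e by (simp add: ennreal_minus ennreal_lessI)
    then obtain n where n: "near s f - ennreal e < jump_int (ball z0 s - ball z0 (s / real (n + 2))) f z0"
      by (auto simp: less_SUP_iff)
    define t where "t = s / real (n + 2)"
    have t: "0 < t" "t \<le> s" using s by (auto simp: t_def field_simps)
    define A where "A = jump_int (ball z0 s - ball z0 t) f z0"
    have sub: "ball z0 t \<subseteq> ball z0 s" using t by (intro subset_ball)
    have m: "(\<lambda>v. f v * indicator B v * ennreal (j z0 v)) \<in> borel_measurable m" if [measurable]: "B \<in> sets borel" for B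
      by (rule measurable_m) measurable
    have "near s f = (\<integral>\<^sup>+v. f v * indicator (ball z0 s - ball z0 t) v * ennreal (j z0 v) + f v * indicator (ball z0 t) v * ennreal (j z0 v) \<partial>m)"
      unfolding jump_int_def using sub by (intro nn_integral_cong) (auto simp: indicator_def)
    also have "\<dots> = A + near t f"
      unfolding A_def jump_int_def by (intro nn_integral_add m) auto
    finally have eq: "near s f = A + near t f" .
    have Afin: "A < \<top>" using nfin unfolding eq by simp
    have ntfin: "near t f < \<top>" using nfin unfolding eq by simp
    have "A + near t f \<le> A + ennreal e"
      using n unfolding eq[symmetric] A_def[symmetric] t_def[symmetric]
      by (metis add.commute ennreal_minus_le_iff less_imp_le)
    then have "near t f \<le> ennreal e" using Afin by (auto simp: ennreal_add_left_cancel_le)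
    then show ?thesis using t by blast
  qed
qed

lemma near_mono: "s \<le> t \<Longrightarrow> near s f \<le> near t f"
  by (intro jump_int_mono_set subset_ball)

text \<open>The main contribution to \<open>f y\<close> comes from jumps beyond \<open>s\<close>, at
  a rate that E1 makes almost constant near \<open>z0\<close>; the rest is controlled by the small
  integral over the ball of radius \<open>s\<close>. So \<open>f y\<close> is the mean exit time
  times \<open>p\<close>, up to errors of order \<open>e\<close>, and in a quotient the mean exit
  time cancels.\<close>

lemma inaccessible_bounds:
  assumes f: "bdry_harm D z0 r0 f" and fin: "full f = ennreal p" "0 \<le> p"
    and s: "0 < s" "s \<le> r0" "ereal s < R" and e: "0 < e" "near s f \<le> ennreal e"
    and r: "0 < r" "r < s" "r \<le> s / 2"
    and E: "\<And>u w. u \<in> ball z0 r - {z0} \<Longrightarrow> w \<notin> ball z0 s \<Longrightarrow> j z0 w \<le> (1 + e) * j u w \<and> j u w \<le> (1 + e) * j z0 w"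
    and y: "y \<in> U (r / 8)" and t: "T r y = ennreal t" "0 < t" and fy: "f y = ennreal v" "0 \<le> v"
  shows "(p - e) * t \<le> (1 + e) * v" "v \<le> ((1 + e) * p + C * e) * t"
proof -
  have yU: "y \<in> U r" using y r by auto
  have rr: "r \<le> r0" "ereal r < R" using r s by (auto intro: le_less_trans[of _ "ereal s"])
  have Lfin: "far s f < \<top>" by (rule far_finite(2)[OF f s])
  then obtain L where L: "far s f = ennreal L" "0 \<le> L" by (cases "far s f") auto
  have sum: "full f = near s f + far s f" by (rule full_eq[OF bdry_harmD(1)[OF f]])
  have "near s f < \<top>" using e by (auto intro: le_less_trans)
  then obtain b where b: "near s f = ennreal b" "0 \<le> b" by (cases "near s f") auto
  have pbL: "p = b + L" using sum fin b L by (simp flip: ennreal_plus)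
  have be: "b \<le> e" using e b by (simp add: ennreal_le_iff)
  have far_eq: "far_part r s f y = occ (U r) (jump_int (- ball z0 s) f) y"
    by (rule far_part_eq[OF f r(2) yU])
  \<comment> \<open>The comparison of rates excludes \<open>z0\<close> itself, which is not in
    \<open>D\<close>.\<close>
  have notz: "u \<in> U r \<Longrightarrow> u \<in> ball z0 r - {z0}" for u using z0_notin by auto
  have "occ (U r) (jump_int (- ball z0 s) f) y \<le> occ (U r) (\<lambda>_. ennreal (1 + e) * far s f) y"
    using E notz e by (intro occ_mono jump_int_le bdry_harmD(1)[OF f]) auto
  then have up: "far_part r s f y \<le> ennreal (1 + e) * ennreal L * ennreal t"
    unfolding far_eq occ_const L t by simp
  have "occ (U r) (\<lambda>_. far s f) y \<le> occ (U r) (\<lambda>u. ennreal (1 + e) * jump_int (- ball z0 s) f u) y"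
    using E notz e by (intro occ_mono jump_int_le bdry_harmD(1)[OF f]) auto
  also have "\<dots> = ennreal (1 + e) * far_part r s f y"
    unfolding far_eq by (intro occ_cmult[OF open_U] jump_int_measurable bdry_harmD(1)[OF f]) auto
  finally have lo: "ennreal L * ennreal t \<le> ennreal (1 + e) * far_part r s f y"
    unfolding occ_const L t .
  have nr: "near_part r s f y \<le> ennreal C * (ennreal t * ennreal b)"
    using near_part_le[OF f r(1) rr less_imp_le[OF r(2)] y] unfolding t b .
  have parts: "f y = near_part r s f y + far_part r s f y" by (rule parts_add[OF f r(1) rr(1) yU])
  have "ennreal L * ennreal t \<le> ennreal (1 + e) * ennreal v"
    using lo parts fy by (metis add.commute le_iff_add mult_left_mono order_trans zero_le)
  then have "L * t \<le> (1 + e) * v"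
    using L t e fy by (simp add: ennreal_le_iff flip: ennreal_mult del: ennreal_plus)
  moreover have "(p - e) * t \<le> L * t" using pbL be t by (intro mult_right_mono) auto
  ultimately show "(p - e) * t \<le> (1 + e) * v" by linarith
  have "ennreal v \<le> ennreal C * (ennreal t * ennreal b) + ennreal (1 + e) * ennreal L * ennreal t"
    unfolding fy(1)[symmetric] parts by (intro add_mono nr up)
  also have "\<dots> = ennreal (C * (t * b) + (1 + e) * L * t)"
    using C_ge t b e L by (simp flip: ennreal_mult ennreal_plus)
  finally have "v \<le> C * (t * b) + (1 + e) * L * t"
    using C_ge t b e L by (subst (asm) ennreal_le_iff) auto
  also have "\<dots> \<le> C * (t * e) + (1 + e) * p * t"
    using be pbL b L t C_ge e by (intro add_mono mult_left_mono mult_right_mono) auto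
  finally show "v \<le> ((1 + e) * p + C * e) * t" by (simp add: algebra_simps)
qed

end

context bdry_ratio
begin

lemma far_le_full: "far_int z0 r f \<le> full f"
  unfolding far_int_eq by (rule jump_int_mono_set) simp

lemma full_pos: "0 < full f1" "0 < full f2"
  using pos1[OF r0(1) order_refl] pos2[OF r0(1) order_refl] far_le_full by (auto intro: less_le_trans)

lemma inaccessible_limit:
  assumes fin: "full f1 = ennreal p1" "0 \<le> p1" "full f2 = ennreal p2" "0 \<le> p2" and e: "0 < e"
  shows "\<exists>r>0. \<forall>y\<in>U r. \<bar>q y - p1 / p2\<bar> \<le> e"
proof -
  have p: "0 < p1" "0 < p2" using full_pos fin by (auto simp: ennreal_less_zero_iff)
  \<comment> \<open>\<open>up\<close> and \<open>lo\<close> are the bounds on the quotient that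
    \<open>inaccessible_bounds\<close> yields for the error \<open>x\<close>; both tend to
    \<open>p1 / p2\<close>.\<close>
  define up where "up x = ((1 + x) * p1 + C * x) * (1 + x) / (p2 - x)" for x
  define lo where "lo x = (p1 - x) / (1 + x) / ((1 + x) * p2 + C * x)" for x
  have "(up \<longlongrightarrow> ((1 + 0) * p1 + C * 0) * (1 + 0) / (p2 - 0)) (at_right 0)"
    unfolding up_def using p by (intro tendsto_intros) auto
  then have up: "(up \<longlongrightarrow> p1 / p2) (at_right 0)" by simp
  have "(lo \<longlongrightarrow> (p1 - 0) / (1 + 0) / ((1 + 0) * p2 + C * 0)) (at_right 0)"
    unfolding lo_def using p by (intro tendsto_intros) auto
  then have lo: "(lo \<longlongrightarrow> p1 / p2) (at_right 0)" by simp
  have "\<forall>\<^sub>F x in at_right 0. up x < p1 / p2 + e" using order_tendstoD(2)[OF up] e by simp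
  moreover have "\<forall>\<^sub>F x in at_right 0. p1 / p2 - e < lo x" using order_tendstoD(1)[OF lo] e by simp
  moreover have "\<forall>\<^sub>F x in at_right 0. x < min p1 p2" using p by (intro order_tendstoD(2)[OF tendsto_ident_at]) auto
  moreover have "\<forall>\<^sub>F x in at_right (0::real). 0 < x" by (simp add: eventually_at_right_less)
  ultimately have "\<forall>\<^sub>F x in at_right 0. up x < p1 / p2 + e \<and> p1 / p2 - e < lo x \<and> x < min p1 p2 \<and> 0 < x"
    by eventually_elim simp
  then obtain x where x: "up x < p1 / p2 + e" "p1 / p2 - e < lo x" "x < min p1 p2" "0 < x"
    by (metis (mono_tags, lifting) eventually_happens trivial_limit_at_right_real)
  have x12: "x < p1" "x < p2" using x by auto
  obtain t1 where t1: "0 < t1" "t1 \<le> r0" "near t1 f1 \<le> ennreal x"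
    using near_small[OF f1 _ r0(1) x(4)] fin by auto
  obtain t2 where t2: "0 < t2" "t2 \<le> r0" "near t2 f2 \<le> ennreal x"
    using near_small[OF f2 _ r0(1) x(4)] fin by auto
  define s where "s = min t1 t2"
  have s: "0 < s" "s \<le> r0" using t1 t2 by (auto simp: s_def)
  have n1: "near s f1 \<le> ennreal x" using near_mono[of s t1 f1] t1 by (auto simp: s_def)
  have n2: "near s f2 \<le> ennreal x" using near_mono[of s t2 f2] t2 by (auto simp: s_def)
  obtain r1 where r1: "0 < r1" "\<forall>u\<in>ball z0 r1 - {z0}. \<forall>w. w \<notin> ball z0 s \<longrightarrow>
        j z0 w \<le> (1 + x) * j u w \<and> j u w \<le> (1 + x) * j z0 w"
    using E1[OF s(1) less_R[OF s(2)] x(4)] by blast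
  define r where "r = min r1 (s / 2)"
  have r: "0 < r" "r < s" "r \<le> s / 2" using r1 s by (auto simp: r_def)
  have E: "j z0 w \<le> (1 + x) * j u w \<and> j u w \<le> (1 + x) * j z0 w"
    if "u \<in> ball z0 r - {z0}" "w \<notin> ball z0 s" for u w
    using r1(2) that by (auto simp: r_def)
  have "\<bar>q y - p1 / p2\<bar> \<le> e" if y: "y \<in> U (r / 8)" for y
  proof -
    have y8: "y \<in> U (r0 / 8)" and yU: "y \<in> U r" using y r s by auto
    have rr: "r \<le> r0" using r s by auto
    have "T r y < \<top>"
      by (rule T_finite[OF f1 r(1) rr less_R[OF rr] y pos1[OF r(1) rr]])
    then obtain t where t: "T r y = ennreal t" "0 < t" using T_pos[OF yU] by (cases "T r y") auto
    obtain v1 where v1: "f1 y = ennreal v1" "0 < v1" using ratio_values[OF y8] by (cases "f1 y") auto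
    obtain v2 where v2: "f2 y = ennreal v2" "0 < v2" using ratio_values[OF y8] by (cases "f2 y") auto
    have b1: "(p1 - x) * t \<le> (1 + x) * v1" "v1 \<le> ((1 + x) * p1 + C * x) * t"
      using inaccessible_bounds[OF f1 fin(1,2) s less_R[OF s(2)] x(4) n1 r E y t v1(1)] v1 by auto
    have b2: "(p2 - x) * t \<le> (1 + x) * v2" "v2 \<le> ((1 + x) * p2 + C * x) * t"
      using inaccessible_bounds[OF f2 fin(3,4) s less_R[OF s(2)] x(4) n2 r E y t v2(1)] v2 by auto
    have qy: "q y = v1 / v2" using v1 v2 by (simp add: q_def)
    have "q y \<le> up x"
    proof -
      have "0 < p2 - x" "0 < 1 + x" using x12 x by auto
      have l: "(p2 - x) * t / (1 + x) \<le> v2" using b2(1) x(4) by (simp add: pos_divide_le_eq mult.commute)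
      have "v1 / v2 \<le> (((1 + x) * p1 + C * x) * t) / ((p2 - x) * t / (1 + x))"
        using b1(2) l x12 x(4) t v1 by (intro frac_le) (auto intro: less_imp_le)
      also have "\<dots> = up x" unfolding up_def using t by simp
      finally show ?thesis unfolding qy .
    qed
    moreover have "lo x \<le> q y"
    proof -
      have l: "(p1 - x) * t / (1 + x) \<le> v1" using b1(1) x(4) by (simp add: pos_divide_le_eq mult.commute)
      have "lo x = ((p1 - x) * t / (1 + x)) / (((1 + x) * p2 + C * x) * t)"
        unfolding lo_def using t by simp
      also have "\<dots> \<le> v1 / v2"
        using l b2(2) v1 v2 x12 x(4) t by (intro frac_le) auto
      finally show ?thesis unfolding qy .
    qed
    ultimately show ?thesis using x(1,2) by linarith
  qed
  then show ?thesis using r(1) by (intro exI[of _ "r / 8"]) auto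
qed

end

context bdry_ratio
begin

lemma swap_ratio: "bdry_ratio X m j D z0 R C c1 f2 f1 r0"
  by unfold_locales (use r0 f1 f2 pos1 pos2 E1 in auto)

lemma full_infinite_iff: "full f1 = \<top> \<longleftrightarrow> full f2 = \<top>"
  using full_infinite bdry_ratio.full_infinite[OF swap_ratio] by blast

lemma ratio_cauchy:
  assumes e: "0 < e"
  shows "\<exists>r>0. \<forall>y\<in>U r. \<forall>y'\<in>U r. \<bar>q y - q y'\<bar> \<le> e"
proof (cases "full f1 = \<top>")
  case True
  from accessible_oscillation[OF True e] obtain r where
    "r > 0" "\<forall>y\<in>U r. \<forall>y'\<in>U r. q y - q y' \<le> e" by blast
  then show ?thesis by (intro exI[of _ r]) (auto simp: abs_le_iff)
next
  case False
  then have "full f2 \<noteq> \<top>" using full_infinite_iff by blast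
  obtain p1 where p1: "full f1 = ennreal p1" "0 \<le> p1" using False by (cases "full f1") auto
  obtain p2 where p2: "full f2 = ennreal p2" "0 \<le> p2" using \<open>full f2 \<noteq> \<top>\<close> by (cases "full f2") auto
  have "0 < e / 2" using e by simp
  from inaccessible_limit[OF p1 p2 this] obtain r where
    r: "r > 0" "\<And>y. y \<in> U r \<Longrightarrow> \<bar>q y - p1 / p2\<bar> \<le> e / 2" by blast
  have "\<bar>q y - q y'\<bar> \<le> e" if "y \<in> U r" "y' \<in> U r" for y y'
    using r(2)[OF that(1)] r(2)[OF that(2)] by linarith
  then show ?thesis using r(1) by blast
qed

end

section \<open>Martin kernels at boundary points\<close>

lemma ennreal_divide_less_top: "a < \<top> \<Longrightarrow> 0 < b \<Longrightarrow> a / b < (\<top>::ennreal)"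
  using ennreal_divide_eq_top_iff[of a b] by (auto simp: less_top)

context green_pair
begin

lemma frontier_notin: "z \<in> frontier D \<Longrightarrow> z \<notin> D"
  using open_D by (simp add: frontier_def interior_open)

text \<open>With the pole outside the closed ball of radius \<open>r0\<close>, it is off the closure
  of every \<open>D \<inter> ball z r\<close> in question, so \<open>exit_green_eq\<close>
  applies.\<close>

lemma bdry_harm_fwd:
  assumes v: "w \<in> D" "w \<notin> cball z r0" and r0: "0 < r0" and z: "z \<in> frontier D"
  shows "fwd.bdry_harm D z r0 (\<lambda>v. G v w)"
  unfolding fwd.bdry_harm_def
proof (intro conjI allI impI)
  show "(\<lambda>v. G v w) \<in> borel_measurable borel" by (rule G_section(2))
  show "G x w = 0" if "x \<notin> D" for x using G_outside that by simp
  have "z \<in> closure D" using z by (simp add: frontier_def)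
  then obtain x where x: "x \<in> D" "dist x z < r0" using r0 closure_approachable by blast
  then have "x \<noteq> w" using v by (auto simp: dist_commute)
  from AE_G_finite[OF v(1) x(1) this] show "AE u in m. G u w < \<top>" .
  fix r x assume r: "0 < r \<and> r \<le> r0 \<and> x \<in> D \<inter> ball z r"
  have "closure (D \<inter> ball z r) \<subseteq> cball z r" by (rule closure_minimal) auto
  then have vc: "w \<notin> closure (D \<inter> ball z r)" using r v by auto
  have o: "open (D \<inter> ball z r)" "D \<inter> ball z r \<subseteq> D" "x \<in> D \<inter> ball z r" using open_D r by auto
  show "fwd.exit_int (D \<inter> ball z r) (\<lambda>v. G v w) x = G x w"
    by (rule exit_green_eq[OF o v(1) vc])
  have "x \<noteq> w" using r v by auto
  then show "G x w < \<top>" by (rule G_finite)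
qed

text \<open>By duality the integral is a potential of the dual process started at \<open>w\<close>,
  with a charge that is positive near \<open>w\<close>.\<close>

lemma far_int_pos_fwd:
  assumes v: "w \<in> D" "w \<notin> cball z r" and r: "0 < r"
  shows "0 < fwd.far_int z r (\<lambda>v. G v w)"
proof -
  interpret sw: green_pair Xh X m jh j D Gh G by (rule swap)
  define F where "F y = ennreal (j z y) * indicator (- closure (ball z (3 * r / 8))) y" for y
  have "closure (ball z (3 * r / 8)) \<subseteq> cball z (3 * r / 8)" by (rule closure_minimal) auto
  also have "\<dots> \<subseteq> cball z r" using r by auto
  finally have sub: "closure (ball z (3 * r / 8)) \<subseteq> cball z r" .
  note [measurable] = fwd.j_section(1)
  have Fm: "F \<in> borel_measurable borel" unfolding F_def by measurable
  have "0 < F y" if "y \<in> - cball z r" for y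
  proof -
    have "y \<noteq> z" using that r by auto
    then have "0 < j z y" by (intro j_pos) auto
    then show ?thesis using that sub by (auto simp: F_def indicator_def)
  qed
  then have "0 < (\<integral>\<^sup>+y. F y * Gh w y \<partial>m)"
    using v by (intro sw.potential_pos[OF _ _ v(1) _ Fm, of "- cball z r"]) auto
  also have "\<dots> = fwd.far_int z r (\<lambda>v. G v w)"
    unfolding fwd.far_int_def F_def dual by (intro nn_integral_cong) (simp add: ac_simps)
  finally show ?thesis .
qed

end

locale martin_setup = green_pair X Xh m j jh D G Gh
  for X :: "('w, 'x::{heine_borel, second_countable_topology}) process"
    and Xh :: "('v, 'x) process" and m j jh D G Gh +
  fixes x0 :: 'x and \<T> :: "'b topology" and \<iota> :: "'x \<Rightarrow> 'b" and M :: "'x \<Rightarrow> 'b \<Rightarrow> ennreal" and c :: "real \<Rightarrow> real"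
  assumes x0: "x0 \<in> D" and martin: "martin_space X D x0 G \<T> \<iota> M"
    and boundary: "\<And>z0. z0 \<in> frontier D \<Longrightarrow> \<exists>R::ereal. 0 < R \<and>
          cond_C1 j jh z0 R \<and> cond_E1 j z0 R \<and> cond_F1 m X j z0 R \<and> cond_F1 m Xh jh z0 R \<and>
          (\<forall>r. 0 < r \<and> ereal r \<le> R \<longrightarrow>
             (SUP x\<in>D \<inter> ball z0 (r / 2). SUP y\<in>- ball z0 r. max (G x y) (Gh x y)) \<le> ennreal (c r))"
    and inaccessible_blowup: "\<And>z0. inaccessible m j D G z0 \<Longrightarrow> filterlim (\<lambda>x. j x z0) at_top (at z0 within D)"
begin

sublocale sw: green_pair Xh X m jh j D Gh G
  by (rule swap)

lemma iota_homeomorphic: "homeomorphic_map (top_of_set D) (subtopology \<T> (\<iota> ` D)) \<iota>"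
  using martin by (simp add: martin_space_def embedding_map_def)

lemma iota_inj: "inj_on \<iota> D"
  using homeomorphic_imp_injective_map[OF iota_homeomorphic] by simp

lemma iota_topspace: "x \<in> D \<Longrightarrow> \<iota> x \<in> topspace \<T>"
proof -
  assume "x \<in> D"
  moreover have "openin \<T> (\<iota> ` D)" using martin by (simp add: martin_space_def)
  ultimately show ?thesis using openin_subset by blast
qed

definition approaches :: "(nat \<Rightarrow> 'x) \<Rightarrow> 'x \<Rightarrow> 'b \<Rightarrow> bool" where
  "approaches y z w \<longleftrightarrow> range y \<subseteq> D \<and> y \<longlonglongrightarrow> z \<and> limitin \<T> (\<lambda>n. \<iota> (y n)) w sequentially \<and>
     w \<in> martin_boundary D \<T> \<iota>"

text \<open>The limit is taken in the Martin space without the pole \<open>\<iota> x0\<close>, where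
  the kernel is continuous; the sequence eventually avoids \<open>x0\<close>, as its limit is
  outside \<open>D\<close>.\<close>

lemma martin_kernel_limit:
  assumes a: "approaches y z w" and z: "z \<in> frontier D" and x: "x \<in> D"
  shows "(\<lambda>n. G x (y n) / G x0 (y n)) \<longlonglongrightarrow> M x w"
proof -
  define S where "S = subtopology \<T> (topspace \<T> - {\<iota> x0})"
  have cont: "continuous_map (prod_topology (top_of_set D) S) euclidean (\<lambda>(x, w). M x w)"
    and eqn: "\<And>x y. x \<in> D \<Longrightarrow> y \<in> D - {x0} \<Longrightarrow> M x (\<iota> y) = G x y / G x0 y"
    using martin by (auto simp: martin_space_def S_def)
  have yD: "y n \<in> D" for n using a by (auto simp: approaches_def)
  have ylim: "y \<longlonglongrightarrow> z" using a by (simp add: approaches_def)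
  have wl: "limitin \<T> (\<lambda>n. \<iota> (y n)) w sequentially" using a by (simp add: approaches_def)
  have wb: "w \<in> topspace \<T>" "w \<notin> \<iota> ` D" using a by (auto simp: approaches_def martin_boundary_def)
  have "z \<noteq> x0" using frontier_notin[OF z] x0 by auto
  then have ne: "\<forall>\<^sub>F n in sequentially. y n \<noteq> x0"
    using ylim by (metis tendsto_imp_eventually_ne)
  have "limitin S (\<lambda>n. \<iota> (y n)) w sequentially"
    unfolding S_def limitin_subtopology
  proof (intro conjI wl)
    show "w \<in> topspace \<T> - {\<iota> x0}" using wb x0 by auto
    show "\<forall>\<^sub>F n in sequentially. \<iota> (y n) \<in> topspace \<T> - {\<iota> x0}"
      using ne
    proof eventually_elim
      case (elim n)
      have "\<iota> (y n) \<in> topspace \<T>" by (rule iota_topspace[OF yD])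
      moreover have "\<iota> (y n) \<noteq> \<iota> x0" using iota_inj yD x0 elim by (auto dest: inj_onD)
      ultimately show ?case by simp
    qed
  qed
  moreover have "continuous_map S euclidean (\<lambda>w. M x w)"
  proof -
    have "continuous_map S (prod_topology (top_of_set D) S) (\<lambda>w. (x, w))"
      using x by (simp add: continuous_map_pairwise o_def)
    from continuous_map_compose[OF this cont] show ?thesis by (simp add: o_def)
  qed
  ultimately have "limitin euclidean (\<lambda>n. M x (\<iota> (y n))) (M x w) sequentially"
    using continuous_map_limit[of S euclidean "\<lambda>w. M x w" "\<lambda>n. \<iota> (y n)" w sequentially] by (simp add: o_def)
  then have "(\<lambda>n. M x (\<iota> (y n))) \<longlonglongrightarrow> M x w" by simp
  moreover have "\<forall>\<^sub>F n in sequentially. M x (\<iota> (y n)) = G x (y n) / G x0 (y n)"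
    using ne by eventually_elim (use eqn[OF x] yD in auto)
  ultimately show ?thesis by (rule Lim_transform_eventually)
qed

lemma M_measurable:
  assumes w: "w \<in> martin_boundary D \<T> \<iota>"
  shows "(\<lambda>v. M v w * indicator D v) \<in> borel_measurable borel"
proof -
  have "w \<in> topspace \<T> - {\<iota> x0}" using w x0 by (auto simp: martin_boundary_def)
  then have "killed_excessive X D (\<lambda>x. M x w)" using martin by (simp add: martin_space_def)
  then have "(\<lambda>x. M x w) \<in> borel_measurable (restrict_space borel D)" by (simp add: killed_excessive_def)
  then show ?thesis
    using open_D by (subst (asm) borel_measurable_restrict_space_iff_ennreal) auto
qed

lemma bdry_harm_bwd: "v \<in> D \<Longrightarrow> v \<notin> cball z r \<Longrightarrow> 0 < r \<Longrightarrow> z \<in> frontier D \<Longrightarrow> bwd.bdry_harm D z r (G v)"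
  using sw.bdry_harm_fwd[of v z r] by (simp add: dual)

lemma far_int_pos_bwd: "v \<in> D \<Longrightarrow> v \<notin> cball z r \<Longrightarrow> 0 < r \<Longrightarrow> 0 < bwd.far_int z r (G v)"
  using sw.far_int_pos_fwd[of v z r] by (simp add: dual)

text \<open>Accessibility becomes divergence of a jump integral of the dual process, the alternative
  \<open>full f = \<top>\<close> of the ratio estimates.\<close>

lemma poisson_eq:
  assumes z: "z \<in> frontier D"
  shows "poisson_kernel m j D G v z = bwd.jump_int UNIV (G v) z"
  unfolding poisson_kernel_def bwd.jump_int_def
proof (rule nn_integral_cong)
  fix y
  show "G v y * ennreal (j y z) * indicator D y = G v y * indicator UNIV y * ennreal (jh z y)"
  proof (cases "y \<in> D")
    case True
    then have "y \<noteq> z" using frontier_notin[OF z] by auto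
    then show ?thesis using j_dual True by simp
  qed (simp add: G_outside)
qed

text \<open>The same number as a potential of the original process; this form serves to separate
  inaccessible points.\<close>

lemma poisson_occ:
  assumes v: "v \<in> D"
  shows "poisson_kernel m j D G v z = fwd.occ D (\<lambda>u. ennreal (j u z)) v"
proof -
  note [measurable] = fwd.j_section(2)
  have "fwd.occ D (\<lambda>u. ennreal (j u z)) v = (\<integral>\<^sup>+y. G v y * ennreal (j y z) \<partial>m)"
    by (rule occ_green[OF _ v]) measurable
  also have "\<dots> = poisson_kernel m j D G v z"
    unfolding poisson_kernel_def by (intro nn_integral_cong) (auto simp: indicator_def G_outside)
  finally show ?thesis ..
qed

end

text \<open>E1 varies the second argument of \<open>j\<close>. By duality this is the jump rate of
  the dual process from a point near \<open>z0\<close>, which is the form \<open>E1b\<close> needed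
  for functions harmonic for the dual.\<close>

locale martin_point = martin_setup X Xh m j jh D G Gh x0 \<T> \<iota> M c
  for X :: "('w, 'x::{heine_borel, second_countable_topology}) process"
    and Xh :: "('v, 'x) process" and m j jh D G Gh x0 and \<T> :: "'b topology" and \<iota> M c +
  fixes z0 :: 'x and R :: ereal and C Ch c1 :: real
  assumes z0: "z0 \<in> frontier D" and R: "0 < R" and F1f: "fwd.F1_with C z0 R" and F1b: "bwd.F1_with Ch z0 R"
    and c1: "0 < c1"
    and C1f: "\<And>s u w. 0 < s \<Longrightarrow> ereal s < R \<Longrightarrow> u \<in> ball z0 (s / 2) \<Longrightarrow> w \<notin> ball z0 s \<Longrightarrow> j u w \<le> c1 * j z0 w"
    and C1b: "\<And>s u w. 0 < s \<Longrightarrow> ereal s < R \<Longrightarrow> u \<in> ball z0 (s / 2) \<Longrightarrow> w \<notin> ball z0 s \<Longrightarrow> jh u w \<le> c1 * jh z0 w"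
    and C1b': "\<And>s u w. 0 < s \<Longrightarrow> ereal s < R \<Longrightarrow> u \<in> ball z0 (s / 2) \<Longrightarrow> w \<notin> ball z0 s \<Longrightarrow> jh z0 w \<le> c1 * jh u w"
    and E1b: "\<And>s e. 0 < s \<Longrightarrow> ereal s < R \<Longrightarrow> 0 < e \<Longrightarrow> \<exists>r>0. \<forall>u\<in>ball z0 r - {z0}. \<forall>w. w \<notin> ball z0 s \<longrightarrow>
        jh z0 w \<le> (1 + e) * jh u w \<and> jh u w \<le> (1 + e) * jh z0 w"
    and bound: "\<And>r x y. 0 < r \<Longrightarrow> ereal r < R \<Longrightarrow> x \<in> D \<inter> ball z0 (r / 2) \<Longrightarrow> y \<notin> ball z0 r \<Longrightarrow>
        G x y \<le> ennreal (c r) \<and> Gh x y \<le> ennreal (c r)"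
begin

sublocale pf: bdry_point X m j D z0 R C c1
  by unfold_locales (use open_D z0 R F1f c1 C1f in auto)

sublocale pb: bdry_point Xh m jh D z0 R Ch c1
  by unfold_locales (use open_D z0 R F1b c1 C1b in auto)

lemma z0_notin: "z0 \<notin> D" by (rule frontier_notin[OF z0])

lemma small_radius:
  assumes "v \<in> D" "0 < s"
  obtains r where "0 < r" "r < s" "ereal r < R" "v \<notin> cball z0 r"
proof -
  have "0 < dist z0 v" using assms z0_notin by auto
  obtain r' where r': "0 < r'" "ereal r' < R"
  proof (cases R)
    case (real x) then show thesis using R that[of "x / 2"] by auto
  next
    case PInf then show thesis using that[of 1] by auto
  qed (use R in auto)
  define r where "r = min r' (min (s / 2) (dist z0 v / 2))"
  have "0 < r" "r < s" "r < dist z0 v" "r \<le> r'" using r' assms \<open>0 < dist z0 v\<close> by (auto simp: r_def min_less_iff_disj)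
  moreover from this have "ereal r < R" using r'(2) by (meson ereal_less_eq(3) le_less_trans)
  ultimately show thesis by (intro that[of r]) auto
qed

lemma ratio_locale:
  assumes v: "v \<in> D" "v \<notin> cball z0 r0" and xv: "x0 \<notin> cball z0 r0" and r0: "0 < r0" "ereal r0 < R"
  shows "bdry_ratio Xh m jh D z0 R Ch c1 (G v) (G x0) r0"
proof unfold_locales
  show "bwd.bdry_harm D z0 r0 (G v)" by (rule bdry_harm_bwd[OF v r0(1) z0])
  show "bwd.bdry_harm D z0 r0 (G x0)" by (rule bdry_harm_bwd[OF x0 xv r0(1) z0])
  show "0 < bwd.far_int z0 r (G v)" if "0 < r" "r \<le> r0" for r
    using v that by (intro far_int_pos_bwd) auto
  show "0 < bwd.far_int z0 r (G x0)" if "0 < r" "r \<le> r0" for r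
    using x0 xv that by (intro far_int_pos_bwd) auto
qed (use r0 E1b in auto)

lemma G_cross:
  assumes v: "v \<in> D" "v \<notin> cball z0 r0" and xv: "x0 \<notin> cball z0 r0" and r0: "0 < r0" "ereal r0 < R"
    and y: "y \<in> D \<inter> ball z0 (r0 / 8)" "y' \<in> D \<inter> ball z0 (r0 / 8)"
  shows "G v y * G x0 y' \<le> ennreal (Ch ^ 4) * (G v y' * G x0 y)"
  by (rule pb.bdry_harm_cross[OF bdry_harm_bwd[OF v r0(1) z0] bdry_harm_bwd[OF x0 xv r0(1) z0]
      r0(1) order_refl r0(2) y])

lemma G_x0_pos:
  assumes xv: "x0 \<notin> cball z0 r0" and r0: "0 < r0" "ereal r0 < R" and y: "y \<in> D \<inter> ball z0 (r0 / 8)"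
  shows "0 < G x0 y" "G x0 y < \<top>"
proof -
  interpret br: bdry_ratio Xh m jh D z0 R Ch c1 "G x0" "G x0" r0
    by (rule ratio_locale[OF x0 xv xv r0])
  show "0 < G x0 y" "G x0 y < \<top>" using br.ratio_values[OF y] by auto
qed

text \<open>The bound is independent of \<open>y\<close>, so one multiple of \<open>G v y'\<close>
  dominates all quotients along an approaching sequence.\<close>

lemma G_ratio_le:
  assumes v: "v \<in> D" "v \<notin> cball z0 r0" and xv: "x0 \<notin> cball z0 r0" and r0: "0 < r0" "ereal r0 < R"
    and y: "y \<in> D \<inter> ball z0 (r0 / 8)" "y' \<in> D \<inter> ball z0 (r0 / 8)"
  shows "G v y / G x0 y \<le> ennreal (Ch ^ 4) / G x0 y' * G v y'"
proof -
  note p = G_x0_pos[OF xv r0 y(1)] and p' = G_x0_pos[OF xv r0 y(2)]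
  have "G v y / G x0 y = G v y * G x0 y' / G x0 y' / G x0 y"
    using p' by (simp add: mult_divide_eq_ennreal)
  also have "\<dots> \<le> ennreal (Ch ^ 4) * (G v y' * G x0 y) / G x0 y' / G x0 y"
    by (intro divide_right_mono_ennreal G_cross[OF v xv r0 y])
  also have "\<dots> = (ennreal (Ch ^ 4) / G x0 y' * G v y') * G x0 y / G x0 y"
    by (simp add: divide_ennreal_def ac_simps)
  also have "\<dots> = ennreal (Ch ^ 4) / G x0 y' * G v y'"
    using p by (simp add: mult_divide_eq_ennreal)
  finally show ?thesis .
qed

lemma approaches_eventually:
  assumes a: "approaches y z0 w" and r: "0 < r"
  shows "\<forall>\<^sub>F n in sequentially. y n \<in> D \<inter> ball z0 r"
proof -
  have "y \<longlonglongrightarrow> z0" "range y \<subseteq> D" using a by (auto simp: approaches_def)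
  have "\<forall>\<^sub>F n in sequentially. dist (y n) z0 < r" using \<open>y \<longlonglongrightarrow> z0\<close> r by (rule tendstoD)
  then show ?thesis by eventually_elim (use \<open>range y \<subseteq> D\<close> in \<open>auto simp: dist_commute\<close>)
qed

lemma M_le:
  assumes a: "approaches y z0 w"
    and v: "v \<in> D" "v \<notin> cball z0 r0" and xv: "x0 \<notin> cball z0 r0" and r0: "0 < r0" "ereal r0 < R"
    and y': "y' \<in> D \<inter> ball z0 (r0 / 8)"
  shows "M v w \<le> ennreal (Ch ^ 4) / G x0 y' * G v y'"
proof (rule tendsto_upperbound[OF martin_kernel_limit[OF a z0 v(1)]])
  show "\<forall>\<^sub>F n in sequentially. G v (y n) / G x0 (y n) \<le> ennreal (Ch ^ 4) / G x0 y' * G v y'"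
    using approaches_eventually[OF a, of "r0 / 8"] r0
    by (auto elim!: eventually_mono intro: G_ratio_le[OF v xv r0 _ y'])
qed simp

text \<open>Both kernels are limits of the same ratio, whose Cauchy property at \<open>z0\<close>
  concerns all approaching sequences at once.\<close>

lemma M_unique:
  assumes a: "approaches y z0 w" and a': "approaches y' z0 w'" and x: "x \<in> D"
  shows "M x w = M x w'"
proof -
  obtain s where s: "0 < s" "ereal s < R" "x0 \<notin> cball z0 s" using small_radius[OF x0, of 1] by auto
  obtain r where r: "0 < r" "r < s" "ereal r < R" "x \<notin> cball z0 r" using small_radius[OF x s(1)] by auto
  have xr: "x0 \<notin> cball z0 r" using s r by auto
  interpret br: bdry_ratio Xh m jh D z0 R Ch c1 "G x" "G x0" r
    by (rule ratio_locale[OF x r(4) xr r(1,3)])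
  obtain A0 where A0: "\<And>y. y \<in> D \<inter> ball z0 (r / 8) \<Longrightarrow> br.q y \<le> A0" using br.q_bounded by blast
  have key: "\<exists>\<mu>. M x w = ennreal \<mu> \<and> (\<lambda>n. br.q (y n)) \<longlonglongrightarrow> \<mu>" if a: "approaches y z0 w" for y w
  proof -
    have ev: "\<forall>\<^sub>F n in sequentially. y n \<in> D \<inter> ball z0 (r / 8)"
      by (rule approaches_eventually[OF a]) (use r in simp)
    then have "\<forall>\<^sub>F n in sequentially. G x (y n) / G x0 (y n) = ennreal (br.q (y n))"
    proof eventually_elim
      case (elim n)
      show ?case unfolding br.f1_eq(1)[OF elim]
        using br.ratio_values[OF elim] by (intro mult_divide_eq_ennreal) auto
    qed
    from Lim_transform_eventually[OF martin_kernel_limit[OF a z0 x] this]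
    have lim: "(\<lambda>n. ennreal (br.q (y n))) \<longlonglongrightarrow> M x w" .
    have "M x w \<le> ennreal A0"
      by (rule tendsto_upperbound[OF lim]) (use ev in \<open>auto elim!: eventually_mono intro!: ennreal_leI A0\<close>)
    then obtain \<mu> where \<mu>: "M x w = ennreal \<mu>" "0 \<le> \<mu>" by (cases "M x w") (auto simp: top_unique)
    have "(\<lambda>n. enn2real (ennreal (br.q (y n)))) \<longlonglongrightarrow> enn2real (ennreal \<mu>)"
      using lim unfolding \<mu>(1) by (intro tendsto_enn2real) auto
    then have "(\<lambda>n. br.q (y n)) \<longlonglongrightarrow> \<mu>" using \<mu>(2) by (simp add: br.q_def)
    with \<mu> show ?thesis by blast
  qed
  obtain \<mu> where \<mu>: "M x w = ennreal \<mu>" "(\<lambda>n. br.q (y n)) \<longlonglongrightarrow> \<mu>" using key[OF a] by blast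
  obtain \<mu>' where \<mu>': "M x w' = ennreal \<mu>'" "(\<lambda>n. br.q (y' n)) \<longlonglongrightarrow> \<mu>'" using key[OF a'] by blast
  have "\<bar>\<mu> - \<mu>'\<bar> \<le> e" if e: "0 < e" for e
  proof -
    obtain t where t: "t > 0" "\<forall>y\<in>D \<inter> ball z0 t. \<forall>y'\<in>D \<inter> ball z0 t. \<bar>br.q y - br.q y'\<bar> \<le> e"
      using br.ratio_cauchy[OF e] by blast
    have "(\<lambda>n. \<bar>br.q (y n) - br.q (y' n)\<bar>) \<longlonglongrightarrow> \<bar>\<mu> - \<mu>'\<bar>" by (intro tendsto_intros \<mu> \<mu>')
    then show ?thesis
    proof (rule tendsto_upperbound)
      show "\<forall>\<^sub>F n in sequentially. \<bar>br.q (y n) - br.q (y' n)\<bar> \<le> e"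
        using approaches_eventually[OF a t(1)] approaches_eventually[OF a' t(1)]
        by eventually_elim (use t(2) in blast)
    qed simp
  qed
  then have "\<bar>\<mu> - \<mu>'\<bar> \<le> 0" by (rule field_le_epsilon) simp
  then show ?thesis using \<mu> \<mu>' by simp
qed

lemma inaccessible_kernel:
  assumes a: "approaches y z0 w" and x: "x \<in> D" and fin: "poisson_kernel m j D G x z0 < \<top>" "poisson_kernel m j D G x0 z0 < \<top>"
  shows "0 < poisson_kernel m j D G x0 z0"
    "M x w = poisson_kernel m j D G x z0 / poisson_kernel m j D G x0 z0"
proof -
  obtain s where s: "0 < s" "ereal s < R" "x0 \<notin> cball z0 s" using small_radius[OF x0, of 1] by auto
  obtain r where r: "0 < r" "r < s" "ereal r < R" "x \<notin> cball z0 r" using small_radius[OF x s(1)] by auto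
  have xr: "x0 \<notin> cball z0 r" using s r by auto
  interpret br: bdry_ratio Xh m jh D z0 R Ch c1 "G x" "G x0" r
    by (rule ratio_locale[OF x r(4) xr r(1,3)])
  obtain p1 where p1: "poisson_kernel m j D G x z0 = ennreal p1" "0 \<le> p1"
    using fin by (cases "poisson_kernel m j D G x z0") auto
  obtain p2 where p2: "poisson_kernel m j D G x0 z0 = ennreal p2" "0 \<le> p2"
    using fin by (cases "poisson_kernel m j D G x0 z0") auto
  show pos: "0 < poisson_kernel m j D G x0 z0" unfolding poisson_eq[OF z0] by (rule br.full_pos(2))
  then have p2pos: "0 < p2" using p2 by (simp add: ennreal_less_zero_iff)
  have lim: "\<exists>t>0. \<forall>y\<in>D \<inter> ball z0 t. \<bar>br.q y - p1 / p2\<bar> \<le> e" if "0 < e" for e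
    by (rule br.inaccessible_limit[OF _ p1(2) _ p2(2) that]) (use p1 p2 poisson_eq[OF z0] in auto)
  have "(\<lambda>n. br.q (y n)) \<longlonglongrightarrow> p1 / p2"
  proof (rule tendstoI)
    fix e :: real assume "0 < e"
    then have "0 < e / 2" by simp
    from lim[OF this] obtain t where t: "t > 0" "\<And>y. y\<in>D \<inter> ball z0 t \<Longrightarrow> \<bar>br.q y - p1 / p2\<bar> \<le> e / 2" by blast
    show "\<forall>\<^sub>F n in sequentially. dist (br.q (y n)) (p1 / p2) < e"
      using approaches_eventually[OF a t(1)]
    proof eventually_elim
      case (elim n)
      then show ?case using t(2)[OF elim] \<open>0 < e\<close> by (simp add: dist_real_def)
    qed
  qed
  then have "(\<lambda>n. ennreal (br.q (y n))) \<longlonglongrightarrow> ennreal (p1 / p2)" by (rule tendsto_ennrealI)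
  moreover have ev: "\<forall>\<^sub>F n in sequentially. y n \<in> D \<inter> ball z0 (r / 8)"
    by (rule approaches_eventually[OF a]) (use r in simp)
  from ev have "\<forall>\<^sub>F n in sequentially. ennreal (br.q (y n)) = G x (y n) / G x0 (y n)"
  proof eventually_elim
    case (elim n)
    show ?case unfolding br.f1_eq(1)[OF elim]
      using br.ratio_values[OF elim] by (intro mult_divide_eq_ennreal[symmetric]) auto
  qed
  ultimately have "(\<lambda>n. G x (y n) / G x0 (y n)) \<longlonglongrightarrow> ennreal (p1 / p2)" by (rule Lim_transform_eventually)
  with martin_kernel_limit[OF a z0 x] have "M x w = ennreal (p1 / p2)" using LIMSEQ_unique by blast
  then show "M x w = poisson_kernel m j D G x z0 / poisson_kernel m j D G x0 z0"
    unfolding p1 p2 using p1 p2pos by (simp add: divide_ennreal)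
qed

text \<open>The negation of \<open>accessible\<close> provides finiteness at one point only;
  comparability of Green functions near \<open>z0\<close> spreads it to all.\<close>

lemma poisson_finite_all:
  assumes x: "x \<in> D" "poisson_kernel m j D G x z0 < \<top>" and x': "x' \<in> D"
  shows "poisson_kernel m j D G x' z0 < \<top>"
proof -
  have x0fin: "poisson_kernel m j D G v z0 < \<top> \<longleftrightarrow> poisson_kernel m j D G x0 z0 < \<top>" if v: "v \<in> D" for v
  proof -
    obtain s where s: "0 < s" "ereal s < R" "x0 \<notin> cball z0 s" using small_radius[OF x0, of 1] by auto
    obtain r where r: "0 < r" "r < s" "ereal r < R" "v \<notin> cball z0 r" using small_radius[OF v s(1)] by auto
    have xr: "x0 \<notin> cball z0 r" using s r by auto
    interpret br: bdry_ratio Xh m jh D z0 R Ch c1 "G v" "G x0" r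
      by (rule ratio_locale[OF v r(4) xr r(1,3)])
    show ?thesis using br.full_infinite_iff unfolding poisson_eq[OF z0] by (auto simp: top.not_eq_extremum[symmetric])
  qed
  show ?thesis using x0fin[OF x(1)] x0fin[OF x'] x(2) by simp
qed

text \<open>The quotient in \<open>inaccessible_kernel\<close> read as a potential: \<open>p\<close>
  is the Poisson kernel at \<open>x0\<close>.\<close>

lemma inaccessible_potential:
  assumes nacc: "\<not> accessible m j D G z0" and a: "approaches y z0 w"
  obtains p :: real where "0 < p"
    "\<And>v. v \<in> D \<Longrightarrow> fwd.occ D (\<lambda>u. ennreal (j u z0 / p)) v = M v w \<and> M v w < \<top>"
proof -
  let ?P = "poisson_kernel m j D G"
  note [measurable] = fwd.j_section
  obtain v0 where v0: "v0 \<in> D" "?P v0 z0 \<noteq> \<infinity>" using nacc z0 unfolding accessible_def by blast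
  have fin: "?P x z0 < \<top>" if "x \<in> D" for x
    by (rule poisson_finite_all[OF v0(1) _ that]) (use v0(2) in \<open>simp add: less_top\<close>)
  note k = inaccessible_kernel[OF a _ fin fin[OF x0]]
  obtain p where p: "?P x0 z0 = ennreal p" "0 < p"
    using k(1)[OF x0 x0] fin[OF x0] by (cases "?P x0 z0") auto
  have "fwd.occ D (\<lambda>u. ennreal (j u z0 / p)) v = M v w \<and> M v w < \<top>" if v: "v \<in> D" for v
  proof -
    have "fwd.occ D (\<lambda>u. ennreal (j u z0 / p)) v = fwd.occ D (\<lambda>u. inverse (ennreal p) * ennreal (j u z0)) v"
      using p by (simp add: inverse_ennreal divide_inverse mult.commute flip: ennreal_mult')
    also have "\<dots> = inverse (ennreal p) * fwd.occ D (\<lambda>u. ennreal (j u z0)) v"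
      by (rule fwd.occ_cmult[OF open_D]) measurable
    also have "\<dots> = M v w" using k(2)[OF v v] p by (simp add: poisson_occ[OF v] divide_ennreal_def mult.commute)
    finally show ?thesis using k(2)[OF v v] fin[OF v] p by (auto intro: ennreal_divide_less_top)
  qed
  with p(2) show thesis by (rule that)
qed

section \<open>Uniform integrability and the submean property at an accessible point\<close>

lemma mass_vanishes:
  assumes \<delta>: "0 < \<delta>"
  shows "\<exists>\<epsilon>>0. emeasure m (D \<inter> ball z0 \<epsilon>) \<le> ennreal \<delta>"
proof -
  define A where "A n = D \<inter> ball z0 (1 / real (Suc n))" for n
  have "open (A n)" for n using open_D by (auto simp: A_def)
  then have Am: "range A \<subseteq> sets m" unfolding fwd.sets_m by (intro image_subsetI borel_open)
  have dec: "decseq A"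
  proof (rule decseq_SucI)
    fix n
    have "1 / real (Suc (Suc n)) \<le> 1 / real (Suc n)" by (simp add: field_simps)
    then show "A (Suc n) \<subseteq> A n" unfolding A_def by (intro Int_mono order_refl subset_ball)
  qed
  have fin: "emeasure m (A n) \<noteq> \<infinity>" for n
  proof -
    have "emeasure m (A n) \<le> emeasure m (cball z0 (1 / real (Suc n)))"
      using fwd.sets_m by (intro emeasure_mono) (auto simp: A_def)
    also have "\<dots> < \<infinity>" by (intro fwd.m_finite_compact) (simp add: compact_eq_bounded_closed)
    finally show ?thesis by simp
  qed
  \<comment> \<open>An atom of \<open>m\<close> at \<open>z0\<close> does no harm, since
    \<open>z0\<close> is not in \<open>D\<close>.\<close>
  have "(\<Inter>n. A n) = {}"
  proof -
    have False if "\<And>n. v \<in> A n" for v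
    proof -
      have "v \<in> D" using that[of 0] by (simp add: A_def)
      then have d: "0 < dist z0 v" using z0_notin by auto
      then obtain n where "1 / real (Suc n) < dist z0 v" using reals_Archimedean[OF d] by (metis inverse_eq_divide)
      then show False using that[of n] by (simp add: A_def)
    qed
    then show ?thesis by blast
  qed
  then have "(\<lambda>n. emeasure m (A n)) \<longlonglongrightarrow> 0"
    using Lim_emeasure_decseq[OF Am dec fin] by simp
  from order_tendstoD(2)[OF this, of "ennreal \<delta>"] \<delta>
  have "\<forall>\<^sub>F n in sequentially. emeasure m (A n) < ennreal \<delta>" by simp
  then obtain n where "emeasure m (A n) < ennreal \<delta>" by (auto simp: eventually_sequentially)
  then show ?thesis unfolding A_def by (intro exI[of _ "1 / real (Suc n)"]) auto
qed

text \<open>Uniform integrability at an accessible point: the expected time that the dual process started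
  at \<open>y\<close> spends near \<open>z0\<close> is negligible against \<open>G x0 y\<close>.  Within a ball of radius \<open>\<rho>\<close> this
  holds because the integral in F1 diverges as \<open>\<rho>\<close> tends to \<open>0\<close>; after leaving that ball, F1 for
  the original process compares \<open>G v w\<close> with \<open>G v0 w\<close> for a fixed \<open>v0\<close>.\<close>

lemma near_mass_small:
  assumes acc: "accessible m j D G z0" and a: "approaches y z0 w" and \<eta>: "0 < \<eta>"
  shows "\<exists>\<epsilon>0>0. \<forall>\<epsilon>. 0 < \<epsilon> \<and> \<epsilon> \<le> \<epsilon>0 \<longrightarrow>
    (\<forall>\<^sub>F n in sequentially. (\<integral>\<^sup>+v. G v (y n) * indicator (ball z0 \<epsilon>) v \<partial>m) \<le> ennreal \<eta> * G x0 (y n))"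
proof -
  obtain s where s: "0 < s" "ereal s < R" "x0 \<notin> cball z0 s" using small_radius[OF x0, of 1] by auto
  have hf: "bwd.bdry_harm D z0 s (G x0)" by (rule bdry_harm_bwd[OF x0 s(3,1) z0])
  have "bwd.jump_int UNIV (G x0) z0 = \<top>"
    using acc x0 poisson_eq[OF z0, of x0] by (auto simp: accessible_def)
  then have near: "pb.near s (G x0) = \<top>"
    using pb.far_finite(2)[OF hf s(1) order_refl s(2)] unfolding pb.full_eq[OF G_section(1), of x0 s] by auto
  have Ch: "1 \<le> Ch" by (rule pb.C_ge)
  have C: "1 \<le> C" by (rule pf.C_ge)
  \<comment> \<open>Then \<open>Ch / K = \<eta> / 2\<close>: F1 converts an integral of size
    \<open>K\<close> into a mean exit time of at most half the allowance.\<close>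
  define K where "K = 2 * Ch / \<eta>"
  have K: "0 < K" using Ch \<eta> by (simp add: K_def)
  obtain n0 where n0: "\<And>n. n0 \<le> n \<Longrightarrow> ennreal K \<le> bwd.jump_int (ball z0 s - ball z0 (s / real (n + 2))) (G x0) z0"
    using pb.annulus_large[OF hf s(1) near] by blast
  define \<rho> where "\<rho> = s / real (n0 + 2)"
  have \<rho>: "0 < \<rho>" "\<rho> \<le> s" using s by (auto simp: \<rho>_def field_simps)
  have \<rho>R: "ereal \<rho> < R" using \<rho> s by (meson ereal_less_eq(3) le_less_trans)
  have KL: "ennreal K \<le> bwd.far_int z0 \<rho> (G x0)"
  proof -
    have "ennreal K \<le> bwd.jump_int (ball z0 s - ball z0 \<rho>) (G x0) z0" using n0[of n0] by (simp add: \<rho>_def)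
    also have "\<dots> \<le> pb.far \<rho> (G x0)" by (rule pb.jump_int_mono_set) auto
    also have "\<dots> \<le> bwd.far_int z0 \<rho> (G x0)" by (rule pb.far_le_far_int[OF \<rho>(1)])
    finally show ?thesis .
  qed
  define Tb where "Tb y = mean_exit Xh (D \<inter> ball z0 \<rho>) y" for y
  have Tb: "Tb y \<le> ennreal (\<eta> / 2) * G x0 y" if y: "y \<in> D \<inter> ball z0 (\<rho> / 8)" for y
  proof -
    have "Tb y * ennreal K \<le> Tb y * bwd.far_int z0 \<rho> (G x0)" by (intro mult_left_mono KL) simp
    also have "\<dots> \<le> ennreal Ch * G x0 y"
      unfolding Tb_def by (rule pb.bdry_harm_bounds(2)[OF hf \<rho> \<rho>R y])
    finally have le: "Tb y * ennreal K \<le> ennreal Ch * G x0 y" .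
    have "Tb y = Tb y * ennreal K * ennreal (1 / K)"
      using K by (simp add: mult.assoc flip: ennreal_mult)
    also have "\<dots> \<le> ennreal Ch * G x0 y * ennreal (1 / K)" by (intro mult_right_mono le) simp
    also have "\<dots> = (ennreal Ch * ennreal (1 / K)) * G x0 y" by (simp add: ac_simps)
    also have "ennreal Ch * ennreal (1 / K) = ennreal (Ch / K)"
      using Ch K by (simp flip: ennreal_mult)
    also have "Ch / K = \<eta> / 2" using Ch by (simp add: K_def)
    finally show ?thesis .
  qed
  \<comment> \<open>Strictly smaller than \<open>\<rho>\<close>, so that every point outside the
    ball of radius \<open>\<rho>\<close> is a pole off \<open>cball z0 r'\<close>, as F1 for the
    original process needs.\<close>
  define r' where "r' = \<rho> / 2"
  have r': "0 < r'" "ereal r' < R" "r' < \<rho>"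
    using \<rho> \<rho>R by (auto simp: r'_def intro: le_less_trans[of _ "ereal \<rho>"])
  have x0r: "x0 \<notin> cball z0 r'" using s \<rho> r' by auto
  define Tf where "Tf v = mean_exit X (D \<inter> ball z0 r') v" for v
  have Tfm[measurable]: "Tf \<in> borel_measurable borel"
    unfolding Tf_def fwd.mean_exit_eq using open_D by (intro fwd.occ_measurable) auto
  have hfx: "fwd.bdry_harm D z0 r' (\<lambda>v. G v x0)" by (rule bdry_harm_fwd[OF x0 x0r r'(1) z0])
  define L where "L = fwd.far_int z0 r' (\<lambda>v. G v x0)"
  have L: "0 < L" "L < \<top>"
    unfolding L_def using far_int_pos_fwd[OF x0 x0r r'(1)] pf.far_finite(1)[OF hfx r'(1) order_refl r'(2)] by auto
  \<comment> \<open>Bounds the mean exit time near \<open>z0\<close>: F1 for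
    \<open>\<lambda>v. G v x0\<close> compares the two, and the assumed bound on Green functions
    with one argument near \<open>z0\<close> controls \<open>G v x0\<close>.\<close>
  define B where "B = ennreal C * ennreal (c r') / L"
  have B: "B < \<top>" unfolding B_def using L by (intro ennreal_divide_less_top) (auto simp: ennreal_mult_less_top)
  have TfB: "Tf v \<le> B" if v: "v \<in> D \<inter> ball z0 (r' / 8)" for v
  proof -
    have "Tf v * L \<le> ennreal C * G v x0"
      unfolding Tf_def L_def by (rule pf.bdry_harm_bounds(2)[OF hfx r'(1) order_refl r'(2) v])
    also have "\<dots> \<le> ennreal C * ennreal (c r')"
      using bound[OF r'(1,2), of v x0] v x0r r' by (intro mult_left_mono) auto
    finally have "Tf v * L / L \<le> B" unfolding B_def by (rule divide_right_mono_ennreal)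
    then show ?thesis using L by (simp add: mult_divide_eq_ennreal)
  qed
  have "D \<inter> ball z0 (r' / 8) \<noteq> {}" using pf.U_nonempty[of "r' / 8"] r' by simp
  then obtain v0 where v0: "v0 \<in> D \<inter> ball z0 (r' / 8)" by blast
  have v0U: "v0 \<in> D \<inter> ball z0 r'" using v0 r' by auto
  have Tf0: "0 < Tf v0" "Tf v0 < \<top>"
    using pf.T_pos[OF v0U] TfB[OF v0] B by (auto simp: Tf_def intro: le_less_trans)
  have comp: "G v u * Tf v0 \<le> ennreal (C\<^sup>2) * Tf v * G v0 u"
    if v: "v \<in> D \<inter> ball z0 (r' / 8)" and u: "u \<in> D" "u \<notin> ball z0 \<rho>" for v u
  proof -
    have ur: "u \<notin> cball z0 r'" using u r' by auto
    have h: "fwd.bdry_harm D z0 r' (\<lambda>v. G v u)" by (rule bdry_harm_fwd[OF u(1) ur r'(1) z0])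
    define \<Lambda> where "\<Lambda> = fwd.far_int z0 r' (\<lambda>v. G v u)"
    have "G v u * Tf v0 \<le> ennreal C * (Tf v * \<Lambda>) * Tf v0"
      unfolding Tf_def \<Lambda>_def by (intro mult_right_mono pf.bdry_harm_bounds(1)[OF h r'(1) order_refl r'(2) v]) simp
    also have "\<dots> = ennreal C * Tf v * (Tf v0 * \<Lambda>)" by (simp add: ac_simps)
    also have "\<dots> \<le> ennreal C * Tf v * (ennreal C * G v0 u)"
      unfolding Tf_def \<Lambda>_def by (intro mult_left_mono pf.bdry_harm_bounds(2)[OF h r'(1) order_refl r'(2) v0]) simp
    also have "\<dots> = ennreal (C\<^sup>2) * Tf v * G v0 u"
      using C by (simp add: ac_simps power2_eq_square ennreal_mult)
    finally show ?thesis .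
  qed
  obtain \<epsilon>1 where \<epsilon>1: "0 < \<epsilon>1" "\<epsilon>1 < s" "ereal \<epsilon>1 < R" "v0 \<notin> cball z0 \<epsilon>1"
    using small_radius[of v0 s] v0 s by auto
  have x0e: "x0 \<notin> cball z0 \<epsilon>1" using \<epsilon>1 s by auto
  have "D \<inter> ball z0 (\<epsilon>1 / 8) \<noteq> {}" using pf.U_nonempty[of "\<epsilon>1 / 8"] \<epsilon>1 by simp
  then obtain y' where y': "y' \<in> D \<inter> ball z0 (\<epsilon>1 / 8)" by blast
  define B' where "B' = ennreal (Ch ^ 4) / G x0 y' * G v0 y'"
  have B': "B' < \<top>"
  proof -
    have "v0 \<noteq> y'" using y' \<epsilon>1 by auto
    then have "G v0 y' < \<top>" by (rule G_finite)
    moreover have "0 < G x0 y'" using G_x0_pos[OF x0e \<epsilon>1(1,3) y'] by simp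
    ultimately show ?thesis unfolding B'_def
      by (auto simp: ennreal_mult_less_top intro: ennreal_divide_less_top)
  qed
  have Gv0: "G v0 y \<le> B' * G x0 y" if y: "y \<in> D \<inter> ball z0 (\<epsilon>1 / 8)" for y
  proof -
    note p = G_x0_pos[OF x0e \<epsilon>1(1,3) y]
    have "G v0 y = G v0 y / G x0 y * G x0 y"
      using p by (simp add: ennreal_divide_times mult_divide_eq_ennreal)
    also have "\<dots> \<le> B' * G x0 y"
      unfolding B'_def using v0 \<epsilon>1 x0e y y' by (intro mult_right_mono G_ratio_le) auto
    finally show ?thesis .
  qed
  define Q where "Q = ennreal (C\<^sup>2) * B * B' / Tf v0"
  have "Q < \<top>"
    unfolding Q_def using B B' Tf0 by (intro ennreal_divide_less_top) (auto simp: ennreal_mult_less_top)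
  then obtain Qr where Qr: "Q = ennreal Qr" "0 \<le> Qr" by (cases Q) auto
  \<comment> \<open>A mass below \<open>\<delta>\<close> near \<open>z0\<close> compensates the
    collected constants, as \<open>Qr * \<delta> \<le> \<eta> / 2\<close>; the summand
    \<open>1\<close> avoids division by zero.\<close>
  define \<delta> where "\<delta> = \<eta> / (2 * (Qr + 1))"
  have "0 < 2 * (Qr + 1)" using Qr by simp
  then have \<delta>0: "0 < \<delta>" unfolding \<delta>_def by (rule divide_pos_pos[OF \<eta>])
  have "Qr + 1 \<noteq> 0" using Qr by simp
  then have "(Qr + 1) * \<delta> = \<eta> / 2" unfolding \<delta>_def by (simp add: divide_simps)
  moreover have "(Qr + 1) * \<delta> = Qr * \<delta> + \<delta>" by (rule distrib_right[where c = \<delta> and b = 1, simplified])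
  ultimately have \<delta>: "0 < \<delta>" "Qr * \<delta> \<le> \<eta> / 2" using \<delta>0 by linarith+
  obtain \<epsilon>2 where \<epsilon>2: "0 < \<epsilon>2" "emeasure m (D \<inter> ball z0 \<epsilon>2) \<le> ennreal \<delta>" using mass_vanishes[OF \<delta>(1)] by blast
  define \<epsilon>0 where "\<epsilon>0 = min \<epsilon>2 (r' / 8)"
  have mass: "(\<integral>\<^sup>+v. G v y * indicator (ball z0 \<epsilon>) v \<partial>m) \<le> ennreal \<eta> * G x0 y"
    if \<epsilon>: "0 < \<epsilon>" "\<epsilon> \<le> \<epsilon>0" and y: "y \<in> D \<inter> ball z0 (\<rho> / 8)" "y \<in> D \<inter> ball z0 (\<epsilon>1 / 8)" for \<epsilon> y
  proof -
    define U where "U = D \<inter> ball z0 \<rho>"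
    have U: "open U" "U \<subseteq> D" "y \<in> U" using open_D y \<rho> by (auto simp: U_def)
    have "(\<integral>\<^sup>+v. G v y * indicator (ball z0 \<epsilon>) v \<partial>m) = (\<integral>\<^sup>+v. Gh y v * indicator (ball z0 \<epsilon>) v \<partial>m)"
      by (simp add: dual)
    also have "\<dots> = bwd.occ U (indicator (ball z0 \<epsilon>)) y +
        (\<integral>\<^sup>+v. bwd.exit_int U (\<lambda>u. Gh u v) y * indicator (ball z0 \<epsilon>) v \<partial>m)"
      by (rule sw.exit_green_integral[OF U]) simp
    also have "\<dots> \<le> Tb y + ennreal (\<eta> / 2) * G x0 y"
    proof (rule add_mono)
      have "bwd.occ U (indicator (ball z0 \<epsilon>)) y \<le> bwd.occ U (\<lambda>_. 1) y"
        by (rule bwd.occ_mono) (auto simp: indicator_def)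
      then show "bwd.occ U (indicator (ball z0 \<epsilon>)) y \<le> Tb y"
        unfolding Tb_def U_def[symmetric] bwd.mean_exit_eq .
      have pt: "bwd.exit_int U (\<lambda>u. Gh u v) y \<le> ennreal (C\<^sup>2) * B / Tf v0 * G v0 y"
        if v: "v \<in> D \<inter> ball z0 (r' / 8)" for v
      proof -
        have "bwd.exit_int U (\<lambda>u. Gh u v) y = bwd.exit_int U (\<lambda>u. Gh u v) y * Tf v0 / Tf v0"
          using Tf0 by (simp add: mult_divide_eq_ennreal)
        also have "bwd.exit_int U (\<lambda>u. Gh u v) y * Tf v0 = bwd.exit_int U (\<lambda>u. Tf v0 * Gh u v) y"
          using bwd.exit_int_cmult[OF U(1) sw.G_section(2), of "Tf v0" v y] by (simp add: mult.commute)
        also have "\<dots> \<le> bwd.exit_int U (\<lambda>u. (ennreal (C\<^sup>2) * B) * Gh u v0) y"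
        proof (rule bwd.exit_int_mono'[OF U(1)])
          fix u assume "u \<notin> U"
          show "Tf v0 * Gh u v \<le> (ennreal (C\<^sup>2) * B) * Gh u v0"
          proof (cases "u \<in> D")
            case True
            then have "u \<notin> ball z0 \<rho>" using \<open>u \<notin> U\<close> by (simp add: U_def)
            from comp[OF v True this] have "Tf v0 * G v u \<le> ennreal (C\<^sup>2) * Tf v * G v0 u"
              by (simp add: mult.commute)
            also have "\<dots> \<le> ennreal (C\<^sup>2) * B * G v0 u"
              by (intro mult_left_mono mult_right_mono TfB[OF v]) auto
            finally show ?thesis by (simp add: dual)
          qed (simp add: sw.G_outside)
        qed
        also have "\<dots> = (ennreal (C\<^sup>2) * B) * bwd.exit_int U (\<lambda>u. Gh u v0) y"
          by (rule bwd.exit_int_cmult[OF U(1) sw.G_section(2)])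
        also have "\<dots> \<le> (ennreal (C\<^sup>2) * B) * Gh y v0"
          using v0 by (intro mult_left_mono sw.exit_green_le[OF U]) auto
        finally have "bwd.exit_int U (\<lambda>u. Gh u v) y \<le> (ennreal (C\<^sup>2) * B) * G v0 y / Tf v0"
          by (simp add: dual divide_right_mono_ennreal)
        then show ?thesis by (simp add: divide_ennreal_def ac_simps)
      qed
      have "(\<integral>\<^sup>+v. bwd.exit_int U (\<lambda>u. Gh u v) y * indicator (ball z0 \<epsilon>) v \<partial>m) \<le>
        (\<integral>\<^sup>+v. (ennreal (C\<^sup>2) * B / Tf v0 * G v0 y) * indicator (D \<inter> ball z0 \<epsilon>2) v \<partial>m)"
      proof (rule nn_integral_mono)
        fix v
        show "bwd.exit_int U (\<lambda>u. Gh u v) y * indicator (ball z0 \<epsilon>) v \<le>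
            (ennreal (C\<^sup>2) * B / Tf v0 * G v0 y) * indicator (D \<inter> ball z0 \<epsilon>2) v"
        proof (cases "v \<in> D")
          case True
          then show ?thesis using pt[of v] \<epsilon> by (auto simp: indicator_def \<epsilon>0_def)
        next
          case False
          then have "(\<lambda>u. Gh u v) = (\<lambda>u. 0)" using sw.G_outside by auto
          then have "bwd.exit_int U (\<lambda>u. Gh u v) y = 0"
            using bwd.exit_int_cmult[OF U(1), of "\<lambda>_. 0" 0 y] by simp
          then show ?thesis by simp
        qed
      qed
      also have "\<dots> = ennreal (C\<^sup>2) * B / Tf v0 * G v0 y * emeasure m (D \<inter> ball z0 \<epsilon>2)"
        using open_D fwd.sets_m by (intro nn_integral_cmult_indicator) auto
      also have "\<dots> \<le> ennreal (C\<^sup>2) * B / Tf v0 * (B' * G x0 y) * ennreal \<delta>"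
        by (intro mult_mono mult_left_mono Gv0[OF y(2)] \<epsilon>2) auto
      also have "\<dots> = (Q * ennreal \<delta>) * G x0 y"
        unfolding Q_def by (simp add: divide_ennreal_def ac_simps)
      also have "\<dots> \<le> ennreal (\<eta> / 2) * G x0 y"
        using \<delta> Qr by (intro mult_right_mono) (auto intro!: ennreal_leI simp flip: ennreal_mult)
      finally show "(\<integral>\<^sup>+v. bwd.exit_int U (\<lambda>u. Gh u v) y * indicator (ball z0 \<epsilon>) v \<partial>m) \<le> ennreal (\<eta> / 2) * G x0 y" .
    qed
    also have "\<dots> \<le> ennreal (\<eta> / 2) * G x0 y + ennreal (\<eta> / 2) * G x0 y"
      by (intro add_right_mono Tb[OF y(1)])
    also have "\<dots> = ennreal \<eta> * G x0 y"
      using \<eta> by (simp flip: distrib_right ennreal_plus)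
    finally show ?thesis .
  qed
  show ?thesis
  proof (intro exI[of _ \<epsilon>0] conjI allI impI)
    show "0 < \<epsilon>0" using \<epsilon>2 r' by (simp add: \<epsilon>0_def)
    fix \<epsilon> assume \<epsilon>: "0 < \<epsilon> \<and> \<epsilon> \<le> \<epsilon>0"
    have "\<forall>\<^sub>F n in sequentially. y n \<in> D \<inter> ball z0 (\<rho> / 8)"
      by (rule approaches_eventually[OF a]) (use \<rho> in simp)
    moreover have "\<forall>\<^sub>F n in sequentially. y n \<in> D \<inter> ball z0 (\<epsilon>1 / 8)"
      by (rule approaches_eventually[OF a]) (use \<epsilon>1 in simp)
    ultimately show "\<forall>\<^sub>F n in sequentially. (\<integral>\<^sup>+v. G v (y n) * indicator (ball z0 \<epsilon>) v \<partial>m) \<le> ennreal \<eta> * G x0 (y n)"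
      by eventually_elim (rule mass, use \<epsilon> in auto)
  qed
qed

text \<open>Jumps from \<open>u\<close> into a fixed ball around \<open>z0\<close> occur at a rate
  that dominates a multiple of \<open>j u z0\<close>. By the Levy system the accumulated rate is the
  probability of exit by such a jump, hence finite.\<close>

lemma occ_jump_finite:
  assumes r: "0 < r" "ereal r < R"
    and x: "x \<in> D - cball z0 r"
  shows "fwd.occ (D - cball z0 r) (\<lambda>u. ennreal (j u z0)) x < \<top>"
proof -
  define V where "V = D - cball z0 r"
  define A where "A = ball z0 (r / 2)"
  have V: "open V" "x \<in> V" using open_D x by (auto simp: V_def)
  have A[measurable]: "A \<in> sets borel" by (simp add: A_def)
  have "closure V \<subseteq> - ball z0 r" by (rule closure_minimal) (auto simp: V_def)
  then have disj: "A \<inter> closure V = {}" using r by (auto simp: A_def)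
  note [measurable] = fwd.j_section
  have mA: "0 < emeasure m A" using r by (intro fwd.m_pos_open) (auto simp: A_def)
  have le: "emeasure m A * ennreal (j u z0) \<le> ennreal c1 * fwd.jump_int A (\<lambda>_. 1) u" if u: "u \<in> V" for u
  proof -
    have "emeasure m A * ennreal (j u z0) = (\<integral>\<^sup>+v. ennreal (j u z0) * indicator A v \<partial>m)"
      using fwd.sets_m by (subst nn_integral_cmult_indicator) (auto simp: mult.commute)
    also have "\<dots> \<le> (\<integral>\<^sup>+v. ennreal c1 * (1 * indicator A v * ennreal (j u v)) \<partial>m)"
    proof (rule nn_integral_mono)
      fix v
      show "ennreal (j u z0) * indicator A v \<le> ennreal c1 * (1 * indicator A v * ennreal (j u v))"
      proof (cases "v \<in> A")
        case True
        then have "u \<noteq> v" "u \<noteq> z0" "u \<notin> ball z0 r" using u r by (auto simp: V_def A_def)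
        then have "j u z0 \<le> c1 * j u v" using C1b'[OF r, of v u] True by (simp add: j_dual A_def)
        then show ?thesis using True c1 by (simp add: ennreal_leI flip: ennreal_mult')
      qed simp
    qed
    also have "\<dots> = ennreal c1 * fwd.jump_int A (\<lambda>_. 1) u"
      unfolding fwd.jump_int_def by (intro nn_integral_cmult fwd.measurable_m) measurable
    finally show ?thesis .
  qed
  have "emeasure m A * fwd.occ V (\<lambda>u. ennreal (j u z0)) x = fwd.occ V (\<lambda>u. emeasure m A * ennreal (j u z0)) x"
    by (rule fwd.occ_cmult[OF V(1), symmetric]) measurable
  also have "\<dots> \<le> fwd.occ V (\<lambda>u. ennreal c1 * fwd.jump_int A (\<lambda>_. 1) u) x"
    by (rule fwd.occ_mono[OF le])
  also have "\<dots> = ennreal c1 * fwd.occ V (fwd.jump_int A (\<lambda>_. 1)) x"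
    by (intro fwd.occ_cmult[OF V(1)] fwd.jump_int_measurable A) simp
  also have "fwd.occ V (fwd.jump_int A (\<lambda>_. 1)) x = fwd.exit_int V (\<lambda>v. 1 * indicator A v) x"
    by (rule fwd.levy_exit[OF V A disj, symmetric]) simp
  finally have le: "emeasure m A * fwd.occ V (\<lambda>u. ennreal (j u z0)) x \<le>
    ennreal c1 * fwd.exit_int V (\<lambda>v. 1 * indicator A v) x" .
  have "fwd.exit_int V (\<lambda>v. 1 * indicator A v) x \<le> fwd.exit_int V (\<lambda>v. 1) x"
    by (rule fwd.exit_int_mono) (simp add: indicator_def)
  also have "\<dots> < \<top>"
    using finite_measure.emeasure_finite[OF fwd.finite_exit_law[OF V(1), of x], of UNIV]
    by (simp add: fwd.exit_int_eq[OF V(1)] top.not_eq_extremum)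
  finally have "ennreal c1 * fwd.exit_int V (\<lambda>v. 1 * indicator A v) x < \<top>"
    by (simp add: ennreal_mult_less_top)
  from le_less_trans[OF le this] have "emeasure m A * fwd.occ V (\<lambda>u. ennreal (j u z0)) x < \<top>" .
  then show ?thesis using mA by (auto simp: ennreal_mult_less_top V_def)
qed

text \<open>On the small ball the exit law has a bounded density: by C1 the jump density from
  \<open>u\<close> to any \<open>v\<close> near \<open>z0\<close> is at most
  \<open>c1 * j u z0\<close>. So only the mass of \<open>f\<close> near \<open>z0\<close>
  counts.\<close>

lemma near_exit_le:
  assumes r: "0 < r" "ereal r < R" and x: "x \<in> D - cball z0 r" and \<epsilon>: "\<epsilon> \<le> r / 2"
    and f[measurable]: "f \<in> borel_measurable borel"
  shows "fwd.exit_int (D - cball z0 r) (\<lambda>v. f v * indicator (ball z0 \<epsilon>) v) x \<le>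
    ennreal c1 * (\<integral>\<^sup>+v. f v * indicator (ball z0 \<epsilon>) v \<partial>m) * fwd.occ (D - cball z0 r) (\<lambda>u. ennreal (j u z0)) x"
proof -
  define V where "V = D - cball z0 r"
  define A where "A = ball z0 \<epsilon>"
  define g where "g = (\<integral>\<^sup>+v. f v * indicator A v \<partial>m)"
  have V: "open V" "x \<in> V" using open_D x by (auto simp: V_def)
  have A[measurable]: "A \<in> sets borel" by (simp add: A_def)
  have "closure V \<subseteq> - ball z0 r" by (rule closure_minimal) (auto simp: V_def)
  then have disj: "A \<inter> closure V = {}" using r \<epsilon> by (auto simp: A_def)
  note [measurable] = fwd.j_section
  have le: "fwd.jump_int A f u \<le> (ennreal c1 * g) * ennreal (j u z0)" if u: "u \<in> V" for u
  proof -
    have "fwd.jump_int A f u \<le> (\<integral>\<^sup>+v. (ennreal c1 * ennreal (j u z0)) * (f v * indicator A v) \<partial>m)"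
      unfolding fwd.jump_int_def
    proof (rule nn_integral_mono)
      fix v
      show "f v * indicator A v * ennreal (j u v) \<le> (ennreal c1 * ennreal (j u z0)) * (f v * indicator A v)"
      proof (cases "v \<in> A")
        case True
        then have "u \<noteq> v" "u \<noteq> z0" "u \<notin> ball z0 r" using u r \<epsilon> by (auto simp: V_def A_def)
        then have "j u v \<le> c1 * j u z0" using C1b[OF r, of v u] True \<epsilon> by (simp add: j_dual A_def)
        then have "ennreal (j u v) \<le> ennreal c1 * ennreal (j u z0)"
          using c1 by (simp add: ennreal_leI flip: ennreal_mult')
        then have "f v * indicator A v * ennreal (j u v) \<le> f v * indicator A v * (ennreal c1 * ennreal (j u z0))"
          by (intro mult_left_mono) auto
        then show ?thesis by (simp add: mult.commute)
      qed simp
    qed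
    also have "\<dots> = (ennreal c1 * ennreal (j u z0)) * g"
      unfolding g_def by (intro nn_integral_cmult fwd.measurable_m) measurable
    finally show ?thesis by (simp add: ac_simps)
  qed
  have "fwd.exit_int V (\<lambda>v. f v * indicator A v) x = fwd.occ V (fwd.jump_int A f) x"
    by (rule fwd.levy_exit[OF V A disj f])
  also have "\<dots> \<le> fwd.occ V (\<lambda>u. (ennreal c1 * g) * ennreal (j u z0)) x"
    by (rule fwd.occ_mono[OF le])
  also have "\<dots> = (ennreal c1 * g) * fwd.occ V (\<lambda>u. ennreal (j u z0)) x"
    by (rule fwd.occ_cmult[OF V(1)]) measurable
  finally show ?thesis by (simp add: V_def A_def g_def)
qed

text \<open>Fatou's lemma would give the opposite inequality. Each quotient has exit mean
  \<open>1\<close>; its share from a tiny ball around \<open>z0\<close> is at most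
  \<open>\<eta>\<close> uniformly in \<open>n\<close>, and off this ball all quotients have a common
  integrable bound, so the rest converges.\<close>

lemma kernel_submean:
  assumes acc: "accessible m j D G z0" and a: "approaches y z0 w" and r: "0 < r" "ereal r < R" and x0r: "x0 \<notin> cball z0 r"
  shows "1 \<le> fwd.exit_int (D - cball z0 r) (\<lambda>v. M v w * indicator D v) x0"
proof (rule ennreal_le_epsilon)
  fix \<eta> :: real assume \<eta>: "0 < \<eta>"
  define V where "V = D - cball z0 r"
  have V: "open V" "V \<subseteq> D" "x0 \<in> V" using open_D x0 x0r by (auto simp: V_def)
  have clV: "closure V \<subseteq> - ball z0 r" by (rule closure_minimal) (auto simp: V_def)
  have wM: "w \<in> martin_boundary D \<T> \<iota>" using a by (simp add: approaches_def)
  note [measurable] = M_measurable[OF wM]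
  define J where "J = fwd.occ V (\<lambda>u. ennreal (j u z0)) x0"
  have "J < \<top>" using V(3) unfolding J_def V_def by (rule occ_jump_finite[OF r])
  then obtain Jr where Jr: "J = ennreal Jr" "0 \<le> Jr" by (cases J) auto
  \<comment> \<open>Makes \<open>c1 * \<eta>' * J \<le> \<eta>\<close>, where \<open>J\<close> is
    the constant that \<open>near_exit_le\<close> leaves behind.\<close>
  define \<eta>' where "\<eta>' = \<eta> / (c1 * (Jr + 1))"
  have "0 < c1 * (Jr + 1)" using c1 Jr by simp
  then have \<eta>': "0 < \<eta>'" "c1 * \<eta>' * Jr \<le> \<eta>" using \<eta> c1 Jr by (auto simp: \<eta>'_def divide_simps algebra_simps)
  obtain \<epsilon>0 where \<epsilon>0: "0 < \<epsilon>0" "\<And>\<epsilon>. 0 < \<epsilon> \<Longrightarrow> \<epsilon> \<le> \<epsilon>0 \<Longrightarrow>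
    \<forall>\<^sub>F n in sequentially. (\<integral>\<^sup>+v. G v (y n) * indicator (ball z0 \<epsilon>) v \<partial>m) \<le> ennreal \<eta>' * G x0 (y n)"
    using near_mass_small[OF acc a \<eta>'(1)] by blast
  define \<epsilon> where "\<epsilon> = min \<epsilon>0 (r / 2)"
  have \<epsilon>: "0 < \<epsilon>" "\<epsilon> \<le> \<epsilon>0" "\<epsilon> \<le> r / 2" using \<epsilon>0 r by (auto simp: \<epsilon>_def)
  have \<epsilon>2: "0 < \<epsilon> / 2" "ereal (\<epsilon> / 2) < R" "x0 \<notin> cball z0 (\<epsilon> / 2)"
    using \<epsilon> r x0r by (auto intro: le_less_trans[of _ "ereal r"])
  define q where "q n v = G v (y n) / G x0 (y n)" for n v
  define A where "A = ball z0 \<epsilon>"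
  have A[measurable]: "A \<in> sets borel" by (simp add: A_def)
  have qm[measurable]: "q n \<in> borel_measurable borel" for n unfolding q_def divide_ennreal_def by measurable
  define good where "good n \<longleftrightarrow> y n \<in> D \<inter> ball z0 (\<epsilon> / 2 / 8) \<and>
    (\<integral>\<^sup>+v. G v (y n) * indicator A v \<partial>m) \<le> ennreal \<eta>' * G x0 (y n)" for n
  have "\<forall>\<^sub>F n in sequentially. good n"
    unfolding good_def A_def
    by (intro eventually_conj approaches_eventually[OF a] \<epsilon>0(2) \<epsilon>) (use \<epsilon> in auto)
  then obtain N where N: "\<And>n. N \<le> n \<Longrightarrow> good n" by (auto simp: eventually_sequentially)
  have pos: "0 < G x0 (y n)" "G x0 (y n) < \<top>" if "good n" for n
    using G_x0_pos[OF \<epsilon>2(3,1,2), of "y n"] that by (auto simp: good_def)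
  have near: "fwd.exit_int V (\<lambda>v. q n v * indicator A v) x0 \<le> ennreal \<eta>" if g: "good n" for n
  proof -
    have "fwd.exit_int V (\<lambda>v. q n v * indicator A v) x0 =
        fwd.exit_int V (\<lambda>v. inverse (G x0 (y n)) * (G v (y n) * indicator A v)) x0"
      by (simp add: q_def divide_ennreal_def ac_simps)
    also have "\<dots> = inverse (G x0 (y n)) * fwd.exit_int V (\<lambda>v. G v (y n) * indicator A v) x0"
      by (rule fwd.exit_int_cmult[OF V(1)]) measurable
    also have "\<dots> \<le> inverse (G x0 (y n)) * (ennreal c1 * (\<integral>\<^sup>+v. G v (y n) * indicator A v \<partial>m) * J)"
      unfolding J_def V_def A_def using V(3) \<epsilon>(3)
      by (intro mult_left_mono near_exit_le[OF r]) (auto simp: V_def)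
    also have "\<dots> \<le> inverse (G x0 (y n)) * (ennreal c1 * (ennreal \<eta>' * G x0 (y n)) * J)"
      using g by (intro mult_left_mono mult_right_mono) (auto simp: good_def)
    also have "\<dots> = (ennreal c1 * ennreal \<eta>' * ennreal Jr) * (G x0 (y n) / G x0 (y n))"
      by (simp add: Jr divide_ennreal_def ac_simps)
    also have "G x0 (y n) / G x0 (y n) = 1" using pos[OF g] by (intro ennreal_divide_self) auto
    also have "ennreal c1 * ennreal \<eta>' * ennreal Jr * 1 = ennreal (c1 * \<eta>' * Jr)"
      using c1 \<eta>' Jr by (simp add: ennreal_mult)
    also have "\<dots> \<le> ennreal \<eta>" by (rule ennreal_leI[OF \<eta>'(2)])
    finally show ?thesis .
  qed
  \<comment> \<open>The pole \<open>y n\<close> is off the closure of \<open>V\<close>, so the exit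
    mean reproduces \<open>G x0 (y n)\<close> exactly.\<close>
  have one: "fwd.exit_int V (q n) x0 = 1" if g: "good n" for n
  proof -
    have yn: "y n \<in> D" "y n \<notin> closure V" using g clV \<epsilon> r by (auto simp: good_def)
    have "fwd.exit_int V (q n) x0 = fwd.exit_int V (\<lambda>v. inverse (G x0 (y n)) * G v (y n)) x0"
      by (simp add: q_def[abs_def] divide_ennreal_def ac_simps)
    also have "\<dots> = inverse (G x0 (y n)) * fwd.exit_int V (\<lambda>v. G v (y n)) x0"
      by (rule fwd.exit_int_cmult[OF V(1)]) measurable
    also have "fwd.exit_int V (\<lambda>v. G v (y n)) x0 = G x0 (y n)"
      by (rule exit_green_eq[OF V yn])
    also have "inverse (G x0 (y n)) * G x0 (y n) = G x0 (y n) / G x0 (y n)"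
      by (simp add: divide_ennreal_def ac_simps)
    also have "\<dots> = 1" using pos[OF g] by (intro ennreal_divide_self) auto
    finally show ?thesis .
  qed
  have ge: "1 \<le> ennreal \<eta> + fwd.exit_int V (\<lambda>v. q n v * indicator (- A) v) x0" if g: "good n" for n
  proof -
    have "1 = fwd.exit_int V (\<lambda>v. q n v * indicator A v + q n v * indicator (- A) v) x0"
      unfolding one[OF g, symmetric] by (rule arg_cong[where f = "\<lambda>f. fwd.exit_int V f x0"]) (auto simp: indicator_def)
    also have "\<dots> = fwd.exit_int V (\<lambda>v. q n v * indicator A v) x0 + fwd.exit_int V (\<lambda>v. q n v * indicator (- A) v) x0"
      by (rule fwd.exit_int_add[OF V(1)]) measurable
    also have "\<dots> \<le> ennreal \<eta> + fwd.exit_int V (\<lambda>v. q n v * indicator (- A) v) x0"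
      by (intro add_right_mono near[OF g])
    finally show ?thesis .
  qed
  define h where "h v = M v w * indicator D v" for v
  have hm[measurable]: "h \<in> borel_measurable borel" unfolding h_def by measurable
  define y' where "y' = y N"
  have gN: "good N" by (rule N) simp
  have y': "y' \<in> D \<inter> ball z0 (\<epsilon> / 2 / 8)" using gN by (simp add: good_def y'_def)
  \<comment> \<open>Integrable against the exit law, because by \<open>exit_green_le\<close> the
    exit mean of \<open>\<lambda>v. G v y'\<close> is at most \<open>G x0 y'\<close>.\<close>
  define W where "W v = ennreal (Ch ^ 4) / G x0 y' * G v y'" for v
  have Wm[measurable]: "W \<in> borel_measurable borel" unfolding W_def by measurable
  have "(\<lambda>n. \<integral>\<^sup>+v. q (n + N) v * indicator (- A) v \<partial>fwd.exit_law V x0) \<longlonglongrightarrow> (\<integral>\<^sup>+v. h v * indicator (- A) v \<partial>fwd.exit_law V x0)"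
  proof (rule nn_integral_dominated_convergence[where w = W])
    show "AE v in fwd.exit_law V x0. q (n + N) v * indicator (- A) v \<le> W v" for n
    proof (rule AE_I2)
      fix v
      show "q (n + N) v * indicator (- A) v \<le> W v"
      proof (cases "v \<in> D \<and> v \<notin> A")
        case True
        then have "v \<in> D" "v \<notin> cball z0 (\<epsilon> / 2)" using \<epsilon> by (auto simp: A_def)
        moreover have "good (n + N)" by (rule N) simp
        ultimately show ?thesis
          using True G_ratio_le[OF _ _ \<epsilon>2(3,1,2) _ y', of v "y (n + N)"] by (auto simp: q_def W_def good_def)
      next
        case False
        then have "q (n + N) v * indicator (- A) v = 0" by (auto simp: q_def G_outside indicator_def)
        then show ?thesis by (simp only: zero_le)
      qed
    qed
    have "(\<integral>\<^sup>+v. W v \<partial>fwd.exit_law V x0) = fwd.exit_int V W x0" by (rule fwd.exit_int_eq[OF V(1) Wm, symmetric])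
    also have "\<dots> = ennreal (Ch ^ 4) / G x0 y' * fwd.exit_int V (\<lambda>v. G v y') x0"
      unfolding W_def by (rule fwd.exit_int_cmult[OF V(1)]) measurable
    also have "\<dots> \<le> ennreal (Ch ^ 4) / G x0 y' * G x0 y'"
      using y' by (intro mult_left_mono exit_green_le[OF V]) auto
    also have "\<dots> < \<infinity>" using pos[OF gN] by (auto simp: y'_def ennreal_mult_less_top intro: ennreal_divide_less_top)
    finally show "(\<integral>\<^sup>+v. W v \<partial>fwd.exit_law V x0) < \<infinity>" .
    show "AE v in fwd.exit_law V x0. (\<lambda>n. q (n + N) v * indicator (- A) v) \<longlonglongrightarrow> h v * indicator (- A) v"
    proof (rule AE_I2)
      fix v
      show "(\<lambda>n. q (n + N) v * indicator (- A) v) \<longlonglongrightarrow> h v * indicator (- A) v"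
      proof (cases "v \<in> D \<and> v \<notin> A")
        case True
        then have "(\<lambda>n. q n v) \<longlonglongrightarrow> M v w" using martin_kernel_limit[OF a z0] by (simp add: q_def)
        from LIMSEQ_ignore_initial_segment[OF this, of N] show ?thesis using True by (simp add: h_def)
      next
        case False
        then have "(\<lambda>n. q (n + N) v * indicator (- A) v) = (\<lambda>_. 0)" "h v * indicator (- A) v = 0"
          by (auto simp: q_def h_def G_outside indicator_def fun_eq_iff)
        then show ?thesis by (simp only: tendsto_const)
      qed
    qed
  qed (auto simp: W_def)
  then have "(\<lambda>n. fwd.exit_int V (\<lambda>v. q (n + N) v * indicator (- A) v) x0) \<longlonglongrightarrow> fwd.exit_int V (\<lambda>v. h v * indicator (- A) v) x0"
    by (subst (1 2) fwd.exit_int_eq[OF V(1)]) auto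
  then have "(\<lambda>n. ennreal \<eta> + fwd.exit_int V (\<lambda>v. q (n + N) v * indicator (- A) v) x0) \<longlonglongrightarrow>
      ennreal \<eta> + fwd.exit_int V (\<lambda>v. h v * indicator (- A) v) x0"
    by (intro tendsto_intros)
  then have "1 \<le> ennreal \<eta> + fwd.exit_int V (\<lambda>v. h v * indicator (- A) v) x0"
    by (rule tendsto_lowerbound) (auto intro!: always_eventually ge N)
  also have "\<dots> \<le> ennreal \<eta> + fwd.exit_int V h x0"
    by (intro add_left_mono fwd.exit_int_mono) (auto simp: indicator_def)
  finally show "1 \<le> fwd.exit_int (D - cball z0 r) (\<lambda>v. M v w * indicator D v) x0 + ennreal \<eta>"
    by (simp add: V_def h_def[abs_def] add.commute)
qed

end

section \<open>Boundary points are separated by their kernels\<close>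

context jump_hunt
begin

text \<open>A left limit of exit positions at \<open>z\<close> would contradict quasi-left-continuity, since the
  process does not visit \<open>z\<close> before leaving \<open>D\<close>.\<close>

lemma exit_exhaustion:
  assumes D: "open D" and z: "z \<notin> D" and \<rho>: "decseq \<rho>" "\<rho> \<longlonglongrightarrow> 0" and x: "x \<in> D - cball z (\<rho> 0)"
  shows "AE \<omega> in start X x. (SUP n. exit_time X (D - cball z (\<rho> n)) \<omega>) = exit_time X D \<omega>"
proof -
  define V where "V n = D - cball z (\<rho> n)" for n
  have V: "open (V n)" "V n \<subseteq> D" for n using D by (auto simp: V_def)
  have Vmono: "V k \<subseteq> V n" if "k \<le> n" for k n
    using decseqD[OF \<rho>(1) that] by (auto simp: V_def)
  have inc: "incseq (\<lambda>n. exit_time X (V n) \<omega>)" for \<omega>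
    by (intro monoI exit_time_mono Vmono)
  have "AE \<omega> in start X x. (SUP n. exit_time X (V n) \<omega>) < \<top> \<longrightarrow>
       limitin cem_top (\<lambda>n. traj X (exit_time X (V n) \<omega>) \<omega>) (traj X (SUP n. exit_time X (V n) \<omega>) \<omega>) sequentially"
    by (rule quasi_left[OF stopping_exit[OF V(1)] inc])
  then show ?thesis
    unfolding V_def[symmetric] using AE_start[of x]
  proof eventually_elim
    case (elim \<omega>)
    define T where "T = (SUP n. exit_time X (V n) \<omega>)"
    have le: "exit_time X (V n) \<omega> \<le> T" for n unfolding T_def by (rule SUP_upper) simp
    have pos: "0 < exit_time X (V n) \<omega>" for n
      using Vmono[of 0 n] x elim(2) by (intro exit_time_pos V) (auto simp: V_def)
    have "T \<le> exit_time X D \<omega>" unfolding T_def by (intro SUP_least exit_time_mono V)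
    moreover have "\<not> T < exit_time X D \<omega>"
    proof
      assume less: "T < exit_time X D \<omega>"
      have "traj X T \<omega> \<in> Some ` D" using pos[of 0] le[of 0] less by (intro traj_before_exit) auto
      then obtain p where p: "p \<in> D" "traj X T \<omega> = Some p" by auto
      define d where "d = dist z p"
      have d: "0 < d" using p z by (auto simp: d_def)
      have "limitin cem_top (\<lambda>n. traj X (exit_time X (V n) \<omega>) \<omega>) (Some p) sequentially"
        using elim(1) less p by (auto simp: T_def[symmetric] dest: less_le_trans[OF _ top_greatest])
      moreover have "openin cem_top (Some ` (- cball z (d / 2)))" by (rule openin_cem_Some) auto
      moreover have "Some p \<in> Some ` (- cball z (d / 2))" using d by (auto simp: d_def)
      ultimately have "\<forall>\<^sub>F n in sequentially. traj X (exit_time X (V n) \<omega>) \<omega> \<in> Some ` (- cball z (d / 2))"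
        unfolding limitin_def by blast
      moreover have "\<forall>\<^sub>F n in sequentially. \<rho> n < d / 2"
        using order_tendstoD(2)[OF \<rho>(2), of "d / 2"] d by simp
      ultimately have "\<forall>\<^sub>F n in sequentially. False"
      proof eventually_elim
        case (elim n)
        have "traj X (exit_time X (V n) \<omega>) \<omega> \<in> Some ` D"
          using pos[of n] le[of n] less by (intro traj_before_exit) auto
        moreover have "traj X (exit_time X (V n) \<omega>) \<omega> \<notin> Some ` V n"
          by (rule traj_exit_notin[OF V(1)])
        ultimately show False using elim by (auto simp: V_def)
      qed
      then show False by simp
    qed
    ultimately show ?case by (simp add: T_def)
  qed
qed

text \<open>Monotone convergence in the exit times. For a finite potential it follows that the share
  collected after leaving \<open>D - cball z (\<rho> n)\<close> tends to \<open>0\<close>.\<close>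

lemma occ_exhaustion:
  assumes D: "open D" and z: "z \<notin> D" and \<rho>: "decseq \<rho>" "\<rho> \<longlonglongrightarrow> 0" and x: "x \<in> D - cball z (\<rho> 0)"
    and f[measurable]: "f \<in> borel_measurable borel"
  shows "occ D f x = (SUP n. occ (D - cball z (\<rho> n)) f x)"
proof -
  define V where "V n = D - cball z (\<rho> n)" for n
  have V: "open (V n)" "V n \<subseteq> D" for n using D by (auto simp: V_def)
  have Vmono: "V k \<subseteq> V n" if "k \<le> n" for k n
    using decseqD[OF \<rho>(1) that] by (auto simp: V_def)
  have inc: "exit_time X (V k) \<omega> \<le> exit_time X (V n) \<omega>" if "k \<le> n" for k n \<omega>
    by (rule exit_time_mono[OF Vmono[OF that]])
  have path: "occ_path D f \<omega> = (SUP n. occ_path (V n) f \<omega>)"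
    if eq: "(SUP n. exit_time X (V n) \<omega>) = exit_time X D \<omega>" for \<omega>
  proof -
    have [measurable]: "(\<lambda>t. ext0 f (traj X (ennreal t) \<omega>)) \<in> borel_measurable borel"
      by (rule measurable_compose[OF path_measurable measurable_ext0[OF f]])
    have "{t. 0 \<le> t \<and> ennreal t < exit_time X (V n) \<omega>} \<in> sets borel" for n by measurable
    then have [measurable]: "{t. 0 \<le> t \<and> ennreal t < exit_time X (V n) \<omega>} \<in> sets lborel" for n by simp
    have ind: "(indicator {t. 0 \<le> t \<and> ennreal t < exit_time X D \<omega>} t :: ennreal) =
        (SUP n. indicator {t. 0 \<le> t \<and> ennreal t < exit_time X (V n) \<omega>} t)" for t :: real
    proof (cases "0 \<le> t \<and> ennreal t < exit_time X D \<omega>")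
      case True
      then obtain n where "ennreal t < exit_time X (V n) \<omega>" unfolding eq[symmetric] less_SUP_iff by blast
      with True have "1 \<le> (SUP n. indicator {t. 0 \<le> t \<and> ennreal t < exit_time X (V n) \<omega>} t :: ennreal)"
        by (intro SUP_upper2[of n]) auto
      moreover have "(SUP n. indicator {t. 0 \<le> t \<and> ennreal t < exit_time X (V n) \<omega>} t :: ennreal) \<le> 1"
        by (intro SUP_least) (simp add: indicator_def)
      ultimately have "(SUP n. indicator {t. 0 \<le> t \<and> ennreal t < exit_time X (V n) \<omega>} t :: ennreal) = 1"
        by (rule antisym[rotated])
      then show ?thesis using True by (simp only: indicator_simps mem_Collect_eq simp_thms)
    next
      case False
      then have "\<not> (0 \<le> t \<and> ennreal t < exit_time X (V n) \<omega>)" for n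
        using exit_time_mono[OF V(2), of n \<omega>] by (auto dest: less_le_trans)
      then show ?thesis using False by simp
    qed
    have "occ_path D f \<omega> = (\<integral>\<^sup>+t. (SUP n. ext0 f (traj X (ennreal t) \<omega>) *
        indicator {t. 0 \<le> t \<and> ennreal t < exit_time X (V n) \<omega>} t) \<partial>lborel)"
      unfolding occ_path_def ind by (simp add: SUP_mult_left_ennreal)
    also have "\<dots> = (SUP n. occ_path (V n) f \<omega>)"
      unfolding occ_path_def
      by (intro nn_integral_monotone_convergence_SUP)
         (auto simp: incseq_def le_fun_def intro!: mult_left_mono dest: less_le_trans[OF _ inc] split: split_indicator)
    finally show ?thesis .
  qed
  have "occ D f x = (\<integral>\<^sup>+\<omega>. (SUP n. occ_path (V n) f \<omega>) \<partial>start X x)"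
    unfolding occ_def
    by (rule nn_integral_cong_AE) (use exit_exhaustion[OF D z \<rho> x] path in \<open>auto simp: V_def\<close>)
  also have "\<dots> = (SUP n. occ (V n) f x)"
    unfolding occ_def
  proof (rule nn_integral_monotone_convergence_SUP)
    show "incseq (\<lambda>n. occ_path (V n) f)"
      unfolding occ_path_def incseq_def le_fun_def
      by (auto intro!: nn_integral_mono mult_left_mono dest: less_le_trans[OF _ inc] split: split_indicator)
    show "occ_path (V n) f \<in> borel_measurable (start X x)" for n
      by (rule measurable_aug_prob_at[OF occ_path_measurable[OF V(1) f]])
  qed
  finally show ?thesis by (simp add: V_def)
qed

end

context martin_point
begin

text \<open>This is \<open>M_le\<close> integrated over the pole \<open>y'\<close>, which runs
  through a piece of \<open>D\<close> near \<open>z0\<close>. The gain over a bound by a single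
  Green function is that a potential of a function can be exhausted by
  \<open>occ_exhaustion\<close>.\<close>

lemma kernel_potential_bound:
  assumes a: "approaches y z0 w" and s: "0 < s" "ereal s < R" and x0s: "x0 \<notin> cball z0 s"
  defines "f \<equiv> indicator (D \<inter> ball z0 (s / 8)) :: 'x \<Rightarrow> ennreal"
  shows "0 < fwd.occ D f x0" "fwd.occ D f x0 < \<top>"
    "\<And>v. v \<in> D \<Longrightarrow> v \<notin> cball z0 s \<Longrightarrow> M v w * fwd.occ D f x0 \<le> ennreal (Ch ^ 4) * fwd.occ D f v"
proof -
  define K where "K = D \<inter> ball z0 (s / 8)"
  have oK: "open K" using open_D by (auto simp: K_def)
  then have [measurable]: "K \<in> sets borel" by simp
  have fK: "f = indicator K" by (simp add: f_def K_def)
  have Km: "K \<in> sets m" using fwd.sets_m by simp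
  have occ: "fwd.occ D f v = (\<integral>\<^sup>+y. G v y * indicator K y \<partial>m)" if "v \<in> D" for v
    unfolding fK by (rule occ_green[OF _ that]) measurable
  have "K \<noteq> {}" using pf.U_nonempty[of "s / 8"] s by (simp add: K_def)
  then have mK: "0 < emeasure m K" using oK by (rule fwd.m_pos_open[rotated])
  have Gpos: "0 < G x0 y" "G x0 y < \<top>" if "y \<in> K" for y
    using G_x0_pos[OF x0s s] that by (auto simp: K_def)
  show "0 < fwd.occ D f x0"
  proof (rule ccontr)
    assume "\<not> 0 < fwd.occ D f x0"
    then have "(\<integral>\<^sup>+y. G x0 y * indicator K y \<partial>m) = 0" using occ[OF x0] by simp
    then have "emeasure m {y \<in> space m. G x0 y * indicator K y \<noteq> 0} = 0"
      by (subst (asm) nn_integral_0_iff) (auto intro!: fwd.measurable_m)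
    moreover have "{y \<in> space m. G x0 y * indicator K y \<noteq> 0} = K"
      using Gpos(1) by (auto simp: indicator_def fwd.space_m dest: Gpos(1))
    ultimately show False using mK by simp
  qed
  have "fwd.occ D f x0 \<le> (\<integral>\<^sup>+y. ennreal (c s) * indicator K y \<partial>m)"
    unfolding occ[OF x0]
  proof (rule nn_integral_mono)
    fix y
    show "G x0 y * indicator K y \<le> ennreal (c s) * indicator K y"
      using bound[OF s, of y x0] x0s s by (auto simp: indicator_def K_def dual)
  qed
  also have "\<dots> = ennreal (c s) * emeasure m K" by (rule nn_integral_cmult_indicator[OF Km])
  also have "\<dots> < \<top>"
  proof -
    have "emeasure m K \<le> emeasure m (cball z0 s)"
      using fwd.sets_m s by (intro emeasure_mono) (auto simp: K_def)
    also have "\<dots> < \<infinity>" by (intro fwd.m_finite_compact) (simp add: compact_eq_bounded_closed)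
    finally show ?thesis by (simp add: ennreal_mult_less_top)
  qed
  finally show "fwd.occ D f x0 < \<top>" .
  fix v assume v: "v \<in> D" "v \<notin> cball z0 s"
  have "M v w * fwd.occ D f x0 = (\<integral>\<^sup>+y. M v w * (G x0 y * indicator K y) \<partial>m)"
    unfolding occ[OF x0] by (intro nn_integral_cmult[symmetric] fwd.measurable_m) measurable
  also have "\<dots> \<le> (\<integral>\<^sup>+y. ennreal (Ch ^ 4) * (G v y * indicator K y) \<partial>m)"
  proof (rule nn_integral_mono)
    fix y
    show "M v w * (G x0 y * indicator K y) \<le> ennreal (Ch ^ 4) * (G v y * indicator K y)"
    proof (cases "y \<in> K")
      case True
      have "M v w * G x0 y \<le> ennreal (Ch ^ 4) / G x0 y * G v y * G x0 y"
        using True by (intro mult_right_mono M_le[OF a v x0s s]) (auto simp: K_def)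
      also have "\<dots> = ennreal (Ch ^ 4) * G v y * (G x0 y / G x0 y)"
        by (simp add: divide_ennreal_def ac_simps)
      also have "G x0 y / G x0 y = 1" using Gpos[OF True] by (intro ennreal_divide_self) auto
      finally show ?thesis using True by simp
    qed simp
  qed
  also have "\<dots> = ennreal (Ch ^ 4) * fwd.occ D f v"
    unfolding occ[OF v(1)] by (intro nn_integral_cmult fwd.measurable_m) measurable
  finally show "M v w * fwd.occ D f x0 \<le> ennreal (Ch ^ 4) * fwd.occ D f v" .
qed

end

section \<open>Local data at every boundary point and the two separation arguments\<close>

context martin_setup
begin

lemma martin_point_exists:
  assumes z0: "z0 \<in> frontier D"
  obtains R C Ch c1 where "martin_point X Xh m j jh D G Gh x0 \<T> \<iota> M c z0 R C Ch c1"
proof -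
  obtain R :: ereal where R: "0 < R" and C1: "cond_C1 j jh z0 R" and E1: "cond_E1 j z0 R"
    and F1: "cond_F1 m X j z0 R" "cond_F1 m Xh jh z0 R"
    and bd: "\<And>r. 0 < r \<Longrightarrow> ereal r \<le> R \<Longrightarrow>
             (SUP x\<in>D \<inter> ball z0 (r / 2). SUP y\<in>- ball z0 r. max (G x y) (Gh x y)) \<le> ennreal (c r)"
    using boundary[OF z0] by blast
  obtain C where C: "fwd.F1_with C z0 R" using fwd.F1_with_exists[OF F1(1)] by blast
  obtain Ch where Ch: "bwd.F1_with Ch z0 R" using bwd.F1_with_exists[OF F1(2)] by blast
  obtain c' :: "real \<Rightarrow> real" where c': "\<And>r1 r2. 0 < r1 \<Longrightarrow> r1 < r2 \<Longrightarrow> ereal r2 < R \<Longrightarrow>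
        0 < c' (r2 / r1) \<and>
        (\<forall>x\<in>ball z0 r1. \<forall>y\<in>- ball z0 r2.
           inverse (c' (r2 / r1)) * j z0 y \<le> j x y \<and> j x y \<le> c' (r2 / r1) * j z0 y \<and>
           inverse (c' (r2 / r1)) * jh z0 y \<le> jh x y \<and> jh x y \<le> c' (r2 / r1) * jh z0 y)"
    using C1 unfolding cond_C1_def by blast
  define c1 where "c1 = c' 2"
  have half: "0 < c1 \<and> (\<forall>u\<in>ball z0 (s / 2). \<forall>w\<in>- ball z0 s.
      inverse c1 * j z0 w \<le> j u w \<and> j u w \<le> c1 * j z0 w \<and> inverse c1 * jh z0 w \<le> jh u w \<and> jh u w \<le> c1 * jh z0 w)"
    if "0 < s" "ereal s < R" for s
    using c'[of "s / 2" s] that by (simp add: c1_def)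
  obtain s0 :: real where s0: "0 < s0" "ereal s0 < R"
    using ereal_dense2[OF R] by (auto simp: zero_ereal_def)
  have c1: "0 < c1" using half[OF s0] by simp
  have "martin_point X Xh m j jh D G Gh x0 \<T> \<iota> M c z0 R C Ch c1"
  proof (unfold_locales, fact z0, fact R, fact C, fact Ch, fact c1)
    fix s u w assume s: "0 < s" "ereal s < R" and u: "u \<in> ball z0 (s / 2)" and w: "w \<notin> ball z0 s"
    note h = half[OF s, THEN conjunct2, rule_format, OF u, of w]
    show "j u w \<le> c1 * j z0 w" "jh u w \<le> c1 * jh z0 w" using h w by auto
    show "jh z0 w \<le> c1 * jh u w" using h w c1 by (simp add: field_simps)
  next
    fix s e :: real assume s: "0 < s" "ereal s < R" and e: "0 < e"
    \<comment> \<open>E1 is used at radius \<open>s / 2\<close>: it speaks of points at distance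
      greater than the radius, whereas a point at distance exactly \<open>s\<close> is already
      outside \<open>ball z0 s\<close>.\<close>
    let ?Z = "{z. s / 2 < dist z0 z}"
    have half_R: "0 < s / 2 \<and> ereal (s / 2) < R" using s by (auto intro: le_less_trans[of _ "ereal s"])
    note lims = E1[unfolded cond_E1_def, rule_format, OF half_R, THEN conjunct1]
      E1[unfolded cond_E1_def, rule_format, OF half_R, THEN conjunct2]
    have "(1::ennreal) < ennreal (1 + e)" using e by (metis ennreal_1 ennreal_less_iff less_add_same_cancel1 zero_le_one)
    moreover have "ennreal (1 / (1 + e)) < 1" using e by (metis ennreal_1 ennreal_less_iff divide_less_eq_1_pos less_add_same_cancel1 add_pos_pos zero_less_one divide_nonneg_nonneg less_imp_le)
    ultimately have "\<forall>\<^sub>F y in at z0. (SUP z\<in>?Z. ennreal (j z z0 / j z y)) < ennreal (1 + e) \<and>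
        ennreal (1 / (1 + e)) < (INF z\<in>?Z. ennreal (j z z0 / j z y))"
      using lims by (intro eventually_conj order_tendstoD)
    then obtain d where d: "0 < d" "\<And>y. y \<noteq> z0 \<Longrightarrow> dist y z0 < d \<Longrightarrow>
        (SUP z\<in>?Z. ennreal (j z z0 / j z y)) < ennreal (1 + e) \<and>
        ennreal (1 / (1 + e)) < (INF z\<in>?Z. ennreal (j z z0 / j z y))"
      unfolding eventually_at by auto
    show "\<exists>r>0. \<forall>u\<in>ball z0 r - {z0}. \<forall>w. w \<notin> ball z0 s \<longrightarrow>
        jh z0 w \<le> (1 + e) * jh u w \<and> jh u w \<le> (1 + e) * jh z0 w"
    proof (intro exI[of _ "min d s"] conjI ballI allI impI)
      show "0 < min d s" using d s by simp
      fix u w assume u: "u \<in> ball z0 (min d s) - {z0}" and w: "w \<notin> ball z0 s"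
      have ne: "w \<noteq> u" "w \<noteq> z0" "w \<in> ?Z" using u w s by auto
      have eq: "jh z0 w = j w z0" "jh u w = j w u" using ne by (auto simp: j_dual)
      have pos: "0 < j w z0" "0 < j w u" using ne by (auto intro: j_pos)
      note du = d(2)[of u]
      have "ennreal (j w z0 / j w u) \<le> (SUP z\<in>?Z. ennreal (j z z0 / j z u))" by (rule SUP_upper[OF ne(3)])
      also have "\<dots> < ennreal (1 + e)" using du u by (auto simp: dist_commute)
      finally have "j w z0 / j w u < 1 + e" using pos by (simp add: ennreal_less_iff)
      then show "jh z0 w \<le> (1 + e) * jh u w" using pos by (simp add: eq field_simps)
      have "ennreal (1 / (1 + e)) < (INF z\<in>?Z. ennreal (j z z0 / j z u))" using du u by (auto simp: dist_commute)
      also have "\<dots> \<le> ennreal (j w z0 / j w u)" by (rule INF_lower[OF ne(3)])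
      finally have "1 / (1 + e) < j w z0 / j w u" using e by (simp add: ennreal_less_iff)
      then show "jh u w \<le> (1 + e) * jh z0 w" using pos e by (simp add: eq field_simps)
    qed
  next
    fix r x y assume r: "0 < r" "ereal r < R" and x: "x \<in> D \<inter> ball z0 (r / 2)" and y: "y \<notin> ball z0 r"
    have "max (G x y) (Gh x y) \<le> (SUP y\<in>- ball z0 r. max (G x y) (Gh x y))"
      using y by (intro SUP_upper) simp
    also have "\<dots> \<le> (SUP x\<in>D \<inter> ball z0 (r / 2). SUP y\<in>- ball z0 r. max (G x y) (Gh x y))"
      using x by (rule SUP_upper)
    also have "\<dots> \<le> ennreal (c r)" using r by (intro bd) auto
    finally show "G x y \<le> ennreal (c r) \<and> Gh x y \<le> ennreal (c r)" by simp
  qed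
  then show thesis by (rule that)
qed

lemma kernel_unique:
  assumes "z \<in> frontier D" "approaches y z w" "approaches y' z w'"
  shows "w = w'"
proof -
  obtain R C Ch c1 where "martin_point X Xh m j jh D G Gh x0 \<T> \<iota> M c z R C Ch c1"
    by (rule martin_point_exists[OF assms(1)])
  then interpret p: martin_point X Xh m j jh D G Gh x0 \<T> \<iota> M c z R C Ch c1 .
  have "\<forall>w1\<in>martin_boundary D \<T> \<iota>. \<forall>w2\<in>martin_boundary D \<T> \<iota>. w1 \<noteq> w2 \<longrightarrow> (\<exists>x\<in>D. M x w1 \<noteq> M x w2)"
    using martin by (simp add: martin_space_def martin_boundary_def)
  then show ?thesis using p.M_unique[OF assms(2,3)] assms(2,3) unfolding approaches_def by blast
qed

text \<open>\<open>F\<close> is a finite potential at \<open>x0\<close>. By the submean property at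
  \<open>z1\<close> and the domination coming from \<open>z2\<close>, a share of at least
  \<open>F / k\<close> is still to be collected after leaving \<open>V n\<close>, however small the
  removed ball; but in the limit all of \<open>F\<close> is collected before.\<close>

lemma accessible_separation:
  assumes z: "z1 \<in> frontier D" "z2 \<in> frontier D" "z1 \<noteq> z2"
    and acc: "accessible m j D G z1" and a: "approaches y1 z1 w" "approaches y2 z2 w"
  shows False
proof -
  obtain R C Ch c1 where "martin_point X Xh m j jh D G Gh x0 \<T> \<iota> M c z1 R C Ch c1"
    by (rule martin_point_exists[OF z(1)])
  then interpret p1: martin_point X Xh m j jh D G Gh x0 \<T> \<iota> M c z1 R C Ch c1 .
  obtain R2 C2 Ch2 c2 where "martin_point X Xh m j jh D G Gh x0 \<T> \<iota> M c z2 R2 C2 Ch2 c2"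
    by (rule martin_point_exists[OF z(2)])
  then interpret p2: martin_point X Xh m j jh D G Gh x0 \<T> \<iota> M c z2 R2 C2 Ch2 c2 .
  \<comment> \<open>Radii below half the distance keep the two closed balls disjoint, so the
    domination coming from \<open>z2\<close> is available on
    \<open>cball z1 (\<rho> n)\<close>.\<close>
  have d: "0 < dist z1 z2 / 2" using z by simp
  obtain r where r: "0 < r" "r < dist z1 z2 / 2" "ereal r < R" "x0 \<notin> cball z1 r"
    using p1.small_radius[OF x0 d] by auto
  obtain s where s: "0 < s" "s < dist z1 z2 / 2" "ereal s < R2" "x0 \<notin> cball z2 s"
    using p2.small_radius[OF x0 d] by auto
  define f :: "'x \<Rightarrow> ennreal" where "f = indicator (D \<inter> ball z2 (s / 8))"
  have fm[measurable]: "f \<in> borel_measurable borel"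
    unfolding f_def using open_D by (intro borel_measurable_indicator borel_open open_Int) auto
  note pot = p2.kernel_potential_bound[OF a(2) s(1,3,4), folded f_def]
  define k where "k = ennreal (Ch2 ^ 4)"
  have k: "0 < k" "k < \<top>" using p2.pb.C_ge by (auto simp: k_def)
  define F where "F = fwd.occ D f x0"
  have F: "0 < F" "F < \<top>" using pot(1,2) by (auto simp: F_def)
  define \<rho> where "\<rho> n = r / real (Suc n)" for n
  have dec: "decseq \<rho>" unfolding \<rho>_def decseq_Suc_iff using r by (auto simp: field_simps)
  have lim: "\<rho> \<longlonglongrightarrow> 0" unfolding \<rho>_def by real_asymp
  have \<rho>: "0 < \<rho> n" "\<rho> n \<le> r" for n using r by (auto simp: \<rho>_def field_simps)
  define V where "V n = D - cball z1 (\<rho> n)" for n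
  have V: "open (V n)" "V n \<subseteq> D" "x0 \<in> V n" for n
    using open_D x0 r(4) \<rho>(2)[of n] by (auto simp: V_def)
  have wM: "w \<in> martin_boundary D \<T> \<iota>" using a by (simp add: approaches_def)
  have occm: "fwd.occ D f \<in> borel_measurable borel" by (rule fwd.occ_measurable[OF open_D fm])
  have step: "fwd.occ (V n) f x0 + F / k \<le> F" for n
  proof -
    have \<rho>R: "ereal (\<rho> n) < R" using \<rho>(2)[of n] r(3) by (meson ereal_less_eq(3) le_less_trans)
    have "x0 \<notin> cball z1 (\<rho> n)" using V(3)[of n] by (simp add: V_def)
    then have "1 \<le> fwd.exit_int (V n) (\<lambda>v. M v w * indicator D v) x0"
      unfolding V_def by (intro p1.kernel_submean[OF acc a(1)] \<rho> \<rho>R)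
    then have "F * 1 \<le> F * fwd.exit_int (V n) (\<lambda>v. M v w * indicator D v) x0" by (intro mult_left_mono) auto
    also have "\<dots> = fwd.exit_int (V n) (\<lambda>v. F * (M v w * indicator D v)) x0"
      by (rule fwd.exit_int_cmult[OF V(1) M_measurable[OF wM], symmetric])
    also have "\<dots> \<le> fwd.exit_int (V n) (\<lambda>v. k * (fwd.occ D f v * indicator D v)) x0"
    proof (rule fwd.exit_int_mono'[OF V(1)])
      fix v assume v: "v \<notin> V n"
      show "F * (M v w * indicator D v) \<le> k * (fwd.occ D f v * indicator D v)"
      proof (cases "v \<in> D")
        case True
        then have "v \<in> cball z1 (\<rho> n)" using v by (simp add: V_def)
        then have "v \<notin> cball z2 s"
          using \<rho>(2)[of n] r(2) s(2) dist_triangle[of z1 z2 v] by (auto simp: dist_commute)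
        from pot(3)[OF True this] True show ?thesis by (simp add: F_def k_def mult.commute)
      qed simp
    qed
    also have "\<dots> = k * fwd.exit_int (V n) (\<lambda>v. fwd.occ D f v * indicator D v) x0"
      using occm open_D by (intro fwd.exit_int_cmult[OF V(1)]) auto
    finally have "F / k \<le> fwd.exit_int (V n) (\<lambda>v. fwd.occ D f v * indicator D v) x0 * k / k"
      by (simp add: divide_right_mono_ennreal mult.commute)
    also have "\<dots> = fwd.exit_int (V n) (\<lambda>v. fwd.occ D f v * indicator D v) x0"
      using k by (intro mult_divide_eq_ennreal) auto
    finally have "fwd.occ (V n) f x0 + F / k \<le>
        fwd.occ (V n) f x0 + fwd.exit_int (V n) (\<lambda>v. fwd.occ D f v * indicator D v) x0" by (rule add_left_mono)
    also have "\<dots> = F" unfolding F_def by (rule fwd.occ_split[OF open_D V(1,2) fm V(3), symmetric])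
    finally show ?thesis .
  qed
  have "F = (SUP n. fwd.occ (V n) f x0)"
    unfolding F_def V_def
    by (rule fwd.occ_exhaustion[OF open_D p1.z0_notin dec lim _ fm]) (use V(3)[of 0] in \<open>simp add: V_def\<close>)
  then have "F + F / k = (SUP n. fwd.occ (V n) f x0 + F / k)"
    by (simp add: ennreal_SUP_add_left)
  also have "\<dots> \<le> F" by (intro SUP_least step)
  finally have "F + F / k \<le> F + 0" by simp
  then have "F / k \<le> 0" using F(2) by (subst (asm) ennreal_add_left_cancel_le) auto
  then have "F = 0 \<or> k = \<top>" by (simp add: ennreal_divide_eq_0_iff)
  then show False using F(1) k(2) less_irrefl by blast
qed

lemma inaccessible_separation:
  assumes z: "z1 \<in> frontier D" "z2 \<in> frontier D" "z1 \<noteq> z2"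
    and nacc: "\<not> accessible m j D G z1" "\<not> accessible m j D G z2" and a: "approaches y1 z1 w" "approaches y2 z2 w"
  shows False
proof -
  obtain R C Ch c1 where "martin_point X Xh m j jh D G Gh x0 \<T> \<iota> M c z1 R C Ch c1"
    by (rule martin_point_exists[OF z(1)])
  then interpret p1: martin_point X Xh m j jh D G Gh x0 \<T> \<iota> M c z1 R C Ch c1 .
  obtain R2 C2 Ch2 c2 where "martin_point X Xh m j jh D G Gh x0 \<T> \<iota> M c z2 R2 C2 Ch2 c2"
    by (rule martin_point_exists[OF z(2)])
  then interpret p2: martin_point X Xh m j jh D G Gh x0 \<T> \<iota> M c z2 R2 C2 Ch2 c2 .
  obtain q1 where q1: "0 < q1"
    and o1: "\<And>v. v \<in> D \<Longrightarrow> fwd.occ D (\<lambda>u. ennreal (j u z1 / q1)) v = M v w \<and> M v w < \<top>"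
    by (rule p1.inaccessible_potential[OF nacc(1) a(1)]) blast
  obtain q2 where q2: "0 < q2"
    and o2: "\<And>v. v \<in> D \<Longrightarrow> fwd.occ D (\<lambda>u. ennreal (j u z2 / q2)) v = M v w \<and> M v w < \<top>"
    by (rule p2.inaccessible_potential[OF nacc(2) a(2)]) blast
  define \<phi>1 where "\<phi>1 u = ennreal (j u z1 / q1)" for u
  define \<phi>2 where "\<phi>2 u = ennreal (j u z2 / q2)" for u
  note [measurable] = fwd.j_section
  have m1: "\<phi>1 \<in> borel_measurable borel" and m2: "\<phi>2 \<in> borel_measurable borel"
    unfolding \<phi>1_def \<phi>2_def by measurable
  obtain s where s: "0 < s" "s < dist z1 z2" "ereal s < R"
    using p1.small_radius[OF x0, of "dist z1 z2"] z by auto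
  \<comment> \<open>C1 bounds \<open>j \<cdot> z2\<close> near \<open>z1\<close>, while
    \<open>j \<cdot> z1\<close> blows up there; close to \<open>z1\<close> the normalised charge of
    \<open>z1\<close> is at least twice that of \<open>z2\<close>.\<close>
  define B where "B = c1 * j z1 z2"
  have B: "j u z2 \<le> B" if "u \<in> ball z1 (s / 2)" for u
    unfolding B_def using p1.C1f[OF s(1,3) that, of z2] s by auto
  have "filterlim (\<lambda>x. j x z1) at_top (at z1 within D)"
    using nacc(1) z(1) by (intro inaccessible_blowup) (simp add: inaccessible_def)
  then have "\<forall>\<^sub>F x in at z1 within D. 2 * q1 * B / q2 \<le> j x z1" by (simp add: filterlim_at_top)
  then obtain d where d: "0 < d" "\<And>x. x \<in> D \<Longrightarrow> x \<noteq> z1 \<Longrightarrow> dist x z1 < d \<Longrightarrow> 2 * q1 * B / q2 \<le> j x z1"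
    unfolding eventually_at by auto
  define \<delta> where "\<delta> = min d (s / 2)"
  define U where "U = D \<inter> ball z1 \<delta>"
  have \<delta>: "0 < \<delta>" using d s by (simp add: \<delta>_def)
  have U: "open U" "U \<subseteq> D" using open_D by (auto simp: U_def)
  obtain x where x: "x \<in> U" using p1.pf.U_nonempty[OF \<delta>] unfolding U_def by blast
  have le: "2 * \<phi>2 u \<le> \<phi>1 u" if u: "u \<in> U" for u
  proof -
    have uD: "u \<in> D" "u \<noteq> z1" using u p1.z0_notin by (auto simp: U_def)
    have "j u z2 \<le> B" using u by (intro B) (auto simp: U_def \<delta>_def)
    then have "2 * (j u z2 / q2) \<le> 2 * (B / q2)" using q2 by (intro mult_left_mono divide_right_mono) auto
    also have "\<dots> = (2 * q1 * B / q2) / q1" using q1 by simp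
    also have "\<dots> \<le> j u z1 / q1"
      using q1 u uD by (intro divide_right_mono d(2)) (auto simp: U_def \<delta>_def dist_commute)
    finally have "2 * (j u z2 / q2) \<le> j u z1 / q1" .
    then have "ennreal (2 * (j u z2 / q2)) \<le> \<phi>1 u" unfolding \<phi>1_def by (rule ennreal_leI)
    then show ?thesis unfolding \<phi>2_def by (subst (asm) ennreal_mult') auto
  qed
  have pos: "0 < \<phi>2 u" if u: "u \<in> U" for u
  proof -
    have "0 < j u z2" using u p2.z0_notin by (auto simp: U_def intro!: j_pos)
    then show ?thesis using q2 by (simp add: \<phi>2_def)
  qed
  \<comment> \<open>Both potentials equal the kernel, so what they collect after the exit from
    \<open>U\<close> is the same number. Being finite, it cancels, and the two charges would have
    the same finite positive potential inside \<open>U\<close>.\<close>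
  define E where "E = fwd.exit_int U (\<lambda>v. M v w * indicator D v) x"
  have split: "M x w = fwd.occ U \<phi> x + E"
    if \<phi>: "\<phi> \<in> borel_measurable borel" "\<And>v. v \<in> D \<Longrightarrow> fwd.occ D \<phi> v = M v w" for \<phi>
  proof -
    have "M x w = fwd.occ U \<phi> x + fwd.exit_int U (\<lambda>v. fwd.occ D \<phi> v * indicator D v) x"
      using x U \<phi>(2) fwd.occ_split[OF open_D U \<phi>(1) x] by auto
    also have "(\<lambda>v. fwd.occ D \<phi> v * indicator D v) = (\<lambda>v. M v w * indicator D v)"
      using \<phi>(2) by (auto simp: indicator_def)
    finally show ?thesis by (simp add: E_def)
  qed
  have s1: "M x w = fwd.occ U \<phi>1 x + E" by (rule split[OF m1]) (simp add: \<phi>1_def[abs_def] o1)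
  have s2: "M x w = fwd.occ U \<phi>2 x + E" by (rule split[OF m2]) (simp add: \<phi>2_def[abs_def] o2)
  have Mx: "M x w < \<top>" using x U o1 by blast
  then have sum: "fwd.occ U \<phi>2 x + E < \<top>" by (simp only: s2)
  have "E \<le> fwd.occ U \<phi>2 x + E" "fwd.occ U \<phi>2 x \<le> fwd.occ U \<phi>2 x + E" by auto
  then have fin: "E < \<top>" "fwd.occ U \<phi>2 x < \<top>" using sum by (blast intro: le_less_trans)+
  have "E + fwd.occ U \<phi>1 x = E + fwd.occ U \<phi>2 x" using s1 s2 by (simp only: add.commute)
  then have eq: "fwd.occ U \<phi>1 x = fwd.occ U \<phi>2 x" using fin(1) by (simp only: ennreal_add_left_cancel) auto
  have "2 * fwd.occ U \<phi>2 x = fwd.occ U (\<lambda>u. 2 * \<phi>2 u) x" by (rule fwd.occ_cmult[OF U(1) m2, symmetric])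
  also have "\<dots> \<le> fwd.occ U \<phi>1 x" by (rule fwd.occ_mono[OF le])
  finally have "fwd.occ U \<phi>2 x + fwd.occ U \<phi>2 x \<le> fwd.occ U \<phi>2 x + 0" unfolding eq by (simp add: mult_2)
  then have "fwd.occ U \<phi>2 x \<le> 0" using fin(2) by (subst (asm) ennreal_add_left_cancel_le) auto
  moreover have "0 < fwd.occ U \<phi>2 x" by (rule fwd.occ_pos[OF U(1) x m2 pos])
  ultimately show False by simp
qed

lemma kernel_separation:
  assumes "z1 \<in> frontier D" "z2 \<in> frontier D" "approaches y1 z1 w" "approaches y2 z2 w"
  shows "z1 = z2"
  using accessible_separation[OF assms(1,2) _ _ assms(3,4)] accessible_separation[OF assms(2,1) _ _ assms(4,3)]
    inaccessible_separation[OF assms(1,2) _ _ _ assms(3,4)] by metis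

end

section \<open>The Martin topology at the boundary\<close>

context martin_setup
begin

lemma martin_compact: "compact_space \<T>" and martin_metrizable: "metrizable_space \<T>"
  and martin_dense: "\<T> closure_of (\<iota> ` D) = topspace \<T>" and martin_open: "openin \<T> (\<iota> ` D)"
  using martin by (auto simp: martin_space_def)

lemma martin_subsequence:
  assumes "range y \<subseteq> D"
  obtains w r where "strict_mono r" "limitin \<T> (\<lambda>n. \<iota> (y (r n :: nat))) w sequentially"
proof -
  obtain S d where S: "Metric_space S d" "\<T> = Metric_space.mtopology S d"
    using martin_metrizable by (auto simp: metrizable_space_def)
  interpret Metric_space S d by (rule S(1))
  have "range (\<iota> \<circ> y) \<subseteq> S" using iota_topspace assms S(2) by auto
  then obtain w r where "strict_mono (r :: nat \<Rightarrow> nat)" "limitin \<T> (\<iota> \<circ> y \<circ> r) w sequentially"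
    using martin_compact unfolding S(2) compact_space_sequentially by blast
  then show thesis by (intro that) (auto simp: o_def)
qed

lemma iota_limit:
  assumes "range y \<subseteq> D" "p \<in> D"
  shows "limitin \<T> (\<lambda>n. \<iota> (y n)) (\<iota> p) sequentially \<longleftrightarrow> y \<longlonglongrightarrow> p"
proof
  obtain g where g: "homeomorphic_maps (top_of_set D) (subtopology \<T> (\<iota> ` D)) \<iota> g"
    using iota_homeomorphic by (auto simp: homeomorphic_map_maps)
  then have gc: "continuous_map (subtopology \<T> (\<iota> ` D)) (top_of_set D) g"
    and ic: "continuous_map (top_of_set D) (subtopology \<T> (\<iota> ` D)) \<iota>"
    and gi: "\<And>x. x \<in> D \<Longrightarrow> g (\<iota> x) = x"
    by (auto simp: homeomorphic_maps_def)
  have yD: "y n \<in> D" for n using assms by auto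
  {
    assume "limitin \<T> (\<lambda>n. \<iota> (y n)) (\<iota> p) sequentially"
    then have "limitin (subtopology \<T> (\<iota> ` D)) (\<lambda>n. \<iota> (y n)) (\<iota> p) sequentially"
      using assms(2) yD by (simp add: limitin_subtopology)
    from continuous_map_limit[OF gc this] show "y \<longlonglongrightarrow> p"
      using open_D assms yD by (simp add: o_def gi)
  next
    assume "y \<longlonglongrightarrow> p"
    then have "limitin (top_of_set D) y p sequentially" using open_D assms by simp
    from continuous_map_limit[OF ic this] show "limitin \<T> (\<lambda>n. \<iota> (y n)) (\<iota> p) sequentially"
      by (simp add: limitin_subtopology o_def)
  }
qed

lemma limit_in_martin_boundary:
  assumes y: "range y \<subseteq> D" "y \<longlonglongrightarrow> z" "z \<notin> D" and w: "limitin \<T> (\<lambda>n. \<iota> (y n)) w sequentially"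
  shows "w \<in> martin_boundary D \<T> \<iota>"
proof -
  have "w \<notin> \<iota> ` D"
    using iota_limit[OF y(1)] w y LIMSEQ_unique by blast
  then show ?thesis using limitin_topspace[OF w] by (simp add: martin_boundary_def)
qed

lemma approaches_exists:
  assumes z: "z \<in> frontier D"
  shows "\<exists>y w. approaches y z w"
proof -
  have "z \<in> closure D" using z by (simp add: frontier_def)
  then obtain y where y: "\<And>n. y n \<in> D" "y \<longlonglongrightarrow> z" by (auto simp: closure_sequential)
  then have "range y \<subseteq> D" by auto
  then obtain w r where wr: "strict_mono r" "limitin \<T> (\<lambda>n. \<iota> (y (r n :: nat))) w sequentially"
    by (rule martin_subsequence)
  have "(\<lambda>n. y (r n)) \<longlonglongrightarrow> z" using LIMSEQ_subseq_LIMSEQ[OF y(2) wr(1)] by (simp add: o_def)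
  then have "approaches (\<lambda>n. y (r n)) z w"
    unfolding approaches_def using y(1) wr(2) limit_in_martin_boundary[OF _ _ frontier_notin[OF z] wr(2)]
    by auto
  then show ?thesis by blast
qed

lemma associated_iff: "martin_associated D \<T> \<iota> z w \<longleftrightarrow> z \<in> frontier D \<and> (\<exists>y. approaches y z w)"
  by (auto simp: martin_associated_def approaches_def)

lemma associated_unique: "z \<in> frontier D \<Longrightarrow> \<exists>!w. martin_associated D \<T> \<iota> z w"
  using approaches_exists kernel_unique unfolding associated_iff by metis

definition point_at :: "'x \<Rightarrow> 'b" where
  "point_at z = (THE w. martin_associated D \<T> \<iota> z w)"

lemma approaches_point_at: "z \<in> frontier D \<Longrightarrow> \<exists>y. approaches y z (point_at z)"
  using theI'[OF associated_unique] unfolding point_at_def associated_iff by blast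

lemma point_at_eq: "z \<in> frontier D \<Longrightarrow> approaches y z w \<Longrightarrow> point_at z = w"
  using approaches_point_at kernel_unique by blast

lemma inj_point_at: "inj_on point_at (frontier D)"
  using approaches_point_at kernel_separation by (metis inj_onI)

text \<open>A bounded sequence has a limit point in the state space, and this cannot be in
  \<open>D\<close>, where the Martin topology is the original one.\<close>

lemma point_at_image: "point_at ` frontier D = finite_martin_boundary D \<T> \<iota>"
proof (intro equalityI subsetI)
  fix w assume "w \<in> point_at ` frontier D"
  then obtain y z where "approaches y z w" using approaches_point_at by blast
  then show "w \<in> finite_martin_boundary D \<T> \<iota>"
    unfolding finite_martin_boundary_def approaches_def using convergent_imp_bounded by blast
next
  fix w assume "w \<in> finite_martin_boundary D \<T> \<iota>"
  then obtain y where w: "w \<in> martin_boundary D \<T> \<iota>" and y: "range y \<subseteq> D" "bounded (range y)"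
      "limitin \<T> (\<lambda>n. \<iota> (y n)) w sequentially"
    by (auto simp: finite_martin_boundary_def)
  obtain z r where r: "strict_mono (r :: nat \<Rightarrow> nat)" "(y \<circ> r) \<longlonglongrightarrow> z"
    using bounded_imp_convergent_subsequence[OF y(2)] by blast
  have yr: "range (y \<circ> r) \<subseteq> D" using y(1) by auto
  have lim: "limitin \<T> (\<lambda>n. \<iota> ((y \<circ> r) n)) w sequentially"
    using limitin_subsequence[OF r(1) y(3)] by (simp add: o_def)
  have "z \<notin> D"
  proof
    assume "z \<in> D"
    then have "limitin \<T> (\<lambda>n. \<iota> ((y \<circ> r) n)) (\<iota> z) sequentially" using iota_limit[OF yr] r(2) by blast
    then have "w = \<iota> z"
      by (rule limitin_Hausdorff_unique[OF lim]) (auto intro: metrizable_imp_Hausdorff_space martin_metrizable)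
    then show False using w \<open>z \<in> D\<close> by (simp add: martin_boundary_def)
  qed
  moreover have "z \<in> closure D" using yr r(2) unfolding closure_sequential by blast
  ultimately have "z \<in> frontier D" using open_D by (simp add: frontier_def interior_open)
  moreover have "approaches (y \<circ> r) z w" using yr r(2) lim w by (simp add: approaches_def)
  ultimately show "w \<in> point_at ` frontier D" using point_at_eq by blast
qed

text \<open>Compactness: a sequence avoiding \<open>U\<close> would have a Martin limit point
  outside \<open>U\<close>, and that point would again be associated with \<open>z\<close>.\<close>

lemma iota_tendsto_point_at:
  assumes z: "z \<in> frontier D" and U: "openin \<T> U" "point_at z \<in> U"
  shows "\<forall>\<^sub>F y in at z within D. \<iota> y \<in> U"
proof (rule sequentially_imp_eventually_within, intro allI impI)
  fix y :: "nat \<Rightarrow> 'x" assume y: "(\<forall>n. y n \<in> D \<and> y n \<noteq> z) \<and> y \<longlonglongrightarrow> z"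
  show "\<forall>\<^sub>F n in sequentially. \<iota> (y n) \<in> U"
  proof (rule ccontr)
    assume "\<not> (\<forall>\<^sub>F n in sequentially. \<iota> (y n) \<in> U)"
    then obtain r where r: "strict_mono (r :: nat \<Rightarrow> nat)" "\<And>n. \<iota> (y (r n)) \<notin> U"
      using not_eventually_sequentiallyD by blast
    have "range (\<lambda>n. y (r n)) \<subseteq> D" using y by auto
    then obtain w r' where w: "strict_mono r'" "limitin \<T> (\<lambda>n. \<iota> (y (r (r' n :: nat)))) w sequentially"
      by (rule martin_subsequence)
    have "(\<lambda>n. y (r (r' n))) \<longlonglongrightarrow> z"
      using LIMSEQ_subseq_LIMSEQ[OF LIMSEQ_subseq_LIMSEQ[OF _ r(1)] w(1), of y z] y by (simp add: o_def)
    then have "approaches (\<lambda>n. y (r (r' n))) z w"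
      unfolding approaches_def using y w(2) limit_in_martin_boundary[OF _ _ frontier_notin[OF z] w(2)] by auto
    then have "w \<in> U" using point_at_eq[OF z] U(2) by simp
    then have "\<forall>\<^sub>F n in sequentially. \<iota> (y (r (r' n))) \<in> U" using w(2) U(1) by (simp add: limitin_def)
    then show False using r(2) by simp
  qed
qed

text \<open>For \<open>y\<close> in \<open>D\<close> near \<open>z\<close> the points
  \<open>\<iota> y\<close> lie in a neighbourhood \<open>A\<close>. The image of a nearby boundary
  point is a limit of such points, so it lies only in the closure of \<open>A\<close>; regularity of
  the Martin space provides an \<open>A\<close> whose closure stays in \<open>U\<close>.\<close>

lemma continuous_point_at: "continuous_map (top_of_set (frontier D)) \<T> point_at"
  unfolding continuous_map_def
proof (intro conjI allI impI)
  have top: "point_at z \<in> topspace \<T>" if "z \<in> frontier D" for z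
    using approaches_point_at[OF that] by (auto simp: approaches_def martin_boundary_def)
  then show "point_at \<in> topspace (top_of_set (frontier D)) \<rightarrow> topspace \<T>" by simp
  fix U assume U: "openin \<T> U"
  let ?S = "{z \<in> topspace (top_of_set (frontier D)). point_at z \<in> U}"
  show "openin (top_of_set (frontier D)) ?S"
    unfolding openin_euclidean_subtopology_iff
  proof (intro conjI ballI)
    fix z assume "z \<in> ?S"
    then have z: "z \<in> frontier D" "point_at z \<in> U" by auto
    have "closedin \<T> (topspace \<T> - U)" using U by blast
    moreover have "point_at z \<in> topspace \<T> - (topspace \<T> - U)" using z top by auto
    ultimately obtain A B where AB: "openin \<T> A" "openin \<T> B" "point_at z \<in> A" "topspace \<T> - U \<subseteq> B" "disjnt A B"
      using metrizable_imp_regular_space[OF martin_metrizable] unfolding regular_space_def by meson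
    obtain d where d: "0 < d" "\<And>y. y \<in> D \<Longrightarrow> y \<noteq> z \<Longrightarrow> dist y z < d \<Longrightarrow> \<iota> y \<in> A"
      using iota_tendsto_point_at[OF z(1) AB(1,3)] unfolding eventually_at by blast
    show "\<exists>e>0. \<forall>z'\<in>frontier D. dist z' z < e \<longrightarrow> z' \<in> ?S"
    proof (intro exI[of _ d] conjI ballI impI d(1))
      fix z' assume z': "z' \<in> frontier D" "dist z' z < d"
      obtain y where y: "approaches y z' (point_at z')" using approaches_point_at[OF z'(1)] by blast
      then have yD: "\<And>n. y n \<in> D" and yl: "y \<longlonglongrightarrow> z'" by (auto simp: approaches_def)
      have "point_at z' \<notin> B"
      proof
        assume "point_at z' \<in> B"
        then have "\<forall>\<^sub>F n in sequentially. \<iota> (y n) \<in> B"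
          using y AB(2) by (simp add: approaches_def limitin_def)
        moreover have "(\<lambda>n. dist (y n) z) \<longlonglongrightarrow> dist z' z" by (intro tendsto_intros yl)
        then have "\<forall>\<^sub>F n in sequentially. dist (y n) z < d" using z'(2) by (rule order_tendstoD)
        ultimately have "\<forall>\<^sub>F n in sequentially. False"
        proof eventually_elim
          case (elim n)
          have "y n \<noteq> z" using yD[of n] frontier_notin[OF z(1)] by auto
          then have "\<iota> (y n) \<in> A" by (rule d(2)[OF yD _ elim(2)])
          then show False using elim(1) AB(5) by (auto simp: disjnt_def)
        qed
        then show False by simp
      qed
      then show "z' \<in> ?S" using z'(1) top AB(4) by auto
    qed
  qed auto
qed

text \<open>Density of \<open>D\<close> and metrizability provide an approximating sequence, which
  is bounded along with \<open>D\<close>.\<close>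

lemma martin_boundary_finite:
  assumes "bounded D"
  shows "finite_martin_boundary D \<T> \<iota> = martin_boundary D \<T> \<iota>"
proof (intro equalityI subsetI)
  fix w assume w: "w \<in> martin_boundary D \<T> \<iota>"
  obtain S d where S: "Metric_space S d" "\<T> = Metric_space.mtopology S d"
    using martin_metrizable by (auto simp: metrizable_space_def)
  interpret Metric_space S d by (rule S(1))
  have "w \<in> \<T> closure_of (\<iota> ` D)" using w by (simp add: martin_dense martin_boundary_def)
  then obtain \<sigma> where \<sigma>: "range \<sigma> \<subseteq> \<iota> ` D" "limitin \<T> \<sigma> w sequentially"
    unfolding S(2) closure_of_sequentially by blast
  then have "\<forall>n. \<exists>y. y \<in> D \<and> \<sigma> n = \<iota> y" by blast
  then obtain y where y: "\<And>n. y n \<in> D" "\<And>n. \<sigma> n = \<iota> (y n)" by metis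
  then have "range y \<subseteq> D" by auto
  moreover from this have "bounded (range y)" using assms bounded_subset by blast
  moreover have "\<sigma> = (\<lambda>n. \<iota> (y n))" using y by auto
  ultimately show "w \<in> finite_martin_boundary D \<T> \<iota>"
    using w \<sigma>(2) by (auto simp: finite_martin_boundary_def)
qed (auto simp: finite_martin_boundary_def)

text \<open>A continuous bijection from a compact space onto a Hausdorff space is a
  homeomorphism.\<close>

lemma frontier_homeomorphic:
  assumes D: "bounded D"
  shows "top_of_set (frontier D) homeomorphic_space subtopology \<T> (martin_boundary D \<T> \<iota>)"
proof (rule homeomorphic_map_imp_homeomorphic_space, rule continuous_imp_homeomorphic_map)
  have im: "point_at ` frontier D = martin_boundary D \<T> \<iota>"
    using point_at_image martin_boundary_finite[OF D] by simp
  have sub: "martin_boundary D \<T> \<iota> \<subseteq> topspace \<T>" by (auto simp: martin_boundary_def)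
  show "continuous_map (top_of_set (frontier D)) (subtopology \<T> (martin_boundary D \<T> \<iota>)) point_at"
    using continuous_point_at im by (auto simp: continuous_map_in_subtopology)
  have "compact (frontier D)" using D by (rule compact_frontier_bounded)
  then show "compact_space (top_of_set (frontier D))" by (simp add: compact_space_subtopology)
  show "Hausdorff_space (subtopology \<T> (martin_boundary D \<T> \<iota>))"
    by (intro Hausdorff_space_subtopology metrizable_imp_Hausdorff_space martin_metrizable)
  show "point_at ` topspace (top_of_set (frontier D)) = topspace (subtopology \<T> (martin_boundary D \<T> \<iota>))"
    using im sub by auto
  show "inj_on point_at (topspace (top_of_set (frontier D)))" using inj_point_at by simp
qed

end

theorem corollary1p3:
  fixes m :: "'x::{heine_borel, second_countable_topology} measure"
    and R0 :: ereal
    and X :: "('w, 'x) process" and Xh :: "('v, 'x) process"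
    and j jh :: "'x \<Rightarrow> 'x \<Rightarrow> real"
    and D :: "'x set" and x0 :: 'x
    and G Gh :: "'x \<Rightarrow> 'x \<Rightarrow> ennreal"
    and c :: "real \<Rightarrow> real"
    and T :: "'b topology" and \<iota> :: "'x \<Rightarrow> 'b" and M :: "'x \<Rightarrow> 'b \<Rightarrow> ennreal"
  assumes setting: "hunt_setting m R0 X Xh j jh"
    and D: "open D" "x0 \<in> D"
    and green: "green_functions m X Xh D G Gh"
    and greenian: "greenian G"
    and G: "cond_G X D G"
    and martin: "martin_space X D x0 G T \<iota> M"
    and boundary: "\<forall>z0\<in>frontier D. \<exists>R::ereal. 0 < R \<and> R \<le> R0 \<and>
          cond_C1 j jh z0 R \<and> cond_E1 j z0 R \<and>
          cond_F1 m X j z0 R \<and> cond_F1 m Xh jh z0 R \<and>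
          (\<forall>r. 0 < r \<and> ereal r \<le> R \<longrightarrow>
             (SUP x\<in>D \<inter> ball z0 (r / 2). SUP y\<in>- ball z0 r. max (G x y) (Gh x y)) \<le> ennreal (c r)) \<and>
          (\<not> bounded D \<longrightarrow>
             (\<forall>r. 0 < r \<and> ereal r \<le> R \<longrightarrow>
                (\<forall>y\<in>D \<inter> ball z0 r. ((\<lambda>x. G x y) \<longlongrightarrow> 0) (to_infinity x0))))"
    and inaccessible: "\<forall>z0. inaccessible m j D G z0 \<longrightarrow>
          filterlim (\<lambda>x. j x z0) at_top (at z0 within D)"
  shows "((\<forall>z\<in>frontier D. \<exists>!w. martin_associated D T \<iota> z w) \<and>
          bij_betw (\<lambda>z. THE w. martin_associated D T \<iota> z w)
            (frontier D) (finite_martin_boundary D T \<iota>)) \<and>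
         (bounded D \<longrightarrow>
          top_of_set (frontier D) homeomorphic_space
            subtopology T (martin_boundary D T \<iota>))"
proof -
  interpret hunt_setting m R0 X Xh j jh by (rule setting)
  interpret martin_setup X Xh m j jh D G Gh x0 T \<iota> M c
  proof unfold_locales
    show "resolvent_abs_cont m X" "resolvent_abs_cont m Xh"
      using duality by (auto simp: strong_duality_def)
    show "\<exists>R::ereal. 0 < R \<and> cond_C1 j jh z0 R \<and> cond_E1 j z0 R \<and> cond_F1 m X j z0 R \<and> cond_F1 m Xh jh z0 R \<and>
          (\<forall>r. 0 < r \<and> ereal r \<le> R \<longrightarrow>
             (SUP x\<in>D \<inter> ball z0 (r / 2). SUP y\<in>- ball z0 r. max (G x y) (Gh x y)) \<le> ennreal (c r))"
      if "z0 \<in> frontier D" for z0 using boundary that by blast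
    show "filterlim (\<lambda>x. j x z0) at_top (at z0 within D)" if "inaccessible m j D G z0" for z0
      using inaccessible that by blast
  qed (fact hunt_X hunt_Xh sets_m m_locally_finite m_full_support feller_X feller_Xh j_measurable jh_measurable
      levy_X levy_Xh D green greenian j_dual j_pos martin)+
  have "bij_betw point_at (frontier D) (finite_martin_boundary D T \<iota>)"
    using inj_point_at point_at_image by (simp add: bij_betw_def)
  then have "bij_betw (\<lambda>z. THE w. martin_associated D T \<iota> z w) (frontier D) (finite_martin_boundary D T \<iota>)"
    by (simp add: point_at_def[abs_def])
  then show ?thesis using associated_unique frontier_homeomorphic by blast
qed

end
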